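(* Let $T$ be any unidimensional simple theory. Then $T$ is PCFT, i.e. for every (small) set $A$ and every $\tau^f$-open set $\mathcal U(x,y)$ over $A$, the set $\exists y\,\mathcal U(x,y)$ is $\tau^f$-open over $A$.
   Context: $T$ is a complete first-order theory in a language $L$; work in a highly saturated, highly strongly homogeneous model $\mathcal C$ of $T$; all parameter sets are small. Orthogonality: $p\in S(A)$ is orthogonal to $q\in S(B)$ if for every $C\supseteq A\cup B$, every non-forking extension $\bar p\in S(C)$ of $p$, every non-forking extension $\bar q\in S(C)$ of $q$, every $a\models\bar p$ and every $b\models\bar q$, $a$ is independent (in the sense of non-forking) from $b$ over $C$. $T$ is unidimensional if any two complete non-algebraic types are non-orthogonal. Forking topology: for a finite tuple of variables $x$, a basic $\tau^f$-open set over $A$ is a set of the form $\{a \mid \phi(a,y)\text{ forks over }A\}$ with $\phi(x,y)\in L(A)$. These sets are closed under finite intersections and, identified with sets of types, form a basis of a topology on $S_x(A)$, the $\tau^f$-topology; its open sets, viewed as $A$-invariant sets, are the $\tau^f$-open sets over $A$. *)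

theory Defs
  imports "HOL-Analysis.Abstract_Topology"
begin

unbundle cardinal_syntax

section \<open>First-order languages, formulas and structures\<close>

record ('f, 'r) language =
  funs :: "'f set"
  rels :: "'r set"
  fun_ar :: "'f \<Rightarrow> nat"
  rel_ar :: "'r \<Rightarrow> nat"

datatype 'f tm = Var nat | Fn 'f "'f tm list"

datatype ('f, 'r) fm =
    Eql "'f tm" "'f tm"
  | Rel 'r "'f tm list"
  | Neg "('f, 'r) fm"
  | Con "('f, 'r) fm" "('f, 'r) fm"
  | Exi nat "('f, 'r) fm"

fun wf_tm :: "('f, 'r) language \<Rightarrow> 'f tm \<Rightarrow> bool" where
  "wf_tm L (Var i) \<longleftrightarrow> True"
| "wf_tm L (Fn f ts) \<longleftrightarrow> f \<in> funs L \<and> length ts = fun_ar L f \<and> (\<forall>t \<in> set ts. wf_tm L t)"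

fun wf_fm :: "('f, 'r) language \<Rightarrow> ('f, 'r) fm \<Rightarrow> bool" where
  "wf_fm L (Eql s t) \<longleftrightarrow> wf_tm L s \<and> wf_tm L t"
| "wf_fm L (Rel r ts) \<longleftrightarrow> r \<in> rels L \<and> length ts = rel_ar L r \<and> (\<forall>t \<in> set ts. wf_tm L t)"
| "wf_fm L (Neg \<phi>) \<longleftrightarrow> wf_fm L \<phi>"
| "wf_fm L (Con \<phi> \<psi>) \<longleftrightarrow> wf_fm L \<phi> \<and> wf_fm L \<psi>"
| "wf_fm L (Exi i \<phi>) \<longleftrightarrow> wf_fm L \<phi>"

fun fv_tm :: "'f tm \<Rightarrow> nat set" where
  "fv_tm (Var i) = {i}"
| "fv_tm (Fn f ts) = (\<Union>t \<in> set ts. fv_tm t)"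

fun fv_fm :: "('f, 'r) fm \<Rightarrow> nat set" where
  "fv_fm (Eql s t) = fv_tm s \<union> fv_tm t"
| "fv_fm (Rel r ts) = (\<Union>t \<in> set ts. fv_tm t)"
| "fv_fm (Neg \<phi>) = fv_fm \<phi>"
| "fv_fm (Con \<phi> \<psi>) = fv_fm \<phi> \<union> fv_fm \<psi>"
| "fv_fm (Exi i \<phi>) = fv_fm \<phi> - {i}"

text \<open>The L-formulas in the free variables \<open>x\<^sub>0, \<dots>, x\<^sub>n\<^sub>-\<^sub>1\<close>; those with \<open>n = 0\<close> are the L-sentences.\<close>

definition fmls :: "('f, 'r) language \<Rightarrow> nat \<Rightarrow> ('f, 'r) fm set" where
  "fmls L n = {\<phi>. wf_fm L \<phi> \<and> fv_fm \<phi> \<subseteq> {..<n}}"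

record ('f, 'r, 'c) struct =
  carr :: "'c set"
  fint :: "'f \<Rightarrow> 'c list \<Rightarrow> 'c"
  rint :: "'r \<Rightarrow> 'c list \<Rightarrow> bool"

definition tuples :: "('f, 'r, 'c) struct \<Rightarrow> nat \<Rightarrow> 'c list set" where
  "tuples M n = {a. set a \<subseteq> carr M \<and> length a = n}"

definition is_struct :: "('f, 'r) language \<Rightarrow> ('f, 'r, 'c) struct \<Rightarrow> bool" where
  "is_struct L M \<longleftrightarrow> carr M \<noteq> {} \<and>
     (\<forall>f \<in> funs L. \<forall>a \<in> tuples M (fun_ar L f). fint M f a \<in> carr M)"

fun eval_tm :: "('f, 'r, 'c) struct \<Rightarrow> (nat \<Rightarrow> 'c) \<Rightarrow> 'f tm \<Rightarrow> 'c" where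
  "eval_tm M e (Var i) = e i"
| "eval_tm M e (Fn f ts) = fint M f (map (eval_tm M e) ts)"

fun sat :: "('f, 'r, 'c) struct \<Rightarrow> (nat \<Rightarrow> 'c) \<Rightarrow> ('f, 'r) fm \<Rightarrow> bool" where
  "sat M e (Eql s t) \<longleftrightarrow> eval_tm M e s = eval_tm M e t"
| "sat M e (Rel r ts) \<longleftrightarrow> rint M r (map (eval_tm M e) ts)"
| "sat M e (Neg \<phi>) \<longleftrightarrow> \<not> sat M e \<phi>"
| "sat M e (Con \<phi> \<psi>) \<longleftrightarrow> sat M e \<phi> \<and> sat M e \<psi>"
| "sat M e (Exi i \<phi>) \<longleftrightarrow> (\<exists>d \<in> carr M. sat M (e(i := d)) \<phi>)"

text \<open>\<open>holds M \<phi> a\<close> is \<open>M \<Turnstile> \<phi>(a)\<close>; it is only used for \<open>\<phi> \<in> fmls L (length a)\<close>, so the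
  values of \<open>(!) a\<close> beyond the length of \<open>a\<close> are irrelevant.\<close>

definition holds :: "('f, 'r, 'c) struct \<Rightarrow> ('f, 'r) fm \<Rightarrow> 'c list \<Rightarrow> bool" where
  "holds M \<phi> a \<longleftrightarrow> sat M ((!) a) \<phi>"

section \<open>Complete theories\<close>

definition is_model :: "('f, 'r) language \<Rightarrow> ('f, 'r) fm set \<Rightarrow> ('f, 'r, 'c) struct \<Rightarrow> bool" where
  "is_model L T M \<longleftrightarrow> is_struct L M \<and> (\<forall>\<sigma> \<in> T. holds M \<sigma> [])"

text \<open>HOL cannot quantify over structures of all types. The type \<open>('f, 'r) fm\<close> is infinite and at
  least as large as the set of L-formulas, so by the downward Loewenheim--Skolem theorem a set of
  L-sentences that has a model at all has one whose universe is a subset of this type. Hence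
  satisfiability and entailment below are the usual notions.\<close>

definition satisfiable :: "('f, 'r) language \<Rightarrow> ('f, 'r) fm set \<Rightarrow> bool" where
  "satisfiable L T \<longleftrightarrow> (\<exists>N :: ('f, 'r, ('f, 'r) fm) struct. is_model L T N)"

definition entails :: "('f, 'r) language \<Rightarrow> ('f, 'r) fm set \<Rightarrow> ('f, 'r) fm \<Rightarrow> bool" where
  "entails L T \<sigma> \<longleftrightarrow> (\<forall>N :: ('f, 'r, ('f, 'r) fm) struct. is_model L T N \<longrightarrow> holds N \<sigma> [])"

definition complete_theory :: "('f, 'r) language \<Rightarrow> ('f, 'r) fm set \<Rightarrow> bool" where
  "complete_theory L T \<longleftrightarrow> T \<subseteq> fmls L 0 \<and> satisfiable L T \<and>
     (\<forall>\<sigma> \<in> fmls L 0. entails L T \<sigma> \<or> entails L T (Neg \<sigma>))"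

section \<open>Parameters and types\<close>

text \<open>\<open>lang L A\<close> is \<open>L(A)\<close>, with a new constant symbol \<open>Inr a\<close> for each \<open>a \<in> A\<close>;
  \<open>named M\<close> is \<open>M\<close> with every element named by its constant.\<close>

definition lang :: "('f, 'r) language \<Rightarrow> 'c set \<Rightarrow> ('f + 'c, 'r) language" where
  "lang L A = \<lparr>funs = Inl ` funs L \<union> Inr ` A, rels = rels L,
     fun_ar = case_sum (fun_ar L) (\<lambda>_. 0), rel_ar = rel_ar L\<rparr>"

definition named :: "('f, 'r, 'c) struct \<Rightarrow> ('f + 'c, 'r, 'c) struct" where
  "named M = \<lparr>carr = carr M, fint = case_sum (fint M) (\<lambda>c _. c), rint = rint M\<rparr>"

definition realizes ::
  "('f, 'r, 'c) struct \<Rightarrow> 'c list \<Rightarrow> ('f + 'c, 'r) fm set \<Rightarrow> bool" where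
  "realizes M a p \<longleftrightarrow> (\<forall>\<phi> \<in> p. holds (named M) \<phi> a)"

text \<open>\<open>types L M A n\<close> is \<open>S\<^sub>n(A)\<close>: the complete n-types over \<open>A\<close> that are consistent with the
  theory of \<open>M\<close> with names for its elements, i.e. finitely satisfiable in \<open>M\<close>.\<close>

definition types ::
  "('f, 'r) language \<Rightarrow> ('f, 'r, 'c) struct \<Rightarrow> 'c set \<Rightarrow> nat \<Rightarrow> ('f + 'c, 'r) fm set set" where
  "types L M A n = {p. p \<subseteq> fmls (lang L A) n \<and>
     (\<forall>P. finite P \<and> P \<subseteq> p \<longrightarrow> (\<exists>a \<in> tuples M n. realizes M a P)) \<and>
     (\<forall>\<phi> \<in> fmls (lang L A) n. \<phi> \<in> p \<or> Neg \<phi> \<in> p)}"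

definition tp ::
  "('f, 'r) language \<Rightarrow> ('f, 'r, 'c) struct \<Rightarrow> 'c list \<Rightarrow> 'c set \<Rightarrow> ('f + 'c, 'r) fm set" where
  "tp L M a A = {\<phi> \<in> fmls (lang L A) (length a). holds (named M) \<phi> a}"

definition algebraic ::
  "('f, 'r, 'c) struct \<Rightarrow> nat \<Rightarrow> ('f + 'c, 'r) fm set \<Rightarrow> bool" where
  "algebraic M n p \<longleftrightarrow> (\<exists>\<phi> \<in> p. finite {a \<in> tuples M n. holds (named M) \<phi> a})"

section \<open>The monster model\<close>

definition small :: "'k rel \<Rightarrow> ('f, 'r, 'c) struct \<Rightarrow> 'c set \<Rightarrow> bool" where
  "small \<kappa> M A \<longleftrightarrow> A \<subseteq> carr M \<and> |A| <o \<kappa>"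

definition saturated ::
  "'k rel \<Rightarrow> ('f, 'r) language \<Rightarrow> ('f, 'r, 'c) struct \<Rightarrow> bool" where
  "saturated \<kappa> L M \<longleftrightarrow> (\<forall>A n. small \<kappa> M A \<longrightarrow>
     (\<forall>p \<in> types L M A n. \<exists>a \<in> tuples M n. realizes M a p))"

definition elementary_on ::
  "('f, 'r) language \<Rightarrow> ('f, 'r, 'c) struct \<Rightarrow> 'c set \<Rightarrow> ('c \<Rightarrow> 'c) \<Rightarrow> bool" where
  "elementary_on L M A h \<longleftrightarrow> h ` A \<subseteq> carr M \<and>
     (\<forall>n. \<forall>\<phi> \<in> fmls L n. \<forall>a. set a \<subseteq> A \<and> length a = n \<longrightarrow>
        (holds M \<phi> a \<longleftrightarrow> holds M \<phi> (map h a)))"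

definition automorphism ::
  "('f, 'r) language \<Rightarrow> ('f, 'r, 'c) struct \<Rightarrow> ('c \<Rightarrow> 'c) \<Rightarrow> bool" where
  "automorphism L M g \<longleftrightarrow> bij_betw g (carr M) (carr M) \<and>
     (\<forall>f \<in> funs L. \<forall>a \<in> tuples M (fun_ar L f). g (fint M f a) = fint M f (map g a)) \<and>
     (\<forall>r \<in> rels L. \<forall>a \<in> tuples M (rel_ar L r). rint M r a \<longleftrightarrow> rint M r (map g a))"

definition strongly_homogeneous ::
  "'k rel \<Rightarrow> ('f, 'r) language \<Rightarrow> ('f, 'r, 'c) struct \<Rightarrow> bool" where
  "strongly_homogeneous \<kappa> L M \<longleftrightarrow> (\<forall>A h. small \<kappa> M A \<and> elementary_on L M A h \<longrightarrow>
     (\<exists>g. automorphism L M g \<and> (\<forall>a \<in> A. g a = h a)))"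

text \<open>Convention for ``highly'' and ``small'': small means of cardinality below \<open>\<kappa>\<close>, where \<open>\<kappa>\<close> is an
  uncountable strong limit cardinal greater than the number of symbols of the language.\<close>

definition monster ::
  "'k rel \<Rightarrow> ('f, 'r) language \<Rightarrow> ('f, 'r) fm set \<Rightarrow> ('f, 'r, 'c) struct \<Rightarrow> bool" where
  "monster \<kappa> L T M \<longleftrightarrow>
     Card_order \<kappa> \<and> natLeq <o \<kappa> \<and> |funs L| <o \<kappa> \<and> |rels L| <o \<kappa> \<and>
     (\<forall>X \<subseteq> Field \<kappa>. |X| <o \<kappa> \<longrightarrow> |Pow X| <o \<kappa>) \<and>
     is_model L T M \<and> saturated \<kappa> L M \<and> strongly_homogeneous \<kappa> L M"

section \<open>Simplicity\<close>

text \<open>The solution set of \<open>\<phi>(x, c)\<close>: here \<open>x\<close> is the tuple of the first \<open>n\<close> variables of \<open>\<phi>\<close>,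
  and \<open>c\<close> is substituted for the following \<open>length c\<close> variables.\<close>

definition solutions ::
  "('f, 'r, 'c) struct \<Rightarrow> nat \<Rightarrow> ('f + 'c, 'r) fm \<Rightarrow> 'c list \<Rightarrow> 'c list set" where
  "solutions M n \<phi> c = {a \<in> tuples M n. holds (named M) \<phi> (a @ c)}"

text \<open>Inconsistency is counted by indices, so a constant family of a nonempty set is never
  k-inconsistent.\<close>

definition k_inconsistent :: "nat \<Rightarrow> (nat \<Rightarrow> 'a set) \<Rightarrow> bool" where
  "k_inconsistent k X \<longleftrightarrow> (\<forall>I. finite I \<and> card I = k \<longrightarrow> (\<Inter>i \<in> I. X i) = {})"

text \<open>Tree property of \<open>\<phi>(x, y)\<close> with \<open>x\<close> of length \<open>n\<close> and \<open>y\<close> of length \<open>m\<close>; the nodes of the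
  tree are the nonempty finite sequences of natural numbers.\<close>

definition tree_property ::
  "('f, 'r, 'c) struct \<Rightarrow> nat \<Rightarrow> nat \<Rightarrow> ('f + 'c, 'r) fm \<Rightarrow> bool" where
  "tree_property M n m \<phi> \<longleftrightarrow> (\<exists>k. \<exists>a :: nat list \<Rightarrow> 'c list.
     (\<forall>s. s \<noteq> [] \<longrightarrow> a s \<in> tuples M m) \<and>
     (\<forall>s. k_inconsistent k (\<lambda>i. solutions M n \<phi> (a (s @ [i])))) \<and>
     (\<forall>\<eta> :: nat \<Rightarrow> nat. \<forall>J. finite J \<and> J \<subseteq> {1..} \<longrightarrow>
        (\<exists>x \<in> tuples M n. \<forall>j \<in> J. x \<in> solutions M n \<phi> (a (map \<eta> [0..<j])))))"

definition simple_theory :: "('f, 'r) language \<Rightarrow> ('f, 'r, 'c) struct \<Rightarrow> bool" where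
  "simple_theory L M \<longleftrightarrow>
     (\<forall>n m. \<forall>\<phi> \<in> fmls (lang L ({} :: 'c set)) (n + m). \<not> tree_property M n m \<phi>)"

section \<open>Forking and independence\<close>

text \<open>\<open>\<phi>(x, c)\<close> divides over \<open>A\<close>, where \<open>\<phi>(x, z)\<close> is an \<open>L(A)\<close>-formula and \<open>x\<close> has length \<open>n\<close>.\<close>

definition divides ::
  "('f, 'r) language \<Rightarrow> ('f, 'r, 'c) struct \<Rightarrow> 'c set \<Rightarrow> nat \<Rightarrow> ('f + 'c, 'r) fm \<Rightarrow> 'c list \<Rightarrow> bool"
where
  "divides L M A n \<phi> c \<longleftrightarrow>
     \<phi> \<in> fmls (lang L A) (n + length c) \<and> c \<in> tuples M (length c) \<and>
     (\<exists>k. \<exists>s :: nat \<Rightarrow> 'c list.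
        (\<forall>i. s i \<in> tuples M (length c) \<and> tp L M (s i) A = tp L M c A) \<and>
        k_inconsistent k (\<lambda>i. solutions M n \<phi> (s i)))"

text \<open>A formula forks over \<open>A\<close> if it implies a finite disjunction of formulas that divide over \<open>A\<close>.
  This depends only on its solution set, and is stated for the solution set \<open>X\<close>, a set of n-tuples.\<close>

definition forks ::
  "('f, 'r) language \<Rightarrow> ('f, 'r, 'c) struct \<Rightarrow> 'c set \<Rightarrow> nat \<Rightarrow> 'c list set \<Rightarrow> bool" where
  "forks L M A n X \<longleftrightarrow>
     (\<exists>D. finite D \<and> (\<forall>(\<psi>, d) \<in> D. divides L M A n \<psi> d) \<and>
        X \<subseteq> (\<Union>(\<psi>, d) \<in> D. solutions M n \<psi> d))"

definition type_forks ::
  "('f, 'r) language \<Rightarrow> ('f, 'r, 'c) struct \<Rightarrow> 'c set \<Rightarrow> nat \<Rightarrow> ('f + 'c, 'r) fm set \<Rightarrow> bool" where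
  "type_forks L M A n p \<longleftrightarrow>
     (\<exists>P. finite P \<and> P \<subseteq> p \<and> forks L M A n {a \<in> tuples M n. realizes M a P})"

definition indep ::
  "('f, 'r) language \<Rightarrow> ('f, 'r, 'c) struct \<Rightarrow> 'c list \<Rightarrow> 'c list \<Rightarrow> 'c set \<Rightarrow> bool" where
  "indep L M a b C \<longleftrightarrow> \<not> type_forks L M C (length a) (tp L M a (C \<union> set b))"

definition nonforking_extension ::
  "('f, 'r) language \<Rightarrow> ('f, 'r, 'c) struct \<Rightarrow> nat \<Rightarrow> 'c set \<Rightarrow> ('f + 'c, 'r) fm set
     \<Rightarrow> 'c set \<Rightarrow> ('f + 'c, 'r) fm set \<Rightarrow> bool" where
  "nonforking_extension L M n A p C p' \<longleftrightarrow>
     p' \<in> types L M C n \<and> p \<subseteq> p' \<and> \<not> type_forks L M A n p'"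

text \<open>\<open>orthogonal \<kappa> L M n A p m B q\<close>: the type \<open>p \<in> S\<^sub>n(A)\<close> is orthogonal to \<open>q \<in> S\<^sub>m(B)\<close>.\<close>

definition orthogonal ::
  "'k rel \<Rightarrow> ('f, 'r) language \<Rightarrow> ('f, 'r, 'c) struct
     \<Rightarrow> nat \<Rightarrow> 'c set \<Rightarrow> ('f + 'c, 'r) fm set \<Rightarrow> nat \<Rightarrow> 'c set \<Rightarrow> ('f + 'c, 'r) fm set \<Rightarrow> bool" where
  "orthogonal \<kappa> L M n A p m B q \<longleftrightarrow>
     (\<forall>C p' q'. small \<kappa> M C \<and> A \<union> B \<subseteq> C \<and>
        nonforking_extension L M n A p C p' \<and> nonforking_extension L M m B q C q' \<longrightarrow>
        (\<forall>a \<in> tuples M n. \<forall>b \<in> tuples M m.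
           realizes M a p' \<and> realizes M b q' \<longrightarrow> indep L M a b C))"

definition unidimensional ::
  "'k rel \<Rightarrow> ('f, 'r) language \<Rightarrow> ('f, 'r, 'c) struct \<Rightarrow> bool" where
  "unidimensional \<kappa> L M \<longleftrightarrow>
     (\<forall>A B n m. \<forall>p \<in> types L M A n. \<forall>q \<in> types L M B m.
        small \<kappa> M A \<and> small \<kappa> M B \<and> \<not> algebraic M n p \<and> \<not> algebraic M m q \<longrightarrow>
        \<not> orthogonal \<kappa> L M n A p m B q)"

section \<open>The forking topology\<close>

text \<open>\<open>{a \<in> M\<^sup>n. \<phi>(a, y) forks over A}\<close>, where \<open>y\<close> has length \<open>k\<close>.\<close>

definition tauf_basic ::
  "('f, 'r) language \<Rightarrow> ('f, 'r, 'c) struct \<Rightarrow> 'c set \<Rightarrow> nat \<Rightarrow> nat \<Rightarrow> ('f + 'c, 'r) fm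
     \<Rightarrow> 'c list set" where
  "tauf_basic L M A n k \<phi> =
     {a \<in> tuples M n. forks L M A k {b \<in> tuples M k. holds (named M) \<phi> (a @ b)}}"

definition tauf_topology ::
  "('f, 'r) language \<Rightarrow> ('f, 'r, 'c) struct \<Rightarrow> 'c set \<Rightarrow> nat \<Rightarrow> ('f + 'c, 'r) fm set topology" where
  "tauf_topology L M A n = topology_generated_by
     {(\<lambda>a. tp L M a A) ` tauf_basic L M A n k \<phi> | k \<phi>. \<phi> \<in> fmls (lang L A) (n + k)}"

text \<open>Open sets of types, viewed as A-invariant sets of n-tuples of the monster model.\<close>

definition tauf_open ::
  "('f, 'r) language \<Rightarrow> ('f, 'r, 'c) struct \<Rightarrow> 'c set \<Rightarrow> nat \<Rightarrow> 'c list set \<Rightarrow> bool" where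
  "tauf_open L M A n U \<longleftrightarrow>
     (\<exists>Q. openin (tauf_topology L M A n) Q \<and> U = {a \<in> tuples M n. tp L M a A \<in> Q})"

definition PCFT :: "'k rel \<Rightarrow> ('f, 'r) language \<Rightarrow> ('f, 'r, 'c) struct \<Rightarrow> bool" where
  "PCFT \<kappa> L M \<longleftrightarrow>
     (\<forall>A n m U. small \<kappa> M A \<and> tauf_open L M A (n + m) U \<longrightarrow>
        tauf_open L M A n {a \<in> tuples M n. \<exists>b \<in> tuples M m. a @ b \<in> U})"

end

theory Submission
  imports Defs "HOL-Library.Ramsey"
begin

text \<open>Suppose that \<open>\<Phi>(z, a, b\<^sub>0)\<close> forks over \<open>A\<close>, but that arbitrarily close to \<open>a\<close> there are points \<open>a'\<close> such that
  \<open>\<Phi>(z, a', b)\<close> forks over \<open>A\<close> for no \<open>b\<close>. Over such an \<open>a'\<close> every \<open>b\<close> has a tester: a solution \<open>z\<close> of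
  \<open>\<Phi>(z, a', b)\<close> independent from \<open>a'\<close> over \<open>A\<close>. By compactness one may pretend that \<open>a\<close> itself has this
  property: every system of testers and of conjugates of \<open>b\<^sub>0\<close> generic over prescribed sets that exists over the
  nearby points exists over \<open>a\<close>, and it can be enlarged by a tester for any conjugate \<open>b\<close> of \<open>b\<^sub>0\<close> over \<open>Aa\<close>.
  If \<open>b\<close> were algebraic over the set collected so far, such a tester would be independent from \<open>ab\<close> over \<open>A\<close>,
  although \<open>\<Phi>(z, a, b)\<close> forks. So \<open>b\<close> is never algebraic, and unidimensionality, applied to \<open>b\<close> and
  to a generic conjugate \<open>e\<close> of \<open>b\<^sub>0\<close>, yields a larger set, containing a copy of \<open>e\<close> and further testers, over which
  the type of \<open>b\<close> forks, while the testers remain independent from \<open>b\<close> over \<open>Aa\<close>. A long enough transfinite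
  iteration contradicts the local character of non-forking.\<close>

section \<open>Structures as families of definable relations\<close>

text \<open>Independence passes from the nearby points to \<open>a\<close> because forking with
  \<open>a\<close> is itself a basic tau^f-open condition on \<open>a\<close>: a formula over
  \<open>a\<close> that forks over \<open>A\<close> keeps forking over all points of some
  neighbourhood, so a failure of independence at \<open>a\<close> would be visible nearby. The
  obstacle in the iteration is that unidimensionality makes \<open>b\<close> depend on
  \<open>e\<close> only over a further tuple \<open>d\<close>, and nothing keeps \<open>d\<close>
  independent from testers that are chosen later, as the refutation of algebraicity requires. Local
  character allows the configuration to be enlarged until \<open>d\<close> depends on no later
  tester over what is present; but the enlargement may spoil the relation between \<open>d\<close>,
  \<open>e\<close> and the testers. Hence \<open>e\<close> is taken from a long indiscernible
  sequence, one \<open>d\<close> is made to fit all its members, and the member is chosen after the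
  enlargement. Only definable sets, types and automorphisms matter for this, so languages are absent
  until the last sections. The length \<open>\<nu>\<close> of all iterations exceeds the number of
  parameter-free definable relations, so that infinitely many steps of a chain are witnessed by the
  same finite set of formulas.\<close>

definition tup :: "'c set => nat => 'c list set" where
  "tup M n = {a. set a <= M & length a = n}"

lemma tup_iff: "a \<in> tup M n \<longleftrightarrow> set a <= M & length a = n"
  by (simp add: tup_def)

lemma tup_nth: "a \<in> tup M n ==> i < n ==> a ! i \<in> M"
  by (auto simp: tup_def)

text \<open>Formulas are replaced by the relations they define. Parameters are never part of a
  relation: they are appended to the tuple, so \<open>Def\<close> stands for the parameter-free
  definable sets. Saturation is assumed for one variable only; \<open>compactness\<close> lifts it
  to \<open>\<nu>\<close> many.\<close>

locale dstruct =
  fixes M :: "'c set" and Def :: "nat => 'c list set set" and \<nu> :: "'v rel"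
  assumes M_ne: "M ~= {}"
    and Def_sub: "!!R n. R \<in> Def n ==> R <= tup M n"
    and Def_full: "!!n. tup M n \<in> Def n"
    and Def_Diff: "!!R n. R \<in> Def n ==> tup M n - R \<in> Def n"
    and Def_Int: "!!R S n. R \<in> Def n ==> S \<in> Def n ==> R Int S \<in> Def n"
    and Def_reindex: "!!R m n \<sigma>. R \<in> Def m ==> (!!i. i < m ==> \<sigma> i < n) ==>
           {a \<in> tup M n. map (%i. a ! \<sigma> i) [0..<m] \<in> R} \<in> Def n"
    and Def_ex: "!!R n. R \<in> Def (Suc n) ==> {a \<in> tup M n. \<exists>x\<in>M. a @ [x] \<in> R} \<in> Def n"
    and Def_eq: "{a \<in> tup M 2. a ! 0 = a ! 1} \<in> Def 2"
    and nu_card: "Card_order \<nu>"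
    and nu_inf: "\<not> finite (Field \<nu>)"
    and sat1: "!!B \<Psi>. B <= M ==> |B| \<le>o \<nu> ==>
           (!!R c. (R, c) \<in> \<Psi> ==> R \<in> Def (Suc (length c)) & set c <= B) ==>
           (!!\<Psi>0. \<Psi>0 <= \<Psi> ==> finite \<Psi>0 ==> \<exists>x\<in>M. \<forall>(R, c) \<in> \<Psi>0. x # c \<in> R) ==>
           \<exists>x\<in>M. \<forall>(R, c) \<in> \<Psi>. x # c \<in> R"
begin

definition sm :: "'c set => bool" where
  "sm B \<longleftrightarrow> B <= M & |B| \<le>o \<nu>"

lemma sm_sub: "sm B ==> B <= M" by (simp add: sm_def)

lemma sm_mono: "sm B ==> C <= B ==> sm C"
  unfolding sm_def by (meson card_of_mono1 ordLeq_transitive subset_trans)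

lemma sm_Un: "sm B ==> sm C ==> sm (B Un C)"
  unfolding sm_def using card_of_Un_ordLeq_infinite_Field[OF nu_inf] nu_card by auto

lemma finite_le_nu: "finite B ==> |B| \<le>o \<nu>"
proof -
  assume "finite B"
  then have "|B| \<le>o |Field \<nu>|" using nu_inf
    by (intro ordLess_imp_ordLeq finite_ordLess_infinite card_of_Well_order) (simp_all add: Field_card_of)
  moreover have "|Field \<nu>| =o \<nu>" using nu_card by (rule card_of_Field_ordIso)
  ultimately show ?thesis using ordLeq_ordIso_trans by blast
qed

lemma sm_finite: "finite B ==> B <= M ==> sm B"
  unfolding sm_def using finite_le_nu by blast

lemma sm_set: "set b <= M ==> sm (set b)"
  by (rule sm_finite) auto

lemma sm_empty: "sm {}" by (rule sm_finite) auto

lemma le_nu_Field: "|I| \<le>o \<nu> \<longleftrightarrow> |I| \<le>o |Field \<nu>|"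
  using card_of_Field_ordIso[OF nu_card] ordIso_symmetric ordLeq_ordIso_trans by blast

lemma le_nu_UN: "|I| \<le>o \<nu> ==> (!!i. i \<in> I ==> |B i| \<le>o \<nu>) ==> |\<Union>i\<in>I. B i| \<le>o \<nu>"
  unfolding le_nu_Field using card_of_UNION_ordLeq_infinite[OF nu_inf] by blast

lemma sm_UN: "|I| \<le>o \<nu> ==> (!!i. i \<in> I ==> sm (B i)) ==> sm (\<Union>i\<in>I. B i)"
  unfolding sm_def using le_nu_UN by blast

definition x0 :: 'c where "x0 = (SOME x. x \<in> M)"

lemma x0: "x0 \<in> M" unfolding x0_def using M_ne by (simp add: some_in_eq)

definition asg :: "'c list => nat => 'c" where
  "asg a i = (if i < length a then a ! i else x0)"

lemma asg_range: "set a <= M ==> range (asg a) <= M"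
  using x0 by (auto simp: asg_def)

lemma map_asg: "map (asg a) [0..<length a] = a"
  by (rule nth_equalityI) (auto simp: asg_def)

abbreviation vl :: "('j => 'c) => 'j + 'c => 'c" where
  "vl f \<equiv> case_sum f id"

text \<open>Definable predicates on assignments of an arbitrary, possibly infinite, set of
  variables, as needed for types in \<open>\<nu>\<close> many variables. The list \<open>ts\<close>
  mixes variables (\<open>Inl\<close>) and parameters (\<open>Inr\<close>). Nothing is claimed about
  assignments that leave \<open>M\<close>.\<close>

definition DF :: "'j set => 'c set => (('j => 'c) => bool) => bool" where
  "DF V B Q \<longleftrightarrow> (\<exists>ts R. set ts <= Inl ` V Un Inr ` (B Int M) & R \<in> Def (length ts) &
     (\<forall>f. range f <= M --> Q f = (map (vl f) ts \<in> R)))"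

lemma DF_I: "set ts <= Inl ` V Un Inr ` (B Int M) ==> R \<in> Def (length ts) ==>
    (!!f. range f <= M ==> Q f = (map (vl f) ts \<in> R)) ==> DF V B Q"
  unfolding DF_def by blast

lemma DF_mono: "DF V B Q ==> V <= V' ==> B <= B' ==> DF V' B' Q"
  unfolding DF_def by (elim exE conjE, intro exI conjI, erule order_trans) auto

lemma DF_cong: "DF V B Q ==> (!!f. range f <= M ==> Q f = Q' f) ==> DF V B Q'"
  unfolding DF_def by metis

lemma vl_in: "range f <= M ==> set ts <= Inl ` V Un Inr ` (B Int M) ==> map (vl f) ts \<in> tup M (length ts)"
  by (fastforce simp: tup_iff)

lemma DF_not: "DF V B Q ==> DF V B (%f. \<not> Q f)"
proof -
  assume "DF V B Q"
  then obtain ts R where ts: "set ts <= Inl ` V Un Inr ` (B Int M)" "R \<in> Def (length ts)"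
     "!!f. range f <= M ==> Q f = (map (vl f) ts \<in> R)" unfolding DF_def by blast
  show ?thesis
    by (rule DF_I[OF ts(1) Def_Diff[OF ts(2)]]) (use ts vl_in in auto)
qed

lemma DF_and: "DF V B Q ==> DF V B Q' ==> DF V B (%f. Q f & Q' f)"
proof -
  assume "DF V B Q" "DF V B Q'"
  then obtain ts R ts' R' where ts: "set ts <= Inl ` V Un Inr ` (B Int M)" "R \<in> Def (length ts)"
     "!!f. range f <= M ==> Q f = (map (vl f) ts \<in> R)"
    and ts': "set ts' <= Inl ` V Un Inr ` (B Int M)" "R' \<in> Def (length ts')"
     "!!f. range f <= M ==> Q' f = (map (vl f) ts' \<in> R')" unfolding DF_def by metis
  let ?n = "length (ts @ ts')"
  let ?S = "{a \<in> tup M ?n. map (%i. a ! i) [0..<length ts] \<in> R}"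
  let ?S' = "{a \<in> tup M ?n. map (%i. a ! (length ts + i)) [0..<length ts'] \<in> R'}"
  have "?S \<in> Def ?n" by (rule Def_reindex[OF ts(2)]) auto
  moreover have "?S' \<in> Def ?n" by (rule Def_reindex[OF ts'(2)]) auto
  ultimately have S: "?S Int ?S' \<in> Def ?n" by (rule Def_Int)
  have T: "set (ts @ ts') <= Inl ` V Un Inr ` (B Int M)" using ts(1) ts'(1) by auto
  show ?thesis
  proof (rule DF_I[OF T S])
    fix f :: "'a => 'c" assume f: "range f <= M"
    have 1: "map (%i. map (vl f) (ts @ ts') ! i) [0..<length ts] = map (vl f) ts"
      by (rule nth_equalityI) (auto simp: nth_append)
    have 2: "map (%i. map (vl f) (ts @ ts') ! (length ts + i)) [0..<length ts'] = map (vl f) ts'"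
      by (rule nth_equalityI) (auto simp: nth_append)
    show "(Q f & Q' f) = (map (vl f) (ts @ ts') \<in> ?S Int ?S')"
      unfolding Int_iff mem_Collect_eq 1 2 using ts(3)[OF f] ts'(3)[OF f] vl_in[OF f T] by blast
  qed
qed

lemma DF_or: "DF V B Q ==> DF V B Q' ==> DF V B (%f. Q f \<or> Q' f)"
  using DF_not[OF DF_and[OF DF_not DF_not]] by (rule DF_cong) auto

lemma DF_True: "DF V B (%f. True)"
  by (rule DF_I[of "[]" _ _ "tup M 0"]) (auto intro: Def_full[of 0, simplified] simp: tup_iff)

lemma DF_const: "DF V B (%f. P)"
  by (cases P) (use DF_True DF_not[OF DF_True] in auto)

lemma DF_Ball: "finite I ==> (!!i. i \<in> I ==> DF V B (Q i)) ==> DF V B (%f. \<forall>i\<in>I. Q i f)"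
proof (induction I rule: finite_induct)
  case empty then show ?case using DF_True by simp
next
  case (insert x F)
  then have "DF V B (%f. Q x f & (\<forall>i\<in>F. Q i f))" by (intro DF_and) auto
  then show ?case by (rule DF_cong) auto
qed

lemma DF_mem: "R \<in> Def n ==> length vs + length cs = n ==> set vs <= V ==> set cs <= B ==> set cs <= M ==>
   DF V B (%f. map f vs @ cs \<in> R)"
  by (rule DF_I[of "map Inl vs @ map Inr cs" _ _ R]) (auto simp: comp_def)

lemma DF_eqv: "u \<in> V ==> v \<in> V ==> DF V B (%f. f u = f v)"
  by (rule DF_I[of "[Inl u, Inl v]" _ _ "{a \<in> tup M 2. a ! 0 = a ! 1}"])
    (use Def_eq in \<open>auto simp: tup_iff numeral_2_eq_2\<close>)

lemma DF_eqc: "u \<in> V ==> c \<in> B ==> c \<in> M ==> DF V B (%f. f u = c)"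
  by (rule DF_I[of "[Inl u, Inr c]" _ _ "{a \<in> tup M 2. a ! 0 = a ! 1}"])
    (use Def_eq in \<open>auto simp: tup_iff numeral_2_eq_2\<close>)

text \<open>All occurrences of \<open>j\<close> have to be read from one slot:
  \<open>\<sigma>\<close> sends them to the last coordinate, over which \<open>Def_ex\<close>
  projects, and every other term to a position in the list without \<open>j\<close>.\<close>

lemma DF_ex1:
  assumes "DF V B Q" shows "DF (V - {j}) B (%f. \<exists>x\<in>M. Q (f(j := x)))"
proof -
  obtain ts R where ts: "set ts <= Inl ` V Un Inr ` (B Int M)" "R \<in> Def (length ts)"
     "!!f. range f <= M ==> Q f = (map (vl f) ts \<in> R)" using assms unfolding DF_def by blast
  let ?n = "length ts" let ?ts = "filter (%t. t ~= Inl j) ts" let ?m = "length ?ts"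
  define pos where "pos t = (SOME p. p < ?m & ?ts ! p = t)" for t
  have pos: "pos t < ?m & ?ts ! pos t = t" if "t \<in> set ts" "t ~= Inl j" for t
  proof -
    have "t \<in> set ?ts" using that by simp
    then have "\<exists>p. p < ?m & ?ts ! p = t" by (meson in_set_conv_nth)
    then show ?thesis unfolding pos_def by (rule someI_ex)
  qed
  define \<sigma> where "\<sigma> i = (if ts ! i = Inl j then ?m else pos (ts ! i))" for i
  have \<sigma>: "\<sigma> i < Suc ?m" if "i < ?n" for i using that pos[of "ts ! i"] unfolding \<sigma>_def by auto
  let ?R1 = "{b \<in> tup M (Suc ?m). map (%i. b ! \<sigma> i) [0..<?n] \<in> R}"
  have R1: "?R1 \<in> Def (Suc ?m)" by (rule Def_reindex[OF ts(2)]) (use \<sigma> in auto)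
  have T: "set ?ts <= Inl ` (V - {j}) Un Inr ` (B Int M)" using ts(1) by auto
  show ?thesis
  proof (rule DF_I[OF T Def_ex[OF R1]])
    fix f :: "'a => 'c" assume f: "range f <= M"
    have t: "map (vl f) ?ts \<in> tup M ?m" by (rule vl_in[OF f T])
    have "Q (f(j := x)) = (map (vl f) ?ts @ [x] \<in> ?R1)" if x: "x \<in> M" for x
    proof -
      have r: "range (f(j := x)) <= M" using f x by auto
      have "map (%i. (map (vl f) ?ts @ [x]) ! \<sigma> i) [0..<?n] = map (vl (f(j := x))) ts"
      proof (rule nth_equalityI, simp, clarsimp)
        fix i assume i: "i < length ts"
        show "(map (vl f) ?ts @ [x]) ! \<sigma> i = vl (f(j := x)) (ts ! i)"
        proof (cases "ts ! i = Inl j")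
          case True then show ?thesis by (simp add: \<sigma>_def nth_append)
        next
          case False
          have p: "pos (ts ! i) < ?m" "?ts ! pos (ts ! i) = ts ! i" using pos[of "ts ! i"] i False by auto
          have "(map (vl f) ?ts @ [x]) ! \<sigma> i = vl f (?ts ! pos (ts ! i))"
            using False p(1) by (simp add: \<sigma>_def nth_append)
          also have "\<dots> = vl (f(j := x)) (ts ! i)" using False p(2) by (auto split: sum.split)
          finally show ?thesis .
        qed
      qed
      moreover have "map (vl f) ?ts @ [x] \<in> tup M (Suc ?m)" using t x by (auto simp: tup_iff)
      ultimately show ?thesis using ts(3)[OF r] by simp
    qed
    then show "(\<exists>x\<in>M. Q (f(j := x))) = (map (vl f) ?ts \<in> {a \<in> tup M ?m. \<exists>x\<in>M. a @ [x] \<in> ?R1})"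
      using t by blast
  qed
qed

lemma DF_dep: "DF V B Q ==> range f <= M ==> range g <= M ==> (!!i. i \<in> V ==> f i = g i) ==> Q f = Q g"
proof -
  assume a: "DF V B Q" "range f <= M" "range g <= M" "!!i. i \<in> V ==> f i = g i"
  then obtain ts R where ts: "set ts <= Inl ` V Un Inr ` (B Int M)"
     "!!f. range f <= M ==> Q f = (map (vl f) ts \<in> R)" unfolding DF_def by blast
  have "map (vl f) ts = map (vl g) ts" using ts(1) a(4) by (auto split: sum.split)
  then show ?thesis using ts(2) a by metis
qed

lemma DF_fin:
  assumes "DF V B Q" shows "\<exists>U. finite U & U <= V & DF U B Q"
proof -
  obtain ts R where ts: "set ts <= Inl ` V Un Inr ` (B Int M)" "R \<in> Def (length ts)"
     "!!f. range f <= M ==> Q f = (map (vl f) ts \<in> R)" using assms unfolding DF_def by blast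
  have "DF {v. Inl v \<in> set ts} B Q" by (rule DF_I[OF _ ts(2,3)]) (use ts(1) in auto)
  moreover have "finite {v. Inl v \<in> set ts}"
    using finite_vimageI[of "set ts" Inl] by (simp add: vimage_def)
  ultimately show ?thesis using ts(1) by (intro exI[of _ "{v. Inl v \<in> set ts}"]) auto
qed

text \<open>A block of variables is quantified by an assignment \<open>g\<close> that agrees with
  \<open>f\<close> off the block, which avoids listing the variables.\<close>

lemma DF_exs:
  assumes "finite U" "DF V B Q"
  shows "DF (V - U) B (%f. \<exists>g. range g <= M & (\<forall>i. i \<notin> U --> g i = f i) & Q g)"
  using assms
proof (induction U arbitrary: V Q rule: finite_induct)
  case empty
  have "g = f" if "\<forall>i. g i = f i" for f g :: "'a => 'c" using that by auto
  then show ?case using empty by (simp, elim DF_cong) auto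
next
  case (insert j U)
  have "DF (V - {j}) B (%f. \<exists>x\<in>M. Q (f(j := x)))" by (rule DF_ex1[OF insert.prems])
  from insert.IH[OF this] have "DF (V - {j} - U) B (%f. \<exists>g. range g <= M & (\<forall>i. i \<notin> U --> g i = f i) & (\<exists>x\<in>M. Q (g(j := x))))" .
  then have "DF (V - insert j U) B (%f. \<exists>g. range g <= M & (\<forall>i. i \<notin> U --> g i = f i) & (\<exists>x\<in>M. Q (g(j := x))))"
    by (subst Diff_insert2)
  then show ?case
  proof (rule DF_cong)
    fix f :: "'a => 'c" assume f: "range f <= M"
    show "(\<exists>g. range g <= M & (\<forall>i. i \<notin> U --> g i = f i) & (\<exists>x\<in>M. Q (g(j := x)))) =
         (\<exists>g. range g <= M & (\<forall>i. i \<notin> insert j U --> g i = f i) & Q g)" (is "?L = ?R")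
    proof
      assume ?L
      then obtain g x where g: "range g <= M" "\<forall>i. i \<notin> U --> g i = f i" "x \<in> M" "Q (g(j := x))" by blast
      show ?R by (rule exI[of _ "g(j := x)"]) (use g in auto)
    next
      assume ?R
      then obtain g where g: "range g <= M" "\<forall>i. i \<notin> insert j U --> g i = f i" "Q g" by blast
      have "range (g(j := f j)) <= M" using g f by auto
      moreover have "\<forall>i. i \<notin> U --> (g(j := f j)) i = f i" using g by auto
      moreover have "g j \<in> M" using g by auto
      moreover have "Q ((g(j := f j))(j := g j))" using g by simp
      ultimately show ?L by blast
    qed
  qed
qed

lemma DF_list:
  assumes "DF V B Q" "V <= set vs"
  shows "\<exists>R cs. set cs <= B Int M & R \<in> Def (length vs + length cs) &
    (\<forall>f. range f <= M --> Q f = (map f vs @ cs \<in> R))"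
proof -
  obtain ts R where ts: "set ts <= Inl ` V Un Inr ` (B Int M)" "R \<in> Def (length ts)"
     "!!f. range f <= M ==> Q f = (map (vl f) ts \<in> R)" using assms unfolding DF_def by blast
  have "\<exists>cs. set cs = {c. Inr c \<in> set ts}"
  proof (rule finite_list)
    show "finite {c. Inr c \<in> set ts}" using finite_vimageI[of "set ts" Inr] by (simp add: vimage_def)
  qed
  then obtain cs where cs: "set cs = {c. Inr c \<in> set ts}" by blast
  have "\<exists>p < length vs + length cs. \<forall>f. (map f vs @ cs) ! p = vl f (ts ! i)" if "i < length ts" for i
  proof (cases "ts ! i")
    case (Inl v)
    then have "Inl v \<in> set ts" using that by (metis nth_mem)
    then have "v \<in> set vs" using ts(1) assms(2) by auto
    then obtain p where "p < length vs" "vs ! p = v" by (meson in_set_conv_nth)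
    then show ?thesis using Inl by (intro exI[of _ p]) (simp add: nth_append)
  next
    case (Inr c)
    then have "Inr c \<in> set ts" using that by (metis nth_mem)
    then have "c \<in> set cs" using cs by simp
    then obtain p where "p < length cs" "cs ! p = c" by (meson in_set_conv_nth)
    then show ?thesis using Inr by (intro exI[of _ "length vs + p"]) (simp add: nth_append)
  qed
  then obtain \<sigma> where \<sigma>: "!!i. i < length ts ==> \<sigma> i < length vs + length cs"
     "!!i f. i < length ts ==> (map f vs @ cs) ! \<sigma> i = vl f (ts ! i)" by metis
  let ?S = "{a \<in> tup M (length vs + length cs). map (%i. a ! \<sigma> i) [0..<length ts] \<in> R}"
  have S: "?S \<in> Def (length vs + length cs)" by (rule Def_reindex[OF ts(2)]) (use \<sigma> in auto)
  have csM: "set cs <= B Int M" using cs ts(1) by auto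
  have "Q f = (map f vs @ cs \<in> ?S)" if f: "range f <= M" for f
  proof -
    have "map (%i. (map f vs @ cs) ! \<sigma> i) [0..<length ts] = map (vl f) ts"
      by (rule nth_equalityI) (use \<sigma> in auto)
    moreover have "map f vs @ cs \<in> tup M (length vs + length cs)" using f csM by (auto simp: tup_iff)
    ultimately show ?thesis using ts(3)[OF f] by simp
  qed
  then show ?thesis using csM S by blast
qed

lemma DF_Sol:
  assumes "DF {..<n} B Q"
  shows "\<exists>R cs. set cs <= B Int M & R \<in> Def (n + length cs) & (\<forall>a\<in>tup M n. Q (asg a) = (a @ cs \<in> R))"
proof -
  obtain R cs where R: "set cs <= B Int M" "R \<in> Def (n + length cs)"
    "!!f. range f <= M ==> Q f = (map f [0..<n] @ cs \<in> R)"
    using DF_list[OF assms, of "[0..<n]"] by (auto simp: lessThan_atLeast0)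
  have "Q (asg a) = (a @ cs \<in> R)" if "a \<in> tup M n" for a
    using R(3)[of "asg a"] asg_range[of a] map_asg[of a] that by (auto simp: tup_iff)
  then show ?thesis using R(1,2) by blast
qed

text \<open>One-variable saturation is lifted by Zorn: a partial assignment \<open>G\<close> that is
  maximal among those jointly finitely satisfiable with \<open>\<Phi>\<close> is total, because at a
  missing variable the conditions on its value form a finitely satisfiable one-variable type over
  \<open>B\<close> and the values of \<open>G\<close>.\<close>

theorem compactness:
  fixes V :: "'j set"
  assumes V: "|V| \<le>o \<nu>" and B: "sm B" and \<Phi>: "!!Q. Q \<in> \<Phi> ==> DF V B Q"
    and fs: "!!\<Phi>0. \<Phi>0 <= \<Phi> ==> finite \<Phi>0 ==> \<exists>f. range f <= M & (\<forall>Q\<in>\<Phi>0. Q f)"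
  shows "\<exists>f. range f <= M & (\<forall>Q\<in>\<Phi>. Q f)"
proof -
  define ok where "ok \<Phi>0 G f \<longleftrightarrow> range f <= M & (\<forall>Q\<in>\<Phi>0. Q f) & (\<forall>(j, x)\<in>G. f j = x)"
    for \<Phi>0 :: "(('j => 'c) => bool) set" and G :: "('j \<times> 'c) set" and f
  have ok_mono: "ok \<Phi>0 G f ==> \<Phi>1 <= \<Phi>0 ==> G1 <= G ==> ok \<Phi>1 G1 f" for \<Phi>0 \<Phi>1 G G1 f
    unfolding ok_def by auto
  define \<G> where "\<G> = {G. G <= V \<times> M & (\<forall>\<Phi>0 G0. \<Phi>0 <= \<Phi> & finite \<Phi>0 & G0 <= G & finite G0 --> (\<exists>f. ok \<Phi>0 G0 f))}"
  have "{} \<in> \<G>" unfolding \<G>_def ok_def using fs by auto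
  then have ne: "\<G> ~= {}" by blast
  have "\<exists>G\<in>\<G>. \<forall>X\<in>\<G>. G <= X --> X = G"
  proof (rule subset_Zorn_nonempty[OF ne])
    fix C assume C: "C ~= {}" "subset.chain \<G> C"
    then have sub: "C <= \<G>" by (simp add: subset.chain_def)
    show "\<Union>C \<in> \<G>" unfolding \<G>_def
    proof (intro CollectI conjI allI impI)
      show "\<Union>C <= V \<times> M" using sub unfolding \<G>_def by blast
      fix \<Phi>0 G0 assume a: "\<Phi>0 <= \<Phi> & finite \<Phi>0 & G0 <= \<Union>C & finite G0"
      then obtain X where "X \<in> C" "G0 <= X" using finite_subset_Union_chain[of G0 C \<G>] C by metis
      then have "X \<in> \<G>" using sub by blast
      then show "\<exists>f. ok \<Phi>0 G0 f" using a \<open>G0 <= X\<close> unfolding \<G>_def by simp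
    qed
  qed
  then obtain G where G: "G \<in> \<G>" and mx: "!!X. X \<in> \<G> ==> G <= X ==> X = G" by blast
  have GV: "G <= V \<times> M" using G by (simp add: \<G>_def)
  have Gf: "\<exists>f. ok \<Phi>0 G0 f" if "\<Phi>0 <= \<Phi>" "finite \<Phi>0" "G0 <= G" "finite G0" for \<Phi>0 G0
    using G that unfolding \<G>_def by simp
  have sv: "x = y" if "(j, x) \<in> G" "(j, y) \<in> G" for j x y
    using Gf[of "{}" "{(j,x),(j,y)}"] that unfolding ok_def by auto
  have "inj_on fst G" using sv by (auto simp: inj_on_def)
  then have "|G| \<le>o |V|" using GV by (intro card_of_ordLeqI[of fst]) auto
  then have "|snd ` G| \<le>o \<nu>" using V card_of_image[of snd G] by (meson ordLeq_transitive)
  then have smG: "sm (B Un snd ` G)" using B GV by (intro sm_Un) (auto simp: sm_def)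
  have tot: "\<exists>x. (j, x) \<in> G" if j: "j \<in> V" for j
  proof -
    \<comment> \<open>The values at \<open>j\<close> of the solutions of a finite part; a common
      point of all these sets extends \<open>G\<close>.\<close>
    define pr where "pr \<Phi>0 G0 x \<longleftrightarrow> (\<exists>f. ok \<Phi>0 G0 f & f j = x)" for \<Phi>0 G0 x
    have rep: "\<exists>R c. R \<in> Def (Suc (length c)) & set c <= B Un snd ` G & (\<forall>x\<in>M. pr \<Phi>0 G0 x = (x # c \<in> R))"
      if a: "\<Phi>0 <= \<Phi>" "finite \<Phi>0" "G0 <= G" "finite G0" for \<Phi>0 G0
    proof -
      let ?B = "B Un snd ` G"
      have "DF V ?B (%f. \<forall>(i, x)\<in>G0. f i = x)"
      proof -
        have "DF V ?B (%f. \<forall>p\<in>G0. f (fst p) = snd p)"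
          by (rule DF_Ball[OF a(4)], rule DF_eqc) (use a(3) GV in force)+
        then show ?thesis by (rule DF_cong) (auto simp: case_prod_beta)
      qed
      moreover have "DF V ?B (%f. \<forall>Q\<in>\<Phi>0. Q f)"
        by (rule DF_Ball[OF a(2)], rule DF_mono[OF \<Phi>]) (use a in auto)
      ultimately have d: "DF V ?B (%f. (\<forall>Q\<in>\<Phi>0. Q f) & (\<forall>(i, x)\<in>G0. f i = x))" (is "DF V ?B ?Q") by (intro DF_and)
      obtain U where U: "finite U" "U <= V" "DF U ?B ?Q" using DF_fin[OF d] by blast
      define q where "q f = (\<exists>g. range g <= M & (\<forall>i. i \<notin> U - {j} --> g i = f i) & ?Q g)" for f :: "'j => 'c"
      have dq: "DF (U - (U - {j})) ?B q" unfolding q_def by (rule DF_exs) (use U in auto)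
      have qp: "q (%_. x) = pr \<Phi>0 G0 x" if x: "x \<in> M" for x
      proof
        assume "q (%_. x)" then show "pr \<Phi>0 G0 x" unfolding q_def pr_def ok_def by blast
      next
        assume "pr \<Phi>0 G0 x"
        then obtain f where f: "range f <= M" "?Q f" "f j = x" unfolding pr_def ok_def by blast
        let ?g = "%i. if i \<in> U then f i else x"
        have r: "range ?g <= M" using f(1) x by auto
        have "?Q ?g = ?Q f" by (rule DF_dep[OF U(3) r f(1)]) auto
        then show "q (%_. x)" unfolding q_def using f r by (intro exI[of _ ?g]) auto
      qed
      obtain ts R where ts: "set ts <= Inl ` (U - (U - {j})) Un Inr ` (?B Int M)" "R \<in> Def (length ts)"
         "!!f. range f <= M ==> q f = (map (vl f) ts \<in> R)" using dq unfolding DF_def by blast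
      let ?h = "%f::nat => 'c. map (vl (%_::'j. f 0)) ts \<in> R"
      have "DF {..<1::nat} ?B ?h"
      proof (rule DF_I[of "map (map_sum (%_. 0) id) ts" _ _ R])
        show "set (map (map_sum (%_. 0::nat) id) ts) <= Inl ` {..<1} Un Inr ` (?B Int M)"
        proof
          fix t assume "t \<in> set (map (map_sum (%_. 0::nat) id) ts)"
          then obtain t' where "t' \<in> set ts" "t = map_sum (%_. 0) id t'" by auto
          moreover from this have "t' \<in> Inl ` (U - (U - {j})) Un Inr ` (?B Int M)" using ts(1) by blast
          ultimately show "t \<in> Inl ` {..<1} Un Inr ` (?B Int M)"
            by (elim UnE imageE) auto
        qed
      qed (use ts in \<open>auto simp: comp_def intro!: arg_cong[of _ _ "%x. x \<in> R"] split: sum.splits\<close>)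
      from DF_Sol[OF this] obtain S cs where S: "set cs <= ?B Int M" "S \<in> Def (1 + length cs)"
         "!!a. a \<in> tup M 1 ==> ?h (asg a) = (a @ cs \<in> S)" by blast
      have "pr \<Phi>0 G0 x = (x # cs \<in> S)" if x: "x \<in> M" for x
      proof -
        have "pr \<Phi>0 G0 x = (map (vl (%_. x)) ts \<in> R)" using qp[OF x] ts(3)[of "%_. x"] x by auto
        also have "\<dots> = ([x] @ cs \<in> S)" using S(3)[of "[x]"] x by (simp add: tup_iff asg_def)
        finally show ?thesis by simp
      qed
      then show ?thesis using S by auto
    qed
    \<comment> \<open>All definable sets that contain some \<open>pr\<close>-set. By
      \<open>rep\<close> the \<open>pr\<close>-sets themselves are among them, so a realization lies
      in every one of them.\<close>
    define \<Psi> where "\<Psi> = {(R, c). R \<in> Def (Suc (length c)) & set c <= B Un snd ` G &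
       (\<exists>\<Phi>0 G0. \<Phi>0 <= \<Phi> & finite \<Phi>0 & G0 <= G & finite G0 & (\<forall>x\<in>M. pr \<Phi>0 G0 x --> x # c \<in> R))}"
    have "\<exists>x\<in>M. \<forall>(R, c)\<in>\<Psi>. x # c \<in> R"
    proof (rule sat1[of "B Un snd ` G"])
      show "B Un snd ` G <= M" "|B Un snd ` G| \<le>o \<nu>" using smG by (auto simp: sm_def)
      show "R \<in> Def (Suc (length c)) & set c <= B Un snd ` G" if "(R, c) \<in> \<Psi>" for R c
        using that unfolding \<Psi>_def by blast
      fix \<Psi>0 assume p: "\<Psi>0 <= \<Psi>" "finite \<Psi>0"
      have "\<forall>y\<in>\<Psi>0. \<exists>\<Phi>0 G0. \<Phi>0 <= \<Phi> & finite \<Phi>0 & G0 <= G & finite G0 & (\<forall>x\<in>M. pr \<Phi>0 G0 x --> x # snd y \<in> fst y)"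
        using p unfolding \<Psi>_def by auto
      then obtain F H where FH: "!!y. y \<in> \<Psi>0 ==> F y <= \<Phi> & finite (F y) & H y <= G & finite (H y) & (\<forall>x\<in>M. pr (F y) (H y) x --> x # snd y \<in> fst y)"
        by metis
      obtain f where f: "ok (\<Union>y\<in>\<Psi>0. F y) (\<Union>y\<in>\<Psi>0. H y) f"
        using Gf[of "\<Union>y\<in>\<Psi>0. F y" "\<Union>y\<in>\<Psi>0. H y"] FH p(2) by blast
      have "f j \<in> M" using f unfolding ok_def by auto
      moreover have "\<forall>(R, c)\<in>\<Psi>0. f j # c \<in> R"
      proof clarify
        fix R c assume y: "(R, c) \<in> \<Psi>0"
        have "ok (F (R,c)) (H (R,c)) f" by (rule ok_mono[OF f]) (use y in blast)+
        then have "pr (F (R,c)) (H (R,c)) (f j)" unfolding pr_def by blast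
        then show "f j # c \<in> R" using FH[OF y] \<open>f j \<in> M\<close> by auto
      qed
      ultimately show "\<exists>x\<in>M. \<forall>(R, c)\<in>\<Psi>0. x # c \<in> R" by blast
    qed
    then obtain x where x: "x \<in> M" "\<forall>(R, c)\<in>\<Psi>. x # c \<in> R" by blast
    have px: "pr \<Phi>0 G0 x" if a: "\<Phi>0 <= \<Phi>" "finite \<Phi>0" "G0 <= G" "finite G0" for \<Phi>0 G0
    proof -
      obtain R c where Rc: "R \<in> Def (Suc (length c))" "set c <= B Un snd ` G" "\<forall>x\<in>M. pr \<Phi>0 G0 x = (x # c \<in> R)"
        using rep[OF a] by blast
      then have "(R, c) \<in> \<Psi>" unfolding \<Psi>_def using a by blast
      then have "x # c \<in> R" using x(2) by blast
      then show ?thesis using Rc(3) x(1) by blast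
    qed
    have "insert (j, x) G \<in> \<G>" unfolding \<G>_def
    proof (intro CollectI conjI allI impI)
      show "insert (j, x) G <= V \<times> M" using GV j x by auto
      fix \<Phi>0 G0 assume a: "\<Phi>0 <= \<Phi> & finite \<Phi>0 & G0 <= insert (j, x) G & finite G0"
      have "pr \<Phi>0 (G0 - {(j, x)}) x" by (rule px) (use a in auto)
      then obtain f where f: "ok \<Phi>0 (G0 - {(j, x)}) f" "f j = x" unfolding pr_def by (elim exE conjE)
      note f' = f(1)[unfolded ok_def]
      have "f i = y" if "(i, y) \<in> G0" for i y
        using that bspec[OF f'[THEN conjunct2, THEN conjunct2], of "(i, y)"] f(2)
        by (cases "(i, y) = (j, x)") auto
      then have "\<forall>(i, y)\<in>G0. f i = y" by auto
      then have "ok \<Phi>0 G0 f" unfolding ok_def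
        by (rule conjI[OF f'[THEN conjunct1] conjI[OF f'[THEN conjunct2, THEN conjunct1]]])
      then show "\<exists>f. ok \<Phi>0 G0 f" by (rule exI[of "ok \<Phi>0 G0" f])
    qed
    then have "insert (j, x) G = G" by (rule mx) (rule subset_insertI)
    then show ?thesis by (metis insertI1)
  qed
  define f where "f j = (if j \<in> V then (SOME x. (j, x) \<in> G) else x0)" for j
  have fG: "(j, f j) \<in> G" if "j \<in> V" for j using someI_ex[OF tot[OF that]] that by (simp add: f_def)
  have r: "range f <= M" using fG GV x0 unfolding f_def by fastforce
  have "Q f" if Q: "Q \<in> \<Phi>" for Q
  proof -
    obtain U where U: "finite U" "U <= V" "DF U B Q" using DF_fin[OF \<Phi>[OF Q]] by blast
    have "\<exists>g. ok {Q} ((%j. (j, f j)) ` U) g" by (rule Gf) (use Q U fG in auto)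
    then obtain g where g: "range g <= M" "Q g" "\<forall>j\<in>U. g j = f j" unfolding ok_def by auto
    show "Q f" using DF_dep[OF U(3) r g(1)] g by auto
  qed
  then show ?thesis using r by blast
qed

corollary compactness_indexed:
  fixes V :: "'j set"
  assumes V: "|V| \<le>o \<nu>" and B: "sm B" and Q: "!!t. t \<in> T ==> DF V B (Q t)"
    and fs: "!!T0. T0 <= T ==> finite T0 ==> \<exists>f. range f <= M & (\<forall>t\<in>T0. Q t f)"
  shows "\<exists>f. range f <= M & (\<forall>t\<in>T. Q t f)"
proof -
  have "\<exists>f. range f <= M & (\<forall>P\<in>Q ` T. P f)"
  proof (rule compactness[OF V B])
    show "DF V B P" if "P \<in> Q ` T" for P using that Q by auto
    fix \<Phi>0 assume "\<Phi>0 <= Q ` T" "finite \<Phi>0"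
    then obtain T0 where T0: "T0 <= T" "finite T0" "\<Phi>0 = Q ` T0" by (meson finite_subset_image)
    show "\<exists>f. range f <= M & (\<forall>P\<in>\<Phi>0. P f)" using fs[OF T0(1,2)] unfolding T0(3) by (simp only: ball_simps)
  qed
  then show ?thesis by (simp only: ball_simps)
qed

end

section \<open>Automorphisms and indiscernible sequences\<close>

locale homstruct = dstruct M Def \<nu>
  for M :: "'c set" and Def :: "nat => 'c list set set" and \<nu> :: "'v rel" +
  assumes homog: "!!S h. S <= M ==> |S| \<le>o \<nu> ==> h ` S <= M ==>
       (!!n R u. R \<in> Def n ==> u \<in> R ==> set u <= S ==> map h u \<in> R) ==>
       \<exists>\<sigma>. bij_betw \<sigma> M M & (\<forall>n R u. R \<in> Def n --> u \<in> R --> map \<sigma> u \<in> R) & (\<forall>x\<in>S. \<sigma> x = h x)"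
begin

definition aut :: "('c => 'c) => bool" where
  "aut \<sigma> \<longleftrightarrow> bij_betw \<sigma> M M & (\<forall>n R u. R \<in> Def n --> u \<in> R --> map \<sigma> u \<in> R)"

definition fixes_on :: "'c set => ('c => 'c) => bool" where
  "fixes_on B \<sigma> \<longleftrightarrow> aut \<sigma> & (\<forall>x\<in>B. \<sigma> x = x)"

text \<open>The tuples \<open>a\<close> and \<open>b\<close> have the same type over
  \<open>B\<close>.\<close>

definition eqt :: "'c set => 'c list => 'c list => bool" where
  "eqt B a b \<longleftrightarrow> length a = length b & set a <= M & set b <= M &
     (\<forall>R c. set c <= B --> R \<in> Def (length a + length c) --> (a @ c \<in> R \<longleftrightarrow> b @ c \<in> R))"

lemma Def_length: "R \<in> Def n ==> u \<in> R ==> length u = n & set u <= M"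
  using Def_sub by (fastforce simp: tup_iff)

lemma aut_M: "aut \<sigma> ==> x \<in> M ==> \<sigma> x \<in> M"
  unfolding aut_def bij_betw_def by blast

lemma aut_set: "aut \<sigma> ==> S <= M ==> \<sigma> ` S <= M"
  using aut_M by blast

lemma aut_tup: "aut \<sigma> ==> a \<in> tup M n ==> map \<sigma> a \<in> tup M n"
  using aut_M by (auto simp: tup_iff)

lemma aut_Def:
  assumes "aut \<sigma>" "R \<in> Def n" "u \<in> tup M n"
  shows "map \<sigma> u \<in> R \<longleftrightarrow> u \<in> R"
proof
  assume "u \<in> R" then show "map \<sigma> u \<in> R" using assms unfolding aut_def by metis
next
  assume m: "map \<sigma> u \<in> R"
  show "u \<in> R"
  proof (rule ccontr)
    assume "u \<notin> R"
    then have "u \<in> tup M n - R" using assms by blast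
    then have "map \<sigma> u \<in> tup M n - R" using assms(1) Def_Diff[OF assms(2)] unfolding aut_def by metis
    then show False using m by blast
  qed
qed

lemma aut_inverse:
  assumes "aut \<sigma>"
  obtains \<tau> where "aut \<tau>" "!!x. x \<in> M ==> \<tau> (\<sigma> x) = x" "!!x. x \<in> M ==> \<sigma> (\<tau> x) = x"
proof
  let ?t = "inv_into M \<sigma>"
  have b: "bij_betw \<sigma> M M" using assms by (simp add: aut_def)
  show 1: "?t (\<sigma> x) = x" if "x \<in> M" for x using b that by (simp add: bij_betw_inv_into_left)
  show 2: "\<sigma> (?t x) = x" if "x \<in> M" for x using b that by (simp add: bij_betw_inv_into_right)
  show "aut ?t" unfolding aut_def
  proof (intro conjI allI impI)
    show bt: "bij_betw ?t M M" by (rule bij_betw_inv_into[OF b])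
    fix n R u assume R: "R \<in> Def n" "u \<in> R"
    have u: "u \<in> tup M n" using Def_sub R by blast
    then have tu: "map ?t u \<in> tup M n" using bt unfolding bij_betw_def tup_iff by auto
    have "map \<sigma> (map ?t u) = u" using u 2 by (auto simp: tup_iff intro!: map_idI)
    then show "map ?t u \<in> R" using aut_Def[OF assms R(1) tu] R(2) by simp
  qed
qed

lemma fixes_aut: "fixes_on B \<sigma> ==> aut \<sigma>" by (simp add: fixes_on_def)

lemma fixes_mono: "fixes_on B \<sigma> ==> C <= B ==> fixes_on C \<sigma>" by (auto simp: fixes_on_def)

lemma fixes_image: "fixes_on B \<sigma> ==> C <= B ==> \<sigma> ` C = C" by (force simp: fixes_on_def)

lemma fixes_map: "fixes_on B \<sigma> ==> set c <= B ==> map \<sigma> c = c" by (auto simp: fixes_on_def intro!: map_idI)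

lemma fixes_inverse:
  assumes "fixes_on B \<sigma>" "B <= M"
  obtains \<tau> where "fixes_on B \<tau>" "!!x. x \<in> M ==> \<tau> (\<sigma> x) = x" "!!x. x \<in> M ==> \<sigma> (\<tau> x) = x"
proof -
  obtain \<tau> where \<tau>: "aut \<tau>" "!!x. x \<in> M ==> \<tau> (\<sigma> x) = x" "!!x. x \<in> M ==> \<sigma> (\<tau> x) = x"
    using aut_inverse[OF fixes_aut[OF assms(1)]] by blast
  have "\<tau> x = x" if "x \<in> B" for x using \<tau>(2)[of x] that assms unfolding fixes_on_def by (metis subsetD)
  then show ?thesis using that[of \<tau>] \<tau> by (simp add: fixes_on_def)
qed

lemma fixes_eqt: "fixes_on B \<sigma> ==> set a <= M ==> eqt B a (map \<sigma> a)"
proof -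
  assume a: "fixes_on B \<sigma>" "set a <= M"
  have "(a @ c \<in> R) = (map \<sigma> a @ c \<in> R)" if "set c <= B" "R \<in> Def (length a + length c)" for R c
  proof (cases "set c <= M")
    case True
    then have "a @ c \<in> tup M (length a + length c)" using a by (auto simp: tup_iff)
    from aut_Def[OF fixes_aut[OF a(1)] that(2) this] show ?thesis using fixes_map[OF a(1) that(1)] by simp
  next
    case False
    then show ?thesis using Def_length[OF that(2), of "a @ c"] Def_length[OF that(2), of "map \<sigma> a @ c"] by auto
  qed
  moreover have "set (map \<sigma> a) <= M" using aut_set[OF fixes_aut[OF a(1)] a(2)] by simp
  ultimately show ?thesis using a(2) unfolding eqt_def by simp
qed

lemma eqt_length: "eqt B a b ==> length a = length b" by (simp add: eqt_def)
lemma eqt_M: "eqt B a b ==> set a <= M & set b <= M" by (simp add: eqt_def)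
lemma eqt_refl: "set a <= M ==> eqt B a a" by (simp add: eqt_def)
lemma eqt_sym: "eqt B a b ==> eqt B b a" by (auto simp: eqt_def)
lemma eqt_trans: "eqt B a b ==> eqt B b c ==> eqt B a c" by (auto simp: eqt_def)
lemma eqt_mono: "eqt B a b ==> C <= B ==> eqt C a b" unfolding eqt_def by blast
lemma eqtD: "eqt B a b ==> a @ c \<in> R ==> R \<in> Def (length a + length c) ==> set c <= B ==> b @ c \<in> R"
  unfolding eqt_def by blast

lemma eqt_iff: "eqt B a b ==> R \<in> Def (length a + length c) ==> set c <= B ==> a @ c \<in> R \<longleftrightarrow> b @ c \<in> R"
  unfolding eqt_def by blast

text \<open>One implication is enough because the complement of a definable relation is
  definable.\<close>

lemma eqtI:
  assumes "length a = length b" "set a <= M" "set b <= M"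
    "!!R c. set c <= B ==> R \<in> Def (length a + length c) ==> a @ c \<in> R ==> b @ c \<in> R"
  shows "eqt B a b"
proof -
  have "a @ c \<in> R" if c: "set c <= B" and R: "R \<in> Def (length a + length c)" and b: "b @ c \<in> R" for R c
  proof (rule ccontr)
    assume "a @ c \<notin> R"
    moreover have "a @ c \<in> tup M (length a + length c)" using assms(2) Def_length[OF R b] by (auto simp: tup_iff)
    ultimately have "b @ c \<in> tup M (length a + length c) - R" using assms(4)[OF c Def_Diff[OF R]] by blast
    then show False using b by blast
  qed
  then show ?thesis using assms unfolding eqt_def by blast
qed

lemma eqt_nth_eq:
  assumes "eqt B a b" "i < length a" "j < length a"
  shows "a ! i = a ! j \<longleftrightarrow> b ! i = b ! j"
proof -
  let ?E = "{x \<in> tup M (length a). map (%p. x ! (if p = 0 then i else j)) [0..<2] \<in> {a \<in> tup M 2. a ! 0 = a ! 1}}"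
  have E: "?E \<in> Def (length a + length ([] :: 'c list))" using Def_reindex[OF Def_eq, of "%p. if p = 0 then i else j" "length a"] assms by simp
  have "x \<in> ?E \<longleftrightarrow> x ! i = x ! j" if "x \<in> tup M (length a)" for x
    using that assms by (auto simp: tup_iff numeral_2_eq_2)
  moreover have "a \<in> ?E \<longleftrightarrow> b \<in> ?E" using eqt_iff[OF assms(1) E] by (simp del: mem_Collect_eq)
  moreover have "a \<in> tup M (length a)" "b \<in> tup M (length a)"
    using eqt_length[OF assms(1)] eqt_M[OF assms(1)] by (auto simp: tup_iff)
  ultimately show ?thesis by blast
qed

lemma eqt_nth_const:
  assumes "eqt B a b" "i < length a" "x \<in> B"
  shows "a ! i = x \<longleftrightarrow> b ! i = x"
proof -
  have 0: "a @ [x] \<in> tup M (Suc (length a)) & b @ [x] \<in> tup M (Suc (length a))" if "x \<in> M"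
    using eqt_length[OF assms(1)] eqt_M[OF assms(1)] that by (auto simp: tup_iff)
  let ?E = "{x \<in> tup M (length a + 1). map (%p. x ! (if p = 0 then i else length a)) [0..<2] \<in> {a \<in> tup M 2. a ! 0 = a ! 1}}"
  have E: "?E \<in> Def (length a + length [x])" using Def_reindex[OF Def_eq, of "%p. if p = 0 then i else length a" "length a + 1"] assms by simp
  have "a @ [x] \<in> ?E \<longleftrightarrow> b @ [x] \<in> ?E" using assms E by (intro eqt_iff) auto
  moreover have "a @ [x] \<in> ?E \<longleftrightarrow> a ! i = x" if "x \<in> M"
    using 0[OF that] assms by (auto simp: tup_iff numeral_2_eq_2 nth_append)
  moreover have "b @ [x] \<in> ?E \<longleftrightarrow> b ! i = x" if "x \<in> M"
    using 0[OF that] assms eqt_length[OF assms(1)] by (auto simp: tup_iff numeral_2_eq_2 nth_append)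
  moreover have "a ! i \<in> M" "b ! i \<in> M" using assms eqt_M[OF assms(1)] eqt_length[OF assms(1)] by (metis nth_mem subsetD)+
  ultimately show ?thesis by (cases "x \<in> M") auto
qed

lemma aut_of_map:
  assumes "sm S" "h ` S <= M" "!!n R u. R \<in> Def n ==> u \<in> R ==> set u <= S ==> map h u \<in> R"
  obtains \<sigma> where "aut \<sigma>" "!!x. x \<in> S ==> \<sigma> x = h x"
proof -
  obtain \<sigma> where "bij_betw \<sigma> M M & (\<forall>n R u. R \<in> Def n --> u \<in> R --> map \<sigma> u \<in> R) & (\<forall>x\<in>S. \<sigma> x = h x)"
    using homog[of S h] assms(1,2,3) unfolding sm_def by (elim exE conjE) auto
  then have "aut \<sigma>" "!!x. x \<in> S ==> \<sigma> x = h x" unfolding aut_def by simp_all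
  then show ?thesis by (rule that)
qed

lemma list_reindex:
  assumes "set u <= set a Un B"
  obtains \<sigma> cs where "set cs <= B" "!!i. i < length u ==> \<sigma> i < length a + length cs" "map (%i. (a @ cs) ! \<sigma> i) [0..<length u] = u"
proof -
  let ?cs = "filter (%x. x \<in> B) u"
  have "\<exists>p < length a + length ?cs. (a @ ?cs) ! p = u ! i" if "i < length u" for i
  proof -
    have "u ! i \<in> set (a @ ?cs)" using subsetD[OF assms nth_mem[OF that]] nth_mem[OF that] by auto
    then show ?thesis by (metis in_set_conv_nth length_append)
  qed
  then obtain \<sigma> where "!!i. i < length u ==> \<sigma> i < length a + length ?cs" "!!i. i < length u ==> (a @ ?cs) ! \<sigma> i = u ! i" by metis
  moreover from this have "map (%i. (a @ ?cs) ! \<sigma> i) [0..<length u] = u" by (intro nth_equalityI) auto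
  ultimately show ?thesis by (intro that[of ?cs \<sigma>]) auto
qed

text \<open>The map that is the identity on \<open>B\<close> and sends \<open>a\<close> to
  \<open>b\<close> is well defined, since equalities between entries of \<open>a\<close>, and
  between them and elements of \<open>B\<close>, belong to the type. It is elementary, so
  homogeneity extends it.\<close>

lemma eqt_aut:
  assumes "eqt B a b" "sm B"
  obtains \<sigma> where "fixes_on B \<sigma>" "map \<sigma> a = b"
proof -
  define h where "h x = (if x \<in> B then x else b ! (SOME i. i < length a & a ! i = x))" for x
  have la: "length a = length b" "set a <= M" "set b <= M" using assms by (auto simp: eqt_def)
  have ha: "h (a ! i) = b ! i" if i: "i < length a" for i
  proof (cases "a ! i \<in> B")
    case True then show ?thesis using eqt_nth_const[OF assms(1) i True] by (simp add: h_def)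
  next
    case False
    let ?j = "SOME j. j < length a & a ! j = a ! i"
    have "?j < length a & a ! ?j = a ! i" by (rule someI[of _ i]) (use i in simp)
    then show ?thesis using False eqt_nth_eq[OF assms(1) _ i, of ?j] by (simp add: h_def)
  qed
  have mha: "map h a = b" by (rule nth_equalityI) (use la ha in auto)
  have hb: "h x = x" if "x \<in> B" for x using that by (simp add: h_def)
  obtain \<sigma> where \<sigma>: "aut \<sigma>" "!!x. x \<in> set a Un B ==> \<sigma> x = h x"
  proof (rule aut_of_map[of "set a Un B" h])
    show "sm (set a Un B)" using sm_Un sm_set la assms by blast
    have "h ` set a = set b" using mha by (metis image_set)
    then show "h ` (set a Un B) <= M" using hb la sm_sub[OF assms(2)] by (auto simp: image_Un)
    fix n R u assume R: "R \<in> Def n" "u \<in> R" "set u <= set a Un B"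
    have lu: "length u = n" using Def_length R by blast
    obtain \<rho> cs where r: "set cs <= B" "!!i. i < length u ==> \<rho> i < length a + length cs" "map (%i. (a @ cs) ! \<rho> i) [0..<length u] = u"
      by (rule list_reindex[OF R(3)], rule that, assumption+)
    let ?S = "{x \<in> tup M (length a + length cs). map (%i. x ! \<rho> i) [0..<n] \<in> R}"
    have S: "?S \<in> Def (length a + length cs)" by (rule Def_reindex[OF R(1)]) (use r lu in auto)
    have "a @ cs \<in> ?S" using r R lu la sm_sub[OF assms(2)] by (auto simp: tup_iff)
    then have "b @ cs \<in> ?S" by (rule eqtD[OF assms(1) _ S r(1)])
    then have 1: "map (%i. (b @ cs) ! \<rho> i) [0..<n] \<in> R" by simp
    have "map h (a @ cs) = b @ cs" using mha hb r(1) by (auto intro!: map_idI)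
    then have 2: "(b @ cs) ! \<rho> i = h ((a @ cs) ! \<rho> i)" if "i < n" for i
      using r(2)[of i] that lu by (metis length_append nth_map)
    have "map (%i. (b @ cs) ! \<rho> i) [0..<n] = map h (map (%i. (a @ cs) ! \<rho> i) [0..<length u])"
      using 2 lu by auto
    then show "map h u \<in> R" using 1 r(3) by simp
  qed blast
  show ?thesis
  proof (rule that[of \<sigma>])
    show "fixes_on B \<sigma>" using \<sigma> hb by (simp add: fixes_on_def)
    show "map \<sigma> a = b" using \<sigma>(2) mha by (metis (no_types, lifting) UnI1 map_eq_conv)
  qed
qed

section \<open>Indiscernible sequences and their extraction by Ramsey's theorem\<close>

definition increasing :: "'i set => ('i => 'i => bool) => 'i list => bool" where
  "increasing I lt is \<longleftrightarrow> set is <= I & sorted_wrt lt is"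

definition indisc :: "'i set => ('i => 'i => bool) => 'c set => nat => ('i => 'c list) => bool" where
  "indisc I lt B m J \<longleftrightarrow> (\<forall>i\<in>I. J i \<in> tup M m) &
     (\<forall>is js. increasing I lt is --> increasing I lt js --> length is = length js -->
        eqt B (concat (map J is)) (concat (map J js)))"

lemma finite_Ramsey:
  assumes "finite T" "infinite (Z :: nat set)"
  shows "\<exists>Y. Y <= Z & infinite Y & (\<forall>t\<in>T. \<forall>X X'. X <= Y --> finite X --> card X = N t --> X' <= Y --> finite X' --> card X' = N t -->
      (P t X \<longleftrightarrow> P t X'))"
  using assms
proof (induction T rule: finite_induct)
  case empty then show ?case by blast
next
  case (insert t T)
  from insert.IH[OF insert.prems] obtain Y where Y: "Y <= Z" "infinite Y"
    "\<forall>t\<in>T. \<forall>X X'. X <= Y --> finite X --> card X = N t --> X' <= Y --> finite X' --> card X' = N t -->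
      (P t X \<longleftrightarrow> P t X')" by (elim exE conjE)
  let ?f = "%X. if P t X then 0 else (1::nat)"
  have "\<exists>W c. W <= Y & infinite W & c < 2 & (\<forall>X. X <= W & finite X & card X = N t --> ?f X = c)"
    by (rule Ramsey[OF Y(2)]) simp
  then obtain W c where W: "W <= Y" "infinite W" "!!X. X <= W ==> finite X ==> card X = N t ==> ?f X = c"
    by meson
  have "W <= Z" using W(1) Y(1) by blast
  moreover have "P s X = P s X'" if "s \<in> insert t T" "X <= W" "finite X" "card X = N s" "X' <= W" "finite X'" "card X' = N s" for s X X'
  proof (cases "s = t")
    case True then show ?thesis using W(3)[of X] W(3)[of X'] that by (metis zero_neq_one)
  next
    case False then show ?thesis using Y(3)[rule_format, of s X X'] W(1) that by (meson insertE subset_trans)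
  qed
  ultimately show ?case using W(2) by (intro exI[of _ W] conjI ballI allI impI) assumption+
qed

text \<open>An index is sent to the element of \<open>Y\<close> whose number is the count of its
  predecessors in \<open>I0\<close>; these counts grow strictly along \<open>lt\<close>.\<close>

lemma increasing_embed:
  assumes "finite I0" "infinite (Y :: nat set)"
    and irr: "!!i. i \<in> I0 ==> \<not> lt i i" and tr: "!!i j k. i \<in> I0 ==> j \<in> I0 ==> k \<in> I0 ==> lt i j ==> lt j k ==> lt i k"
  shows "\<exists>\<pi>. \<pi> ` I0 <= Y & (\<forall>i\<in>I0. \<forall>j\<in>I0. lt i j --> \<pi> i < \<pi> j)"
proof -
  let ?\<pi> = "%i. enumerate Y (card {j \<in> I0. lt j i})"
  have "?\<pi> i < ?\<pi> j" if ij: "i \<in> I0" "j \<in> I0" "lt i j" for i j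
  proof -
    have "{k \<in> I0. lt k i} \<subset> {k \<in> I0. lt k j}" using ij irr tr by blast
    then have "card {k \<in> I0. lt k i} < card {k \<in> I0. lt k j}" using assms(1) by (intro psubset_card_mono) auto
    then show ?thesis using assms(2) by (simp add: enumerate_mono)
  qed
  moreover have "?\<pi> ` I0 <= Y" using assms(2) by (auto simp: enumerate_in_set)
  ultimately show ?thesis by blast
qed

text \<open>Ehrenfeucht-Mostowski extraction. Finitely many requirements are met on \<open>s\<close>
  itself: Ramsey gives an infinite set of indices on which the formulas involved are constant, and
  the finitely many elements of \<open>I\<close> involved embed into it in increasing order.
  Compactness does the rest.\<close>

lemma EM_sequence:
  fixes I :: "'i set" and s :: "nat => 'c list"
  assumes s: "!!i. s i \<in> tup M m" and B: "sm B" and I: "|I| \<le>o \<nu>"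
    and irr: "!!i. i \<in> I ==> \<not> lt i i" and tr: "!!i j k. i \<in> I ==> j \<in> I ==> k \<in> I ==> lt i j ==> lt j k ==> lt i k"
  shows "\<exists>J. indisc I lt B m J &
    (\<forall>is R c. increasing I lt is --> set c <= B --> R \<in> Def (length is * m + length c) --> concat (map J is) @ c \<in> R -->
       (\<exists>js. sorted_wrt (<) js & length js = length is & concat (map s js) @ c \<in> R))"
proof -
  define vs where "vs is = concat (map (%i. map (Pair i) [0..<m]) is)" for "is" :: "'i list"
  define JJ where "JJ f = (%i. map (%p. f (i, p)) [0..<m])" for f :: "'i \<times> nat => 'c"
  have vsJ: "map f (vs is) = concat (map (JJ f) is)" for f "is"
    by (simp add: vs_def JJ_def map_concat comp_def)
  have lvs: "length (vs is) = length is * m" for "is" by (induction "is") (auto simp: vs_def)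
  have svs: "set (vs is) <= I \<times> {..<m}" if "set is <= I" for "is" using that by (auto simp: vs_def)
  have lJ: "length (concat (map J is)) = length is * m" if "!!i. i \<in> set is ==> length (J i) = m" for J :: "'k => 'c list" and "is"
    using that by (induction "is") auto
  \<comment> \<open>If all increasing subsequences of \<open>s\<close> satisfy \<open>R\<close>, the
    requirement demands \<open>R\<close> at \<open>is\<close>; otherwise \<open>js\<close> is
    increasing and \<open>R\<close> at \<open>js\<close> has to imply \<open>R\<close> at
    \<open>is\<close>. The first kind transfers formulas from \<open>s\<close>, the second gives
    indiscernibility.\<close>
  define T where "T = {(is, js, R, c). increasing I lt is & length js = length is & set c <= B & R \<in> Def (length is * m + length c) &
     (increasing I lt js \<or> (\<forall>ks. sorted_wrt (<) ks --> length ks = length is --> concat (map s ks) @ c \<in> R))}"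
  define Q where "Q t f = (case t of (is, js, R, c) => map f (vs is) @ c \<in> R \<or>
     (increasing I lt js & map f (vs js) @ c \<notin> R & \<not> (\<forall>ks. sorted_wrt (<) ks --> length ks = length is --> concat (map s ks) @ c \<in> R)))" for t f
  have "\<exists>f. range f <= M & (\<forall>t\<in>T. Q t f)"
  proof (rule compactness_indexed[OF _ B, of "I \<times> {..<m}"])
    show "|I \<times> {..<m}| \<le>o \<nu>"
      by (rule card_of_Times_ordLeq_infinite_Field[OF nu_inf I _ nu_card]) (simp add: finite_le_nu)
    show "DF (I \<times> {..<m}) B (Q t)" if t: "t \<in> T" for t
    proof -
      obtain "is" js R c where tt: "t = (is, js, R, c)" by (cases t)
      have a: "increasing I lt is" "length js = length is" "set c <= B" "R \<in> Def (length is * m + length c)"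
        using t unfolding tt T_def by auto
      have cM: "set c <= M" using a(3) B sm_sub by blast
      have 1: "DF (I \<times> {..<m}) B (%f. map f (vs is) @ c \<in> R)"
        by (rule DF_mem[OF a(4)]) (use a lvs svs cM in \<open>auto simp: increasing_def\<close>)
      show ?thesis
      proof (cases "increasing I lt js")
        case True
        have 2: "DF (I \<times> {..<m}) B (%f. map f (vs js) @ c \<in> R)"
          by (rule DF_mem[OF a(4)]) (use True a lvs svs cM in \<open>auto simp: increasing_def\<close>)
        show ?thesis unfolding Q_def tt prod.case
          by (intro DF_or DF_and DF_not DF_const 1 2)
      next
        case False
        show ?thesis unfolding Q_def tt prod.case using False 1 by simp
      qed
    qed
    fix T0 assume T0: "T0 <= T" "finite T0"
    let ?N = "%t. length (fst t)" let ?P = "%t X. concat (map s (sorted_list_of_set X)) @ snd (snd (snd t)) \<in> fst (snd (snd t))"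
    from finite_Ramsey[OF T0(2) infinite_UNIV_nat, of ?N ?P]
    obtain Y where Y: "infinite Y" "\<forall>t\<in>T0. \<forall>X X'. X <= Y --> finite X --> card X = ?N t --> X' <= Y --> finite X' --> card X' = ?N t -->
      (?P t X \<longleftrightarrow> ?P t X')" by (elim exE conjE)
    define I0 where "I0 = (\<Union>t\<in>T0. (set (fst t) Un set (fst (snd t))) Int I)"
    have I0: "finite I0" "I0 <= I" unfolding I0_def using T0 by auto
    have "\<exists>\<pi>. \<pi> ` I0 <= Y & (\<forall>i\<in>I0. \<forall>j\<in>I0. lt i j --> \<pi> i < \<pi> j)"
    proof (rule increasing_embed[OF I0(1) Y(1)])
      show "\<not> lt i i" if "i \<in> I0" for i using irr that I0(2) by blast
      show "lt i k" if "i \<in> I0" "j \<in> I0" "k \<in> I0" "lt i j" "lt j k" for i j k using tr that I0(2) by blast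
    qed
    then obtain \<pi> where \<pi>: "\<pi> ` I0 <= Y" "!!i j. i \<in> I0 ==> j \<in> I0 ==> lt i j ==> \<pi> i < \<pi> j"
      by (elim exE conjE) simp
    define f where "f = (%(i, p). asg (s (\<pi> i)) p)"
    have JJf: "JJ f i = s (\<pi> i)" for i
      unfolding JJ_def f_def using s[of "\<pi> i"] by (auto simp: tup_iff asg_def intro!: nth_equalityI)
    have rf: "range f <= M" unfolding f_def using asg_range s by (fastforce simp: tup_iff)
    have srt: "sorted_wrt (<) (map \<pi> is)" if "set is <= I0" "sorted_wrt lt is" for "is"
      using that by (induction "is") (auto intro: \<pi>(2))
    have val: "map f (vs is) @ c \<in> R \<longleftrightarrow> concat (map s (map \<pi> is)) @ c \<in> R" for "is" R c
      by (simp add: vsJ JJf comp_def cong: map_cong)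
    have "Q t f" if t: "t \<in> T0" for t
    proof -
      obtain "is" js R c where tt: "t = (is, js, R, c)" by (cases t)
      have a: "increasing I lt is" "length js = length is"
        "increasing I lt js \<or> (\<forall>ks. sorted_wrt (<) ks --> length ks = length is --> concat (map s ks) @ c \<in> R)"
        using t T0 unfolding tt T_def by auto
      have is0: "set is <= I0" using a(1) t unfolding I0_def tt increasing_def by force
      have sl: "sorted_list_of_set (set ks) = ks" if "sorted_wrt (<) ks" for ks :: "nat list"
        using that by (metis sorted_list_of_set.idem_if_sorted_distinct strict_sorted_iff)
      have cd: "card (set ks) = length ks" if "sorted_wrt (<) ks" for ks :: "nat list"
        using that by (metis distinct_card strict_sorted_iff)
      have si: "sorted_wrt (<) (map \<pi> is)" using srt is0 a(1) by (simp add: increasing_def)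
      show ?thesis
      proof (cases "\<forall>ks. sorted_wrt (<) ks --> length ks = length is --> concat (map s ks) @ c \<in> R")
        case True
        then have "concat (map s (map \<pi> is)) @ c \<in> R" using si by (metis length_map)
        then show ?thesis unfolding Q_def tt prod.case val by blast
      next
        case False
        then have ij: "increasing I lt js" using a by blast
        have js0: "set js <= I0" using ij t unfolding I0_def tt increasing_def by force
        have sj: "sorted_wrt (<) (map \<pi> js)" using srt js0 ij by (simp add: increasing_def)
        have "?P t (set (map \<pi> is)) \<longleftrightarrow> ?P t (set (map \<pi> js))"
          by (rule Y(2)[rule_format, OF t]) (use is0 js0 \<pi>(1) cd[OF si] cd[OF sj] a tt in auto)
        then have "concat (map s (map \<pi> is)) @ c \<in> R \<longleftrightarrow> concat (map s (map \<pi> js)) @ c \<in> R"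
          unfolding sl[OF si] sl[OF sj] tt by simp
        then show ?thesis unfolding Q_def tt prod.case val using False ij by blast
      qed
    qed
    then show "\<exists>f. range f <= M & (\<forall>t\<in>T0. Q t f)" using rf by (intro exI[of _ f]) simp
  qed
  then obtain f where f: "range f <= M" "!!t. t \<in> T ==> Q t f" by (elim exE conjE) simp
  let ?J = "JJ f"
  have J: "?J i \<in> tup M m" for i using f(1) by (auto simp: JJ_def tup_iff)
  have tr1: "concat (map ?J is) @ c \<in> R"
    if "increasing I lt is" "set c <= B" "R \<in> Def (length is * m + length c)"
      "!!ks. sorted_wrt (<) ks ==> length ks = length is ==> concat (map s ks) @ c \<in> R" for "is" R c
    using f(2)[of "(is, is, R, c)"] that unfolding T_def Q_def prod.case vsJ by blast
  have tr2: "concat (map ?J is) @ c \<in> R"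
    if "increasing I lt is" "increasing I lt js" "length js = length is" "set c <= B" "R \<in> Def (length is * m + length c)"
      "concat (map ?J js) @ c \<in> R" for "is" js R c
    using f(2)[of "(is, js, R, c)"] that unfolding T_def Q_def prod.case vsJ by blast
  have Jl: "length (?J i) = m" for i using J by (simp add: tup_iff)
  have JM: "set (concat (map ?J is)) <= M" for "is" using J by (auto simp: tup_iff)
  show ?thesis
  proof (intro exI[of _ ?J] conjI allI impI)
    show "indisc I lt B m ?J" unfolding indisc_def
    proof (intro conjI ballI allI impI J eqtI)
      fix "is" js assume a: "increasing I lt is" "increasing I lt js" "length is = length js"
      show "length (concat (map ?J is)) = length (concat (map ?J js))" using a Jl by (simp add: lJ)
      show "set (concat (map ?J is)) <= M" "set (concat (map ?J js)) <= M" using JM by auto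
      fix R c assume "set c <= B" "R \<in> Def (length (concat (map ?J is)) + length c)" "concat (map ?J is) @ c \<in> R"
      then show "concat (map ?J js) @ c \<in> R" using tr2[OF a(2,1,3)] a(3) Jl by (simp add: lJ)
    qed
    fix "is" R c assume a: "increasing I lt is" "set c <= B" "R \<in> Def (length is * m + length c)" "concat (map ?J is) @ c \<in> R"
    show "\<exists>js. sorted_wrt (<) js & length js = length is & concat (map s js) @ c \<in> R"
    proof (rule ccontr)
      assume n: "\<not> ?thesis"
      \<comment> \<open>Transfer is applied to the complement: if no increasing subsequence of
        \<open>s\<close> satisfied \<open>R\<close>, then \<open>?J\<close> could not satisfy it
        either.\<close>
      have "concat (map ?J is) @ c \<in> tup M (length is * m + length c) - R"
      proof (rule tr1[OF a(1,2) Def_Diff[OF a(3)]])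
        fix ks :: "nat list" assume k: "sorted_wrt (<) ks" "length ks = length is"
        have "concat (map s ks) @ c \<in> tup M (length is * m + length c)"
          using s k(2) a(2) B sm_sub by (auto simp: tup_iff lJ) blast+
        then show "concat (map s ks) @ c \<in> tup M (length is * m + length c) - R" using n k by blast
      qed
      then show False using a(4) by blast
    qed
  qed
qed

end

section \<open>Dividing, forking and local ranks\<close>

lemma kinc_inj: "k_inconsistent k X ==> inj f ==> k_inconsistent k (%i. X (f i))"
  unfolding k_inconsistent_def
proof (intro allI impI)
  fix I :: "nat set" assume a: "\<forall>I. finite I & card I = k --> \<Inter> (X ` I) = {}" "inj f" "finite I & card I = k"
  have "card (f ` I) = k" using a(2,3) by (simp add: card_image inj_on_subset)
  then have "\<Inter> (X ` (f ` I)) = {}" using a(1,3) by blast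
  then show "(\<Inter>i\<in>I. X (f i)) = {}" by (simp add: image_image)
qed

context dstruct
begin

lemma countable_le_nu: "countable S ==> |S| \<le>o \<nu>"
proof -
  assume "countable S"
  then obtain f :: "_ => nat" where "inj_on f S" unfolding countable_def by blast
  then have "|S| \<le>o |UNIV :: nat set|" by (intro card_of_ordLeqI[of f]) auto
  moreover have "|UNIV :: nat set| \<le>o |Field \<nu>|" using nu_inf by (simp add: infinite_iff_card_of_nat)
  ultimately show ?thesis unfolding le_nu_Field by (rule ordLeq_transitive)
qed

lemma DF_pull:
  fixes \<pi> :: "'i => 'j"
  assumes "DF V B Q" shows "DF (\<pi> ` V) B (%f. Q (f \<circ> \<pi>))"
proof -
  obtain ts R where ts: "set ts <= Inl ` V Un Inr ` (B Int M)" "R \<in> Def (length ts)"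
     "!!f. range f <= M ==> Q f = (map (vl f) ts \<in> R)" using assms unfolding DF_def by (elim exE conjE) simp
  show ?thesis
  proof (rule DF_I[of "map (map_sum \<pi> id) ts" _ _ R])
    show "set (map (map_sum \<pi> id) ts) <= Inl ` \<pi> ` V Un Inr ` (B Int M)"
    proof
      fix t assume "t \<in> set (map (map_sum \<pi> id) ts)"
      then obtain t' where "t' \<in> set ts" "t = map_sum \<pi> id t'" by auto
      moreover from this have "t' \<in> Inl ` V Un Inr ` (B Int M)" using ts(1) by blast
      ultimately show "t \<in> Inl ` \<pi> ` V Un Inr ` (B Int M)" by (elim UnE imageE) auto
    qed
    show "R \<in> Def (length (map (map_sum \<pi> id) ts))" using ts(2) by simp
    fix f :: "'j => 'c" assume f: "range f <= M"
    have e: "map (vl f) (map (map_sum \<pi> id) ts) = map (vl (f \<circ> \<pi>)) ts" by (auto split: sum.split)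
    have "range (f \<circ> \<pi>) <= M" using f by auto
    then show "Q (f \<circ> \<pi>) = (map (vl f) (map (map_sum \<pi> id) ts) \<in> R)" unfolding e by (rule ts(3))
  qed
qed

text \<open>The quantified coordinates live in the summand \<open>Inr\<close>, so they cannot clash
  with variables already in use.\<close>

lemma DF_tuple:
  fixes Q :: "('j + nat => 'c) => bool"
  assumes Q: "DF (Inl ` V Un Inr ` {..<n}) B Q"
  shows "DF V B (%f. \<exists>x\<in>tup M n. Q (case_sum f (asg x)))"
proof -
  let ?U = "Inr ` {..<n} :: ('j + nat) set"
  let ?\<pi> = "case_sum id (%_. undefined) :: 'j + nat => 'j"
  define Q' where "Q' f = (\<exists>g. range g <= M & (\<forall>i. i \<notin> ?U --> g i = f i) & Q g)" for f
  have "DF (Inl ` V Un ?U - ?U) B Q'" unfolding Q'_def by (rule DF_exs[OF _ Q]) simp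
  then have "DF (?\<pi> ` (Inl ` V Un ?U - ?U)) B (%f. Q' (f \<circ> ?\<pi>))" by (rule DF_pull)
  then have "DF V B (%f. Q' (f \<circ> ?\<pi>))" by (rule DF_mono) auto
  then show ?thesis
  proof (rule DF_cong)
    fix f :: "'j => 'c" assume f: "range f <= M"
    have rr: "range (case_sum f (asg x)) <= M" if "x \<in> tup M n" for x
      using f asg_range[of x] that by (auto simp: tup_iff image_subset_iff split: sum.split)
    show "Q' (f \<circ> ?\<pi>) = (\<exists>x\<in>tup M n. Q (case_sum f (asg x)))"
    proof
      assume "Q' (f \<circ> ?\<pi>)"
      then obtain g where g: "range g <= M" "\<forall>i. i \<notin> ?U --> g i = (f \<circ> ?\<pi>) i" "Q g" unfolding Q'_def by (elim exE conjE)
      let ?x = "map (%p. g (Inr p)) [0..<n]"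
      have x: "?x \<in> tup M n" using g(1) by (auto simp: tup_iff)
      have "Q (case_sum f (asg ?x)) = Q g"
      proof (rule DF_dep[OF Q rr[OF x] g(1)])
        fix i assume "i \<in> Inl ` V Un ?U"
        then show "case_sum f (asg ?x) i = g i" using g(2)[rule_format, of i] by (cases i) (auto simp: asg_def image_iff)
      qed
      then have "Q (case_sum f (asg ?x))" using g(3) by (simp only:)
      then show "\<exists>x\<in>tup M n. Q (case_sum f (asg x))" using x by (rule bexI)
    next
      assume "\<exists>x\<in>tup M n. Q (case_sum f (asg x))"
      then obtain x where x: "x \<in> tup M n" "Q (case_sum f (asg x))" by (elim bexE)
      let ?g = "case_sum f (%p. if p < n then asg x p else f undefined)"
      have rg: "range ?g <= M" using f asg_range[of x] x(1) by (auto simp: tup_iff image_subset_iff split: sum.split)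
      have "Q ?g = Q (case_sum f (asg x))"
        by (rule DF_dep[OF Q rg rr[OF x(1)]]) auto
      then show "Q' (f \<circ> ?\<pi>)" unfolding Q'_def using x(2) rg
        by (intro exI[of _ ?g] conjI) (auto split: sum.splits)
    qed
  qed
qed

lemma DF_ex_tuple:
  fixes V :: "'j set"
  assumes "finite K" "!!i. i \<in> K ==> \<psi> i \<in> Def (n + length (vs i) + length (cs i))" "!!i. i \<in> K ==> set (vs i) <= V"
    "!!i. i \<in> K ==> set (cs i) <= B" "B <= M"
  shows "DF V B (%f. \<exists>x\<in>tup M n. \<forall>i\<in>K. x @ map f (vs i) @ cs i \<in> \<psi> i)"
proof -
  let ?Q = "%g. \<forall>i\<in>K. map g (map Inr [0..<n] @ map Inl (vs i)) @ cs i \<in> \<psi> i"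
  have "DF (Inl ` V Un Inr ` {..<n}) B ?Q"
  proof (rule DF_Ball[OF assms(1)])
    fix i assume i: "i \<in> K"
    show "DF (Inl ` V Un Inr ` {..<n}) B (%g. map g (map Inr [0..<n] @ map Inl (vs i)) @ cs i \<in> \<psi> i)"
      by (rule DF_mem[OF assms(2)[OF i]]) (use assms(3,4)[OF i] assms(5) in auto)
  qed
  from DF_tuple[OF this] show ?thesis
  proof (rule DF_cong)
    fix f :: "'j => 'c"
    have "map (case_sum f (asg x)) (map Inr [0..<n] @ map Inl (vs i)) @ cs i = x @ map f (vs i) @ cs i" if "x \<in> tup M n" for x i
      using map_asg[of x] that by (simp add: comp_def tup_iff)
    then show "(\<exists>x\<in>tup M n. ?Q (case_sum f (asg x))) = (\<exists>x\<in>tup M n. \<forall>i\<in>K. x @ map f (vs i) @ cs i \<in> \<psi> i)"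
      by (intro bex_cong refl) (simp add: case_sum_o_inj)
  qed
qed

definition Sol :: "nat => 'c list set => 'c list => 'c list set" where
  "Sol n \<psi> d = {x \<in> tup M n. x @ d \<in> \<psi>}"

lemma Sol_tup: "Sol n \<psi> d <= tup M n" by (auto simp: Sol_def)

text \<open>Consistency of \<open>N\<close> instances of \<open>\<psi>\<close> thereby becomes a
  definable property of their concatenated parameters, so that inconsistency can be carried over to
  extracted and to indiscernible sequences.\<close>

lemma Def_common:
  assumes \<psi>: "\<psi> \<in> Def (n + m + l)"
  obtains R where "R \<in> Def (N * m + l)"
    "!!ds c. length ds = N ==> set ds <= tup M m ==> c \<in> tup M l ==>
       concat ds @ c \<in> R \<longleftrightarrow> (\<exists>x\<in>tup M n. \<forall>d\<in>set ds. x @ d @ c \<in> \<psi>)"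
proof -
  let ?vs = "%i. [i * m..<i * m + m] @ [N * m..<N * m + l]"
  have "DF {..<N * m + l} {} (%f. \<exists>x\<in>tup M n. \<forall>i\<in>{..<N}. x @ map f (?vs i) @ [] \<in> \<psi>)"
  proof (rule DF_ex_tuple)
    fix i assume "i \<in> {..<N}"
    then have "i * m + m \<le> N * m" by (metis Suc_leI add.commute lessThan_iff mult_Suc mult_le_mono1)
    then show "set (?vs i) <= {..<N * m + l}" by auto
    show "\<psi> \<in> Def (n + length (?vs i) + length ([] :: 'c list))" using \<psi> by (simp add: add.assoc)
  qed auto
  from DF_Sol[OF this] obtain R cs where R: "set cs <= {}" "R \<in> Def (N * m + l + length cs)"
     "!!a. a \<in> tup M (N * m + l) ==> (\<exists>x\<in>tup M n. \<forall>i\<in>{..<N}. x @ map (asg a) (?vs i) @ [] \<in> \<psi>) = (a @ cs \<in> R)"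
    by (elim exE conjE) simp
  show ?thesis
  proof (rule that[of R])
    show "R \<in> Def (N * m + l)" using R(1,2) by simp
    fix ds c assume ds: "length ds = N" "set ds <= tup M m" and c: "c \<in> tup M l"
    have ln: "length (concat ds) = N * m" using ds
    proof (induction ds arbitrary: N)
      case (Cons d ds) then show ?case by (cases N) (auto simp: tup_iff)
    qed simp
    let ?a = "concat ds @ c"
    have "set (concat ds) <= M" using ds(2) by (force simp: tup_iff)
    then have a: "?a \<in> tup M (N * m + l)" using ln c by (simp add: tup_iff)
    have cc: "concat ds ! (i * m + p) = ds ! i ! p" if "i < N" "p < m" for i p
      using ds that
    proof (induction ds arbitrary: N i)
      case (Cons d ds)
      then obtain N' where N': "N = Suc N'" by (cases N) auto
      have d: "length d = m" using Cons.prems by (auto simp: tup_iff)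
      show ?case
      proof (cases i)
        case 0 then show ?thesis using d Cons.prems by (simp add: nth_append)
      next
        case (Suc i')
        have "concat ds ! (i' * m + p) = ds ! i' ! p" using Cons.IH[of N' i'] Cons.prems N' Suc by auto
        then show ?thesis using d Suc by (simp add: nth_append add.assoc)
      qed
    qed simp
    have mp: "map (asg ?a) (?vs i) = ds ! i @ c" if i: "i < N" for i
    proof (rule nth_equalityI)
      have di: "length (ds ! i) = m" using ds i by (metis nth_mem subsetD tup_iff)
      have le: "i * m + m \<le> N * m" using i by (metis Suc_leI add.commute mult_Suc mult_le_mono1)
      show "length (map (asg ?a) (?vs i)) = length (ds ! i @ c)" using di c by (simp add: tup_iff)
      fix p assume "p < length (map (asg ?a) (?vs i))"
      then have p: "p < m + l" by simp
      show "map (asg ?a) (?vs i) ! p = (ds ! i @ c) ! p"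
      proof (cases "p < m")
        case True
        then have "i * m + p < N * m" using le by linarith
        then show ?thesis using True cc[OF i True] di ln by (simp add: nth_append asg_def)
      next
        case False
        then obtain q where "p = m + q" by (metis add_diff_inverse_nat)
        then show ?thesis using p di ln c by (simp add: nth_append asg_def tup_iff)
      qed
    qed
    have "(?a \<in> R) = (\<exists>x\<in>tup M n. \<forall>i\<in>{..<N}. x @ ds ! i @ c \<in> \<psi>)" using R(1) R(3)[OF a] mp by simp
    also have "\<dots> = (\<exists>x\<in>tup M n. \<forall>d\<in>set ds. x @ d @ c \<in> \<psi>)"
      by (intro bex_cong refl) (metis ds(1) in_set_conv_nth lessThan_iff)
    finally show "(?a \<in> R) = (\<exists>x\<in>tup M n. \<forall>d\<in>set ds. x @ d @ c \<in> \<psi>)" .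
  qed
qed

text \<open>Inverse image of \<open>X\<close> under the map of tuples induced by the coordinate map
  \<open>\<sigma>\<close>; it serves to view a formula as one in more variables.\<close>

definition pre :: "(nat => nat) => nat => nat => 'c list set => 'c list set" where
  "pre \<sigma> n n' X = {z \<in> tup M n'. map (%i. z ! \<sigma> i) [0..<n] \<in> X}"

lemma Def_pre:
  assumes "\<psi> \<in> Def (n + m)" "!!i. i < n ==> \<sigma> i < n'"
  obtains \<psi>' where "\<psi>' \<in> Def (n' + m)" "!!d. d \<in> tup M m ==> Sol n' \<psi>' d = pre \<sigma> n n' (Sol n \<psi> d)"
proof -
  let ?r = "%i. if i < n then \<sigma> i else n' + (i - n)"
  let ?S = "{z \<in> tup M (n' + m). map (%i. z ! ?r i) [0..<n + m] \<in> \<psi>}"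
  have S: "?S \<in> Def (n' + m)" by (rule Def_reindex[OF assms(1)]) (use assms(2) in \<open>auto intro: trans_less_add1\<close>)
  have "x \<in> Sol n' ?S d \<longleftrightarrow> x \<in> pre \<sigma> n n' (Sol n \<psi> d)" if d: "d \<in> tup M m" for d x
  proof (cases "x \<in> tup M n'")
    case True
    have "map (%i. (x @ d) ! ?r i) [0..<n + m] = map (%i. x ! \<sigma> i) [0..<n] @ d"
      using True d assms(2) by (intro nth_equalityI) (auto simp: nth_append tup_iff)
    moreover have "map (%i. x ! \<sigma> i) [0..<n] \<in> tup M n" using True assms(2) by (auto simp: tup_iff)
    moreover have "x @ d \<in> tup M (n' + m)" using True d by (auto simp: tup_iff)
    ultimately show ?thesis using True unfolding Sol_def pre_def by simp
  next
    case False then show ?thesis by (auto simp: Sol_def pre_def)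
  qed
  then show ?thesis using that[OF S] by blast
qed

lemma Def_swap:
  assumes "\<psi> \<in> Def (n1 + n2 + m)"
  obtains \<psi>' where "\<psi>' \<in> Def (n2 + (n1 + m))"
    "!!a x e. a \<in> tup M n1 ==> x \<in> tup M n2 ==> e \<in> tup M m ==> x @ a @ e \<in> \<psi>' \<longleftrightarrow> a @ x @ e \<in> \<psi>"
proof -
  let ?r = "%i. if i < n1 then n2 + i else if i < n1 + n2 then i - n1 else i"
  let ?S = "{z \<in> tup M (n2 + (n1 + m)). map (%i. z ! ?r i) [0..<n1 + n2 + m] \<in> \<psi>}"
  have S: "?S \<in> Def (n2 + (n1 + m))" by (rule Def_reindex[OF assms]) auto
  have "x @ a @ e \<in> ?S \<longleftrightarrow> a @ x @ e \<in> \<psi>" if "a \<in> tup M n1" "x \<in> tup M n2" "e \<in> tup M m" for a x e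
  proof -
    have "map (%i. (x @ a @ e) ! ?r i) [0..<n1 + n2 + m] = a @ x @ e"
      using that by (intro nth_equalityI) (auto simp: nth_append tup_iff add.commute)
    then show ?thesis using that by (auto simp: tup_iff)
  qed
  then show ?thesis using that[OF S] by blast
qed

text \<open>Shelah's local rank: \<open>Dge \<Delta> n N X\<close> says that the rank of
  \<open>X\<close> with respect to \<open>\<Delta>\<close> is at least \<open>N\<close>, where each
  step splits the set by countably many k-inconsistent instances of a formula. The number
  \<open>k\<close> is part of \<open>\<Delta>\<close>, so it ranges over a finite set once
  \<open>\<Delta>\<close> is finite.\<close>

primrec Dge :: "(nat \<times> 'c list set \<times> nat) set => nat => nat => 'c list set => bool" where
  "Dge \<Delta> n 0 X \<longleftrightarrow> X ~= {}"
| "Dge \<Delta> n (Suc N) X \<longleftrightarrow> (\<exists>m \<psi> k s. (m, \<psi>, k) \<in> \<Delta> & (\<forall>i. s i \<in> tup M m) &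
     k_inconsistent k (%i::nat. Sol n \<psi> (s i)) & (\<forall>i. Dge \<Delta> n N (X Int Sol n \<psi> (s i))))"

lemma Dge_mono: "Dge \<Delta> n N X ==> X <= Y ==> Dge \<Delta> n N Y"
proof (induction N arbitrary: X Y)
  case (Suc N)
  then obtain m \<psi> k s where s: "(m, \<psi>, k) \<in> \<Delta>" "\<forall>i. s i \<in> tup M m" "k_inconsistent k (%i::nat. Sol n \<psi> (s i))"
    "!!i. Dge \<Delta> n N (X Int Sol n \<psi> (s i))" unfolding Dge.simps by (elim exE conjE, intro that) (erule spec | assumption | blast)+
  have "Dge \<Delta> n N (Y Int Sol n \<psi> (s i))" for i by (rule Suc.IH[OF s(4)]) (use Suc.prems in blast)
  then show ?case using s(1-3) unfolding Dge.simps by (intro exI conjI allI) auto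
qed auto

lemma Dge_Suc: "Dge \<Delta> n (Suc N) X ==> Dge \<Delta> n N X"
  unfolding Dge.simps by (elim exE conjE) (rule Dge_mono[of _ _ _ "X Int _"], auto)

lemma Dge_le: "Dge \<Delta> n N X ==> N' \<le> N ==> Dge \<Delta> n N' X"
  by (induction N) (auto simp del: Dge.simps simp: le_Suc_eq dest: Dge_Suc)

lemma Dge_ne: "Dge \<Delta> n N X ==> X ~= {}"
  using Dge_le[of \<Delta> n N X 0] by simp

text \<open>Infinitely many of the splitting instances must keep their rank on the same side of the
  union, and an infinite subfamily of a k-inconsistent family is again k-inconsistent.\<close>

lemma Dge_Un: "Dge \<Delta> n N (X Un Y) ==> Dge \<Delta> n N X \<or> Dge \<Delta> n N Y"
proof (induction N arbitrary: X Y)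
  case (Suc N)
  then obtain m \<psi> k s where s: "(m, \<psi>, k) \<in> \<Delta>" "\<forall>i. s i \<in> tup M m" "k_inconsistent k (%i::nat. Sol n \<psi> (s i))"
    "!!i. Dge \<Delta> n N ((X Un Y) Int Sol n \<psi> (s i))" unfolding Dge.simps by (elim exE conjE, intro that) (erule spec | assumption | blast)+
  have one: "Dge \<Delta> n (Suc N) Z" if i: "infinite {i. Dge \<Delta> n N (Z Int Sol n \<psi> (s i))}" for Z
  proof -
    obtain f :: "nat => nat" where f: "inj f" "range f <= {i. Dge \<Delta> n N (Z Int Sol n \<psi> (s i))}"
      using infinite_countable_subset[OF i] by (elim exE conjE)
    have "k_inconsistent k (%i. Sol n \<psi> (s (f i)))" by (rule kinc_inj[OF s(3) f(1)])
    then show ?thesis using s(1,2) f(2) unfolding Dge.simps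
      by (intro exI[of _ m] exI[of _ \<psi>] exI[of _ k] exI[of _ "s \<circ> f"]) auto
  qed
  have "Dge \<Delta> n N (X Int Sol n \<psi> (s i)) \<or> Dge \<Delta> n N (Y Int Sol n \<psi> (s i))" for i
    using Suc.IH[of "X Int Sol n \<psi> (s i)" "Y Int Sol n \<psi> (s i)"] s(4)[of i] by (simp add: Int_Un_distrib2)
  then have "{i. Dge \<Delta> n N (X Int Sol n \<psi> (s i))} Un {i. Dge \<Delta> n N (Y Int Sol n \<psi> (s i))} = UNIV" by auto
  then have "infinite {i. Dge \<Delta> n N (X Int Sol n \<psi> (s i))} \<or> infinite {i. Dge \<Delta> n N (Y Int Sol n \<psi> (s i))}"
    by (metis finite_Un infinite_UNIV_nat)
  then show ?case using one by blast
qed auto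

lemma Dge_UN:
  assumes "finite D" "Dge \<Delta> n N X" "X <= (\<Union>p\<in>D. Y p)" shows "\<exists>p\<in>D. Dge \<Delta> n N (X Int Y p)"
  using assms
proof (induction D arbitrary: X rule: finite_induct)
  case empty then show ?case using Dge_ne[OF empty(1)] by auto
next
  case (insert p D)
  have "X = (X Int Y p) Un (X - Y p)" by blast
  then have "Dge \<Delta> n N (X Int Y p) \<or> Dge \<Delta> n N (X - Y p)" using insert.prems(1) Dge_Un by metis
  then show ?case
  proof
    assume a: "Dge \<Delta> n N (X - Y p)"
    have "X - Y p <= \<Union> (Y ` D)" using insert.prems(2) by blast
    from insert.IH[OF a this] obtain q where q: "q \<in> D" "Dge \<Delta> n N ((X - Y p) Int Y q)" by (elim bexE)
    have "Dge \<Delta> n N (X Int Y q)" by (rule Dge_mono[OF q(2)]) blast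
    then show ?thesis using q(1) by blast
  qed blast
qed

text \<open>Pigeonhole on the formulas used for splitting. If the first splitting uses
  \<open>?l\<close>, the target for \<open>?l\<close> is lowered by one; either all children reach
  this lowered target for \<open>?l\<close>, or some child already has the full target for another
  member of \<open>\<Delta>\<close>.\<close>

lemma Dge_sum:
  assumes "finite \<Delta>" "\<Delta> ~= {}"
  shows "Dge \<Delta> n N X ==> (\<Sum>l\<in>\<Delta>. nf l) \<le> N ==> \<exists>l\<in>\<Delta>. Dge {l} n (nf l) X"
proof (induction N arbitrary: X nf)
  case 0
  then show ?case using assms by (metis Dge.simps(1) ex_in_conv le_zero_eq sum_eq_0_iff)
next
  case (Suc N)
  from Suc.prems(1) obtain m \<psi> k s where s: "(m, \<psi>, k) \<in> \<Delta>" "\<forall>i. s i \<in> tup M m" "k_inconsistent k (%i::nat. Sol n \<psi> (s i))"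
    "!!i. Dge \<Delta> n N (X Int Sol n \<psi> (s i))" unfolding Dge.simps by (elim exE conjE, intro that) (erule spec | assumption | blast)+
  let ?l = "(m, \<psi>, k)"
  show ?case
  proof (cases "nf ?l")
    case 0
    have "X ~= {}" by (rule Dge_ne[OF Suc.prems(1)])
    then show ?thesis using 0 s(1) by (intro bexI[of _ ?l]) auto
  next
    case (Suc q)
    have "(\<Sum>l\<in>\<Delta>. (nf(?l := q)) l) + 1 = (\<Sum>l\<in>\<Delta>. nf l)"
    proof -
      have "(\<Sum>l\<in>\<Delta>. nf l) = nf ?l + (\<Sum>l\<in>\<Delta> - {?l}. nf l)" by (rule sum.remove[OF assms(1) s(1)])
      moreover have "(\<Sum>l\<in>\<Delta>. (nf(?l := q)) l) = q + (\<Sum>l\<in>\<Delta> - {?l}. (nf(?l := q)) l)"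
        using sum.remove[OF assms(1) s(1), of "nf(?l := q)"] by simp
      moreover have "(\<Sum>l\<in>\<Delta> - {?l}. (nf(?l := q)) l) = (\<Sum>l\<in>\<Delta> - {?l}. nf l)" by (rule sum.cong) auto
      ultimately show ?thesis using Suc by simp
    qed
    then have le: "(\<Sum>l\<in>\<Delta>. (nf(?l := q)) l) \<le> N" using Suc.prems(2) by linarith
    have ex: "\<exists>l\<in>\<Delta>. Dge {l} n ((nf(?l := q)) l) (X Int Sol n \<psi> (s i))" for i by (rule Suc.IH[OF s(4) le])
    show ?thesis
    proof (cases "\<forall>i. Dge {?l} n q (X Int Sol n \<psi> (s i))")
      case True
      then have "Dge {?l} n (Suc q) X" using s(2,3) unfolding Dge.simps by (intro exI[of _ m] exI[of _ \<psi>] exI[of _ k] exI[of _ s]) auto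
      then show ?thesis using Suc s(1) by metis
    next
      case False
      then obtain i where i: "\<not> Dge {?l} n q (X Int Sol n \<psi> (s i))" by blast
      obtain l where l: "l \<in> \<Delta>" "Dge {l} n ((nf(?l := q)) l) (X Int Sol n \<psi> (s i))" using ex[of i] by (elim bexE)
      then have "l ~= ?l" using i by (metis fun_upd_same)
      then have "Dge {l} n (nf l) X" using l(2) Dge_mono[of "{l}" n "nf l" "X Int Sol n \<psi> (s i)" X] by (metis fun_upd_other inf_le1)
      then show ?thesis using l(1) by blast
    qed
  qed
qed

lemma Dge_tree:
  "Dge {(m, \<psi>, k)} n N X ==> X <= tup M n ==> \<exists>a. (\<forall>\<sigma>. a \<sigma> \<in> tup M m) &
     (\<forall>\<sigma>. length \<sigma> < N --> k_inconsistent k (%i::nat. Sol n \<psi> (a (\<sigma> @ [i])))) &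
     (\<forall>\<sigma>. length \<sigma> \<le> N --> (\<exists>x\<in>X. \<forall>j. 1 \<le> j --> j \<le> length \<sigma> --> x \<in> Sol n \<psi> (a (take j \<sigma>))))"
proof (induction N arbitrary: X)
  case 0
  have "replicate m x0 \<in> tup M m" using x0 by (auto simp: tup_iff)
  then show ?case using 0 by (intro exI[of _ "%_. replicate m x0"]) auto
next
  case (Suc N)
  have "\<exists>s. (\<forall>i. s i \<in> tup M m) & k_inconsistent k (%i::nat. Sol n \<psi> (s i)) & (\<forall>i. Dge {(m, \<psi>, k)} n N (X Int Sol n \<psi> (s i)))"
    using Suc.prems(1) unfolding Dge.simps by (simp only: singleton_iff prod.inject simp_thms) metis
  then obtain s where s: "\<forall>i. s i \<in> tup M m" "k_inconsistent k (%i::nat. Sol n \<psi> (s i))"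
    "!!i. Dge {(m, \<psi>, k)} n N (X Int Sol n \<psi> (s i))" by (elim exE conjE, intro that) (assumption | erule spec)+
  have "\<forall>i. \<exists>a. (\<forall>\<sigma>. a \<sigma> \<in> tup M m) &
     (\<forall>\<sigma>. length \<sigma> < N --> k_inconsistent k (%i::nat. Sol n \<psi> (a (\<sigma> @ [i])))) &
     (\<forall>\<sigma>. length \<sigma> \<le> N --> (\<exists>x\<in>X Int Sol n \<psi> (s i). \<forall>j. 1 \<le> j --> j \<le> length \<sigma> --> x \<in> Sol n \<psi> (a (take j \<sigma>))))"
    by (intro allI Suc.IH[OF s(3)]) (use Suc.prems(2) in blast)
  from choice[OF this] obtain b where b0: "\<forall>i. (\<forall>\<sigma>. b i \<sigma> \<in> tup M m) &
     (\<forall>\<sigma>. length \<sigma> < N --> k_inconsistent k (%j::nat. Sol n \<psi> (b i (\<sigma> @ [j])))) &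
     (\<forall>\<sigma>. length \<sigma> \<le> N --> (\<exists>x\<in>X Int Sol n \<psi> (s i). \<forall>j. 1 \<le> j --> j \<le> length \<sigma> --> x \<in> Sol n \<psi> (b i (take j \<sigma>))))"
    by (elim exE)
  note b = b0[THEN spec, THEN conjunct1, rule_format] b0[THEN spec, THEN conjunct2, THEN conjunct1, rule_format]
    b0[THEN spec, THEN conjunct2, THEN conjunct2, rule_format]
  \<comment> \<open>No formula is attached to the root, so its value \<open>s 0\<close> is a dummy;
    below the first level the trees of the children are grafted.\<close>
  define a where "a \<sigma> = (case \<sigma> of [] => s 0 | i # \<tau> => if \<tau> = [] then s i else b i \<tau>)" for \<sigma>
  have a1: "a \<sigma> \<in> tup M m" for \<sigma> using s(1) b(1) by (auto simp: a_def split: list.split)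
  have a2: "k_inconsistent k (%i::nat. Sol n \<psi> (a (\<sigma> @ [i])))" if "length \<sigma> < Suc N" for \<sigma>
    using that s(2) b(2) by (cases \<sigma>) (auto simp: a_def)
  have a3: "\<exists>x\<in>X. \<forall>j. 1 \<le> j --> j \<le> length \<sigma> --> x \<in> Sol n \<psi> (a (take j \<sigma>))" if l: "length \<sigma> \<le> Suc N" for \<sigma>
  proof (cases \<sigma>)
    case Nil
    have "X ~= {}" by (rule Dge_ne[OF Suc.prems(1)])
    then show ?thesis using Nil by auto
  next
    case (Cons i \<tau>)
    have "length \<tau> \<le> N" using l Cons by simp
    from b(3)[OF this, of i] obtain x where x: "x \<in> X Int Sol n \<psi> (s i)" "\<forall>j. 1 \<le> j --> j \<le> length \<tau> --> x \<in> Sol n \<psi> (b i (take j \<tau>))"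
      by (elim bexE)
    have "x \<in> Sol n \<psi> (a (take j \<sigma>))" if jj: "1 \<le> j" "j \<le> length \<sigma>" for j
    proof (cases "j = 1")
      case True then show ?thesis using x(1) Cons by (simp add: a_def)
    next
      case False
      then obtain j' where "j = Suc j'" "1 \<le> j'" using jj by (cases j) auto
      moreover have "take j' \<tau> ~= []" using calculation jj Cons by auto
      ultimately show ?thesis using x(2) Cons jj by (simp add: a_def)
    qed
    then show ?thesis using x(1) by blast
  qed
  show ?case using a1 a2 a3 by (intro exI[of _ a]) simp
qed

end

text \<open>\<open>pigeon\<close> isolates what the size of \<open>\<nu>\<close> is for: finite sets
  of formulas attached to the indices below \<open>\<nu>\<close> repeat infinitely often.
  \<open>NTP\<close> is simplicity.\<close>

locale simplestruct = homstruct M Def \<nu>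
  for M :: "'c set" and Def :: "nat => 'c list set set" and \<nu> :: "'v rel" +
  assumes pigeon: "!!F :: 'v => (nat \<times> 'c list set \<times> nat) set. (!!i. i \<in> Field \<nu> ==> finite (F i)) ==>
       (!!i m \<psi> k. i \<in> Field \<nu> ==> (m, \<psi>, k) \<in> F i ==> \<exists>n. \<psi> \<in> Def n) ==> \<exists>\<Delta>. infinite {i \<in> Field \<nu>. F i = \<Delta>}"
    and NTP: "!!n m \<psi> k a. \<psi> \<in> Def (n + m) ==> (!!s. s ~= [] ==> a s \<in> tup M m) ==>
       (!!s. k_inconsistent k (%i::nat. {x \<in> tup M n. x @ a (s @ [i]) \<in> \<psi>})) ==>
       (!!\<eta> J. finite J ==> J <= {1..} ==> \<exists>x\<in>tup M n. \<forall>j\<in>J. x @ a (map \<eta> [0..<j]) \<in> \<psi>) ==> False"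
begin

text \<open>Unbounded rank gives trees of every finite height, and compactness combines them into
  one infinite tree, which is the tree property.\<close>

lemma Dge_bounded1:
  assumes \<psi>: "\<psi> \<in> Def (n + m)"
  shows "\<exists>N. \<not> Dge {(m, \<psi>, k)} n N (tup M n)"
proof (rule ccontr)
  assume "\<not> ?thesis"
  then have all: "Dge {(m, \<psi>, k)} n N (tup M n)" for N by blast
  define vs where "vs \<sigma> = map (Pair \<sigma>) [0..<m]" for \<sigma> :: "nat list"
  define Q where "Q t f = (case t of
       Inl (\<sigma>, I) => \<not> (\<exists>x\<in>tup M n. \<forall>i\<in>I. x @ map f (vs (\<sigma> @ [i])) @ [] \<in> \<psi>)
     | Inr \<sigma> => (\<exists>x\<in>tup M n. \<forall>j\<in>{1..length \<sigma>}. x @ map f (vs (take j \<sigma>)) @ [] \<in> \<psi>))"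
    for t :: "(nat list \<times> nat set) + nat list" and f :: "nat list \<times> nat => 'c"
  define T :: "((nat list \<times> nat set) + nat list) set" where "T = {Inl (\<sigma>, I) | \<sigma> I. finite I & card I = k} Un range Inr"
  have "\<exists>f. range f <= M & (\<forall>t\<in>T. Q t f)"
  proof (rule compactness_indexed[of UNIV "{}"])
    show "|UNIV :: (nat list \<times> nat) set| \<le>o \<nu>" by (rule countable_le_nu) simp
    show "sm {}" by (rule sm_empty)
    fix t assume "t \<in> T"
    then consider \<sigma> I where "t = Inl (\<sigma>, I)" "finite I" | \<sigma> where "t = Inr \<sigma>" unfolding T_def by blast
    then show "DF UNIV {} (Q t)"
    proof cases
      case 1
      show ?thesis unfolding 1(1) Q_def sum.case prod.case
        by (rule DF_not, rule DF_ex_tuple[OF 1(2)]) (use \<psi> in \<open>auto simp: vs_def\<close>)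
    next
      case 2
      show ?thesis unfolding 2(1) Q_def sum.case prod.case
        by (rule DF_ex_tuple) (use \<psi> in \<open>auto simp: vs_def\<close>)
    qed
  next
    fix T0 assume T0: "T0 <= T" "finite T0"
    define ht where "ht t = (case t of Inl (\<sigma>, I) => Suc (length \<sigma>) | Inr \<sigma> => length \<sigma>)" for t :: "(nat list \<times> nat set) + nat list"
    obtain N where N: "!!t. t \<in> T0 ==> ht t \<le> N" using T0(2)
      by (meson finite_imageI finite_nat_set_iff_bounded_le imageI)
    obtain a where a0: "\<forall>\<sigma>. a \<sigma> \<in> tup M m" "\<forall>\<sigma>. length \<sigma> < N --> k_inconsistent k (%i::nat. Sol n \<psi> (a (\<sigma> @ [i])))"
      "\<forall>\<sigma>. length \<sigma> \<le> N --> (\<exists>x\<in>tup M n. \<forall>j. 1 \<le> j --> j \<le> length \<sigma> --> x \<in> Sol n \<psi> (a (take j \<sigma>)))"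
      using Dge_tree[OF all[of N] order_refl] by (elim exE conjE)
    note a = a0(1)[rule_format] a0(2)[rule_format] a0(3)[rule_format]
    define f where "f = (%(\<sigma>, p). asg (a \<sigma>) p)"
    have rf: "range f <= M" unfolding f_def using asg_range a(1) by (fastforce simp: tup_iff)
    have fa: "map f (vs \<sigma>) = a \<sigma>" for \<sigma> unfolding vs_def f_def using map_asg[of "a \<sigma>"] a(1)[of \<sigma>] by (simp add: comp_def tup_iff)
    have "Q t f" if t: "t \<in> T0" for t
    proof -
      from t T0 consider \<sigma> I where "t = Inl (\<sigma>, I)" "finite I" "card I = k" | \<sigma> where "t = Inr \<sigma>" unfolding T_def by blast
      then show ?thesis
      proof cases
        case 1
        have "length \<sigma> < N" using N[OF t] 1 by (simp add: ht_def)
        then have e: "(\<Inter>i\<in>I. Sol n \<psi> (a (\<sigma> @ [i]))) = {}" using a(2) 1 unfolding k_inconsistent_def by simp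
        show ?thesis unfolding 1(1) Q_def sum.case prod.case fa
        proof
          assume "\<exists>x\<in>tup M n. \<forall>i\<in>I. x @ a (\<sigma> @ [i]) @ [] \<in> \<psi>"
          then obtain x where "x \<in> tup M n" "\<forall>i\<in>I. x @ a (\<sigma> @ [i]) \<in> \<psi>" by auto
          then have "x \<in> (\<Inter>i\<in>I. Sol n \<psi> (a (\<sigma> @ [i])))" by (simp add: Sol_def)
          then show False using e by blast
        qed
      next
        case 2
        have "length \<sigma> \<le> N" using N[OF t] 2 by (simp add: ht_def)
        from a(3)[OF this] obtain x where x: "x \<in> tup M n" "\<forall>j. 1 \<le> j --> j \<le> length \<sigma> --> x \<in> Sol n \<psi> (a (take j \<sigma>))"
          by (elim bexE)
        show ?thesis unfolding 2(1) Q_def sum.case fa using x(2) by (intro bexI[OF _ x(1)]) (simp add: Sol_def)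
      qed
    qed
    then show "\<exists>f. range f <= M & (\<forall>t\<in>T0. Q t f)" using rf by (intro exI[of _ f]) simp
  qed
  then obtain f where f0: "range f <= M" "\<forall>t\<in>T. Q t f" by (elim exE conjE)
  note f = f0(1) f0(2)[rule_format]
  define a where "a \<sigma> = map f (vs \<sigma>)" for \<sigma>
  show False
  proof (rule NTP[OF \<psi>, of a k])
    show "a s \<in> tup M m" for s using f(1) by (auto simp: a_def vs_def tup_iff)
    show "k_inconsistent k (%i. {x \<in> tup M n. x @ a (s @ [i]) \<in> \<psi>})" for s
    proof -
      have "(\<Inter>i\<in>I. {x \<in> tup M n. x @ a (s @ [i]) \<in> \<psi>}) = {}" if I: "finite I" "card I = k" for I
      proof (cases "I = {}")
        \<comment> \<open>An empty \<open>I\<close> means \<open>k = 0\<close>; then the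
          inconsistency requirement met by \<open>f\<close> would say that \<open>tup M n\<close> is
          empty.\<close>
        case True
        have "Q (Inl (s, I)) f" by (rule f(2)) (use I in \<open>auto simp: T_def\<close>)
        moreover have "replicate n x0 \<in> tup M n" using x0 by (auto simp: tup_iff)
        ultimately show ?thesis using True unfolding Q_def by auto
      next
        case False
        have "Q (Inl (s, I)) f" by (rule f(2)) (use I in \<open>auto simp: T_def\<close>)
        then show ?thesis using False unfolding Q_def by (auto simp: a_def)
      qed
      then show ?thesis unfolding k_inconsistent_def by blast
    qed
    fix \<eta> :: "nat => nat" and J :: "nat set" assume J: "finite J" "J <= {1..}"
    define \<sigma> where "\<sigma> = map \<eta> [0..<Max (insert 0 J)]"
    have "Q (Inr \<sigma>) f" by (rule f(2)) (auto simp: T_def)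
    then obtain x where x: "x \<in> tup M n" "\<forall>j\<in>{1..length \<sigma>}. x @ a (take j \<sigma>) \<in> \<psi>" unfolding Q_def by (auto simp: a_def)
    have "x @ a (map \<eta> [0..<j]) \<in> \<psi>" if "j \<in> J" for j
    proof -
      have l: "j \<le> Max (insert 0 J)" using J that by simp
      then have "take j \<sigma> = map \<eta> [0..<j]" by (simp add: \<sigma>_def take_map min_def)
      then show ?thesis using x(2) l J that by (metis \<sigma>_def atLeastAtMost_iff atLeast_iff diff_zero length_map length_upt subsetD)
    qed
    then show "\<exists>x\<in>tup M n. \<forall>j\<in>J. x @ a (map \<eta> [0..<j]) \<in> \<psi>" using x(1) by blast
  qed
qed

section \<open>Dividing, forking, independence and the rank of a type\<close>

definition good :: "nat => (nat \<times> 'c list set \<times> nat) set => bool" where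
  "good n \<Delta> \<longleftrightarrow> finite \<Delta> & (\<forall>m \<psi> k. (m, \<psi>, k) \<in> \<Delta> --> \<psi> \<in> Def (n + m))"

lemma good_Def: "good n \<Delta> ==> (m, \<psi>, k) \<in> \<Delta> ==> \<psi> \<in> Def (n + m)"
  unfolding good_def by blast

lemma Dge_bounded:
  assumes "good n \<Delta>" shows "\<exists>N. \<not> Dge \<Delta> n N (tup M n)"
proof (cases "\<Delta> = {}")
  case True then have "\<not> Dge \<Delta> n 1 (tup M n)" by simp then show ?thesis ..
next
  case False
  have "\<forall>l\<in>\<Delta>. \<exists>N. \<not> Dge {l} n N (tup M n)" using assms Dge_bounded1 unfolding good_def by fast
  from bchoice[OF this] obtain nf where "\<forall>l\<in>\<Delta>. \<not> Dge {l} n (nf l) (tup M n)" ..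
  then have "\<not> Dge \<Delta> n (\<Sum>l\<in>\<Delta>. nf l) (tup M n)"
    using Dge_sum[OF _ False, of n _ "tup M n" nf] assms unfolding good_def by blast
  then show ?thesis ..
qed

text \<open>The formula \<open>\<psi>(x, d)\<close> divides over \<open>C\<close> with inconsistency
  number \<open>k\<close>. As relations carry no parameters, parameters from \<open>C\<close> are
  entries of \<open>d\<close>; the conjugates \<open>s i\<close> over \<open>C\<close> leave them
  fixed.\<close>

definition kd :: "nat => 'c set => 'c list set => 'c list => nat => bool" where
  "kd n C \<psi> d k \<longleftrightarrow> \<psi> \<in> Def (n + length d) & set d <= M &
     (\<exists>s. (\<forall>i::nat. eqt C d (s i)) & k_inconsistent k (%i. Sol n \<psi> (s i)))"

text \<open>Forking together with a record \<open>\<Delta>\<close> of the formulas and inconsistency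
  numbers used. Rank arguments compare many instances of forking and need one finite
  \<open>\<Delta>\<close> for all of them.\<close>

definition forkD :: "'c set => nat => (nat \<times> 'c list set \<times> nat) set => 'c list set => bool" where
  "forkD C n \<Delta> X \<longleftrightarrow> (\<exists>D. finite D & (\<forall>p\<in>D. \<exists>k. (length (snd p), fst p, k) \<in> \<Delta> & kd n C (fst p) (snd p) k) &
     X <= (\<Union>p\<in>D. Sol n (fst p) (snd p)))"

definition fk :: "'c set => nat => 'c list set => bool" where
  "fk C n X \<longleftrightarrow> (\<exists>\<Delta>. good n \<Delta> & forkD C n \<Delta> X)"

definition Ind :: "'c set => 'c set => 'c set => bool" where
  "Ind A C B \<longleftrightarrow> (\<forall>a c R. set a <= A --> set c <= B Un C --> R \<in> Def (length a + length c) --> a @ c \<in> R -->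
     \<not> fk C (length a) (Sol (length a) R c))"

text \<open>The local rank of the type of \<open>a\<close> over \<open>C\<close> is at least
  \<open>N\<close>.\<close>

definition tge :: "(nat \<times> 'c list set \<times> nat) set => 'c set => 'c list => nat => bool" where
  "tge \<Delta> C a N \<longleftrightarrow> (\<forall>R c. set c <= C --> R \<in> Def (length a + length c) --> a @ c \<in> R -->
     Dge \<Delta> (length a) N (Sol (length a) R c))"

lemma kd_eqt: "kd n C \<psi> d k ==> eqt C d d' ==> kd n C \<psi> d' k"
  unfolding kd_def using eqt_length eqt_M eqt_sym eqt_trans by (metis (full_types))

lemma kd_mono: "kd n C \<psi> d k ==> C' <= C ==> kd n C' \<psi> d k"
  unfolding kd_def using eqt_mono by (metis (full_types))

lemma kd_Def: "kd n C \<psi> d k ==> \<psi> \<in> Def (n + length d) & set d <= M"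
  by (simp add: kd_def)

lemma forkD_mono: "forkD C n \<Delta> X ==> Y <= X ==> C' <= C ==> \<Delta> <= \<Delta>' ==> forkD C' n \<Delta>' Y"
  unfolding forkD_def by (elim exE conjE, intro exI conjI, assumption) (fast intro: kd_mono, erule (1) order_trans[rotated])

lemma fkI: "kd n C \<psi> d k ==> X <= Sol n \<psi> d ==> fk C n X"
proof -
  assume a: "kd n C \<psi> d k" "X <= Sol n \<psi> d"
  have "forkD C n {(length d, \<psi>, k)} X" unfolding forkD_def
    by (rule exI[of _ "{(\<psi>, d)}"]) (use a in auto)
  moreover have "good n {(length d, \<psi>, k)}" using kd_Def[OF a(1)] by (simp add: good_def)
  ultimately show ?thesis unfolding fk_def by blast
qed

lemma fk_mono: "fk C n X ==> Y <= X ==> fk C n Y"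
  unfolding fk_def using forkD_mono by blast

lemma fk_base: "fk C n X ==> C' <= C ==> fk C' n X"
  unfolding fk_def using forkD_mono by blast

lemma fk_empty: "fk C n {}"
  unfolding fk_def good_def forkD_def by (rule exI[of _ "{}"], intro conjI exI[of _ "{}"]) auto

lemma fk_Un: "fk C n X ==> fk C n Y ==> fk C n (X Un Y)"
proof -
  assume "fk C n X" "fk C n Y"
  then obtain \<Delta>1 \<Delta>2 where a: "good n \<Delta>1" "forkD C n \<Delta>1 X" "good n \<Delta>2" "forkD C n \<Delta>2 Y" unfolding fk_def by blast
  obtain D1 where D1: "finite D1" "\<forall>p\<in>D1. \<exists>k. (length (snd p), fst p, k) \<in> \<Delta>1 & kd n C (fst p) (snd p) k"
    "X <= (\<Union>p\<in>D1. Sol n (fst p) (snd p))" using a(2) unfolding forkD_def by (elim exE conjE)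
  obtain D2 where D2: "finite D2" "\<forall>p\<in>D2. \<exists>k. (length (snd p), fst p, k) \<in> \<Delta>2 & kd n C (fst p) (snd p) k"
    "Y <= (\<Union>p\<in>D2. Sol n (fst p) (snd p))" using a(4) unfolding forkD_def by (elim exE conjE)
  have "good n (\<Delta>1 Un \<Delta>2)" using a(1,3) unfolding good_def by blast
  moreover have "forkD C n (\<Delta>1 Un \<Delta>2) (X Un Y)" unfolding forkD_def
  proof (intro exI[of _ "D1 Un D2"] conjI)
    show "finite (D1 Un D2)" using D1 D2 by simp
    show "\<forall>p\<in>D1 Un D2. \<exists>k. (length (snd p), fst p, k) \<in> \<Delta>1 Un \<Delta>2 & kd n C (fst p) (snd p) k"
      using D1(2) D2(2) by (metis Un_iff)
    show "X Un Y <= (\<Union>p\<in>D1 Un D2. Sol n (fst p) (snd p))" using D1(3) D2(3) by (simp add: UN_Un) blast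
  qed
  ultimately show ?thesis unfolding fk_def by (intro exI[of _ "\<Delta>1 Un \<Delta>2"] conjI)
qed

lemma fk_UN: "finite D ==> (!!p. p \<in> D ==> fk C n (X p)) ==> fk C n (\<Union>p\<in>D. X p)"
  by (induction D rule: finite_induct) (auto intro: fk_empty fk_Un)

lemma fk_cover: "fk C n X ==> \<exists>D. finite D & (\<forall>p\<in>D. \<exists>k. kd n C (fst p) (snd p) k) & X <= (\<Union>p\<in>D. Sol n (fst p) (snd p))"
  unfolding fk_def forkD_def by (elim exE conjE, intro exI conjI, assumption) (fast, assumption)

lemma kd_pre:
  assumes "kd n C \<psi> d k" "!!i. i < n ==> \<sigma> i < n'"
  shows "\<exists>\<psi>'. kd n' C \<psi>' d k & Sol n' \<psi>' d = pre \<sigma> n n' (Sol n \<psi> d)"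
proof -
  have d: "\<psi> \<in> Def (n + length d)" "d \<in> tup M (length d)" using kd_Def[OF assms(1)] by (auto simp: tup_iff)
  obtain \<psi>' where p: "\<psi>' \<in> Def (n' + length d)" "!!e. e \<in> tup M (length d) ==> Sol n' \<psi>' e = pre \<sigma> n n' (Sol n \<psi> e)"
    using Def_pre[OF d(1), of \<sigma> n'] assms(2) by metis
  obtain s where s: "!!i::nat. eqt C d (s i)" "k_inconsistent k (%i. Sol n \<psi> (s i))" using assms(1) unfolding kd_def by (elim exE conjE, intro that) (erule spec | assumption | blast)+
  have st: "s i \<in> tup M (length d)" for i using s(1)[of i] eqt_length eqt_M by (metis tup_iff)
  have "k_inconsistent k (%i. Sol n' \<psi>' (s i))" unfolding k_inconsistent_def
  proof (intro allI impI)
    fix I :: "nat set" assume I: "finite I & card I = k"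
    then have e: "(\<Inter>i\<in>I. Sol n \<psi> (s i)) = {}" using s(2) unfolding k_inconsistent_def by simp
    have mm: "map (%i. z ! \<sigma> i) [0..<n] \<in> (\<Inter>i\<in>I. Sol n \<psi> (s i))" if "z \<in> (\<Inter>i\<in>I. Sol n' \<psi>' (s i))" for z
      using that p(2)[OF st] unfolding pre_def by auto
    show "(\<Inter>i\<in>I. Sol n' \<psi>' (s i)) = {}"
    proof (rule equals0I)
      fix z assume "z \<in> (\<Inter>i\<in>I. Sol n' \<psi>' (s i))"
      from mm[OF this] show False unfolding e by simp
    qed
  qed
  then have "kd n' C \<psi>' d k" unfolding kd_def using p(1) d(2) s(1) by (intro conjI exI[of _ s]) (auto simp: tup_iff)
  then show ?thesis using p(2)[OF d(2)] by (intro exI[of _ \<psi>'] conjI)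
qed

lemma fk_pre:
  assumes "fk C n X" "!!i. i < n ==> \<sigma> i < n'"
  shows "fk C n' (pre \<sigma> n n' X)"
proof -
  obtain D where D: "finite D" "\<forall>p\<in>D. \<exists>k. kd n C (fst p) (snd p) k" "X <= (\<Union>p\<in>D. Sol n (fst p) (snd p))"
    using fk_cover[OF assms(1)] by (elim exE conjE)
  have "fk C n' (\<Union>p\<in>D. pre \<sigma> n n' (Sol n (fst p) (snd p)))"
  proof (rule fk_UN[OF D(1)])
    fix p assume "p \<in> D"
    then obtain k where "kd n C (fst p) (snd p) k" using D(2) by blast
    then have "\<exists>\<psi>'. kd n' C \<psi>' (snd p) k & Sol n' \<psi>' (snd p) = pre \<sigma> n n' (Sol n (fst p) (snd p))"
      by (rule kd_pre) (use assms(2) in auto)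
    then obtain \<psi>' where "kd n' C \<psi>' (snd p) k" "Sol n' \<psi>' (snd p) = pre \<sigma> n n' (Sol n (fst p) (snd p))"
      by (elim exE conjE)
    then show "fk C n' (pre \<sigma> n n' (Sol n (fst p) (snd p)))" using fkI by (metis order_refl)
  qed
  then show ?thesis by (rule fk_mono) (use D(3) in \<open>auto simp: pre_def\<close>)
qed

lemma Sol_aut: "aut \<sigma> ==> set d <= M ==> \<psi> \<in> Def (n + length d) ==> x \<in> tup M n ==> map \<sigma> x \<in> Sol n \<psi> (map \<sigma> d) \<longleftrightarrow> x \<in> Sol n \<psi> d"
proof -
  assume a: "aut \<sigma>" "set d <= M" "\<psi> \<in> Def (n + length d)" "x \<in> tup M n"
  have "x @ d \<in> tup M (n + length d)" using a by (auto simp: tup_iff)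
  from aut_Def[OF a(1,3) this] show ?thesis using a(4) aut_tup[OF a(1)] by (auto simp: Sol_def)
qed

lemma kinc_aut:
  assumes "aut \<sigma>" "!!i. s i \<in> tup M m" "\<psi> \<in> Def (n + m)" "k_inconsistent k (%i::nat. Sol n \<psi> (s i))"
  shows "k_inconsistent k (%i. Sol n \<psi> (map \<sigma> (s i)))"
  unfolding k_inconsistent_def
proof (intro allI impI)
  fix I :: "nat set" assume I: "finite I & card I = k"
  then have e: "(\<Inter>i\<in>I. Sol n \<psi> (s i)) = {}" using assms(4) unfolding k_inconsistent_def by simp
  then have ne: "I ~= {}" by auto
  obtain \<tau> where \<tau>: "aut \<tau>" "!!x. x \<in> M ==> \<tau> (\<sigma> x) = x" using aut_inverse[OF assms(1)] by metis
  have mm: "map \<tau> y \<in> (\<Inter>i\<in>I. Sol n \<psi> (s i))" if y: "y \<in> (\<Inter>i\<in>I. Sol n \<psi> (map \<sigma> (s i)))" for y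
  proof
    fix i assume i: "i \<in> I"
    have yt: "y \<in> tup M n" using y ne Sol_tup by blast
    have si: "set (map \<sigma> (s i)) <= M" using assms(2)[of i] aut_tup[OF assms(1)] by (metis tup_iff)
    have "map \<tau> (map \<sigma> (s i)) = s i" using assms(2)[of i] \<tau>(2) by (auto simp: tup_iff intro!: map_idI)
    then show "map \<tau> y \<in> Sol n \<psi> (s i)"
      using Sol_aut[OF \<tau>(1) si _ yt, of \<psi>] assms(2)[of i] assms(3) y i by (simp add: tup_iff)
  qed
  show "(\<Inter>i\<in>I. Sol n \<psi> (map \<sigma> (s i))) = {}"
  proof (rule equals0I)
    fix z assume "z \<in> (\<Inter>i\<in>I. Sol n \<psi> (map \<sigma> (s i)))"
    from mm[OF this] show False unfolding e by simp
  qed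
qed

lemma Dge_aut:
  assumes "aut \<sigma>" "good n \<Delta>"
  shows "Dge \<Delta> n N X ==> X <= tup M n ==> (!!x. x \<in> X ==> map \<sigma> x \<in> Y) ==> Dge \<Delta> n N Y"
proof (induction N arbitrary: X Y)
  case 0 then show ?case by auto
next
  case (Suc N)
  from Suc.prems(1) obtain m \<psi> k s where s: "(m, \<psi>, k) \<in> \<Delta>" "!!i. s i \<in> tup M m" "k_inconsistent k (%i::nat. Sol n \<psi> (s i))"
    "!!i. Dge \<Delta> n N (X Int Sol n \<psi> (s i))" unfolding Dge.simps by (elim exE conjE, intro that) (assumption | erule spec)+
  have \<psi>: "\<psi> \<in> Def (n + m)" by (rule good_Def[OF assms(2) s(1)])
  have "Dge \<Delta> n N (Y Int Sol n \<psi> (map \<sigma> (s i)))" for i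
  proof (rule Suc.IH[OF s(4)[of i]])
    show "X Int Sol n \<psi> (s i) <= tup M n" using Suc.prems by blast
    fix x assume x: "x \<in> X Int Sol n \<psi> (s i)"
    then have "map \<sigma> x \<in> Sol n \<psi> (map \<sigma> (s i))"
      using Sol_aut[OF assms(1), of "s i" \<psi> n x] s(2)[of i] \<psi> Suc.prems(2) by (auto simp: tup_iff)
    then show "map \<sigma> x \<in> Y Int Sol n \<psi> (map \<sigma> (s i))" using x Suc.prems(3) by blast
  qed
  then show ?case using s(1) kinc_aut[OF assms(1) s(2) \<psi> s(3)] aut_tup[OF assms(1) s(2)] unfolding Dge.simps
    by (intro exI[of _ m] exI[of _ \<psi>] exI[of _ k] exI[of _ "%i. map \<sigma> (s i)"]) simp
qed

text \<open>A formula of tp(a/C) conjoined with the forking formula has rank at least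
  \<open>N\<close>, so by \<open>Dge_UN\<close> one of the dividing formulas of the cover keeps this
  rank. Its conjugates over \<open>C\<close> along the dividing sequence provide one more
  splitting.\<close>

lemma tge_drop:
  assumes "sm C" "C <= C'" "set c <= C'" "R \<in> Def (length a + length c)" "a @ c \<in> R"
    "forkD C (length a) \<Delta> (Sol (length a) R c)" "good (length a) \<Delta>" "tge \<Delta> C' a N"
  shows "tge \<Delta> C a (Suc N)"
  unfolding tge_def
proof (intro allI impI)
  let ?n = "length a"
  fix S e assume S: "set e <= C" "S \<in> Def (?n + length e)" "a @ e \<in> S"
  have cM: "set c <= M" "set e <= M" "set a <= M" using Def_length[OF assms(4,5)] Def_length[OF S(2,3)] by auto
  have "DF {..<?n} (set c Un set e) (%f. map f [0..<?n] @ c \<in> R & map f [0..<?n] @ e \<in> S)"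
    by (intro DF_and DF_mem[OF assms(4)] DF_mem[OF S(2)]) (use cM in auto)
  from DF_Sol[OF this] obtain U u where U: "set u <= (set c Un set e) Int M" "U \<in> Def (?n + length u)"
     "\<forall>x\<in>tup M ?n. (map (asg x) [0..<?n] @ c \<in> R & map (asg x) [0..<?n] @ e \<in> S) = (x @ u \<in> U)" by (elim exE conjE)
  have Ux: "(x @ u \<in> U) = (x @ c \<in> R & x @ e \<in> S)" if "x \<in> tup M ?n" for x
    using bspec[OF U(3) that] map_asg[of x] that by (simp add: tup_iff)
  have "a @ u \<in> U" using Ux[of a] cM assms(5) S(3) by (simp add: tup_iff)
  then have "Dge \<Delta> ?n N (Sol ?n U u)" using assms(8) U(1,2) assms(2,3) S(1) unfolding tge_def by blast
  moreover have "Sol ?n U u = Sol ?n R c Int Sol ?n S e" using Ux by (auto simp: Sol_def)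
  ultimately have D: "Dge \<Delta> ?n N (Sol ?n R c Int Sol ?n S e)" by simp
  obtain E where E: "finite E" "\<forall>p\<in>E. \<exists>k. (length (snd p), fst p, k) \<in> \<Delta> & kd ?n C (fst p) (snd p) k"
    "Sol ?n R c <= (\<Union>p\<in>E. Sol ?n (fst p) (snd p))" using assms(6) unfolding forkD_def by (elim exE conjE)
  have "\<exists>p\<in>E. Dge \<Delta> ?n N ((Sol ?n R c Int Sol ?n S e) Int Sol ?n (fst p) (snd p))"
    by (rule Dge_UN[OF E(1) D]) (use E(3) in blast)
  then obtain p where p: "p \<in> E" "Dge \<Delta> ?n N ((Sol ?n R c Int Sol ?n S e) Int Sol ?n (fst p) (snd p))" by (elim bexE)
  let ?\<psi> = "fst p" let ?d = "snd p"
  have p2: "Dge \<Delta> ?n N (Sol ?n S e Int Sol ?n ?\<psi> ?d)" by (rule Dge_mono[OF p(2)]) blast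
  obtain k where k: "(length ?d, ?\<psi>, k) \<in> \<Delta>" "kd ?n C ?\<psi> ?d k" using E(2) p(1) by blast
  obtain s where s: "!!i::nat. eqt C ?d (s i)" "k_inconsistent k (%i. Sol ?n ?\<psi> (s i))" using k(2) unfolding kd_def by (elim exE conjE, intro that) (assumption | erule spec)+
  have kk: "?\<psi> \<in> Def (?n + length ?d)" "set ?d <= M" using kd_Def[OF k(2)] by auto
  have "Dge \<Delta> ?n N (Sol ?n S e Int Sol ?n ?\<psi> (s i))" for i
  proof -
    obtain \<sigma> where \<sigma>: "fixes_on C \<sigma>" "map \<sigma> ?d = s i" using eqt_aut[OF s(1)[of i] assms(1)] .
    show ?thesis
    proof (rule Dge_aut[OF fixes_aut[OF \<sigma>(1)] assms(7) p2])
      show "Sol ?n S e Int Sol ?n ?\<psi> ?d <= tup M ?n" using Sol_tup by blast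
      fix x assume x: "x \<in> Sol ?n S e Int Sol ?n ?\<psi> ?d"
      then have xt: "x \<in> tup M ?n" using Sol_tup by blast
      have "map \<sigma> x \<in> Sol ?n S (map \<sigma> e)" using Sol_aut[OF fixes_aut[OF \<sigma>(1)] cM(2) S(2) xt] x by blast
      moreover have "map \<sigma> x \<in> Sol ?n ?\<psi> (map \<sigma> ?d)" using Sol_aut[OF fixes_aut[OF \<sigma>(1)] kk(2,1) xt] x by blast
      ultimately show "map \<sigma> x \<in> Sol ?n S e Int Sol ?n ?\<psi> (s i)" using \<sigma>(2) fixes_map[OF \<sigma>(1) S(1)] by simp
    qed
  qed
  moreover have "s i \<in> tup M (length ?d)" for i using s(1)[of i] eqt_length eqt_M by (metis tup_iff)
  ultimately show "Dge \<Delta> ?n (Suc N) (Sol ?n S e)" using k(1) s(2) unfolding Dge.simps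
    by (intro exI[of _ "length ?d"] exI[of _ ?\<psi>] exI[of _ k] exI[of _ s]) simp
qed

lemma tge_0: "set a <= M ==> tge \<Delta> C a 0"
  unfolding tge_def Sol_def by (auto simp: tup_iff)

lemma tge_bounded:
  assumes "good (length a) \<Delta>" "set a <= M" shows "\<exists>N. \<not> tge \<Delta> C a N"
proof -
  obtain N where N: "\<not> Dge \<Delta> (length a) N (tup M (length a))" using Dge_bounded[OF assms(1)] by blast
  have "Sol (length a) (tup M (length a)) [] = tup M (length a)" by (auto simp: Sol_def)
  then have "\<not> tge \<Delta> C a N" unfolding tge_def using N assms(2) Def_full[of "length a"]
    by (metis add_0_right append_Nil2 empty_set empty_subsetI list.size(3) tup_iff)
  then show ?thesis ..
qed

text \<open>A formula about a tuple of entries of \<open>d\<close> pulls back to a formula about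
  \<open>d\<close>, and pulling back preserves forking; so only the enumeration \<open>d\<close>
  itself has to be tested.\<close>

lemma Ind_list:
  assumes "set d <= M"
    "!!c R. set c <= B Un C ==> R \<in> Def (length d + length c) ==> d @ c \<in> R ==> \<not> fk C (length d) (Sol (length d) R c)"
  shows "Ind (set d) C B"
  unfolding Ind_def
proof (intro allI impI notI)
  fix a c R assume a: "set a <= set d" "set c <= B Un C" "R \<in> Def (length a + length c)" "a @ c \<in> R"
    "fk C (length a) (Sol (length a) R c)"
  have c: "c \<in> tup M (length c)" using Def_length[OF a(3,4)] by (simp add: tup_iff)
  have "\<forall>i<length a. \<exists>j<length d. d ! j = a ! i" using a(1) by (metis in_set_conv_nth nth_mem subsetD)
  then obtain \<sigma> where \<sigma>: "!!i. i < length a ==> \<sigma> i < length d" "!!i. i < length a ==> d ! \<sigma> i = a ! i" by metis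
  obtain R' where R': "R' \<in> Def (length d + length c)" "!!e. e \<in> tup M (length c) ==> Sol (length d) R' e = pre \<sigma> (length a) (length d) (Sol (length a) R e)"
    using Def_pre[OF a(3), of \<sigma> "length d"] \<sigma>(1) by metis
  have da: "map (%i. d ! \<sigma> i) [0..<length a] = a" using \<sigma>(2) by (intro nth_equalityI) auto
  have "d \<in> pre \<sigma> (length a) (length d) (Sol (length a) R c)"
    unfolding pre_def mem_Collect_eq da Sol_def using assms(1) a by (auto simp: tup_iff)
  then have "d \<in> Sol (length d) R' c" using R'(2)[OF c] by simp
  then have "d @ c \<in> R'" by (simp add: Sol_def)
  moreover have "fk C (length d) (Sol (length d) R' c)" unfolding R'(2)[OF c] by (rule fk_pre[OF a(5)]) (use \<sigma> in auto)
  ultimately show False using assms(2)[OF a(2) R'(1)] by blast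
qed

lemma IndD: "Ind A C B ==> set a <= A ==> set c <= B Un C ==> R \<in> Def (length a + length c) ==> a @ c \<in> R ==>
  fk C (length a) (Sol (length a) R c) ==> False"
  unfolding Ind_def by blast

lemma Ind_lists: "(!!a. set a <= A ==> Ind (set a) C B) ==> Ind A C B"
  unfolding Ind_def by (metis order_refl)

lemma Ind_mono: "Ind A C B ==> A' <= A ==> B' <= B ==> Ind A' C B'"
  unfolding Ind_def by (meson Un_mono order_refl subset_trans)

lemma Ind_base_mono: "Ind A C B ==> C <= C' ==> C' <= C Un B ==> Ind A C' B"
  unfolding Ind_def
proof (intro allI impI notI)
  fix a c R
  assume h: "\<forall>a c R. set a <= A --> set c <= B Un C --> R \<in> Def (length a + length c) --> a @ c \<in> R --> \<not> fk C (length a) (Sol (length a) R c)"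
    "C <= C'" "C' <= C Un B" and a: "set a <= A" "set c <= B Un C'" "R \<in> Def (length a + length c)" "a @ c \<in> R"
    "fk C' (length a) (Sol (length a) R c)"
  have "set c <= B Un C" using a(2) h(3) by blast
  then show False using h(1)[rule_format, OF a(1) _ a(3,4)] fk_base[OF a(5) h(2)] by blast
qed

text \<open>With \<open>C' = C\<close>, \<open>tge_drop\<close> would push the rank of the type over
  \<open>C\<close> beyond every bound; hence no type forks over its own domain.\<close>

lemma Ind_refl:
  assumes "sm C" "A <= M" shows "Ind A C C"
proof (rule Ind_lists)
  fix a assume a: "set a <= A"
  show "Ind (set a) C C"
  proof (rule Ind_list)
    show aM: "set a <= M" using a assms by blast
    fix c R assume c: "set c <= C Un C" "R \<in> Def (length a + length c)" "a @ c \<in> R"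
    show "\<not> fk C (length a) (Sol (length a) R c)"
    proof
      assume "fk C (length a) (Sol (length a) R c)"
      then obtain \<Delta> where \<Delta>: "good (length a) \<Delta>" "forkD C (length a) \<Delta> (Sol (length a) R c)" unfolding fk_def by blast
      have "tge \<Delta> C a N" for N
      proof (induction N)
        case 0 show ?case by (rule tge_0[OF aM])
      next
        case (Suc N) show ?case by (rule tge_drop[OF assms(1) order_refl _ c(2,3) \<Delta>(2,1) Suc]) (use c in blast)
      qed
      then show False using tge_bounded[OF \<Delta>(1) aM] by blast
    qed
  qed
qed

lemma nu_wf: "wf (\<nu> - Id)"
  using card_order_on_well_order_on[OF nu_card] by (simp add: well_order_on_def)

lemma nu_total: "i \<in> Field \<nu> ==> j \<in> Field \<nu> ==> i ~= j ==> (i, j) \<in> \<nu> \<or> (j, i) \<in> \<nu>"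
  using card_order_on_well_order_on[OF nu_card] by (simp add: well_order_on_def linear_order_on_def total_on_def)

text \<open>By \<open>pigeon\<close>, infinitely many failures would share one
  \<open>\<Delta>\<close>. Forking at an index lowers the rank for all later ones, from which it
  follows that for each \<open>N\<close> all but finitely many of these indices have rank at least
  \<open>N\<close>; but the rank is bounded.\<close>

lemma local_character:
  assumes d: "set d <= M" and sm: "!!i. i \<in> Field \<nu> ==> sm (C i)"
    and ch: "!!i j. (i, j) \<in> \<nu> ==> i ~= j ==> C i Un B i <= C j"
  shows "\<exists>i\<in>Field \<nu>. Ind (set d) (C i) (B i)"
proof (rule ccontr)
  assume n: "\<not> ?thesis"
  let ?n = "length d"
  let ?P = "%i \<Delta>. good ?n \<Delta> & (\<exists>c R. set c <= B i Un C i & R \<in> Def (?n + length c) & d @ c \<in> R & forkD (C i) ?n \<Delta> (Sol ?n R c))"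
  have "\<exists>\<Delta>. ?P i \<Delta>" if i: "i \<in> Field \<nu>" for i
  proof (rule ccontr)
    assume e: "\<not> (\<exists>\<Delta>. ?P i \<Delta>)"
    have "Ind (set d) (C i) (B i)" by (rule Ind_list[OF d]) (use e in \<open>unfold fk_def, blast\<close>)
    then show False using n i by blast
  qed
  then have "\<forall>i\<in>Field \<nu>. \<exists>\<Delta>. ?P i \<Delta>" by blast
  from bchoice[OF this] obtain F where F: "!!i. i \<in> Field \<nu> ==> ?P i (F i)" by (elim exE, intro that) (erule bspec)
  have "\<exists>\<Delta>. infinite {i \<in> Field \<nu>. F i = \<Delta>}"
  proof (rule pigeon)
    show "finite (F i)" if "i \<in> Field \<nu>" for i using F[OF that] unfolding good_def by simp
    show "\<exists>n. \<psi> \<in> Def n" if "i \<in> Field \<nu>" "(m, \<psi>, k) \<in> F i" for i m \<psi> k using F[OF that(1)] that(2) unfolding good_def by blast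
  qed
  then obtain \<Delta> where inf: "infinite {i \<in> Field \<nu>. F i = \<Delta>}" (is "infinite ?S") by blast
  have fin: "finite {i \<in> ?S. \<not> tge \<Delta> (C i) d N}" for N
  proof (induction N)
    case 0 then show ?case using tge_0[OF d] by simp
  next
    case (Suc N)
    let ?B = "{i \<in> ?S. \<not> tge \<Delta> (C i) d (Suc N)}"
    show ?case
    proof (cases "?B = {}")
      case True then show ?thesis by (simp only: finite.emptyI)
    next
      case False
      then obtain x where "x \<in> ?B" by blast
      \<comment> \<open>Take the least bad index \<open>i0\<close> for \<open>Suc N\<close>. Any
        other bad index is already bad for \<open>N\<close>, as otherwise \<open>tge_drop\<close>
        would lift the rank at \<open>i0\<close>.\<close>
      then have "\<exists>i0\<in>?B. \<forall>y. (y, i0) \<in> \<nu> - Id --> y \<notin> ?B" using nu_wf[unfolded wf_eq_minimal, rule_format, of x ?B] by (simp only: Bex_def)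
      then obtain i0 where i0: "i0 \<in> ?B" "\<forall>y. (y, i0) \<in> \<nu> - Id --> y \<notin> ?B" by (elim bexE)
      have i0': "i0 \<in> Field \<nu>" "F i0 = \<Delta>" "\<not> tge \<Delta> (C i0) d (Suc N)" using i0(1) by auto
      have "j \<in> insert i0 {i \<in> ?S. \<not> tge \<Delta> (C i) d N}" if j: "j \<in> ?B" for j
      proof (cases "j = i0")
        case False
        have j': "j \<in> Field \<nu>" using j by blast
        have "(j, i0) \<notin> \<nu> - Id"
        proof
          assume "(j, i0) \<in> \<nu> - Id"
          from i0(2)[rule_format, OF this] j show False by (rule notE)
        qed
        then have "(j, i0) \<notin> \<nu>" using False by simp
        then have "(i0, j) \<in> \<nu>" using nu_total[OF i0'(1) j' False[symmetric]] by simp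
        then have sub: "C i0 Un B i0 <= C j" by (rule ch[OF _ False[symmetric]])
        obtain c R where c: "set c <= B i0 Un C i0" "R \<in> Def (?n + length c)" "d @ c \<in> R" "forkD (C i0) ?n \<Delta> (Sol ?n R c)"
          and g: "good ?n \<Delta>" using F[OF i0'(1)] unfolding i0'(2) by (elim exE conjE)
        have "\<not> tge \<Delta> (C j) d N"
        proof
          assume t: "tge \<Delta> (C j) d N"
          have "tge \<Delta> (C i0) d (Suc N)"
            by (rule tge_drop[OF sm[OF i0'(1)] _ _ c(2,3,4) g t]) (use sub c(1) in blast)+
          then show False using i0'(3) by blast
        qed
        then show ?thesis using j by blast
      qed simp
      then have "?B <= insert i0 {i \<in> ?S. \<not> tge \<Delta> (C i) d N}" by (rule subsetI)
      then show ?thesis using Suc by (meson finite_insert finite_subset)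
    qed
  qed
  have "?S ~= {}" using inf by (rule contrapos_nn) (simp only: finite.emptyI)
  then obtain i1 where i1: "i1 \<in> Field \<nu>" "F i1 = \<Delta>" by auto
  have g: "good ?n \<Delta>" using F[OF i1(1)] i1(2) by simp
  have bnd: "\<exists>N. \<forall>i. \<not> tge \<Delta> (C i) d N"
  proof -
    obtain N where N: "\<not> Dge \<Delta> ?n N (tup M ?n)" using Dge_bounded[OF g] by blast
    have "Sol ?n (tup M ?n) [] = tup M ?n" by (auto simp: Sol_def)
    then have "\<not> tge \<Delta> (C i) d N" for i unfolding tge_def using N d Def_full[of ?n]
      by (metis add_0_right append_Nil2 empty_set empty_subsetI list.size(3) tup_iff)
    then show ?thesis by blast
  qed
  then obtain N where "!!i. \<not> tge \<Delta> (C i) d N" by blast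
  then have "{i \<in> ?S. \<not> tge \<Delta> (C i) d N} = ?S" by simp
  then show False using fin[of N] inf by simp
qed

end

section \<open>The calculus of independence\<close>

context homstruct
begin

lemma eqt_append: "eqt C a b ==> set c <= C ==> set c <= M ==> eqt C (a @ c) (b @ c)"
  by (rule eqtI) (auto simp: eqt_def add.assoc)

lemma eqt_prepend:
  assumes "eqt C a b" "set c <= C" "set c <= M" "sm C" shows "eqt C (c @ a) (c @ b)"
proof -
  obtain \<sigma> where \<sigma>: "fixes_on C \<sigma>" "map \<sigma> a = b" by (rule eqt_aut[OF assms(1,4)])
  have "eqt C (c @ a) (map \<sigma> (c @ a))" by (rule fixes_eqt[OF \<sigma>(1)]) (use assms(3) eqt_M[OF assms(1)] in auto)
  then show ?thesis using \<sigma>(2) fixes_map[OF \<sigma>(1) assms(2)] by simp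
qed

lemma eqt_absorb:
  assumes "eqt C (u @ d) (u @ d')" "sm C" shows "eqt (C Un set u) d d'"
proof -
  obtain \<sigma> where \<sigma>: "fixes_on C \<sigma>" "map \<sigma> (u @ d) = u @ d'" by (rule eqt_aut[OF assms])
  have "map \<sigma> u = u" "map \<sigma> d = d'" using \<sigma>(2) by auto
  then have "fixes_on (C Un set u) \<sigma>" using \<sigma>(1) unfolding fixes_on_def by (auto simp: map_eq_conv[of \<sigma> u id, simplified])
  from fixes_eqt[OF this, of d] show ?thesis using \<open>map \<sigma> d = d'\<close> eqt_M[OF assms(1)] by simp
qed

text \<open>For each finite tuple from \<open>A\<close> some automorphism over \<open>B\<close>
  moves it as \<open>f\<close> does, so the union of \<open>f\<close> and the identity on
  \<open>B\<close> is elementary and homogeneity applies.\<close>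

lemma aut_of_elem:
  assumes "sm A" "sm B" "f ` A <= M" "!!u. set u <= A ==> eqt B u (map f u)"
  shows "\<exists>\<sigma>. fixes_on B \<sigma> & (\<forall>x\<in>A. \<sigma> x = f x)"
proof -
  define h where "h x = (if x \<in> B then x else f x)" for x
  have hA: "h x = f x" if x: "x \<in> A" for x
  proof (cases "x \<in> B")
    case True
    have "eqt B [x] (map f [x])" by (rule assms(4)) (use x in simp)
    from eqt_nth_const[OF this _ True, of 0] show ?thesis using True by (simp add: h_def)
  qed (simp add: h_def)
  have sAB: "sm (A Un B)" by (rule sm_Un[OF assms(1,2)])
  have hM: "h ` (A Un B) <= M" using hA assms(3) sm_sub[OF assms(2)] by (auto simp: h_def)
  obtain \<sigma> where \<sigma>: "aut \<sigma>" "!!x. x \<in> A Un B ==> \<sigma> x = h x"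
  proof (rule aut_of_map[OF sAB hM])
    fix n R u assume R: "R \<in> Def n" "u \<in> R" "set u <= A Un B"
    let ?u = "filter (%x. x \<in> A) u"
    have "eqt B ?u (map f ?u)" by (rule assms(4)) auto
    then obtain \<tau> where \<tau>: "fixes_on B \<tau>" "map \<tau> ?u = map f ?u" by (rule eqt_aut[OF _ assms(2)])
    have "h x = \<tau> x" if x: "x \<in> set u" for x
    proof (cases "x \<in> B")
      case True then show ?thesis using \<tau>(1) by (simp add: h_def fixes_on_def)
    next
      case False
      then have "x \<in> set ?u" using x R(3) by auto
      then have "\<tau> x = f x" using \<tau>(2) by (metis map_eq_conv)
      then show ?thesis using False by (simp add: h_def)
    qed
    then have e: "map h u = map \<tau> u" by simp
    have "u \<in> tup M n" using Def_sub R(1,2) by blast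
    then show "map h u \<in> R" unfolding e using aut_Def[OF fixes_aut[OF \<tau>(1)] R(1)] R(2) by simp
  qed blast
  have "fixes_on B \<sigma>" unfolding fixes_on_def using \<sigma> by (simp add: h_def)
  then show ?thesis using \<sigma>(2) hA by (intro exI[of _ \<sigma>]) simp
qed

lemma aut_conj:
  assumes "aut \<sigma>" "C <= M" "eqt C a b" shows "eqt (\<sigma> ` C) (map \<sigma> a) (map \<sigma> b)"
proof -
  obtain \<tau> where \<tau>: "aut \<tau>" "!!x. x \<in> M ==> \<tau> (\<sigma> x) = x" "!!x. x \<in> M ==> \<sigma> (\<tau> x) = x" using aut_inverse[OF assms(1)] by blast
  note ab = eqt_length[OF assms(3)] eqt_M[OF assms(3)]
  show ?thesis
  proof (rule eqtI)
    show "length (map \<sigma> a) = length (map \<sigma> b)" "set (map \<sigma> a) <= M" "set (map \<sigma> b) <= M"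
      using ab aut_set[OF assms(1)] by auto
    fix R c assume c: "set c <= \<sigma> ` C" "R \<in> Def (length (map \<sigma> a) + length c)" "map \<sigma> a @ c \<in> R"
    have cM: "set c <= M" using c(1) aut_set[OF assms(1,2)] by blast
    have tc: "set (map \<tau> c) <= C" using c(1) \<tau>(2) assms(2) by fastforce
    have ta: "map \<tau> (map \<sigma> x) = x" if "set x <= M" for x using that \<tau>(2) by (auto intro!: map_idI)
    have tc2: "map \<sigma> (map \<tau> c) = c" using cM \<tau>(3) by (auto intro!: map_idI)
    have "a @ map \<tau> c \<in> tup M (length a + length c)" using ab tc assms(2) by (auto simp: tup_iff)
    from aut_Def[OF assms(1) _ this, of R] have "a @ map \<tau> c \<in> R" using c(2,3) tc2 by simp
    then have b: "b @ map \<tau> c \<in> R" using eqtD[OF assms(3), of "map \<tau> c" R] c(2) tc by simp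
    have "b @ map \<tau> c \<in> tup M (length a + length c)" using ab tc assms(2) by (auto simp: tup_iff)
    from aut_Def[OF assms(1) _ this, of R] show "map \<sigma> b @ c \<in> R" using c(2) b tc2 by simp
  qed
qed

end

section \<open>Invariance of forking, extension, transitivity and symmetry of independence\<close>

context simplestruct
begin

lemma kd_aut:
  assumes "aut \<sigma>" "C <= M" "kd n C \<psi> d k" shows "kd n (\<sigma> ` C) \<psi> (map \<sigma> d) k"
proof -
  have d: "\<psi> \<in> Def (n + length d)" "set d <= M" using kd_Def[OF assms(3)] by auto
  obtain s where s0: "\<forall>i::nat. eqt C d (s i)" "k_inconsistent k (%i. Sol n \<psi> (s i))" using assms(3) unfolding kd_def by (elim exE conjE)
  have st: "s i \<in> tup M (length d)" for i using s0(1) eqt_length eqt_M by (metis tup_iff)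
  show ?thesis unfolding kd_def
  proof (intro conjI exI[of _ "%i. map \<sigma> (s i)"] allI)
    show "\<psi> \<in> Def (n + length (map \<sigma> d))" using d by simp
    show "set (map \<sigma> d) <= M" using aut_set[OF assms(1) d(2)] by simp
    show "eqt (\<sigma> ` C) (map \<sigma> d) (map \<sigma> (s i))" for i by (rule aut_conj[OF assms(1,2)]) (use s0(1) in simp)
    show "k_inconsistent k (%i. Sol n \<psi> (map \<sigma> (s i)))" by (rule kinc_aut[OF assms(1) st d(1) s0(2)])
  qed
qed

lemma forkD_aut:
  assumes "aut \<sigma>" "C <= M" "forkD C n \<Delta> X" "X <= tup M n" shows "forkD (\<sigma> ` C) n \<Delta> (map \<sigma> ` X)"
proof -
  obtain D where D: "finite D" "\<forall>p\<in>D. \<exists>k. (length (snd p), fst p, k) \<in> \<Delta> & kd n C (fst p) (snd p) k"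
    "X <= (\<Union>p\<in>D. Sol n (fst p) (snd p))" using assms(3) unfolding forkD_def by (elim exE conjE)
  let ?g = "%p. (fst p, map \<sigma> (snd p))"
  show ?thesis unfolding forkD_def
  proof (intro exI[of _ "?g ` D"] conjI ballI)
    show "finite (?g ` D)" using D(1) by simp
    fix q assume "q \<in> ?g ` D"
    then obtain p where p: "p \<in> D" "q = ?g p" by blast
    obtain k where "(length (snd p), fst p, k) \<in> \<Delta>" "kd n C (fst p) (snd p) k" using D(2) p(1) by blast
    then show "\<exists>k. (length (snd q), fst q, k) \<in> \<Delta> & kd n (\<sigma> ` C) (fst q) (snd q) k"
      using kd_aut[OF assms(1,2)] p(2) by (intro exI[of _ k]) simp
  next
    show "map \<sigma> ` X <= (\<Union>q\<in>?g ` D. Sol n (fst q) (snd q))"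
    proof
      fix y assume "y \<in> map \<sigma> ` X"
      then obtain x where x: "x \<in> X" "y = map \<sigma> x" by blast
      then obtain p where p: "p \<in> D" "x \<in> Sol n (fst p) (snd p)" using D(3) by blast
      then obtain k where "kd n C (fst p) (snd p) k" using D(2) by blast
      note kk = kd_Def[OF this]
      have "y \<in> Sol n (fst p) (map \<sigma> (snd p))"
        using Sol_aut[OF assms(1) conjunct2[OF kk] conjunct1[OF kk], of x] x p(2) assms(4) by blast
      then show "y \<in> (\<Union>q\<in>?g ` D. Sol n (fst q) (snd q))" using p(1) by force
    qed
  qed
qed

lemma fk_aut: "aut \<sigma> ==> C <= M ==> fk C n X ==> X <= tup M n ==> fk (\<sigma> ` C) n (map \<sigma> ` X)"
  unfolding fk_def using forkD_aut by blast

lemma Sol_image: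
  assumes "aut \<sigma>" "set c <= M" "R \<in> Def (n + length c)"
  shows "map \<sigma> ` Sol n R c = Sol n R (map \<sigma> c)"
proof
  show "map \<sigma> ` Sol n R c <= Sol n R (map \<sigma> c)"
    using Sol_aut[OF assms] Sol_tup by blast
  obtain \<tau> where \<tau>: "aut \<tau>" "!!x. x \<in> M ==> \<tau> (\<sigma> x) = x" "!!x. x \<in> M ==> \<sigma> (\<tau> x) = x" using aut_inverse[OF assms(1)] by blast
  show "Sol n R (map \<sigma> c) <= map \<sigma> ` Sol n R c"
  proof
    fix y assume y: "y \<in> Sol n R (map \<sigma> c)"
    then have yt: "y \<in> tup M n" using Sol_tup by blast
    then have e: "map \<sigma> (map \<tau> y) = y" using \<tau>(3) by (auto simp: tup_iff intro!: map_idI)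
    have "map \<tau> y \<in> Sol n R c" using Sol_aut[OF assms aut_tup[OF \<tau>(1) yt]] y e by simp
    then show "y \<in> map \<sigma> ` Sol n R c" using e by (metis imageI)
  qed
qed

lemma Ind_aut:
  assumes "aut \<sigma>" "A <= M" "B <= M" "C <= M" "Ind A C B" shows "Ind (\<sigma> ` A) (\<sigma> ` C) (\<sigma> ` B)"
  unfolding Ind_def
proof (intro allI impI notI)
  fix a c R assume a: "set a <= \<sigma> ` A" "set c <= \<sigma> ` B Un \<sigma> ` C" "R \<in> Def (length a + length c)" "a @ c \<in> R"
    "fk (\<sigma> ` C) (length a) (Sol (length a) R c)"
  obtain \<tau> where \<tau>: "aut \<tau>" "!!x. x \<in> M ==> \<tau> (\<sigma> x) = x" "!!x. x \<in> M ==> \<sigma> (\<tau> x) = x" using aut_inverse[OF assms(1)] by blast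
  have im: "\<tau> ` \<sigma> ` S = S" if "S <= M" for S using that \<tau>(2) by (force simp: image_image)
  have ac: "a @ c \<in> tup M (length a + length c)" using Def_sub a(3,4) by blast
  have 1: "set (map \<tau> a) <= A" using image_mono[OF a(1), of \<tau>] im[OF assms(2)] by simp
  have 2: "set (map \<tau> c) <= B Un C" using image_mono[OF a(2), of \<tau>] im[OF assms(3)] im[OF assms(4)] by (simp add: image_Un)
  have 3: "map \<tau> a @ map \<tau> c \<in> R" using aut_Def[OF \<tau>(1) a(3) ac] a(4) by simp
  have "\<sigma> ` C <= M" by (rule aut_set[OF assms(1,4)])
  from fk_aut[OF \<tau>(1) this a(5) Sol_tup] have "fk C (length a) (map \<tau> ` Sol (length a) R c)" using im[OF assms(4)] by simp
  moreover have "map \<tau> ` Sol (length a) R c = Sol (length a) R (map \<tau> c)"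
    by (rule Sol_image[OF \<tau>(1) _ a(3)]) (use ac in \<open>auto simp: tup_iff\<close>)
  ultimately show False using IndD[OF assms(5) 1 2, of R] a(3) 3 by simp
qed

lemma position:
  assumes "distinct w" "set w <= M"
  obtains pos where "!!y. y \<in> set w ==> pos y < length w"
    "!!x. x \<in> tup M (length w) ==> \<exists>f. range f <= M & map f w = x & (\<forall>y\<in>set w. f y = x ! pos y)"
proof -
  have "\<forall>y\<in>set w. \<exists>p. p < length w & w ! p = y" by (metis in_set_conv_nth)
  from bchoice[OF this] obtain pos where p: "\<forall>y\<in>set w. pos y < length w & w ! pos y = y" ..
  show ?thesis
  proof (rule that[of pos])
    show "pos y < length w" if "y \<in> set w" for y using p that by simp
    fix x assume x: "x \<in> tup M (length w)"
    let ?f = "%y. if y \<in> set w then x ! pos y else x0"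
    have "range ?f <= M" using p x x0 tup_nth[OF x] by auto
    moreover have "map ?f w = x"
    proof (rule nth_equalityI)
      show "length (map ?f w) = length x" using x by (simp add: tup_iff)
      fix i assume "i < length (map ?f w)"
      then have i: "i < length w" by simp
      then have "pos (w ! i) = i" using p assms(1) by (metis nth_eq_iff_index_eq nth_mem)
      then show "map ?f w ! i = x ! i" using i by simp
    qed
    ultimately show "\<exists>f. range f <= M & map f w = x & (\<forall>y\<in>set w. f y = x ! pos y)"
      by (intro exI[of _ ?f]) simp
  qed
qed

text \<open>Compactness for the type of \<open>A\<close> over \<open>C Un B\<close> together with
  the negations of all formulas over \<open>D Un C\<close> that fork over \<open>C\<close>. If this
  were inconsistent, a formula of the type would be covered by finitely many forking ones, and
  \<open>Ind A C B\<close> would fail.\<close>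

lemma ext_left:
  assumes I: "Ind A C B" and sA: "sm A" and sB: "sm B" and sC: "sm C" and sD: "sm D"
  shows "\<exists>\<sigma>. fixes_on (C Un B) \<sigma> & Ind (\<sigma> ` A) C D"
proof -
  \<comment> \<open>The flag \<open>b\<close> separates formulas that must hold from forking
    formulas that must fail.\<close>
  define T where "T = {(b, u, c, R). set u <= A & R \<in> Def (length u + length c) &
    (if b then set c <= C Un B & u @ c \<in> R else set c <= D Un C & fk C (length u) (Sol (length u) R c))}"
  define Q where "Q t f = (case t of (b, u, c, R) => (map f u @ c \<in> R) = b)" for t :: "bool \<times> 'c list \<times> 'c list \<times> 'c list set" and f :: "'c => 'c"
  have sBCD: "sm (C Un B Un D)" using sB sC sD sm_Un by blast
  have DFQ: "DF V S (Q (b, u, c, R))" if "set u <= V" "set c <= S" "S <= M" "R \<in> Def (length u + length c)" for V S b u c R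
  proof -
    have d: "DF V S (%f. map f u @ c \<in> R)" by (rule DF_mem[OF that(4)]) (use that in auto)
    show ?thesis using d DF_not[OF d] unfolding Q_def by (cases b) simp_all
  qed
  have "\<exists>f. range f <= M & (\<forall>t\<in>T. Q t f)"
  proof (rule compactness_indexed[of A "C Un B Un D"])
    show "|A| \<le>o \<nu>" using sA by (simp add: sm_def)
    show "sm (C Un B Un D)" by (rule sBCD)
    show "DF A (C Un B Un D) (Q t)" if t: "t \<in> T" for t
    proof -
      obtain b u c R where tt: "t = (b, u, c, R)" by (cases t)
      show ?thesis unfolding tt
        by (rule DFQ) (use t sm_sub[OF sBCD] in \<open>auto simp: T_def tt split: if_splits\<close>)
    qed
    fix T0 assume T0: "T0 <= T" "finite T0"
    have "finite (\<Union>t\<in>T0. set (fst (snd t)))" using T0(2) by blast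
    from finite_distinct_list[OF this] obtain w where w: "set w = (\<Union>t\<in>T0. set (fst (snd t)))" "distinct w" by blast
    have uA: "set (fst (snd t)) <= A" if "t \<in> T0" for t using T0(1) that unfolding T_def by fastforce
    have wA: "set w <= A" using uA w(1) by blast
    then have wM: "set w <= M" using sm_sub[OF sA] by blast
    obtain pos where pos: "!!y. y \<in> set w ==> pos y < length w"
      "!!x. x \<in> tup M (length w) ==> \<exists>f. range f <= M & map f w = x & (\<forall>y\<in>set w. f y = x ! pos y)"
      using position[OF w(2) wM] by metis
    define P where "P f = (\<forall>t\<in>{t \<in> T0. fst t}. Q t f)" for f :: "'c => 'c"
    have dP: "DF (set w) (C Un B) P" unfolding P_def
    proof (rule DF_Ball)
      fix t assume t: "t \<in> {t \<in> T0. fst t}"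
      obtain b u c R where tt: "t = (b, u, c, R)" by (cases t)
      have m: "(b, u, c, R) \<in> T" "b" using t T0(1) unfolding tt by auto
      show "DF (set w) (C Un B) (Q t)" unfolding tt
      proof (rule DFQ)
        show "set u <= set w" using w(1) t tt by force
        show "set c <= C Un B" "R \<in> Def (length u + length c)" using m by (auto simp: T_def)
        show "C Un B <= M" using sB sC sm_sub by blast
      qed
    qed (use T0 in simp)
    from DF_list[OF dP order_refl] obtain S cs where S: "set cs <= (C Un B) Int M" "S \<in> Def (length w + length cs)"
      "\<forall>f. range f <= M --> P f = (map f w @ cs \<in> S)" by (elim exE conjE)
    show "\<exists>f. range f <= M & (\<forall>t\<in>T0. Q t f)"
    proof (rule ccontr)
      assume no: "\<not> ?thesis"
      let ?f0 = "%x. if x \<in> M then x else x0"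
      have f0: "range ?f0 <= M" using x0 by auto
      have id: "map ?f0 u = u" if "set u <= M" for u using that by (auto intro!: map_idI)
      have "Q t ?f0" if t: "t \<in> T0" "fst t" for t
      proof -
        obtain b u c R where tt: "t = (b, u, c, R)" by (cases t)
        have "set u <= M" using uA[OF t(1)] tt sm_sub[OF sA] by auto
        then show ?thesis using t T0(1) id[of u] unfolding tt Q_def T_def by auto
      qed
      then have "P ?f0" unfolding P_def by simp
      then have wS: "w @ cs \<in> S" using S(3)[rule_format, OF f0] id[OF wM] by simp
      let ?N = "{t \<in> T0. \<not> fst t}"
      let ?X = "%t. pre (%i. pos (fst (snd t) ! i)) (length (fst (snd t))) (length w) (Sol (length (fst (snd t))) (snd (snd (snd t))) (fst (snd (snd t))))"
      have "fk C (length w) (\<Union>t\<in>?N. ?X t)"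
      proof (rule fk_UN)
        show "finite ?N" using T0(2) by simp
        fix t assume t: "t \<in> ?N"
        obtain b u c R where tt: "t = (b, u, c, R)" by (cases t)
        show "fk C (length w) (?X t)"
        proof (rule fk_pre)
          show "fk C (length (fst (snd t))) (Sol (length (fst (snd t))) (snd (snd (snd t))) (fst (snd (snd t))))"
            using t T0(1) unfolding tt T_def by auto
          show "pos (fst (snd t) ! i) < length w" if "i < length (fst (snd t))" for i
            by (rule pos(1)) (use that w(1) t in \<open>auto intro!: bexI[of _ t]\<close>)
        qed
      qed
      moreover have "Sol (length w) S cs <= (\<Union>t\<in>?N. ?X t)"
      proof
        fix x assume x: "x \<in> Sol (length w) S cs"
        then have xt: "x \<in> tup M (length w)" using Sol_tup by blast
        from pos(2)[OF xt] obtain f where f: "range f <= M" "map f w = x" "\<forall>y\<in>set w. f y = x ! pos y" by (elim exE conjE)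
        have "P f" using S(3)[rule_format, OF f(1)] f(2) x by (simp add: Sol_def)
        have "\<exists>t\<in>T0. \<not> Q t f"
        proof (rule ccontr)
          assume "\<not> ?thesis"
          then have "\<forall>t\<in>T0. Q t f" by simp
          with f(1) have "\<exists>f. range f <= M & (\<forall>t\<in>T0. Q t f)" by (intro exI[of _ f] conjI)
          with no show False by (rule notE)
        qed
        then obtain t where t0: "t \<in> T0" "\<not> Q t f" by (elim bexE)
        then have "\<not> fst t" using \<open>P f\<close> unfolding P_def by (metis (mono_tags, lifting) mem_Collect_eq)
        note t = t0(1) this t0(2)
        obtain b u c R where tt: "t = (b, u, c, R)" by (cases t)
        have "map f u @ c \<in> R" using t(2,3) unfolding tt Q_def by simp
        moreover have "map f u = map (%i. x ! pos (u ! i)) [0..<length u]"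
        proof (rule nth_equalityI)
          fix i assume "i < length (map f u)"
          then have "u ! i \<in> set w" using w(1) t(1) tt by (metis (no_types, lifting) UN_I fst_conv length_map nth_mem snd_conv)
          then show "map f u ! i = map (%i. x ! pos (u ! i)) [0..<length u] ! i" using f(3) \<open>i < length (map f u)\<close> by simp
        qed simp
        moreover have "map f u \<in> tup M (length u)" using f(1) by (auto simp: tup_iff)
        ultimately have "x \<in> ?X t" unfolding tt pre_def Sol_def using xt by simp
        then show "x \<in> (\<Union>t\<in>?N. ?X t)" using t by blast
      qed
      ultimately have "fk C (length w) (Sol (length w) S cs)" by (rule fk_mono)
      then show False using IndD[OF I wA _ S(2) wS] S(1) by blast
    qed
  qed
  then obtain f where f: "range f <= M" "\<forall>t\<in>T. Q t f" by (elim exE conjE)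
  have "\<exists>\<sigma>. fixes_on (C Un B) \<sigma> & (\<forall>x\<in>A. \<sigma> x = f x)"
  proof (rule aut_of_elem[OF sA])
    show "sm (C Un B)" using sB sC sm_Un by blast
    show "f ` A <= M" using f(1) by auto
    fix u assume u: "set u <= A"
    show "eqt (C Un B) u (map f u)"
    proof (rule eqtI)
      show "set u <= M" using u sm_sub[OF sA] by blast
      show "set (map f u) <= M" using f(1) by auto
      fix R c assume "set c <= C Un B" "R \<in> Def (length u + length c)" "u @ c \<in> R"
      then have "(True, u, c, R) \<in> T" using u unfolding T_def by simp
      from f(2)[rule_format, OF this] show "map f u @ c \<in> R" by (simp add: Q_def)
    qed simp
  qed
  then obtain \<sigma> where \<sigma>: "fixes_on (C Un B) \<sigma>" "\<forall>x\<in>A. \<sigma> x = f x" by (elim exE conjE)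
  have "Ind (\<sigma> ` A) C D" unfolding Ind_def
  proof (intro allI impI notI)
    fix a c R assume a: "set a <= \<sigma> ` A" "set c <= D Un C" "R \<in> Def (length a + length c)" "a @ c \<in> R"
      "fk C (length a) (Sol (length a) R c)"
    have "\<forall>y\<in>set a. \<exists>x. x \<in> A & y = f x" using a(1) \<sigma>(2) by auto
    from bchoice[OF this] obtain g where g: "\<forall>y\<in>set a. g y \<in> A & y = f (g y)" ..
    have e: "map f (map g a) = a" using g by (auto intro!: map_idI)
    have "(False, map g a, c, R) \<in> T" unfolding T_def using a g by auto
    from f(2)[rule_format, OF this] show False using a(4) e by (simp add: Q_def)
  qed
  then show ?thesis using \<sigma>(1) by blast
qed

text \<open>Undoing the automorphism of \<open>ext_left\<close> moves \<open>D\<close> instead of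
  \<open>A\<close>.\<close>

lemma ext_right:
  assumes I: "Ind A C B" and sA: "sm A" and sB: "sm B" and sC: "sm C" and sD: "sm D"
  shows "\<exists>\<sigma>. fixes_on (C Un B) \<sigma> & Ind A C (B Un \<sigma> ` D)"
proof -
  obtain \<sigma> where \<sigma>: "fixes_on (C Un B) \<sigma>" "Ind (\<sigma> ` A) C (B Un D)" using ext_left[OF I sA sB sC sm_Un[OF sB sD]] by blast
  have "C Un B <= M" using sB sC sm_sub by blast
  from fixes_inverse[OF \<sigma>(1) this] obtain \<tau> where \<tau>: "fixes_on (C Un B) \<tau>" "!!x. x \<in> M ==> \<tau> (\<sigma> x) = x" by metis
  have "\<tau> ` \<sigma> ` A = A" using \<tau>(2) sm_sub[OF sA] by (force simp: image_image)
  moreover have "\<tau> ` C = C" "\<tau> ` B = B" using fixes_image[OF \<tau>(1)] by auto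
  moreover have "Ind (\<tau> ` \<sigma> ` A) (\<tau> ` C) (\<tau> ` (B Un D))"
    by (rule Ind_aut[OF fixes_aut[OF \<tau>(1)] _ _ _ \<sigma>(2)]) (use aut_set[OF fixes_aut[OF \<sigma>(1)]] sm_sub sA sB sC sD in auto)
  ultimately have "Ind A C (B Un \<tau> ` D)" by (simp add: image_Un)
  then show ?thesis using \<tau>(1) by blast
qed

text \<open>Having the type of \<open>d\<close> over \<open>C\<close> and being k-inconsistent are
  expressed by definable conditions on the members, the latter by \<open>Def_common\<close>, so both
  pass from a dividing sequence to an extracted indiscernible one.\<close>

lemma kd_indisc:
  assumes "kd n C \<psi> d k" "sm C"
  shows "\<exists>J. indisc (UNIV :: nat set) (<) C (length d) J & (\<forall>i. eqt C d (J i)) & k_inconsistent k (%i. Sol n \<psi> (J i))"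
proof -
  let ?m = "length d"
  have \<psi>: "\<psi> \<in> Def (n + ?m + 0)" and dM: "set d <= M" using kd_Def[OF assms(1)] by auto
  obtain s where s: "\<forall>i::nat. eqt C d (s i)" "k_inconsistent k (%i. Sol n \<psi> (s i))" using assms(1) unfolding kd_def by (elim exE conjE)
  have st: "s i \<in> tup M ?m" for i using s(1) eqt_length eqt_M by (metis tup_iff)
  have "\<exists>J. indisc (UNIV :: nat set) (<) C ?m J &
    (\<forall>is R c. increasing UNIV (<) is --> set c <= C --> R \<in> Def (length is * ?m + length c) --> concat (map J is) @ c \<in> R -->
       (\<exists>js. sorted_wrt (<) js & length js = length is & concat (map s js) @ c \<in> R))"
    by (rule EM_sequence[OF st assms(2)]) (auto intro: countable_le_nu)
  then obtain J where J: "indisc (UNIV :: nat set) (<) C ?m J"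
    "\<forall>is R c. increasing UNIV (<) is --> set c <= C --> R \<in> Def (length is * ?m + length c) --> concat (map J is) @ c \<in> R -->
       (\<exists>js. sorted_wrt (<) js & length js = length is & concat (map s js) @ c \<in> R)" by (elim exE conjE)
  have Jt: "J i \<in> tup M ?m" for i using J(1) unfolding indisc_def by simp
  have "eqt C d (J i)" for i
  proof (rule eqtI)
    show "length d = length (J i)" "set (J i) <= M" using Jt[of i] by (auto simp: tup_iff)
    fix R c assume c: "set c <= C" "R \<in> Def (length d + length c)" "d @ c \<in> R"
    have cM: "set c <= M" using c(1) sm_sub[OF assms(2)] by blast
    show "J i @ c \<in> R"
    proof (rule ccontr)
      assume "J i @ c \<notin> R"
      then have "concat (map J [i]) @ c \<in> tup M (?m + length c) - R" using Jt[of i] cM by (auto simp: tup_iff)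
      moreover have "tup M (?m + length c) - R \<in> Def (length [i] * ?m + length c)" using Def_Diff[OF c(2)] by simp
      ultimately obtain js where js: "length js = length [i]" "concat (map s js) @ c \<in> tup M (?m + length c) - R"
        using J(2)[rule_format, of "[i]" c "tup M (?m + length c) - R"] c(1) unfolding increasing_def by auto
      then obtain j where "js = [j]" by (cases js) auto
      then have "s j @ c \<notin> R" using js by simp
      then show False using eqtD[OF s(1)[rule_format, of j] c(3,2,1)] by simp
    qed
  qed (rule dM)
  moreover have "k_inconsistent k (%i. Sol n \<psi> (J i))" unfolding k_inconsistent_def
  proof (intro allI impI)
    fix I :: "nat set" assume I: "finite I & card I = k"
    obtain R where R: "R \<in> Def (k * ?m + 0)" "!!ds c. length ds = k ==> set ds <= tup M ?m ==> c \<in> tup M 0 ==>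
       concat ds @ c \<in> R \<longleftrightarrow> (\<exists>x\<in>tup M n. \<forall>d\<in>set ds. x @ d @ c \<in> \<psi>)" using Def_common[OF \<psi>] by metis
    have nil: "[] \<in> tup M 0" by (simp add: tup_iff)
    have I0: "I ~= {}"
    proof
      assume "I = {}"
      then have "(\<Inter>i\<in>I. Sol n \<psi> (s i)) = {}" using s(2) I unfolding k_inconsistent_def by blast
      then show False using \<open>I = {}\<close> by simp
    qed
    show "(\<Inter>i\<in>I. Sol n \<psi> (J i)) = {}"
    proof (rule ccontr)
      assume "(\<Inter>i\<in>I. Sol n \<psi> (J i)) ~= {}"
      then obtain x where x: "!!i. i \<in> I ==> x \<in> Sol n \<psi> (J i)" by blast
      let ?is = "sorted_list_of_set I"
      have iss: "set ?is = I" "length ?is = k" using I by auto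
      have "concat (map J ?is) @ [] \<in> R"
      proof (subst R(2))
        show "length (map J ?is) = k" "set (map J ?is) <= tup M ?m" "[] \<in> tup M 0" using iss Jt nil by auto
        show "\<exists>x\<in>tup M n. \<forall>d\<in>set (map J ?is). x @ d @ [] \<in> \<psi>"
          using x iss I0 Sol_tup by (intro bexI[of _ x]) (auto simp: Sol_def)
      qed
      then obtain js where js: "sorted_wrt (<) js" "length js = k" "concat (map s js) @ [] \<in> R"
        using J(2)[rule_format, of ?is "[]" R] R(1) iss by (auto simp: increasing_def)
      then have "\<exists>x\<in>tup M n. \<forall>d\<in>set (map s js). x @ d @ [] \<in> \<psi>"
        using R(2)[of "map s js" "[]"] st nil by auto
      then obtain y where y: "y \<in> tup M n" "!!j. j \<in> set js ==> y @ s j \<in> \<psi>" by auto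
      have "card (set js) = k" using js(1,2) by (metis distinct_card strict_sorted_iff)
      then have "(\<Inter>j\<in>set js. Sol n \<psi> (s j)) = {}" using s(2) unfolding k_inconsistent_def by blast
      moreover have "y \<in> (\<Inter>j\<in>set js. Sol n \<psi> (s j))" using y by (simp add: Sol_def)
      ultimately show False by blast
    qed
  qed
  ultimately show ?thesis using J(1) by (intro exI[of _ J] conjI allI)
qed

lemma sorted_enumeration:
  assumes "finite K" "K <= I" and lin: "!!i j. i \<in> I ==> j \<in> I ==> i ~= j ==> lt i j \<or> lt j i"
    and tr: "!!i j k. i \<in> I ==> j \<in> I ==> k \<in> I ==> lt i j ==> lt j k ==> lt i k"
  shows "\<exists>xs. sorted_wrt lt xs & set xs = K"
  using assms(1,2)
proof (induction K rule: finite_induct)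
  case empty show ?case by (rule exI[of _ "[]"]) simp
next
  case (insert x K)
  then obtain xs where xs: "sorted_wrt lt xs" "set xs = K" by auto
  let ?l = "filter (%y. lt y x) xs" and ?r = "filter (%y. \<not> lt y x) xs"
  have r: "lt x y" if "y \<in> set ?r" for y using that lin[of x y] xs(2) insert.hyps(2) insert.prems by auto
  have l: "lt y z" if "y \<in> set ?l" "z \<in> set ?r" for y z
    using tr[of y x z] that r xs(2) insert.prems by auto
  have 1: "sorted_wrt lt ?l" "sorted_wrt lt ?r" by (rule sorted_wrt_filter[OF xs(1)])+
  have 2: "\<forall>y\<in>set ?l. lt y x" by simp
  have "sorted_wrt lt (?l @ x # ?r)" unfolding sorted_wrt_append sorted_wrt.simps list.set(2) using 1 2 r l by blast
  moreover have "set (?l @ x # ?r) = insert x K" using xs(2) by auto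
  ultimately show ?case by blast
qed

text \<open>If the copies of the type of \<open>A\<close> over \<open>C\<close> and \<open>d\<close>
  along \<open>J\<close> were jointly inconsistent, then by indiscernibility one formula of this
  type would be inconsistent along any \<open>N\<close> members of \<open>J\<close>, hence would
  divide over \<open>C\<close>. The subsequence \<open>\<iota>\<close>, indexed by the natural
  numbers, serves to witness this dividing.\<close>

lemma common_realization:
  fixes J :: "'i => 'c list" and \<iota> :: "nat => 'i"
  assumes AI: "Ind A C (set d)" and sA: "sm A" and sC: "sm C" and dM: "set d <= M" and J: "indisc I lt C (length d) J"
    and e: "!!i. i \<in> I ==> eqt C d (J i)" and \<iota>: "!!t. \<iota> t \<in> I" "!!s t. s < t ==> lt (\<iota> s) (\<iota> t)"
    and lin: "!!i j. i \<in> I ==> j \<in> I ==> i ~= j ==> lt i j \<or> lt j i"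
    and tr: "!!i j k. i \<in> I ==> j \<in> I ==> k \<in> I ==> lt i j ==> lt j k ==> lt i k"
    and I: "|I| \<le>o \<nu>"
  shows "\<exists>f. range f <= M & (\<forall>i\<in>I. \<forall>u. set u <= A --> eqt C (u @ d) (map f u @ J i))"
proof -
  let ?m = "length d"
  have Jt: "i \<in> I ==> J i \<in> tup M ?m" for i using J unfolding indisc_def by simp
  define T where "T = {(t, u, c, R) | t u c R. t \<in> I & set u <= A & set c <= C & R \<in> Def (length (u @ d) + length c) & (u @ d) @ c \<in> R}"
  define Q where "Q p f = (case p of (t, u, c, R) => map f u @ J t @ c \<in> R)" for p :: "'i \<times> 'c list \<times> 'c list \<times> 'c list set" and f :: "'c => 'c"
  have sJ: "sm (C Un (\<Union>t\<in>I. set (J t)))"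
    by (intro sm_Un[OF sC] sm_UN I) (use Jt in \<open>auto simp: tup_iff intro!: sm_set\<close>)
  have "\<exists>f. range f <= M & (\<forall>p\<in>T. Q p f)"
  proof (rule compactness_indexed[of A "C Un (\<Union>t\<in>I. set (J t))"])
    show "|A| \<le>o \<nu>" using sA by (simp add: sm_def)
    show "sm (C Un (\<Union>t\<in>I. set (J t)))" by (rule sJ)
    show "DF A (C Un (\<Union>t\<in>I. set (J t))) (Q p)" if p: "p \<in> T" for p
    proof -
      obtain t u c R where pp: "p = (t, u, c, R)" by (cases p)
      have a: "set u <= A" "set c <= C" "R \<in> Def (length (u @ d) + length c)" "t \<in> I" using p unfolding pp T_def by auto
      show ?thesis unfolding pp Q_def prod.case
        by (rule DF_mem[OF a(3)]) (use a Jt[OF a(4)] sm_sub[OF sJ] in \<open>auto simp: tup_iff\<close>)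
    qed
    fix T0 assume T0: "T0 <= T" "finite T0"
    have "finite (\<Union>p\<in>T0. set (fst (snd p)))" using T0(2) by blast
    from finite_distinct_list[OF this] obtain w where w: "set w = (\<Union>p\<in>T0. set (fst (snd p)))" "distinct w" by blast
    have uA: "set (fst (snd p)) <= A" if "p \<in> T0" for p using T0(1) that unfolding T_def by fastforce
    have wA: "set w <= A" using uA w(1) by blast
    then have wM: "set w <= M" using sm_sub[OF sA] by blast
    define K where "K = fst ` T0"
    have K: "finite K" "K <= I" using T0 unfolding K_def T_def by auto
    have "\<exists>ks. sorted_wrt lt ks & set ks = K" by (rule sorted_enumeration[OF K]) (erule (2) lin, erule (4) tr)
    then obtain ks where ks: "sorted_wrt lt ks" "set ks = K" by (elim exE conjE)
    define N where "N = length ks"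
    let ?g = "%p. map Inl (fst (snd p)) @ map Inr [0..<?m] :: ('c + nat) list"
    let ?P = "%g. \<forall>p\<in>T0. map g (?g p) @ fst (snd (snd p)) \<in> snd (snd (snd p))"
    have "DF (Inl ` set w Un Inr ` {..<?m}) C ?P"
    proof (rule DF_Ball[OF T0(2)])
      fix p assume p: "p \<in> T0"
      obtain t u c R where pp: "p = (t, u, c, R)" by (cases p)
      have a: "set u <= A" "set c <= C" "R \<in> Def (length (u @ d) + length c)" using p T0(1) unfolding pp T_def by auto
      have uw: "set u <= set w" using w(1) p pp by force
      show "DF (Inl ` set w Un Inr ` {..<?m}) C (%g. map g (?g p) @ fst (snd (snd p)) \<in> snd (snd (snd p)))"
        unfolding pp fst_conv snd_conv by (rule DF_mem[OF a(3)]) (use a uw sm_sub[OF sC] in auto)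
    qed
    from DF_list[OF this, of "map Inl w @ map Inr [0..<?m]"]
    have "\<exists>R cs. set cs <= C Int M & R \<in> Def (length (map Inl w @ map Inr [0..<?m] :: ('c + nat) list) + length cs) &
        (\<forall>g. range g <= M --> ?P g = (map g (map Inl w @ map Inr [0..<?m]) @ cs \<in> R))" by fastforce
    then obtain S cs where S: "set cs <= C Int M" "S \<in> Def (length (map Inl w @ map Inr [0..<?m] :: ('c + nat) list) + length cs)"
       "\<forall>g. range g <= M --> ?P g = (map g (map Inl w @ map Inr [0..<?m]) @ cs \<in> S)" by (elim exE conjE)
    have S2: "S \<in> Def (length w + ?m + length cs)" using S(2) by simp
    have key: "(\<forall>p\<in>T0. map f (fst (snd p)) @ e @ fst (snd (snd p)) \<in> snd (snd (snd p))) = (map f w @ e @ cs \<in> S)"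
      if f: "range f <= M" and e: "e \<in> tup M ?m" for f e
    proof -
      let ?h = "case_sum f (asg e)"
      have r: "range ?h <= M" using f asg_range[of e] e by (auto simp: tup_iff image_subset_iff split: sum.split)
      have ae: "map (asg e) [0..<?m] = e" using map_asg[of e] e by (simp add: tup_iff)
      show ?thesis using S(3)[rule_format, OF r] ae by (simp add: case_sum_o_inj)
    qed
    obtain R where R: "R \<in> Def (N * ?m + length cs)" "!!ds c. length ds = N ==> set ds <= tup M ?m ==> c \<in> tup M (length cs) ==>
       concat ds @ c \<in> R \<longleftrightarrow> (\<exists>x\<in>tup M (length w). \<forall>d\<in>set ds. x @ d @ c \<in> S)" using Def_common[OF S2] by metis
    have cst: "cs \<in> tup M (length cs)" using S(1) by (simp add: tup_iff)
    let ?f0 = "%x. if x \<in> M then x else x0"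
    have f0: "range ?f0 <= M" using x0 by auto
    have id: "map ?f0 u = u" if "set u <= M" for u using that by (auto intro!: map_idI)
    have dt: "d \<in> tup M ?m" using dM by (simp add: tup_iff)
    have wS: "w @ d @ cs \<in> S"
    proof -
      have "map ?f0 (fst (snd p)) @ d @ fst (snd (snd p)) \<in> snd (snd (snd p))" if p: "p \<in> T0" for p
      proof -
        obtain t u c R where pp: "p = (t, u, c, R)" by (cases p)
        have "set u <= M" using uA[OF p] pp sm_sub[OF sA] by auto
        then show ?thesis using id[of u] p T0(1) unfolding pp T_def by auto
      qed
      then show ?thesis using key[OF f0 dt] id[OF wM] by simp
    qed
    have ex: "\<exists>x\<in>tup M (length w). \<forall>t\<in>K. x @ J t @ cs \<in> S"
    proof (rule ccontr)
      assume no: "\<not> ?thesis"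
      have "kd (length w) C S (d @ cs) N" unfolding kd_def
      proof (intro conjI exI[of _ "%t. J (\<iota> t) @ cs"] allI)
        show "S \<in> Def (length w + length (d @ cs))" using S2 by (simp add: add.assoc)
        show "set (d @ cs) <= M" using dM S(1) by simp
        show "eqt C (d @ cs) (J (\<iota> i) @ cs)" for i by (rule eqt_append) (use e \<iota> S(1) in auto)
        show "k_inconsistent N (%i. Sol (length w) S (J (\<iota> i) @ cs))" unfolding k_inconsistent_def
        proof (intro allI impI)
          fix I' :: "nat set" assume I': "finite I' & card I' = N"
          let ?is = "map \<iota> (sorted_list_of_set I')"
          have iss: "set ?is = \<iota> ` I'" "length ?is = N" using I' by auto
          have "sorted_wrt (%x y. lt (\<iota> x) (\<iota> y)) (sorted_list_of_set I')"
            by (rule sorted_wrt_mono_rel[OF _ strict_sorted_list_of_set]) (rule \<iota>(2))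
          then have inc: "increasing I lt ?is" using \<iota>(1) by (auto simp: increasing_def sorted_wrt_map)
          have N0: "N ~= 0"
          proof
            assume "N = 0"
            then have "K = {}" using ks(2) by (simp add: N_def)
            moreover have "w \<in> tup M (length w)" using wM by (simp add: tup_iff)
            ultimately show False using no by auto
          qed
          then have I0: "I' ~= {}" using I' by auto
          have rep: "concat (map J xs) @ cs \<in> R \<longleftrightarrow> (\<exists>x\<in>tup M (length w). \<forall>i\<in>set xs. x @ J i @ cs \<in> S)" if "length xs = N" "set xs <= I" for xs
            using R(2)[of "map J xs" cs] that Jt cst by auto
          have lc: "length (concat (map J xs)) = length xs * ?m" if "set xs <= I" for xs using that Jt by (induction xs) (auto simp: tup_iff)
          have isI: "set ?is <= I" "set ks <= I" using \<iota>(1) iss ks(2) K(2) by auto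
          have "eqt C (concat (map J ?is)) (concat (map J ks))"
            using J inc iss(2) ks isI unfolding indisc_def increasing_def N_def by metis
          from eqt_iff[OF this, of R cs] have "concat (map J ?is) @ cs \<in> R \<longleftrightarrow> concat (map J ks) @ cs \<in> R"
            using R(1) S(1) iss(2) lc[OF isI(1)] by simp
          moreover have "concat (map J ks) @ cs \<notin> R" using rep[of ks] no isI(2) ks(2) unfolding N_def by auto
          ultimately have nx: "\<not> (\<exists>x\<in>tup M (length w). \<forall>i\<in>\<iota> ` I'. x @ J i @ cs \<in> S)" using rep[OF iss(2) isI(1)] unfolding iss(1) by (simp only: simp_thms)
          show "(\<Inter>i\<in>I'. Sol (length w) S (J (\<iota> i) @ cs)) = {}"
          proof (rule equals0I)
            fix x assume x: "x \<in> (\<Inter>i\<in>I'. Sol (length w) S (J (\<iota> i) @ cs))"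
            then have "x \<in> tup M (length w)" using I0 Sol_tup by blast
            then show False using nx x by (auto simp: Sol_def)
          qed
        qed
      qed
      then have "fk C (length w) (Sol (length w) S (d @ cs))" by (rule fkI) (rule order_refl)
      then show False using IndD[OF AI wA, of "d @ cs" S] S2 S(1) wS by (auto simp: add.assoc)
    qed
    then obtain x where x: "x \<in> tup M (length w)" "\<forall>t\<in>K. x @ J t @ cs \<in> S" by (elim bexE)
    obtain pos where "!!x. x \<in> tup M (length w) ==> \<exists>f. range f <= M & map f w = x & (\<forall>y\<in>set w. f y = x ! pos y)"
      using position[OF w(2) wM] by metis
    from this[OF x(1)] obtain f where f: "range f <= M" "map f w = x" by (elim exE conjE)
    have "Q p f" if p: "p \<in> T0" for p
    proof -
      have "map f w @ J (fst p) @ cs \<in> S" using x(2) f(2) p unfolding K_def by auto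
      then have "\<forall>q\<in>T0. map f (fst (snd q)) @ J (fst p) @ fst (snd (snd q)) \<in> snd (snd (snd q))" using key[OF f(1) Jt] p K(2) unfolding K_def by auto
      then show ?thesis using p unfolding Q_def by (simp add: case_prod_beta)
    qed
    then show "\<exists>f. range f <= M & (\<forall>p\<in>T0. Q p f)" using f(1) by (intro exI[of _ f]) simp
  qed
  then obtain f where f: "range f <= M" "\<forall>p\<in>T. Q p f" by (elim exE conjE)
  have e1: "eqt C (u @ d) (map f u @ J t)" if u: "set u <= A" and t: "t \<in> I" for u t
  proof (rule eqtI)
    show "length (u @ d) = length (map f u @ J t)" using Jt[OF t] by (simp add: tup_iff)
    show "set (u @ d) <= M" using u dM sm_sub[OF sA] by auto
    show "set (map f u @ J t) <= M" using f(1) Jt[OF t] by (auto simp: tup_iff)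
    fix R c assume "set c <= C" "R \<in> Def (length (u @ d) + length c)" "(u @ d) @ c \<in> R"
    then have "(t, u, c, R) \<in> T" using u t unfolding T_def by blast
    from f(2)[rule_format, OF this] show "(map f u @ J t) @ c \<in> R" by (simp add: Q_def)
  qed
  then show ?thesis using f(1) by (intro exI[of _ f]) simp
qed

text \<open>By \<open>common_realization\<close> a copy of \<open>A\<close> is related to all
  members of an indiscernible dividing sequence as \<open>A\<close> is to \<open>d\<close>. Moving
  this copy back to \<open>A\<close> turns the sequence into one of conjugates of \<open>d\<close>
  over \<open>C Un A\<close>.\<close>

lemma kd_Ind:
  assumes I: "Ind A C (set d)" and sA: "sm A" and sC: "sm C" and kd: "kd n C \<psi> d k"
  shows "kd n (C Un A) \<psi> d k"
proof -
  let ?m = "length d"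
  have \<psi>: "\<psi> \<in> Def (n + ?m)" and dM: "set d <= M" using kd_Def[OF kd] by auto
  obtain J where J: "indisc (UNIV :: nat set) (<) C ?m J" "\<forall>i. eqt C d (J i)" "k_inconsistent k (%i. Sol n \<psi> (J i))"
    using kd_indisc[OF kd sC] by (elim exE conjE)
  have Jt: "J i \<in> tup M ?m" for i using J(1) unfolding indisc_def by simp
  have "\<exists>f. range f <= M & (\<forall>i\<in>UNIV. \<forall>u. set u <= A --> eqt C (u @ d) (map f u @ J i))"
    by (rule common_realization[OF I sA sC dM J(1), of id]) (use J(2) countable_le_nu[of "UNIV :: nat set"] in auto)
  then obtain f where f: "range f <= M" "\<forall>i\<in>UNIV. \<forall>u. set u <= A --> eqt C (u @ d) (map f u @ J i)" by (elim exE conjE)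
  have e1: "eqt C (u @ d) (map f u @ J t)" if "set u <= A" for u t using f(2) that by simp
  have "\<exists>\<sigma>. fixes_on C \<sigma> & (\<forall>x\<in>A. \<sigma> x = f x)"
  proof (rule aut_of_elem[OF sA sC])
    show "f ` A <= M" using f(1) by auto
    fix u assume u: "set u <= A"
    obtain \<sigma> where \<sigma>: "fixes_on C \<sigma>" "map \<sigma> (u @ d) = map f u @ J 0" by (rule eqt_aut[OF e1[OF u, of 0] sC])
    have mu: "map \<sigma> u = map f u" using \<sigma>(2) by (simp add: append_eq_append_conv)
    have "set u <= M" using u sm_sub[OF sA] by blast
    from fixes_eqt[OF \<sigma>(1) this] show "eqt C u (map f u)" unfolding mu .
  qed
  then obtain \<sigma> where \<sigma>: "fixes_on C \<sigma>" "\<forall>x\<in>A. \<sigma> x = f x" by (elim exE conjE)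
  obtain \<tau> where \<tau>: "fixes_on C \<tau>" "!!x. x \<in> M ==> \<tau> (\<sigma> x) = x" using fixes_inverse[OF \<sigma>(1) sm_sub[OF sC]] by metis
  have CA: "sm (C Un A)" by (rule sm_Un[OF sC sA])
  have e2: "eqt (C Un A) d (map \<tau> (J t))" for t
  proof (rule eqtI)
    have tJ: "map \<tau> (J t) \<in> tup M ?m" by (rule aut_tup[OF fixes_aut[OF \<tau>(1)] Jt])
    then show "length d = length (map \<tau> (J t))" "set (map \<tau> (J t)) <= M" by (auto simp: tup_iff)
    show "set d <= M" by (rule dM)
    fix R c assume c: "set c <= C Un A" "R \<in> Def (length d + length c)" "d @ c \<in> R"
    let ?u = "filter (%x. x \<in> A) c"
    have uA: "set ?u <= A" by auto
    have "\<tau> (f x) = x" if "x \<in> A" for x using \<sigma>(2) \<tau>(2)[of x] sm_sub[OF sA] that by (metis subsetD)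
    then have "map \<tau> (map f ?u) = ?u" by (auto intro!: map_idI)
    moreover have "eqt C (map f ?u @ J t) (map \<tau> (map f ?u @ J t))"
      by (rule fixes_eqt[OF \<tau>(1)]) (use eqt_M[OF e1[OF uA]] in blast)
    ultimately have "eqt C (?u @ d) (?u @ map \<tau> (J t))" using eqt_trans[OF e1[OF uA, of t]] by simp
    then have "eqt (C Un set ?u) d (map \<tau> (J t))" by (rule eqt_absorb[OF _ sC])
    then show "map \<tau> (J t) @ c \<in> R" by (rule eqtD[OF _ c(3,2)]) (use c(1) in auto)
  qed
  show ?thesis unfolding kd_def
  proof (intro conjI exI[of _ "%t. map \<tau> (J t)"] allI \<psi> dM e2)
    show "k_inconsistent k (%t. Sol n \<psi> (map \<tau> (J t)))" by (rule kinc_aut[OF fixes_aut[OF \<tau>(1)] Jt \<psi> J(3)])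
  qed
qed

text \<open>The parameters of the covering dividing formulas need not be independent from
  \<open>A\<close>. By \<open>ext_right\<close> they can be moved over \<open>C Un B\<close> so that
  they become so; this leaves the covered formula unchanged, and \<open>kd_Ind\<close> applies to
  each of them.\<close>

lemma forkD_Ind:
  assumes I: "Ind A C B" and sm: "sm A" "sm B" "sm C" and c: "set c <= C Un B" "R \<in> Def (n + length c)"
    and fk: "forkD C n \<Delta> (Sol n R c)"
  shows "forkD (C Un A) n \<Delta> (Sol n R c)"
proof -
  obtain D where D: "finite D" "\<forall>p\<in>D. \<exists>k. (length (snd p), fst p, k) \<in> \<Delta> & kd n C (fst p) (snd p) k"
    "Sol n R c <= (\<Union>p\<in>D. Sol n (fst p) (snd p))" using fk unfolding forkD_def by (elim exE conjE)
  let ?E = "\<Union>p\<in>D. set (snd p)"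
  have dM: "set (snd p) <= M & fst p \<in> Def (n + length (snd p))" if "p \<in> D" for p using D(2) kd_Def that by blast
  have "sm ?E" by (rule sm_finite) (use D(1) dM in auto)
  from ext_right[OF I sm(1,2,3) this] obtain \<sigma> where \<sigma>: "fixes_on (C Un B) \<sigma>" "Ind A C (B Un \<sigma> ` ?E)" by (elim exE conjE)
  have cM: "set c <= M" using c(1) sm sm_sub by blast
  have Si: "map \<sigma> ` Sol n R c = Sol n R c" using Sol_image[OF fixes_aut[OF \<sigma>(1)] cM c(2)] fixes_map[OF \<sigma>(1) c(1)] by simp
  let ?g = "%p. (fst p, map \<sigma> (snd p))"
  show ?thesis unfolding forkD_def
  proof (intro exI[of _ "?g ` D"] conjI ballI)
    show "finite (?g ` D)" using D(1) by simp
    fix q assume "q \<in> ?g ` D"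
    then obtain p where p: "p \<in> D" "q = ?g p" by blast
    obtain k where k: "(length (snd p), fst p, k) \<in> \<Delta>" "kd n C (fst p) (snd p) k" using D(2) p(1) by blast
    have "kd n C (fst p) (map \<sigma> (snd p)) k"
      by (rule kd_eqt[OF k(2) fixes_eqt[OF fixes_mono[OF \<sigma>(1)]]]) (use dM[OF p(1)] in auto)
    moreover have "Ind A C (set (map \<sigma> (snd p)))" by (rule Ind_mono[OF \<sigma>(2)]) (use p(1) in auto)
    ultimately have "kd n (C Un A) (fst p) (map \<sigma> (snd p)) k" using kd_Ind sm by blast
    then show "\<exists>k. (length (snd q), fst q, k) \<in> \<Delta> & kd n (C Un A) (fst q) (snd q) k" using k(1) p(2) by (intro exI[of _ k]) simp
  next
    show "Sol n R c <= (\<Union>q\<in>?g ` D. Sol n (fst q) (snd q))"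
    proof
      fix y assume "y \<in> Sol n R c"
      then obtain x where x: "x \<in> Sol n R c" "y = map \<sigma> x" using Si by blast
      then obtain p where p: "p \<in> D" "x \<in> Sol n (fst p) (snd p)" using D(3) by blast
      have "y \<in> Sol n (fst p) (map \<sigma> (snd p))"
        using Sol_aut[OF fixes_aut[OF \<sigma>(1)] conjunct1[OF dM[OF p(1)]] conjunct2[OF dM[OF p(1)]], of x] x(2) p(2) Sol_tup by blast
      then show "y \<in> (\<Union>q\<in>?g ` D. Sol n (fst q) (snd q))" using p(1) by force
    qed
  qed
qed

text \<open>Members of a dividing sequence are conjugate over \<open>C\<close>, and remain so when
  prefixed with \<open>a\<close> from \<open>C\<close>; hence substituting \<open>a\<close> for the
  first coordinates preserves dividing.\<close>

lemma fk_fix: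
  assumes sC: "sm C" and a: "set a <= C" and R: "R \<in> Def (length a + n + length c)" and cM: "set c <= M"
    and f: "fk C (length a + n) (Sol (length a + n) R c)"
  obtains R' where "R' \<in> Def (n + (length a + length c))" "fk C n (Sol n R' (a @ c))"
    "!!x. x \<in> tup M n ==> x @ a @ c \<in> R' \<longleftrightarrow> a @ x @ c \<in> R"
proof -
  let ?l = "length a"
  have at: "a \<in> tup M ?l" using a sm_sub[OF sC] by (auto simp: tup_iff)
  have aM: "set a <= M" using at by (simp add: tup_iff)
  obtain R' where R': "R' \<in> Def (n + (?l + length c))"
    "!!b x e. b \<in> tup M ?l ==> x \<in> tup M n ==> e \<in> tup M (length c) ==> x @ b @ e \<in> R' \<longleftrightarrow> b @ x @ e \<in> R"
    using Def_swap[OF R] by metis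
  have ct: "c \<in> tup M (length c)" using cM by (simp add: tup_iff)
  obtain D where D: "finite D" "\<forall>p\<in>D. \<exists>k. kd (?l + n) C (fst p) (snd p) k" "Sol (?l + n) R c <= (\<Union>p\<in>D. Sol (?l + n) (fst p) (snd p))"
    using fk_cover[OF f] by (elim exE conjE)
  let ?Y = "%p. {x \<in> tup M n. a @ x \<in> Sol (?l + n) (fst p) (snd p)}"
  have "fk C n (\<Union>p\<in>D. ?Y p)"
  proof (rule fk_UN[OF D(1)])
    fix p assume p: "p \<in> D"
    obtain k where k: "kd (?l + n) C (fst p) (snd p) k" using D(2) p by blast
    let ?d = "snd p"
    have d: "fst p \<in> Def (?l + n + length ?d)" "set ?d <= M" using kd_Def[OF k] by auto
    obtain s where s: "\<forall>i::nat. eqt C ?d (s i)" "k_inconsistent k (%i. Sol (?l + n) (fst p) (s i))" using k unfolding kd_def by (elim exE conjE)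
    have st: "s i \<in> tup M (length ?d)" for i using s(1) eqt_length eqt_M by (metis tup_iff)
    obtain \<psi> where \<psi>: "\<psi> \<in> Def (n + (?l + length ?d))"
      "!!b x e. b \<in> tup M ?l ==> x \<in> tup M n ==> e \<in> tup M (length ?d) ==> x @ b @ e \<in> \<psi> \<longleftrightarrow> b @ x @ e \<in> fst p"
      using Def_swap[OF d(1)] by metis
    have Sol: "Sol n \<psi> (a @ e) = {x \<in> tup M n. a @ x \<in> Sol (?l + n) (fst p) e}" if "e \<in> tup M (length ?d)" for e
      using \<psi>(2)[OF at _ that] at unfolding Sol_def by (auto simp: tup_iff)
    have "kd n C \<psi> (a @ ?d) k" unfolding kd_def
    proof (intro conjI exI[of _ "%i. a @ s i"] allI)
      show "\<psi> \<in> Def (n + length (a @ ?d))" using \<psi>(1) by simp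
      show "set (a @ ?d) <= M" using aM d(2) by simp
      show "eqt C (a @ ?d) (a @ s i)" for i by (rule eqt_prepend[OF s(1)[rule_format] a aM sC])
      show "k_inconsistent k (%i. Sol n \<psi> (a @ s i))" unfolding k_inconsistent_def
      proof (intro allI impI)
        fix I :: "nat set" assume "finite I & card I = k"
        then have e: "(\<Inter>i\<in>I. Sol (?l + n) (fst p) (s i)) = {}" using s(2) unfolding k_inconsistent_def by simp
        show "(\<Inter>i\<in>I. Sol n \<psi> (a @ s i)) = {}"
        proof (rule equals0I)
          fix x assume "x \<in> (\<Inter>i\<in>I. Sol n \<psi> (a @ s i))"
          then have "a @ x \<in> (\<Inter>i\<in>I. Sol (?l + n) (fst p) (s i))" using Sol[OF st] by auto
          then show False using e by simp
        qed
      qed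
    qed
    then show "fk C n (?Y p)" by (rule fkI) (use Sol[of ?d] d(2) in \<open>auto simp: tup_iff\<close>)
  qed
  moreover have "Sol n R' (a @ c) <= (\<Union>p\<in>D. ?Y p)"
  proof
    fix x assume "x \<in> Sol n R' (a @ c)"
    then have x: "x \<in> tup M n" "a @ x @ c \<in> R" using R'(2)[OF at _ ct] by (auto simp: Sol_def)
    then have "a @ x \<in> Sol (?l + n) R c" using at by (auto simp: Sol_def tup_iff)
    then show "x \<in> (\<Union>p\<in>D. ?Y p)" using D(3) x(1) by blast
  qed
  ultimately have "fk C n (Sol n R' (a @ c))" by (rule fk_mono)
  then show ?thesis using that[OF R'(1)] R'(2)[OF at _ ct] by blast
qed

text \<open>A formula of the joint type that forks over \<open>C\<close> still forks over
  \<open>C Un A1\<close> by \<open>forkD_Ind\<close>. Substituting the entries from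
  \<open>A1\<close> by \<open>fk_fix\<close> leaves a forking formula of the type of the rest,
  against the second hypothesis.\<close>

lemma left_transitivity:
  assumes I1: "Ind A1 C B" and I2: "Ind A2 (C Un A1) B" and sm: "sm A1" "sm A2" "sm B" "sm C"
  shows "Ind (A1 Un A2) C B"
proof (rule Ind_lists)
  fix a assume a: "set a <= A1 Un A2"
  let ?a1 = "filter (%x. x \<in> A1) a" and ?a2 = "filter (%x. x \<notin> A1) a"
  let ?l = "length ?a1" and ?n = "length ?a2"
  have sa: "set a = set (?a1 @ ?a2)" by auto
  have aM: "set (?a1 @ ?a2) <= M" using a sm sm_sub by auto
  show "Ind (set a) C B" unfolding sa
  proof (rule Ind_list[OF aM])
    fix c R assume c: "set c <= B Un C" "R \<in> Def (length (?a1 @ ?a2) + length c)" "(?a1 @ ?a2) @ c \<in> R"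
    show "\<not> fk C (length (?a1 @ ?a2)) (Sol (length (?a1 @ ?a2)) R c)"
    proof
      assume "fk C (length (?a1 @ ?a2)) (Sol (length (?a1 @ ?a2)) R c)"
      then obtain \<Delta> where \<Delta>: "good (?l + ?n) \<Delta>" "forkD C (?l + ?n) \<Delta> (Sol (?l + ?n) R c)" unfolding fk_def length_append by blast
      have c': "set c <= C Un B" "R \<in> Def (?l + ?n + length c)" using c by auto
      have "forkD (C Un A1) (?l + ?n) \<Delta> (Sol (?l + ?n) R c)" by (rule forkD_Ind[OF I1 sm(1,3,4) c' \<Delta>(2)])
      then have "fk (C Un A1) (?l + ?n) (Sol (?l + ?n) R c)" using \<Delta>(1) unfolding fk_def by blast
      moreover have "set ?a1 <= C Un A1" by auto
      moreover have "set c <= M" using c(1) sm sm_sub by blast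
      ultimately obtain R' where R': "R' \<in> Def (?n + (?l + length c))" "fk (C Un A1) ?n (Sol ?n R' (?a1 @ c))"
        "!!x. x \<in> tup M ?n ==> x @ ?a1 @ c \<in> R' \<longleftrightarrow> ?a1 @ x @ c \<in> R"
        using fk_fix[OF sm_Un[OF sm(4,1)] _ c'(2)] by metis
      have "?a2 \<in> tup M ?n" using aM by (simp add: tup_iff)
      then have "?a2 @ ?a1 @ c \<in> R'" using R'(3) c(3) by simp
      moreover have "set ?a2 <= A2" using a by auto
      moreover have "set (?a1 @ c) <= B Un (C Un A1)" using c(1) by auto
      ultimately show False using IndD[OF I2, of ?a2 "?a1 @ c" R'] R'(1,2) by simp
    qed
  qed
qed

text \<open>Iteration of \<open>ext_left\<close>; the union of the copies made so far is carried
  along in the recursion. The result plays the role of a Morley sequence.\<close>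

lemma Ind_sequence:
  assumes "Ind A C B" "sm A" "sm B" "sm C"
  shows "\<exists>\<sigma>. \<forall>t::nat. fixes_on (C Un B) (\<sigma> t) & Ind (\<sigma> t ` A) C (B Un (\<Union>s<t. \<sigma> s ` A))"
proof -
  let ?P = "%t X. sm (fst X) & fixes_on (C Un B) (snd X) & Ind (snd X ` A) C (B Un fst X)"
  have st: "\<exists>\<sigma>. fixes_on (C Un B) \<sigma> & Ind (\<sigma> ` A) C (B Un X)" if "sm X" for X
    by (rule ext_left[OF assms sm_Un[OF assms(3) that]])
  have "\<exists>f. \<forall>t::nat. ?P t (f t) & fst (f (Suc t)) = fst (f t) Un snd (f t) ` A"
  proof (rule dependent_nat_choice)
    show "\<exists>X. sm (fst X) & fixes_on (C Un B) (snd X) & Ind (snd X ` A) C (B Un fst X)"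
      using st[OF sm_empty] sm_empty by (elim exE, intro exI[of _ "({}, _)"]) simp
    fix X and t :: nat assume X: "?P t X"
    have "sm (snd X ` A)" unfolding sm_def using X assms(2) aut_set[OF fixes_aut, of "C Un B" "snd X" A] sm_sub[OF assms(2)]
      card_of_image[of "snd X" A] unfolding sm_def by (meson ordLeq_transitive)
    then have sX: "sm (fst X Un snd X ` A)" using X sm_Un by blast
    then show "\<exists>Y. (sm (fst Y) & fixes_on (C Un B) (snd Y) & Ind (snd Y ` A) C (B Un fst Y)) & fst Y = fst X Un snd X ` A"
      using st[OF sX] by (elim exE, intro exI[of _ "(fst X Un snd X ` A, _)"]) simp
  qed
  then obtain f where f: "\<forall>t::nat. ?P t (f t) & fst (f (Suc t)) = fst (f t) Un snd (f t) ` A" by (elim exE)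
  have "(\<Union>s<t. snd (f s) ` A) <= fst (f t)" for t
  proof (induction t)
    case (Suc t) then show ?case using f by (simp add: lessThan_Suc) blast
  qed simp
  then have "Ind (snd (f t) ` A) C (B Un (\<Union>s<t. snd (f s) ` A))" for t
    using Ind_mono[of "snd (f t) ` A" C "B Un fst (f t)" "snd (f t) ` A" "B Un (\<Union>s<t. snd (f s) ` A)"] f by blast
  then show ?thesis using f by (intro exI[of _ "%t. snd (f t)"]) simp
qed

lemma sm_image: "aut \<sigma> ==> sm A ==> sm (\<sigma> ` A)"
  unfolding sm_def using aut_set card_of_image ordLeq_transitive by metis

lemma Ind_empty: "sm C ==> Ind {} C B"
  unfolding Ind_def
proof (intro allI impI notI)
  fix a c R assume C: "sm C" and a: "set a <= {}" "set c <= B Un C" "R \<in> Def (length a + length c)" "a @ c \<in> R" "fk C (length a) (Sol (length a) R c)"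
  have a0: "a = []" using a(1) by simp
  have "Sol 0 (tup M 0) [] <= Sol 0 R c" using a(4) a0 by (auto simp: Sol_def tup_iff)
  then have "fk C 0 (Sol 0 (tup M 0) [])" using a(5) a0 fk_mono by auto
  then show False using IndD[OF Ind_refl[OF C empty_subsetI], of "[]" "[]" "tup M 0"] Def_full[of 0] by (auto simp: tup_iff)
qed

text \<open>Suppose \<open>b\<close> satisfies a formula with parameters \<open>c\<close> that forks
  over \<open>C\<close>. Independent copies of the entries of \<open>c\<close> in \<open>A\<close>,
  made over \<open>C\<close> and \<open>b\<close>, give \<open>N\<close> such formulas true of
  \<open>b\<close>. Adding the copies from the last to the first, each formula still forks over the
  copies already added, because these are independent from its parameters. So the rank of the type
  of \<open>b\<close> over \<open>C\<close> would be at least \<open>N\<close> for every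
  \<open>N\<close>.\<close>

lemma symmetry:
  assumes I: "Ind A C B" and sm: "sm A" "sm B" "sm C"
  shows "Ind B C A"
proof (rule Ind_lists)
  fix b assume b: "set b <= B"
  then have bM: "set b <= M" using sm sm_sub by blast
  let ?m = "length b"
  show "Ind (set b) C A"
  proof (rule Ind_list[OF bM])
    fix c R assume c: "set c <= A Un C" "R \<in> Def (?m + length c)" "b @ c \<in> R"
    show "\<not> fk C ?m (Sol ?m R c)"
    proof
      assume "fk C ?m (Sol ?m R c)"
      then obtain \<Delta> where \<Delta>: "good ?m \<Delta>" "forkD C ?m \<Delta> (Sol ?m R c)" unfolding fk_def by blast
      have cM: "set c <= M" using c(1) sm sm_sub by blast
      let ?a = "set (filter (%x. x \<in> A) c)"
      have sa: "sm ?a" by (rule sm_mono[OF sm(1)]) auto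
      have Ia: "Ind ?a C (set b)" by (rule Ind_mono[OF I _ b]) auto
      obtain \<sigma> where \<sigma>: "!!t::nat. fixes_on (C Un set b) (\<sigma> t)" "!!t. Ind (\<sigma> t ` ?a) C (set b Un (\<Union>s<t. \<sigma> s ` ?a))"
        using Ind_sequence[OF Ia sa sm_mono[OF sm(2) b] sm(3)] by metis
      have sI: "sm (\<sigma> t ` ?a)" for t by (rule sm_image[OF fixes_aut[OF \<sigma>(1)] sa])
      have "tge \<Delta> C b N" for N
      proof -
        \<comment> \<open>\<open>Z r\<close> consists of the copies with index at least
          \<open>r\<close>, already in the base; \<open>X r\<close> of those before
          \<open>r\<close>.\<close>
        define Z where "Z r = (\<Union>s\<in>{r..<N}. \<sigma> s ` ?a)" for r
        define X where "X r = (\<Union>s<r. \<sigma> s ` ?a)" for r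
        have ZS: "Z r = \<sigma> r ` ?a Un Z (Suc r)" if "r < N" for r
        proof -
          have "{r..<N} = insert r {Suc r..<N}" using that by auto
          then show ?thesis unfolding Z_def by simp
        qed
        have XS: "X (Suc r) = X r Un \<sigma> r ` ?a" for r unfolding X_def by (simp add: lessThan_Suc Un_commute)
        have sZ: "sm (Z r)" for r unfolding Z_def by (rule sm_UN[OF finite_le_nu sI]) simp
        have sX: "sm (X r)" for r unfolding X_def by (rule sm_UN[OF finite_le_nu sI]) simp
        have IZ: "r \<le> N ==> Ind (Z r) C (X r)" for r
        proof (induction "N - r" arbitrary: r)
          case 0
          then have "Z r = {}" unfolding Z_def by simp
          moreover have "Ind {} C (X r)" by (rule Ind_empty[OF sm(3)])
          ultimately show ?case by simp
        next
          case (Suc q)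
          then have r: "r < N" by simp
          have 1: "Ind (Z (Suc r)) C (X (Suc r))" using Suc r by simp
          have 2: "Ind (\<sigma> r ` ?a) C (X r)" by (rule Ind_mono[OF \<sigma>(2)[of r]]) (auto simp: X_def)
          have "Ind (Z (Suc r)) (C Un \<sigma> r ` ?a) (X (Suc r))" by (rule Ind_base_mono[OF 1]) (auto simp: XS)
          then have "Ind (Z (Suc r)) (C Un \<sigma> r ` ?a) (X r)" by (rule Ind_mono) (auto simp: XS)
          then show ?case unfolding ZS[OF r] by (rule left_transitivity[OF 2 _ sI sZ sX sm(3)])
        qed
        have "r \<le> N ==> tge \<Delta> (C Un Z r) b r" for r
        proof (induction r)
          case 0 show ?case by (rule tge_0[OF bM])
        next
          case (Suc r)
          then have r: "r < N" by simp
          let ?c = "map (\<sigma> r) c"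
          have fC: "fixes_on C (\<sigma> r)" by (rule fixes_mono[OF \<sigma>(1)]) auto
          have aut: "aut (\<sigma> r)" by (rule fixes_aut[OF \<sigma>(1)])
          have sc: "set ?c <= C Un \<sigma> r ` ?a" using c(1) fC by (force simp: fixes_on_def)
          have "b @ c \<in> tup M (?m + length c)" using bM cM by (simp add: tup_iff)
          then have "map (\<sigma> r) (b @ c) \<in> R" using aut_Def[OF aut c(2)] c(3) by blast
          moreover have "map (\<sigma> r) b = b" by (rule fixes_map[OF \<sigma>(1)]) auto
          ultimately have bc: "b @ ?c \<in> R" by simp
          have "forkD (\<sigma> r ` C) ?m \<Delta> (map (\<sigma> r) ` Sol ?m R c)" by (rule forkD_aut[OF aut sm_sub[OF sm(3)] \<Delta>(2) Sol_tup])
          then have f1: "forkD C ?m \<Delta> (Sol ?m R ?c)" using fixes_image[OF fC order_refl] Sol_image[OF aut cM c(2)] by simp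
          have "forkD (C Un Z (Suc r)) ?m \<Delta> (Sol ?m R ?c)"
          proof (rule forkD_Ind[OF IZ sZ sX sm(3) _ _ f1])
            show "Suc r \<le> N" by (rule Suc.prems)
            show "set ?c <= C Un X (Suc r)" using sc XS by blast
            show "R \<in> Def (?m + length ?c)" using c(2) by simp
          qed
          note f2 = this
          show ?case
          proof (rule tge_drop[OF sm_Un[OF sm(3) sZ] _ _ _ bc f2 \<Delta>(1)])
            show "C Un Z (Suc r) <= C Un Z r" "set ?c <= C Un Z r" using ZS[OF r] sc by auto
            show "R \<in> Def (?m + length ?c)" using c(2) by simp
            show "tge \<Delta> (C Un Z r) b r" using Suc r by simp
          qed
        qed
        from this[of N] show ?thesis unfolding Z_def by simp
      qed
      then show False using tge_bounded[OF \<Delta>(1) bM] by blast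
    qed
  qed
qed

section \<open>Algebraic tuples and independence\<close>

definition algb :: "'c set => 'c list => bool" where
  "algb C b \<longleftrightarrow> (\<exists>R c. set c <= C & R \<in> Def (length b + length c) & b @ c \<in> R & finite (Sol (length b) R c))"

lemma algb_mono: "algb C b ==> C <= C' ==> algb C' b"
  unfolding algb_def by (meson subset_trans)

text \<open>Along a dividing sequence every instance contains a conjugate of \<open>b\<close> over
  \<open>C\<close>, and all these lie in one finite set; so some point belongs to infinitely many
  instances, against k-inconsistency.\<close>

lemma Ind_algb:
  assumes "algb C b" "sm C" "set b <= M" shows "Ind (set b) C X"
proof (rule Ind_list[OF assms(3)])
  let ?n = "length b"
  fix c R assume c: "set c <= X Un C" "R \<in> Def (?n + length c)" "b @ c \<in> R"
  obtain S e where S: "set e <= C" "S \<in> Def (?n + length e)" "b @ e \<in> S" "finite (Sol ?n S e)"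
    using assms(1) unfolding algb_def by (elim exE conjE)
  have eM: "set e <= M" using S(1) sm_sub[OF assms(2)] by blast
  have bt: "b \<in> tup M ?n" using assms(3) by (simp add: tup_iff)
  show "\<not> fk C ?n (Sol ?n R c)"
  proof
    assume "fk C ?n (Sol ?n R c)"
    from fk_cover[OF this] obtain D where D: "finite D" "\<forall>p\<in>D. \<exists>k. kd ?n C (fst p) (snd p) k" "Sol ?n R c <= (\<Union>p\<in>D. Sol ?n (fst p) (snd p))"
      by (elim exE conjE)
    have "b \<in> Sol ?n R c" using bt c(3) by (simp add: Sol_def)
    then obtain p where p: "p \<in> D" "b \<in> Sol ?n (fst p) (snd p)" using D(3) by blast
    obtain k where k: "kd ?n C (fst p) (snd p) k" using D(2) p(1) by blast
    have d: "fst p \<in> Def (?n + length (snd p))" "set (snd p) <= M" using kd_Def[OF k] by auto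
    obtain s where s: "\<forall>i::nat. eqt C (snd p) (s i)" "k_inconsistent k (%i. Sol ?n (fst p) (s i))" using k unfolding kd_def by (elim exE conjE)
    have "\<exists>y. y \<in> Sol ?n S e & y \<in> Sol ?n (fst p) (s i)" for i
    proof -
      obtain \<sigma> where \<sigma>: "fixes_on C \<sigma>" "map \<sigma> (snd p) = s i" by (rule eqt_aut[OF s(1)[rule_format, of i] assms(2)])
      have "map \<sigma> b \<in> Sol ?n (fst p) (s i)" using Sol_aut[OF fixes_aut[OF \<sigma>(1)] d(2,1) bt] p(2) \<sigma>(2) by simp
      moreover have "map \<sigma> b \<in> Sol ?n S e"
        using Sol_aut[OF fixes_aut[OF \<sigma>(1)] eM S(2) bt] fixes_map[OF \<sigma>(1) S(1)] S(3) bt by (simp add: Sol_def)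
      ultimately show ?thesis by blast
    qed
    then have "\<forall>i. \<exists>y. y \<in> Sol ?n S e & y \<in> Sol ?n (fst p) (s i)" by blast
    from choice[OF this] obtain y where y: "\<forall>i. y i \<in> Sol ?n S e & y i \<in> Sol ?n (fst p) (s i)" ..
    have "range y <= Sol ?n S e" using y by blast
    from finite_subset[OF this S(4)] have "\<exists>i0\<in>UNIV. infinite {i \<in> UNIV. y i = y i0}"
      by (intro pigeonhole_infinite) auto
    then obtain i0 where i0: "infinite {i. y i = y i0}" by auto
    obtain I where I: "I <= {i. y i = y i0}" "finite I" "card I = k" using infinite_arbitrarily_large[OF i0] by blast
    have "y i0 \<in> (\<Inter>i\<in>I. Sol ?n (fst p) (s i))"
    proof
      fix i assume "i \<in> I"
      then have "y i = y i0" using I(1) by blast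
      then show "y i0 \<in> Sol ?n (fst p) (s i)" using y by metis
    qed
    then show False using s(2) I(2,3) unfolding k_inconsistent_def by blast
  qed
qed

lemma infinitely_many_conjugates:
  assumes "\<not> algb C e" "sm C" "set e <= M" shows "infinite {x. eqt C e x}"
proof
  assume fin0: "finite {x. eqt C e x}"
  define F where "F = {x. eqt C e x}"
  have fin: "finite F" using fin0 unfolding F_def .
  have FD: "y \<in> F \<longleftrightarrow> eqt C e y" for y by (simp add: F_def)
  let ?n = "length e"
  have et: "e \<in> tup M ?n" using assms(3) by (simp add: tup_iff)
  define T where "T = {(c, R) | c R. set c <= C & R \<in> Def (?n + length c) & e @ c \<in> R}"
  define Q where "Q t f = (map f [0..<?n] @ fst t \<in> snd t & (\<forall>y\<in>F. map f [0..<?n] ~= y))" for t :: "'c list \<times> 'c list set" and f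
  let ?P = "\<Union>y\<in>F. set y"
  have Fl: "length y = ?n & set y <= M" if "y \<in> F" for y using that unfolding FD by (metis eqt_length eqt_M)
  have sP: "sm (C Un ?P)" by (rule sm_Un[OF assms(2) sm_finite]) (use fin Fl in auto)
  have "\<exists>f. range f <= M & (\<forall>t\<in>T. Q t f)"
  proof (rule compactness_indexed[of "{..<?n}" "C Un ?P"])
    show "|{..<?n}| \<le>o \<nu>" by (rule finite_le_nu) simp
    show "sm (C Un ?P)" by (rule sP)
    have ne: "DF {..<?n} (C Un ?P) (%f. map f [0..<?n] ~= y)" if y: "y \<in> F" for y
    proof -
      have "DF {..<?n} (C Un ?P) (%f. \<forall>i\<in>{..<?n}. f i = y ! i)"
      proof (rule DF_Ball)
        fix i assume i: "i \<in> {..<?n}"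
        then have yi: "y ! i \<in> set y" using Fl[OF y] by simp
        then have "y ! i \<in> C Un ?P" using y by blast
        moreover have "y ! i \<in> M" using yi Fl[OF y] by blast
        ultimately show "DF {..<?n} (C Un ?P) (%f. f i = y ! i)" by (rule DF_eqc[OF i])
      qed simp
      from DF_not[OF this] show ?thesis
      proof (rule DF_cong)
        fix f :: "nat => 'c"
        have ly: "length y = ?n" using Fl[OF y] by (rule conjunct1)
        have "map f [0..<?n] = y" if "\<forall>i\<in>{..<?n}. f i = y ! i"
          by (rule nth_equalityI) (use that ly in simp_all)
        moreover have "\<forall>i\<in>{..<?n}. f i = y ! i" if m: "map f [0..<?n] = y"
          unfolding m[symmetric] by simp
        ultimately show "(\<not> (\<forall>i\<in>{..<?n}. f i = y ! i)) = (map f [0..<?n] ~= y)" by (rule iffI[THEN arg_cong[of _ _ Not]])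
      qed
    qed
    show "DF {..<?n} (C Un ?P) (Q t)" if t: "t \<in> T" for t
    proof -
      obtain c R where tt: "t = (c, R)" by (cases t)
      have c: "set c <= C" "R \<in> Def (?n + length c)" using t unfolding tt T_def by auto
      have "DF {..<?n} (C Un ?P) (%f. map f [0..<?n] @ c \<in> R)"
        by (rule DF_mem[OF c(2)]) (use c sm_sub[OF assms(2)] in auto)
      moreover have "DF {..<?n} (C Un ?P) (%f. \<forall>y\<in>F. map f [0..<?n] ~= y)" by (rule DF_Ball[OF fin ne])
      ultimately show ?thesis unfolding Q_def tt fst_conv snd_conv by (rule DF_and)
    qed
    fix T0 assume T0: "T0 <= T" "finite T0"
    have "DF {..<?n} C (%f. \<forall>t\<in>T0. map f [0..<?n] @ fst t \<in> snd t)"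
    proof (rule DF_Ball[OF T0(2)])
      fix t assume t: "t \<in> T0"
      obtain c R where tt: "t = (c, R)" by (cases t)
      have c: "set c <= C" "R \<in> Def (?n + length c)" using t T0(1) unfolding tt T_def by auto
      show "DF {..<?n} C (%f. map f [0..<?n] @ fst t \<in> snd t)" unfolding tt fst_conv snd_conv
        by (rule DF_mem[OF c(2)]) (use c sm_sub[OF assms(2)] in auto)
    qed
    from DF_Sol[OF this] obtain R cs where R: "set cs <= C Int M" "R \<in> Def (?n + length cs)"
      "\<forall>a\<in>tup M ?n. (\<forall>t\<in>T0. map (asg a) [0..<?n] @ fst t \<in> snd t) = (a @ cs \<in> R)" by (elim exE conjE)
    have ma: "map (asg a) [0..<?n] = a" if "a \<in> tup M ?n" for a using map_asg[of a] that by (simp add: tup_iff)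
    have "\<forall>t\<in>T0. e @ fst t \<in> snd t" using T0(1) unfolding T_def by auto
    then have "e @ cs \<in> R" using R(3)[rule_format, OF et] ma[OF et] by simp
    then have "infinite (Sol ?n R cs)" using assms(1) R(1,2) unfolding algb_def by blast
    then have "\<not> Sol ?n R cs <= F" using fin finite_subset by blast
    then obtain a where a: "a \<in> Sol ?n R cs" "a \<notin> F" by blast
    have at: "a \<in> tup M ?n" using a(1) Sol_tup by blast
    have "\<forall>t\<in>T0. a @ fst t \<in> snd t" using R(3)[rule_format, OF at] ma[OF at] a(1) by (simp add: Sol_def)
    then have "\<forall>t\<in>T0. Q t (asg a)" unfolding Q_def ma[OF at] using a(2) by blast
    moreover have "range (asg a) <= M" by (rule asg_range) (use at in \<open>simp add: tup_iff\<close>)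
    ultimately show "\<exists>f. range f <= M & (\<forall>t\<in>T0. Q t f)" by (intro exI[of _ "asg a"] conjI)
  qed
  then obtain f where f: "range f <= M" "\<forall>t\<in>T. Q t f" by (elim exE conjE)
  have "eqt C e (map f [0..<?n])"
  proof (rule eqtI)
    show "set (map f [0..<?n]) <= M" using f(1) by auto
    fix R c assume "set c <= C" "R \<in> Def (length e + length c)" "e @ c \<in> R"
    then have "(c, R) \<in> T" unfolding T_def by blast
    from f(2)[rule_format, OF this] show "map f [0..<?n] @ c \<in> R" unfolding Q_def by simp
  qed (use assms in auto)
  moreover have "([], tup M ?n) \<in> T" unfolding T_def using et Def_full[of ?n] by simp
  from f(2)[rule_format, OF this] have "map f [0..<?n] \<notin> F" unfolding Q_def by blast
  ultimately show False using FD by blast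
qed

text \<open>If \<open>e\<close> had infinitely many conjugates over \<open>C\<close>, the formula
  \<open>x = e\<close> would divide over \<open>C\<close> with inconsistency number 2.\<close>

lemma algb_of_self_Ind:
  assumes "Ind (set e) C (set e)" "sm C" "set e <= M" shows "algb C e"
proof (rule ccontr)
  assume nalg: "\<not> algb C e"
  let ?n = "length e"
  from infinite_countable_subset[OF infinitely_many_conjugates[OF nalg assms(2,3)]]
  obtain s :: "nat => 'c list" where s: "inj s" "range s <= {x. eqt C e x}" by (elim exE conjE)
  have "DF {..<?n + ?n} {} (%f. \<forall>i\<in>{..<?n}. f i = f (?n + i))" by (rule DF_Ball) (auto intro!: DF_eqv)
  from DF_Sol[OF this] obtain \<psi> cs where \<psi>0: "set cs <= {} Int M" "\<psi> \<in> Def (?n + ?n + length cs)"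
     "\<forall>a\<in>tup M (?n + ?n). (\<forall>i\<in>{..<?n}. asg a i = asg a (?n + i)) = (a @ cs \<in> \<psi>)" by (elim exE conjE)
  have \<psi>: "\<psi> \<in> Def (?n + ?n)" using \<psi>0(1,2) by simp
  have eq: "x @ y \<in> \<psi> \<longleftrightarrow> x = y" if "x \<in> tup M ?n" "y \<in> tup M ?n" for x y
  proof -
    have "x @ y \<in> tup M (?n + ?n)" using that by (auto simp: tup_iff)
    then have "(x @ y \<in> \<psi>) = (\<forall>i\<in>{..<?n}. asg (x @ y) i = asg (x @ y) (?n + i))" using \<psi>0 by simp
    also have "\<dots> = (x = y)" using that by (auto simp: asg_def nth_append tup_iff list_eq_iff_nth_eq)
    finally show ?thesis .
  qed
  have et: "e \<in> tup M ?n" using assms(3) by (simp add: tup_iff)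
  have es: "eqt C e (s i)" for i using s(2) by (simp add: image_subset_iff)
  have st: "s i \<in> tup M ?n" for i using eqt_length[OF es] eqt_M[OF es] by (metis tup_iff)
  have "kd ?n C \<psi> e 2" unfolding kd_def
  proof (intro conjI exI[of _ s] allI \<psi> assms(3))
    show "eqt C e (s i)" for i by (rule es)
    show "k_inconsistent 2 (%i. Sol ?n \<psi> (s i))" unfolding k_inconsistent_def
    proof (intro allI impI)
      fix I :: "nat set" assume "finite I & card I = 2"
      then obtain i j where ij: "I = {i, j}" "i ~= j" by (auto simp: card_2_iff)
      have "s i ~= s j" using s(1) ij(2) by (auto simp: inj_def)
      then show "(\<Inter>i\<in>I. Sol ?n \<psi> (s i)) = {}" unfolding ij(1) Sol_def using eq st by auto
    qed
  qed
  then have "fk C ?n (Sol ?n \<psi> e)" by (rule fkI) (rule order_refl)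
  then show False using IndD[OF assms(1) order_refl, of e \<psi>] \<psi> eq[OF et et] by blast
qed

text \<open>In a sequence of independent copies of \<open>e\<close> over \<open>C Un B\<close> two
  copies coincide, as all lie in one finite set. Such a copy is independent from itself over
  \<open>C\<close>.\<close>

lemma algb_Ind:
  assumes "Ind (set e) C B" "algb (C Un B) e" "sm C" "sm B" "set e <= M" shows "algb C e"
proof -
  let ?n = "length e"
  obtain S c where S: "set c <= C Un B" "S \<in> Def (?n + length c)" "e @ c \<in> S" "finite (Sol ?n S c)"
    using assms(2) unfolding algb_def by (elim exE conjE)
  have cM: "set c <= M" using S(1) assms sm_sub by blast
  have et: "e \<in> tup M ?n" using assms(5) by (simp add: tup_iff)
  obtain \<sigma> where \<sigma>: "!!t::nat. fixes_on (C Un B) (\<sigma> t)" "!!t. Ind (\<sigma> t ` set e) C (B Un (\<Union>s<t. \<sigma> s ` set e))"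
    using Ind_sequence[OF assms(1) sm_set[OF assms(5)] assms(4,3)] by metis
  have "map (\<sigma> t) e \<in> Sol ?n S c" for t
    using Sol_aut[OF fixes_aut[OF \<sigma>(1)] cM S(2) et, of t] fixes_map[OF \<sigma>(1) S(1)] S(3) et by (simp add: Sol_def)
  then have "range (%t. map (\<sigma> t) e) <= Sol ?n S c" by (rule image_subsetI)
  from finite_subset[OF this S(4)] have "\<not> inj (%t. map (\<sigma> t) e)" by (metis range_inj_infinite)
  then obtain t s where "map (\<sigma> t) e = map (\<sigma> s) e" "t ~= s" unfolding inj_def by (simp only: not_all not_imp) (elim exE conjE, intro that)
  then obtain t s where ts: "map (\<sigma> t) e = map (\<sigma> s) e" "s < t" by (metis linorder_neqE_nat)
  have "\<sigma> s ` set e = \<sigma> t ` set e" using ts(1) by (metis image_set)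
  then have I: "Ind (\<sigma> t ` set e) C (\<sigma> t ` set e)"
    by (intro Ind_mono[OF \<sigma>(2)[of t]]) (use ts(2) in auto)
  have CB: "C Un B <= M" using assms sm_sub by blast
  obtain \<tau> where \<tau>: "fixes_on (C Un B) \<tau>" "!!x. x \<in> M ==> \<tau> (\<sigma> t x) = x" using fixes_inverse[OF \<sigma>(1)[of t] CB] by metis
  have "\<tau> ` \<sigma> t ` set e = set e" using \<tau>(2) assms(5) by (force simp: image_image)
  moreover have "\<tau> ` C = C" by (rule fixes_image[OF \<tau>(1)]) simp
  moreover have "Ind (\<tau> ` \<sigma> t ` set e) (\<tau> ` C) (\<tau> ` \<sigma> t ` set e)"
    by (rule Ind_aut[OF fixes_aut[OF \<tau>(1)] _ _ _ I]) (use aut_set[OF fixes_aut[OF \<sigma>(1)] assms(5)] CB in auto)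
  ultimately show ?thesis using algb_of_self_Ind[OF _ assms(3,5)] by simp
qed

end

section \<open>Transfinite tools\<close>

context dstruct
begin

definition nlt :: "'v => 'v => bool" where "nlt i j \<longleftrightarrow> (i, j) \<in> \<nu> & i ~= j"

lemma nu_well_order: "well_order_on (Field \<nu>) \<nu>"
  using card_order_on_well_order_on[OF nu_card] .

lemma nlt_Field: "nlt i j ==> i \<in> Field \<nu> & j \<in> Field \<nu>"
  unfolding nlt_def by (auto simp: Field_def)

lemma nlt_trans: "nlt i j ==> nlt j k ==> nlt i k"
  using nu_well_order unfolding nlt_def well_order_on_def linear_order_on_def partial_order_on_def preorder_on_def
  by (metis antisymD transD)

lemma nlt_irrefl: "\<not> nlt i i" by (simp add: nlt_def)

lemma nlt_total: "i \<in> Field \<nu> ==> j \<in> Field \<nu> ==> i ~= j ==> nlt i j \<or> nlt j i"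
  using nu_well_order unfolding nlt_def well_order_on_def linear_order_on_def total_on_def by metis

lemma nlt_wf: "wf {(i, j). nlt i j}"
proof -
  have "{(i, j). nlt i j} = \<nu> - Id" unfolding nlt_def by auto
  then show ?thesis using nu_well_order by (simp add: well_order_on_def)
qed

lemma nlt_least:
  assumes "P i" shows "\<exists>i. P i & (\<forall>j. nlt j i --> \<not> P j)"
  using nlt_wf[unfolded wf_eq_minimal, rule_format, of i "{i. P i}"] assms by simp

lemma nlt_unbounded: "i \<in> Field \<nu> ==> \<exists>j. nlt i j"
  using infinite_Card_order_limit[OF nu_card nu_inf] unfolding nlt_def by blast

lemma nu_ne: "\<exists>i. i \<in> Field \<nu>" using nu_inf by (metis ex_in_conv finite.emptyI)

lemma nlt_sequence: "\<exists>\<iota> :: nat => 'v. (\<forall>t. \<iota> t \<in> Field \<nu>) & (\<forall>s t. s < t --> nlt (\<iota> s) (\<iota> t))"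
proof -
  have "\<exists>\<iota> :: nat => 'v. \<forall>t. \<iota> t \<in> Field \<nu> & nlt (\<iota> t) (\<iota> (Suc t))"
    by (rule dependent_nat_choice) (use nu_ne nlt_unbounded nlt_Field in blast)+
  then obtain \<iota> :: "nat => 'v" where \<iota>: "\<forall>t. \<iota> t \<in> Field \<nu> & nlt (\<iota> t) (\<iota> (Suc t))" ..
  have "nlt (\<iota> s) (\<iota> t)" if "s < t" for s t using that
  proof (induction t)
    case (Suc t) then show ?case using \<iota> nlt_trans by (metis less_Suc_eq)
  qed simp
  then show ?thesis using \<iota> by (intro exI[of _ \<iota>]) simp
qed

lemma nu_subset: "J <= Field \<nu> ==> |J| \<le>o \<nu>"
  unfolding le_nu_Field by (rule card_of_mono1)

text \<open>Two relations are needed: at a limit \<open>lim\<close> gives an upper bound only in the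
  weak sense \<open>le\<close>, and \<open>step\<close> then passes strictly above it in the sense
  of \<open>sl\<close>.\<close>

lemma nu_recursion:
  fixes X :: "'s set"
  assumes lim: "!!J f. J <= Field \<nu> ==> (!!i. i \<in> J ==> f i \<in> X) ==>
       (!!i j. i \<in> J ==> j \<in> J ==> nlt i j ==> le (f i) (f j)) ==> \<exists>t\<in>X. \<forall>i\<in>J. le (f i) t"
    and step: "!!s. s \<in> X ==> \<exists>t\<in>X. sl s t"
    and le_sl: "!!s t u. s \<in> X ==> t \<in> X ==> u \<in> X ==> le s t ==> sl t u ==> sl s u"
    and sl_le: "!!s t. s \<in> X ==> t \<in> X ==> sl s t ==> le s t"
  shows "\<exists>f. (\<forall>i\<in>Field \<nu>. f i \<in> X) & (\<forall>i j. nlt i j --> sl (f i) (f j))"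
proof -
  let ?r = "{(i, j). nlt i j}"
  define F where "F g i = (SOME t. t \<in> X & (\<forall>j. nlt j i --> sl (g j) t))" for g :: "'v => 's" and i
  define f where "f = wfrec ?r F"
  have fe: "f i = (SOME t. t \<in> X & (\<forall>j. nlt j i --> sl (f j) t))" for i
  proof -
    have "f i = F (cut f ?r i) i" unfolding f_def by (rule wfrec[OF nlt_wf])
    also have "\<dots> = (SOME t. t \<in> X & (\<forall>j. nlt j i --> sl (f j) t))"
    proof -
      have "cut f ?r i j = f j" if "nlt j i" for j using that by (simp add: cut_apply)
      then show ?thesis unfolding F_def by (metis (no_types, lifting))
    qed
    finally show ?thesis .
  qed
  have main: "i \<in> Field \<nu> --> f i \<in> X & (\<forall>j. nlt j i --> sl (f j) (f i))" for i
    using nlt_wf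
  proof (induction i rule: wf_induct_rule)
    case (less i)
    have IH: "f j \<in> X & (\<forall>k. nlt k j --> sl (f k) (f j))" if "nlt j i" for j
      using less[of j] that nlt_Field[OF that] by simp
    have "\<exists>t\<in>X. \<forall>j\<in>{j. nlt j i}. le (f j) t"
    proof (rule lim)
      show "{j. nlt j i} <= Field \<nu>" using nlt_Field by blast
      show "f j \<in> X" if "j \<in> {j. nlt j i}" for j using IH that by simp
      show "le (f j) (f k)" if "j \<in> {j. nlt j i}" "k \<in> {j. nlt j i}" "nlt j k" for j k
        using IH[of j] IH[of k] that sl_le by simp
    qed
    then obtain t where t: "t \<in> X" "\<forall>j. nlt j i --> le (f j) t" by auto
    obtain u where u: "u \<in> X" "sl t u" using step[OF t(1)] by (elim bexE)
    have "u \<in> X & (\<forall>j. nlt j i --> sl (f j) u)" using u t IH le_sl[OF _ t(1) u(1) _ u(2)] by simp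
    then have "f i \<in> X & (\<forall>j. nlt j i --> sl (f j) (f i))" unfolding fe[of i] by (rule someI)
    then show ?case by simp
  qed
  show ?thesis
  proof (intro exI[of _ f] conjI ballI allI impI)
    show "f i \<in> X" if "i \<in> Field \<nu>" for i using main[of i] that by simp
    show "sl (f i) (f j)" if "nlt i j" for i j using main[of j] nlt_Field[OF that] that by simp
  qed
qed

text \<open>The identity, with a default outside \<open>M\<close> that keeps its range inside
  \<open>M\<close>, where \<open>DF\<close> has a meaning.\<close>

definition idM :: "'c => 'c" where "idM x = (if x \<in> M then x else x0)"

lemma range_idM: "range idM <= M" using x0 by (auto simp: idM_def)

lemma idM_M: "x \<in> M ==> idM x = x" by (simp add: idM_def)

lemma map_idM: "set u <= M ==> map idM u = u" by (auto simp: idM_def intro!: map_idI)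

text \<open>Variables in \<open>U\<close> are named by elements of \<open>M\<close>; evaluating each
  at itself turns it into a parameter.\<close>

lemma DF_subst:
  fixes Q :: "('c + 'j => 'c) => bool"
  assumes "DF (Inl ` U Un Inr ` V) A Q" "U <= M"
  shows "DF V (A Un U) (%f. Q (case_sum idM f))"
proof -
  obtain ts R where ts: "set ts <= Inl ` (Inl ` U Un Inr ` V) Un Inr ` (A Int M)" "R \<in> Def (length ts)"
     "\<forall>f. range f <= M --> Q f = (map (vl f) ts \<in> R)" using assms(1) unfolding DF_def by (elim exE conjE)
  let ?g = "case_sum (case_sum Inr Inl) Inr :: ('c + 'j) + 'c => 'j + 'c"
  show ?thesis
  proof (rule DF_I[of "map ?g ts" _ _ R])
    show "set (map ?g ts) <= Inl ` V Un Inr ` ((A Un U) Int M)"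
    proof
      fix t assume "t \<in> set (map ?g ts)"
      then obtain t' where t': "t' \<in> set ts" "t = ?g t'" by auto
      then have "t' \<in> Inl ` (Inl ` U Un Inr ` V) Un Inr ` (A Int M)" using ts(1) by blast
      then show "t \<in> Inl ` V Un Inr ` ((A Un U) Int M)" using t'(2) assms(2) by (elim UnE imageE) auto
    qed
    show "R \<in> Def (length (map ?g ts))" using ts(2) by simp
    fix f :: "'j => 'c" assume f: "range f <= M"
    have r: "range (case_sum idM f) <= M" using f range_idM by (auto simp: image_subset_iff split: sum.split)
    have "vl (case_sum idM f) t = vl f (?g t)" if "t \<in> set ts" for t
    proof -
      have "t \<in> Inl ` (Inl ` U Un Inr ` V) Un Inr ` (A Int M)" using ts(1) that by blast
      then show ?thesis using assms(2) by (elim UnE imageE) (auto simp: idM_def)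
    qed
    then have e: "map (vl (case_sum idM f)) ts = map (vl f) (map ?g ts)" by simp
    show "Q (case_sum idM f) = (map (vl f) (map ?g ts) \<in> R)" using ts(3) r e by metis
  qed
qed

end

context simplestruct
begin

text \<open>\<open>local_character\<close> is applied to each \<open>C i\<close> and the set
  \<open>C (s i)\<close> at the immediate successor \<open>s i\<close>, which is contained in all
  later sets.\<close>

lemma local_character_chain:
  assumes d: "set d <= M" and sm: "!!i. i \<in> Field \<nu> ==> sm (C i)"
    and ch: "!!i j. nlt i j ==> C i <= C j" and dep: "!!i j. nlt i j ==> \<not> Ind (set d) (C i) (C j)"
  shows False
proof -
  have "\<forall>i\<in>Field \<nu>. \<exists>j. nlt i j & (\<forall>k. nlt k j --> \<not> nlt i k)"
  proof
    fix i assume "i \<in> Field \<nu>"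
    then obtain j where "nlt i j" using nlt_unbounded by blast
    from nlt_least[of "nlt i", OF this] show "\<exists>j. nlt i j & (\<forall>k. nlt k j --> \<not> nlt i k)" .
  qed
  from bchoice[OF this] obtain s where s: "\<forall>i\<in>Field \<nu>. nlt i (s i) & (\<forall>k. nlt k (s i) --> \<not> nlt i k)" ..
  have "\<exists>i\<in>Field \<nu>. Ind (set d) (C i) (C (s i))"
  proof (rule local_character[OF d sm])
    fix i j assume "(i, j) \<in> \<nu>" "i ~= j"
    then have ij: "nlt i j" by (simp add: nlt_def)
    then have f: "i \<in> Field \<nu>" "j \<in> Field \<nu>" using nlt_Field by auto
    then have si: "nlt i (s i)" "\<not> nlt j (s i)" using s ij by auto
    then have "s i = j \<or> nlt (s i) j" using nlt_total[of "s i" j] f nlt_Field[OF si(1)] by blast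
    then have "C (s i) <= C j" using ch by blast
    then show "C i Un C (s i) <= C j" using ch[OF ij] by blast
  qed
  then show False using s dep by blast
qed

lemma right_transitivity:
  assumes "Ind A C B1" "Ind A (C Un B1) B2" "sm A" "sm C" "sm B1" "sm B2"
  shows "Ind A C (B1 Un B2)"
proof (rule symmetry)
  show "Ind (B1 Un B2) C A"
  proof (rule left_transitivity)
    show "Ind B1 C A" by (rule symmetry[OF assms(1,3,5,4)])
    show "Ind B2 (C Un B1) A" by (rule symmetry[OF assms(2,3,6) sm_Un[OF assms(4,5)]])
  qed (use assms in auto)
qed (use assms sm_Un in auto)

lemma Ind_finite_character:
  assumes "!!a b. set a <= A ==> set b <= B ==> Ind (set a) C (set b)" shows "Ind A C B"
  unfolding Ind_def
proof (intro allI impI notI)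
  fix a c R assume a: "set a <= A" "set c <= B Un C" "R \<in> Def (length a + length c)" "a @ c \<in> R" "fk C (length a) (Sol (length a) R c)"
  let ?b = "filter (%x. x \<in> B) c"
  have "Ind (set a) C (set ?b)" by (rule assms[OF a(1)]) auto
  moreover have "set c <= set ?b Un C" using a(2) by auto
  ultimately show False by (rule IndD[OF _ order_refl _ a(3,4,5)])
qed

lemma Ind_eqt:
  assumes "eqt D b b'" "sm D" "Ind (set b) C B" "C Un B <= D" shows "Ind (set b') C B"
proof -
  obtain \<sigma> where \<sigma>: "fixes_on D \<sigma>" "map \<sigma> b = b'" by (rule eqt_aut[OF assms(1,2)])
  have "Ind (\<sigma> ` set b) (\<sigma> ` C) (\<sigma> ` B)"
    by (rule Ind_aut[OF fixes_aut[OF \<sigma>(1)] _ _ _ assms(3)]) (use eqt_M[OF assms(1)] assms(4) sm_sub[OF assms(2)] in auto)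
  moreover have "\<sigma> ` C = C" "\<sigma> ` B = B" using fixes_image[OF \<sigma>(1)] assms(4) by auto
  moreover have "\<sigma> ` set b = set b'" using \<sigma>(2) by (metis image_set)
  ultimately show ?thesis by simp
qed

lemma nonforking_extension_exists:
  assumes "sm C" "sm D" "set b <= M" shows "\<exists>b'. eqt C b b' & Ind (set b') C D"
proof -
  from ext_left[OF Ind_refl[OF assms(1,3)] sm_set[OF assms(3)] assms(1,1,2)]
  obtain \<sigma> where \<sigma>: "fixes_on (C Un C) \<sigma>" "Ind (\<sigma> ` set b) C D" by (elim exE conjE)
  then have "eqt C b (map \<sigma> b)" using fixes_eqt[of C \<sigma> b] assms(3) by simp
  then show ?thesis using \<sigma>(2) by (intro exI[of _ "map \<sigma> b"]) simp
qed

lemma fk_eqt: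
  assumes "eqt C b b'" "sm C" "set p <= C" "R \<in> Def (k + (length b + length p))" "fk C k (Sol k R (b @ p))"
  shows "fk C k (Sol k R (b' @ p))"
proof -
  obtain \<sigma> where \<sigma>: "fixes_on C \<sigma>" "map \<sigma> b = b'" by (rule eqt_aut[OF assms(1,2)])
  have bp: "set (b @ p) <= M" using eqt_M[OF assms(1)] assms(3) sm_sub[OF assms(2)] by auto
  have "fk (\<sigma> ` C) k (map \<sigma> ` Sol k R (b @ p))" by (rule fk_aut[OF fixes_aut[OF \<sigma>(1)] sm_sub[OF assms(2)] assms(5) Sol_tup])
  moreover have "map \<sigma> ` Sol k R (b @ p) = Sol k R (map \<sigma> (b @ p))" by (rule Sol_image[OF fixes_aut[OF \<sigma>(1)] bp]) (use assms(4) in simp)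
  moreover have "\<sigma> ` C = C" by (rule fixes_image[OF \<sigma>(1) order_refl])
  moreover have "map \<sigma> p = p" by (rule fixes_map[OF \<sigma>(1) assms(3)])
  ultimately show ?thesis using \<sigma>(2) by simp
qed

text \<open>A formula that does not fork is not covered by finitely many forking ones, so the
  negations of all forking formulas over the given parameters are finitely satisfiable in
  it.\<close>

lemma nonforking_realization:
  assumes R: "R \<in> Def (l + length c)" "set c <= M" and nf: "\<not> fk C l (Sol l R c)" and sC: "sm C" and sD: "sm D"
  shows "\<exists>z\<in>Sol l R c. Ind (set z) C (D Un set c)"
proof -
  define T where "T = {(e, \<theta>). set e <= (D Un set c) Un C & \<theta> \<in> Def (l + length e) & fk C l (Sol l \<theta> e)}"
  define Q where "Q t f = (map f [0..<l] @ c \<in> R & map f [0..<l] @ fst t \<notin> snd t)" for t :: "'c list \<times> 'c list set" and f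
  have sB: "sm ((D Un set c) Un C)" using sC sD sm_set[OF R(2)] sm_Un by blast
  have ma: "map (asg x) [0..<l] = x" if "x \<in> tup M l" for x using map_asg[of x] that by (simp add: tup_iff)
  have "\<exists>f. range f <= M & (\<forall>t\<in>T. Q t f)"
  proof (rule compactness_indexed[of "{..<l}" "(D Un set c) Un C"])
    show "|{..<l}| \<le>o \<nu>" by (rule finite_le_nu) simp
    show "sm ((D Un set c) Un C)" by (rule sB)
    show "DF {..<l} ((D Un set c) Un C) (Q t)" if t: "t \<in> T" for t
    proof -
      obtain e \<theta> where tt: "t = (e, \<theta>)" by (cases t)
      have e: "set e <= (D Un set c) Un C" "\<theta> \<in> Def (l + length e)" using t unfolding tt T_def by auto
      show ?thesis unfolding Q_def tt fst_conv snd_conv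
        by (intro DF_and DF_not DF_mem[OF R(1)] DF_mem[OF e(2)]) (use e(1) sm_sub[OF sB] in auto)
    qed
    fix T0 assume T0: "T0 <= T" "finite T0"
    have "fk C l (\<Union>t\<in>T0. Sol l (snd t) (fst t))" by (rule fk_UN[OF T0(2)]) (use T0(1) in \<open>auto simp: T_def\<close>)
    then have "\<not> Sol l R c <= (\<Union>t\<in>T0. Sol l (snd t) (fst t))" using nf fk_mono by blast
    then obtain z where z: "z \<in> Sol l R c" "z \<notin> (\<Union>t\<in>T0. Sol l (snd t) (fst t))" by blast
    have zt: "z \<in> tup M l" using z(1) Sol_tup by blast
    have "\<forall>t\<in>T0. Q t (asg z)" unfolding Q_def ma[OF zt] using z zt by (auto simp: Sol_def)
    moreover have "range (asg z) <= M" by (rule asg_range) (use zt in \<open>simp add: tup_iff\<close>)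
    ultimately show "\<exists>f. range f <= M & (\<forall>t\<in>T0. Q t f)" by (intro exI[of _ "asg z"] conjI)
  qed
  then obtain f where f: "range f <= M" "\<forall>t\<in>T. Q t f" by (elim exE conjE)
  let ?z = "map f [0..<l]"
  have zt: "?z \<in> tup M l" using f(1) by (auto simp: tup_iff)
  \<comment> \<open>The empty relation puts an element into \<open>T\<close>, so that
    \<open>Q\<close> also yields the formula \<open>R\<close> itself.\<close>
  have "tup M l - tup M l \<in> Def (l + length ([] :: 'c list))" using Def_Diff[OF Def_full] by simp
  then have "([], tup M l - tup M l) \<in> T" unfolding T_def by (simp add: Sol_def fk_empty)
  from f(2)[rule_format, OF this] have z: "?z \<in> Sol l R c" using zt by (simp add: Q_def Sol_def)
  have "Ind (set ?z) C (D Un set c)"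
  proof (rule Ind_list)
    show "set ?z <= M" using f(1) by auto
    fix e \<theta> assume e: "set e <= D Un set c Un C" "\<theta> \<in> Def (length ?z + length e)" "?z @ e \<in> \<theta>"
    show "\<not> fk C (length ?z) (Sol (length ?z) \<theta> e)"
    proof
      assume "fk C (length ?z) (Sol (length ?z) \<theta> e)"
      then have "(e, \<theta>) \<in> T" using e unfolding T_def by simp
      from f(2)[rule_format, OF this] show False using e(3) by (simp add: Q_def)
    qed
  qed
  then show ?thesis using z by blast
qed

text \<open>Normal form of a dependence on \<open>a\<close>: the parameters of the forking formula
  are listed as all of \<open>a\<close> followed by elements of \<open>C\<close>, so that
  \<open>a\<close> can be replaced by a nearby or conjugate tuple.\<close>

lemma Ind_fails:
  assumes n: "\<not> Ind X C (set a)" and sm: "sm C" "set a <= M"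
  obtains x p R where "set x <= X" "set p <= C" "R \<in> Def (length x + (length a + length p))" "x @ a @ p \<in> R"
    "fk C (length x) (Sol (length x) R (a @ p))"
proof -
  obtain x y S where x: "set x <= X" "set y <= set a Un C" "S \<in> Def (length x + length y)" "x @ y \<in> S"
    "fk C (length x) (Sol (length x) S y)" using n unfolding Ind_def by blast
  from list_reindex[OF x(2)] obtain \<rho> p where p: "set p <= C" "!!i. i < length y ==> \<rho> i < length a + length p"
    "map (%i. (a @ p) ! \<rho> i) [0..<length y] = y" by metis
  let ?k = "length x" let ?n = "?k + (length a + length p)"
  let ?r = "%i. if i < ?k then i else ?k + \<rho> (i - ?k)"
  let ?R = "{w \<in> tup M ?n. map (%i. w ! ?r i) [0..<?k + length y] \<in> S}"
  have R: "?R \<in> Def ?n" by (rule Def_reindex[OF x(3)]) (use p(2) in auto)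
  have apM: "set (a @ p) <= M" using p(1) sm sm_sub by auto
  have e: "z @ a @ p \<in> ?R \<longleftrightarrow> z @ y \<in> S" if "z \<in> tup M ?k" for z
  proof -
    have y: "y ! i = (a @ p) ! \<rho> i" if "i < length y" for i using arg_cong[OF p(3), of "%v. v ! i"] that by simp
    have "map (%i. (z @ a @ p) ! ?r i) [0..<?k + length y] = z @ y"
      using that y by (intro nth_equalityI) (auto simp: nth_append tup_iff)
    moreover have "z @ a @ p \<in> tup M ?n" using that apM by (auto simp: tup_iff)
    ultimately show ?thesis by simp
  qed
  have xt: "x \<in> tup M ?k" using Def_length[OF x(3,4)] by (auto simp: tup_iff)
  have "x @ a @ p \<in> ?R" using e[OF xt] x(4) by blast
  moreover have "Sol ?k ?R (a @ p) = Sol ?k S y" using e unfolding Sol_def by blast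
  ultimately show ?thesis using that[OF x(1) p(1) R] x(5) by simp
qed

end

section \<open>Configurations of testers\<close>

text \<open>\<open>NB\<close> acts as a base of neighbourhoods of \<open>a\<close>, closed under
  intersection, and \<open>F\<close> accumulates at \<open>a\<close>. Neighbourhoods control both
  the type of \<open>a\<close> over \<open>A\<close> (\<open>NB_Def\<close>) and the formulas that
  fork with \<open>a\<close> (\<open>NB_fork\<close>).\<close>

locale worlds = simplestruct M Def \<nu>
  for M :: "'c set" and Def :: "nat => 'c list set set" and \<nu> :: "'v rel" +
  fixes A :: "'c set" and n m l :: nat and a b0 p0 :: "'c list" and F :: "'c list set" and NB :: "'c list set set" and \<Phi> :: "'c list set"
  assumes sA: "sm A" and at: "a \<in> tup M n" and b0t: "b0 \<in> tup M m" and p0A: "set p0 <= A"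
    and \<Phi>: "\<Phi> \<in> Def (l + (n + m + length p0))"
    and fork_ab0: "fk A l (Sol l \<Phi> (a @ b0 @ p0))"
    and F_tup: "F <= tup M n"
    and F_nf: "!!a' b. a' \<in> F ==> b \<in> tup M m ==> \<not> fk A l (Sol l \<Phi> (a' @ b @ p0))"
    and NB_full: "tup M n \<in> NB" and NB_Int: "!!O1 O2. O1 \<in> NB ==> O2 \<in> NB ==> O1 Int O2 \<in> NB"
    and NB_Def: "!!R p. set p <= A ==> R \<in> Def (n + length p) ==> a @ p \<in> R ==> Sol n R p \<in> NB"
    and NB_fork: "!!R p k. set p <= A ==> R \<in> Def (k + (n + length p)) ==> fk A k (Sol k R (a @ p)) ==>
        {a' \<in> tup M n. fk A k (Sol k R (a' @ p))} \<in> NB"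
    and NB_F: "!!X. X \<in> NB ==> \<exists>a'\<in>X. a' \<in> F"
begin

text \<open>A configuration is a set of testers \<open>Inl x\<close> and of constraints \<open>Inr (e, x)\<close>. It is legitimate if every
  finite part of it has a copy over a point \<open>h a\<close> of \<open>F\<close> arbitrarily close to \<open>a\<close> in which the testers are
  independent from \<open>h a\<close> and each constrained \<open>e\<close> is independent from its constraints and the testers.\<close>

definition tst :: "('c + 'c list \<times> 'c) set => 'c set" where "tst c = {x. Inl x \<in> c}"
definition cst :: "('c + 'c list \<times> 'c) set => 'c list => 'c set" where "cst c e = {x. Inr (e, x) \<in> c}"
definition fld :: "('c + 'c list \<times> 'c) set => 'c set" where
  "fld c = tst c Un (\<Union>e\<in>{e. cst c e ~= {}}. set e Un cst c e)"

definition ok :: "('c + 'c list \<times> 'c) set => 'c list set => ('c => 'c) => 'c set => bool" where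
  "ok c X h U \<longleftrightarrow> map h a \<in> F Int X & Ind (h ` (tst c Int U)) A (h ` set a) &
     (\<forall>e. cst c e ~= {} --> set e <= U --> eqt A e (map h e) & Ind (h ` set e) A (h ` ((cst c e Un tst c) Int U)))"

text \<open>Variables are named by the elements of \<open>M\<close> themselves, so
  \<open>idM\<close> is the actual configuration and \<open>Q\<close> an arbitrary formula over
  \<open>A\<close> true of it. A copy is an assignment \<open>h\<close> of the finite set
  \<open>U\<close> that satisfies \<open>Q\<close>.\<close>

definition legit :: "('c + 'c list \<times> 'c) set => bool" where
  "legit c \<longleftrightarrow> sm (fld c) & (\<forall>e. cst c e ~= {} --> length e = m) &
     (\<forall>U Q X. finite U --> U <= M --> set a <= U --> DF U A Q --> Q idM --> X \<in> NB -->
        (\<exists>h. range h <= M & Q h & ok c X h U))"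

lemma aM: "set a <= M" using at by (simp add: tup_iff)
lemma b0M: "set b0 <= M" using b0t by (simp add: tup_iff)
lemma AM: "A <= M" using sA by (rule sm_sub)

lemma tst_fld: "tst c <= fld c" by (auto simp: fld_def)
lemma cst_fld: "cst c e <= fld c" by (auto simp: fld_def)
lemma dom_fld: "cst c e ~= {} ==> set e <= fld c" by (auto simp: fld_def)

lemma legit_sm: "legit c ==> sm (fld c)" by (simp add: legit_def)
lemma legit_length: "legit c ==> cst c e ~= {} ==> length e = m" by (simp add: legit_def)

lemma legitD: "legit c ==> finite U ==> U <= M ==> set a <= U ==> DF U A Q ==> Q idM ==> X \<in> NB ==>
    \<exists>h. range h <= M & Q h & ok c X h U"
  unfolding legit_def by (elim conjE allE[of _ U] allE[of _ Q] allE[of _ X]) simp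

lemma sm_finite_image: "finite U ==> range h <= M ==> sm (h ` U)"
  by (rule sm_finite) auto

lemma okD:
  assumes "ok c X h U"
  shows "map h a \<in> F" "map h a \<in> X" "Ind (h ` (tst c Int U)) A (h ` set a)"
    "!!e. cst c e ~= {} ==> set e <= U ==> eqt A e (map h e)"
    "!!e. cst c e ~= {} ==> set e <= U ==> Ind (h ` set e) A (h ` ((cst c e Un tst c) Int U))"
  using assms unfolding ok_def by simp_all

lemma okI:
  assumes "map h a \<in> F" "map h a \<in> X" "Ind (h ` (tst c Int U)) A (h ` set a)"
    "!!e. cst c e ~= {} ==> set e <= U ==> eqt A e (map h e)"
    "!!e. cst c e ~= {} ==> set e <= U ==> Ind (h ` set e) A (h ` ((cst c e Un tst c) Int U))"
  shows "ok c X h U"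
  using assms unfolding ok_def by simp

lemma ok_mono: "ok c X h U ==> U' <= U ==> X <= X' ==> ok c X' h U'"
proof (rule okI)
  assume o: "ok c X h U" and s: "U' <= U" "X <= X'"
  note d = okD[OF o]
  show "map h a \<in> F" "map h a \<in> X'" using d(1,2) s(2) by auto
  show "Ind (h ` (tst c Int U')) A (h ` set a)" by (rule Ind_mono[OF d(3)]) (use s in auto)
  fix e assume e: "cst c e ~= {}" "set e <= U'"
  then have e': "set e <= U" using s by blast
  show "eqt A e (map h e)" by (rule d(4)[OF e(1) e'])
  show "Ind (h ` set e) A (h ` ((cst c e Un tst c) Int U'))" by (rule Ind_mono[OF d(5)[OF e(1) e']]) (use s in auto)
qed

lemma ok_cong:
  assumes o: "ok c X h U" and e: "!!x. x \<in> U ==> h x = h' x" and a: "set a <= U"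
  shows "ok c X h' U"
proof (rule okI)
  note d = okD[OF o]
  have im: "h' ` S = h ` S" if "S <= U" for S using e that by (force simp: image_def)
  have mp: "map h' u = map h u" if "set u <= U" for u using e that by auto
  show "map h' a \<in> F" "map h' a \<in> X" unfolding mp[OF a] by (rule d(1), rule d(2))
  show "Ind (h' ` (tst c Int U)) A (h' ` set a)" using d(3) im[OF a] im[OF Int_lower2[of "tst c" U]] by (simp only:)
  fix u assume u: "cst c u ~= {}" "set u <= U"
  show "eqt A u (map h' u)" unfolding mp[OF u(2)] by (rule d(4)[OF u])
  have "h' ` ((cst c u Un tst c) Int U) = h ` ((cst c u Un tst c) Int U)" by (rule im) blast
  then show "Ind (h' ` set u) A (h' ` ((cst c u Un tst c) Int U))" unfolding im[OF u(2)] using d(5)[OF u] by (simp only:)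
qed

lemma ok_restrict:
  assumes o: "ok c X h (U Int W)" and W: "fld c <= W"
  shows "ok c X h U"
proof (rule okI)
  note d = okD[OF o]
  have 1: "tst c Int (U Int W) = tst c Int U" using tst_fld[of c] W by blast
  show "map h a \<in> F" "map h a \<in> X" using d(1,2) by auto
  show "Ind (h ` (tst c Int U)) A (h ` set a)" using d(3) 1 by simp
  fix u assume u: "cst c u ~= {}" "set u <= U"
  have u': "set u <= U Int W" using u dom_fld[OF u(1)] W by blast
  show "eqt A u (map h u)" by (rule d(4)[OF u(1) u'])
  have "(cst c u Un tst c) Int (U Int W) = (cst c u Un tst c) Int U" using tst_fld[of c] cst_fld[of c u] W by blast
  then show "Ind (h ` set u) A (h ` ((cst c u Un tst c) Int U))" using d(5)[OF u(1) u'] by simp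
qed

text \<open>Variables outside \<open>W\<close> occur in no condition of \<open>ok\<close>; they are
  quantified away in \<open>Q\<close> and given values at the end.\<close>

lemma legitI:
  assumes f: "sm (fld c)" and len: "!!e. cst c e ~= {} ==> length e = m" and W: "set a Un fld c <= W"
    and ex: "!!U Q X. finite U ==> U <= W ==> U <= M ==> set a <= U ==> DF U A Q ==> Q idM ==> X \<in> NB ==>
       \<exists>h. range h <= M & Q h & ok c X h U"
  shows "legit c"
  unfolding legit_def
proof (intro conjI allI impI f len)
  fix U Q X assume U: "finite U" "U <= M" "set a <= U" "DF U A Q" "Q idM" "X \<in> NB"
  define Q0 where "Q0 h = (\<exists>g. range g <= M & (\<forall>i. i \<notin> U - W --> g i = h i) & Q g)" for h
  have d0: "DF (U - (U - W)) A Q0" unfolding Q0_def by (rule DF_exs[OF _ U(4)]) (use U(1) in simp)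
  have UW: "U - (U - W) = U Int W" by blast
  have aUW: "set a <= U Int W" using U(3) W by blast
  have "\<exists>h. range h <= M & Q0 h & ok c X h (U Int W)"
  proof (rule ex)
    show "DF (U Int W) A Q0" using d0 unfolding UW .
    show "Q0 idM" unfolding Q0_def using U(5) range_idM by (intro exI[of _ idM]) simp
  qed (use U aUW in auto)
  then obtain h where h: "range h <= M" "Q0 h" "ok c X h (U Int W)" by (elim exE conjE)
  obtain g where g: "range g <= M" "\<forall>i. i \<notin> U - W --> g i = h i" "Q g" using h(2) unfolding Q0_def by (elim exE conjE)
  have "ok c X g (U Int W)" by (rule ok_cong[OF h(3) _ aUW]) (use g(2) in auto)
  then have "ok c X g U" by (rule ok_restrict) (use W in blast)
  then show "\<exists>h. range h <= M & Q h & ok c X h U" using g by (intro exI[of _ g] conjI)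
qed

text \<open>Without testers and constraints only the position of the copy of \<open>a\<close>
  matters. Quantifying \<open>Q\<close> down to the entries of \<open>a\<close> gives a formula of
  tp(a/A); its solution set is a neighbourhood of \<open>a\<close>, so it meets \<open>F\<close>
  inside \<open>X\<close>.\<close>

lemma legit_empty: "legit {}"
proof (rule legitI[of _ UNIV])
  have e: "tst {} = {}" "cst {} u = {}" for u by (auto simp: tst_def cst_def)
  show "sm (fld {})" using sm_empty e by (simp add: fld_def)
  show "length u = m" if "cst {} u ~= {}" for u using that e by simp
  fix U Q X assume U: "finite U" "U <= M" "set a <= U" "DF U A Q" "Q idM" "X \<in> NB"
  \<comment> \<open>The entries of \<open>a\<close> get separate coordinates \<open>Inr i\<close>,
    tied to them by equations, since all of \<open>U\<close>, including \<open>set a\<close>, is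
    quantified away and entries may repeat.\<close>
  define Q2 where "Q2 g = (Q (g \<circ> Inl) & (\<forall>i\<in>{..<n}. g (Inl (a ! i)) = g (Inr i)))" for g :: "'c + nat => 'c"
  have la: "length a = n" using at by (simp add: tup_iff)
  have d2: "DF (Inl ` U Un Inr ` {..<n}) A Q2" unfolding Q2_def
  proof (rule DF_and)
    show "DF (Inl ` U Un Inr ` {..<n}) A (%g. Q (g \<circ> Inl))" by (rule DF_mono[OF DF_pull[OF U(4), of Inl]]) auto
    show "DF (Inl ` U Un Inr ` {..<n}) A (%g. \<forall>i\<in>{..<n}. g (Inl (a ! i)) = g (Inr i))"
    proof (rule DF_Ball)
      fix i assume i: "i \<in> {..<n}"
      then have "a ! i \<in> U" using U(3) la by (simp add: subset_iff)
      then show "DF (Inl ` U Un Inr ` {..<n}) A (%g. g (Inl (a ! i)) = g (Inr i))" using i by (intro DF_eqv) auto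
    qed simp
  qed
  let ?V = "Inl ` U :: ('c + nat) set"
  define Q3 where "Q3 g = (\<exists>g'. range g' <= M & (\<forall>i. i \<notin> ?V --> g' i = g i) & Q2 g')" for g
  let ?\<pi> = "case_sum (%_. 0) id :: 'c + nat => nat"
  have "DF (Inl ` U Un Inr ` {..<n} - ?V) A Q3" unfolding Q3_def by (rule DF_exs[OF _ d2]) (use U(1) in simp)
  then have "DF (Inr ` {..<n}) A Q3" by (rule DF_mono) auto
  from DF_pull[OF this, of ?\<pi>] have "DF {..<n} A (%f. Q3 (f \<circ> ?\<pi>))" by (rule DF_mono) auto
  from DF_Sol[OF this] obtain R p where R: "set p <= A Int M" "R \<in> Def (n + length p)"
    "\<forall>x\<in>tup M n. Q3 (asg x \<circ> ?\<pi>) = (x @ p \<in> R)" by (elim exE conjE)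
  have "Q3 (asg a \<circ> ?\<pi>)"
  proof -
    let ?g = "%i. case i of Inl x => if x \<in> U then idM x else asg a 0 | Inr i => asg a i"
    have r: "range ?g <= M" using asg_range[OF aM] range_idM by (auto simp: image_subset_iff split: sum.split)
    have "range (?g \<circ> Inl) <= M"
    proof (rule image_subsetI)
      fix x :: 'c
      have "?g (Inl x) \<in> M" using r by (rule subsetD) (rule rangeI)
      then show "(?g \<circ> Inl) x \<in> M" by (simp only: comp_apply)
    qed
    then have "Q (?g \<circ> Inl) = Q idM" by (rule DF_dep[OF U(4) _ range_idM]) simp
    moreover have "?g (Inl (a ! i)) = ?g (Inr i)" if "i < n" for i
    proof -
      have "a ! i \<in> set a" using that la by simp
      then have "a ! i \<in> U" "a ! i \<in> M" using U(3) aM by blast+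
      then show ?thesis using that la by (simp add: idM_def asg_def)
    qed
    ultimately have "Q2 ?g" unfolding Q2_def using U(5) by simp
    then show ?thesis unfolding Q3_def using r by (intro exI[of _ ?g]) (auto simp: image_iff split: sum.split)
  qed
  then have "a @ p \<in> R" using R(3) at by blast
  then have "Sol n R p Int X \<in> NB" using NB_Int[OF NB_Def U(6)] R(1,2) by blast
  from NB_F[OF this] obtain a' where a': "a' \<in> Sol n R p" "a' \<in> X" "a' \<in> F" by blast
  have a't: "a' \<in> tup M n" using a'(1) Sol_tup by blast
  have "Q3 (asg a' \<circ> ?\<pi>)" using R(3) a'(1) a't by (simp add: Sol_def)
  then obtain g where g: "range g <= M" "\<forall>i. i \<notin> ?V --> g i = (asg a' \<circ> ?\<pi>) i" "Q2 g" unfolding Q3_def by (elim exE conjE)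
  have "map (g \<circ> Inl) a = a'"
  proof (rule nth_equalityI)
    show "length (map (g \<circ> Inl) a) = length a'" using la a't by (simp add: tup_iff)
    fix i assume "i < length (map (g \<circ> Inl) a)"
    then have i: "i < n" using la by simp
    then have "g (Inl (a ! i)) = g (Inr i)" using g(3) unfolding Q2_def by simp
    also have "\<dots> = asg a' i" using g(2)[rule_format, of "Inr i"] by auto
    finally show "map (g \<circ> Inl) a ! i = a' ! i" using i la a't by (simp add: asg_def tup_iff)
  qed
  then have "ok {} X (g \<circ> Inl) U" using a' e Ind_empty[OF sA] unfolding ok_def by simp
  moreover have "range (g \<circ> Inl) <= M" using g(1) by auto
  moreover have "Q (g \<circ> Inl)" using g(3) unfolding Q2_def by blast
  ultimately show "\<exists>h. range h <= M & Q h & ok {} X h U" by (intro exI[of _ "g \<circ> Inl"] conjI)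
qed simp

text \<open>If a formula satisfied by testers forked with \<open>a\<close>, the points over which it
  forks would form a neighbourhood by \<open>NB_fork\<close>. A legitimate copy over such a point
  has testers satisfying a forking formula, although they are independent there.\<close>

lemma legit_tst_Ind:
  assumes c: "legit c" shows "Ind (set a) A (tst c)"
proof -
  have sT: "sm (tst c)" by (rule sm_mono[OF legit_sm[OF c] tst_fld])
  have "Ind (tst c) A (set a)"
  proof (rule ccontr)
    assume "\<not> Ind (tst c) A (set a)"
    then obtain x p R where x: "set x <= tst c" "set p <= A" "R \<in> Def (length x + (length a + length p))" "x @ a @ p \<in> R"
      "fk A (length x) (Sol (length x) R (a @ p))" by (rule Ind_fails[OF _ sA aM])
    have la: "length a = n" using at by (simp add: tup_iff)
    let ?X = "{a' \<in> tup M n. fk A (length x) (Sol (length x) R (a' @ p))}"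
    have X: "?X \<in> NB" by (rule NB_fork[OF x(2)]) (use x la in auto)
    let ?U = "set x Un set a"
    have xM: "set x <= M" using x(1) sT sm_sub by blast
    have "\<exists>h. range h <= M & map h (x @ a) @ p \<in> R & ok c ?X h ?U"
    proof (rule legitD[OF c])
      show "DF ?U A (%h. map h (x @ a) @ p \<in> R)" by (rule DF_mem[OF x(3)]) (use x(2) AM in auto)
      show "map idM (x @ a) @ p \<in> R" using map_idM[OF xM] map_idM[OF aM] x(4) by simp
    qed (use xM aM X in auto)
    then obtain h where h: "range h <= M" "map h (x @ a) @ p \<in> R" "ok c ?X h ?U" by (elim exE conjE)
    note d = okD[OF h(3)]
    have "set (map h x) <= h ` (tst c Int ?U)" using x(1) by auto
    moreover have "set (map h a @ p) <= h ` set a Un A" using x(2) by auto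
    ultimately show False using IndD[OF d(3), of "map h x" "map h a @ p" R] x(3) h(2) d(2) by simp
  qed
  then show ?thesis by (rule symmetry[OF _ sT sm_set[OF aM] sA])
qed

text \<open>The copy of \<open>e\<close> has the type of \<open>e\<close> over \<open>A\<close>, so
  forking carries over to it by conjugation (\<open>fk_eqt\<close>) and the whole space suffices as
  neighbourhood.\<close>

lemma legit_cst_Ind:
  assumes c: "legit c" and e: "cst c e ~= {}" shows "Ind (set e) A (cst c e Un tst c)"
proof -
  let ?T = "cst c e Un tst c"
  have sT: "sm ?T" by (rule sm_mono[OF legit_sm[OF c]]) (use tst_fld cst_fld in blast)
  have eM: "set e <= M" using dom_fld[OF e] sm_sub[OF legit_sm[OF c]] by blast
  have "Ind ?T A (set e)"
  proof (rule ccontr)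
    assume "\<not> Ind ?T A (set e)"
    then obtain x p R where x: "set x <= ?T" "set p <= A" "R \<in> Def (length x + (length e + length p))" "x @ e @ p \<in> R"
      "fk A (length x) (Sol (length x) R (e @ p))" by (rule Ind_fails[OF _ sA eM])
    let ?U = "set x Un set a Un set e"
    have xM: "set x <= M" using x(1) sT sm_sub by blast
    have "\<exists>h. range h <= M & map h (x @ e) @ p \<in> R & ok c (tup M n) h ?U"
    proof (rule legitD[OF c])
      show "DF ?U A (%h. map h (x @ e) @ p \<in> R)" by (rule DF_mem[OF x(3)]) (use x(2) AM in auto)
      show "map idM (x @ e) @ p \<in> R" using map_idM[OF xM] map_idM[OF eM] x(4) by simp
    qed (use xM aM eM NB_full in auto)
    then obtain h where h: "range h <= M" "map h (x @ e) @ p \<in> R" "ok c (tup M n) h ?U" by (elim exE conjE)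
    note d = okD[OF h(3)]
    have "Ind (h ` (?T Int ?U)) A (h ` set e)"
      by (rule symmetry[OF d(5)[OF e]]) (use sm_finite_image[OF _ h(1)] sA in auto)
    moreover have "set (map h x) <= h ` (?T Int ?U)" using x(1) by auto
    moreover have "set (map h e @ p) <= h ` set e Un A" using x(2) by auto
    moreover have "fk A (length x) (Sol (length x) R (map h e @ p))"
      by (rule fk_eqt[OF d(4)[OF e] sA x(2,3,5)]) auto
    ultimately show False using IndD[of "h ` (?T Int ?U)" A "h ` set e" "map h x" "map h e @ p" R] x(3) h(2) by simp
  qed
  then show ?thesis by (rule symmetry[OF _ sT sm_set[OF eM] sA])
qed

text \<open>At a finite \<open>U\<close>, \<open>ok\<close> sees only a finite trace of the union,
  and this trace lies in one member of the chain.\<close>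

lemma legit_Union:
  assumes ne: "\<C> ~= {}" and ch: "!!c d. c \<in> \<C> ==> d \<in> \<C> ==> c <= d \<or> d <= c" and lg: "!!c. c \<in> \<C> ==> legit c"
    and sf: "sm (fld (\<Union>\<C>))"
  shows "legit (\<Union>\<C>)"
proof (rule legitI[OF sf _ subset_UNIV])
  let ?c = "\<Union>\<C>"
  show len: "length e = m" if "cst ?c e ~= {}" for e
  proof -
    obtain c where "c \<in> \<C>" "cst c e ~= {}" using \<open>cst ?c e ~= {}\<close> by (auto simp: cst_def)
    then show ?thesis using lg legit_length by blast
  qed
  fix U Q X assume U: "finite U" "U <= M" "set a <= U" "DF U A Q" "Q idM" "X \<in> NB"
  define E where "E = {e. set e <= U & length e = m}"
  have fE: "finite E" unfolding E_def by (rule finite_lists_length_eq[OF U(1)])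
  \<comment> \<open>One chosen constraint per tuple is put into the trace even if it lies outside
    \<open>U\<close>: \<open>ok\<close> demands nothing of a tuple without constraints.\<close>
  define w where "w e = (SOME x. x \<in> cst ?c e)" for e
  define G where "G = ((Inl ` U Un Inr ` (E \<times> U)) Int ?c) Un (%e. Inr (e, w e)) ` {e \<in> E. cst ?c e ~= {}}"
  have fG: "finite G" unfolding G_def using U(1) fE by simp
  have wc: "Inr (e, w e) \<in> ?c" if "cst ?c e ~= {}" for e
  proof -
    have "w e \<in> cst ?c e" unfolding w_def using that by (simp add: some_in_eq)
    then show ?thesis by (simp add: cst_def)
  qed
  have "G <= ?c" unfolding G_def using wc by blast
  moreover have "subset.chain \<C> \<C>" unfolding subset_chain_def using ch by blast
  ultimately obtain c where c: "c \<in> \<C>" "G <= c" using finite_subset_Union_chain[OF fG _ ne] by metis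
  obtain h where h: "range h <= M" "Q h" "ok c X h U" using legitD[OF lg[OF c(1)] U] by (elim exE conjE)
  note d = okD[OF h(3)]
  have t: "tst ?c Int U = tst c Int U"
  proof
    show "tst c Int U <= tst ?c Int U" using c(1) by (auto simp: tst_def)
    have "Inl x \<in> G" if "x \<in> tst ?c Int U" for x using that unfolding G_def tst_def by simp
    then show "tst ?c Int U <= tst c Int U" using c(2) by (auto simp: tst_def)
  qed
  have s: "cst ?c e Int U = cst c e Int U" if e: "cst ?c e ~= {}" "set e <= U" for e
  proof
    show "cst c e Int U <= cst ?c e Int U" using c(1) by (auto simp: cst_def)
    have "Inr (e, x) \<in> G" if "x \<in> cst ?c e Int U" for x using that e len[OF e(1)] unfolding G_def cst_def E_def by simp
    then show "cst ?c e Int U <= cst c e Int U" using c(2) by (auto simp: cst_def)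
  qed
  have s2: "cst c e ~= {}" if e: "cst ?c e ~= {}" "set e <= U" for e
  proof -
    have "Inr (e, w e) \<in> G" unfolding G_def E_def using e len[OF e(1)] by simp
    then show ?thesis using c(2) by (auto simp: cst_def)
  qed
  have "ok ?c X h U"
  proof (rule okI[OF d(1,2)])
    show "Ind (h ` (tst ?c Int U)) A (h ` set a)" using d(3) t by simp
    fix e assume e: "cst ?c e ~= {}" "set e <= U"
    show "eqt A e (map h e)" by (rule d(4)[OF s2[OF e] e(2)])
    show "Ind (h ` set e) A (h ` ((cst ?c e Un tst ?c) Int U))" using d(5)[OF s2[OF e] e(2)] t s[OF e] by (simp add: Int_Un_distrib2)
  qed
  then show "\<exists>h. range h <= M & Q h & ok ?c X h U" using h by (intro exI[of _ h] conjI)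
qed

lemma NB_finite: "finite S ==> S <= NB ==> \<exists>Y\<in>NB. \<forall>X\<in>S. Y <= X"
proof (induction S rule: finite_induct)
  case empty then show ?case using NB_full by blast
next
  case (insert X S)
  then obtain Y where "Y \<in> NB" "\<forall>X\<in>S. Y <= X" by auto
  then show ?case using insert NB_Int[of X Y] by (intro bexI[of _ "X Int Y"]) auto
qed

text \<open>Common compactness step for adding a tuple \<open>z\<close>. A triple is bad if no
  nearby copy with an admissible \<open>z'\<close> satisfies its formula, and \<open>z\<close> is
  asked to avoid all bad formulas. If this were impossible, the failure of a finite part would be a
  formula true of the actual elements, hence true in a legitimate copy; there \<open>cond\<close>
  provides a \<open>z'\<close> that contradicts it.\<close>

lemma legit_extend:
  fixes \<Q>s :: "(('c + nat => 'c) => bool) set" and r :: nat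
  assumes c: "legit c" and W: "sm W" "set a Un fld c <= W" and V0: "finite V0" "V0 <= W"
    and q: "!!q. q \<in> \<Q>s ==> DF (Inl ` V0 Un Inr ` {..<r}) A q"
    and cond: "!!h U. range h <= M ==> finite U ==> U <= W ==> V0 <= U ==> map h a \<in> F ==>
      \<exists>z'\<in>tup M r. (\<forall>q\<in>\<Q>s. q (case_sum h (asg z'))) & Ind (set z') A (h ` U) & X z'"
  shows "\<exists>z\<in>tup M r. (\<forall>q\<in>\<Q>s. q (case_sum idM (asg z))) &
    (\<forall>U Q Y. finite U --> U <= W Un set z --> set a <= U --> DF U A Q --> Q idM --> Y \<in> NB -->
      (\<exists>h. range h <= M & Q h & ok c Y h (U Int W) & Ind (h ` set z) A (h ` (U Int W)) & X (map h z)))"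
proof -
  have WM: "W <= M" by (rule sm_sub[OF W(1)])
  have rcs: "range (case_sum h (asg z)) <= M" if "range h <= M" "z \<in> tup M r" for h :: "'c => 'c" and z
    using that asg_range[of z] by (auto simp: tup_iff image_subset_iff split: sum.split)
  define bad where "bad t \<longleftrightarrow> (case t of (U, Q, Y) => finite U & U <= W & set a <= U & DF (Inl ` U Un Inr ` {..<r}) A Q & Y \<in> NB &
     \<not> (\<exists>h z'. range h <= M & z' \<in> tup M r & Q (case_sum h (asg z')) & ok c Y h U & Ind (set z') A (h ` U) & X z'))"
    for t :: "'c set \<times> (('c + nat => 'c) => bool) \<times> 'c list set"
  define T where "T = Inl ` \<Q>s Un Inr ` {t. bad t}"
  define P where "P t = (case t of Inl q => q | Inr s => (%g. \<not> (fst (snd s)) g))"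
    for t :: "(('c + nat => 'c) => bool) + ('c set \<times> (('c + nat => 'c) => bool) \<times> 'c list set)"
  define vr where "vr t = (case t of Inl q => V0 | Inr s => fst s)"
    for t :: "(('c + nat => 'c) => bool) + ('c set \<times> (('c + nat => 'c) => bool) \<times> 'c list set)"
  have vr: "finite (vr t) & vr t <= W" if "t \<in> T" for t
    using that V0 unfolding T_def vr_def bad_def by auto
  have DP: "DF (Inl ` vr t Un Inr ` {..<r}) A (P t)" if "t \<in> T" for t
  proof (cases t)
    case (Inl q') then show ?thesis using that q unfolding T_def vr_def P_def by auto
  next
    case (Inr s)
    then have "DF (Inl ` fst s Un Inr ` {..<r}) A (fst (snd s))" using that unfolding T_def bad_def by auto
    from DF_not[OF this] show ?thesis unfolding Inr vr_def P_def by simp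
  qed
  have "\<exists>f. range f <= M & (\<forall>t\<in>T. P t (case_sum idM f))"
  proof (rule compactness_indexed[of "{..<r}" "A Un W"])
    show "|{..<r}| \<le>o \<nu>" by (rule finite_le_nu) simp
    show "sm (A Un W)" by (rule sm_Un[OF sA W(1)])
    show "DF {..<r} (A Un W) (%f. P t (case_sum idM f))" if "t \<in> T" for t
      by (rule DF_mono[OF DF_subst[OF DP[OF that]]]) (use vr[OF that] WM in auto)
    fix T0 assume T0: "T0 <= T" "finite T0"
    let ?U = "set a Un V0 Un (\<Union>t\<in>T0. vr t)"
    have fU: "finite ?U" using V0(1) T0 vr by auto
    have UW: "?U <= W" using W(2) V0(2) T0(1) vr by blast
    define B where "B = {s. Inr s \<in> T0}"
    have fB: "finite B" unfolding B_def using finite_vimageI[OF T0(2), of Inr] by (simp add: vimage_def)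
    have Bbad: "bad s" if "s \<in> B" for s using that T0(1) unfolding B_def T_def by auto
    have "(%s. snd (snd s)) ` B <= NB" using Bbad unfolding bad_def by fastforce
    from NB_finite[OF finite_imageI[OF fB] this] obtain Y where Y: "Y \<in> NB" "\<forall>s\<in>B. Y <= snd (snd s)" by auto
    define PP where "PP g = (\<forall>t\<in>T0. P t g)" for g
    have dPP: "DF (Inl ` ?U Un Inr ` {..<r}) A PP" unfolding PP_def
    proof (rule DF_Ball[OF T0(2)])
      fix t assume t: "t \<in> T0"
      show "DF (Inl ` ?U Un Inr ` {..<r}) A (P t)" by (rule DF_mono[OF DP]) (use t T0(1) in auto)
    qed
    show "\<exists>f. range f <= M & (\<forall>t\<in>T0. P t (case_sum idM f))"
    proof (rule ccontr)
      assume no: "\<not> ?thesis"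
      define QQ where "QQ f = (\<not> (\<exists>z\<in>tup M r. PP (case_sum f (asg z))))" for f
      have dQ: "DF ?U A QQ" unfolding QQ_def by (rule DF_not[OF DF_tuple[OF dPP]])
      have "QQ idM" unfolding QQ_def
      proof
        assume "\<exists>z\<in>tup M r. PP (case_sum idM (asg z))"
        then obtain z where z: "z \<in> tup M r" "PP (case_sum idM (asg z))" by (elim bexE)
        have "range (asg z) <= M" by (rule asg_range) (use z(1) in \<open>simp add: tup_iff\<close>)
        then have "\<exists>f. range f <= M & (\<forall>t\<in>T0. P t (case_sum idM f))" using z(2) unfolding PP_def by (intro exI[of _ "asg z"] conjI)
        with no show False by (rule notE)
      qed
      have "\<exists>h. range h <= M & QQ h & ok c Y h ?U"
      proof (rule legitD[OF c fU _ _ dQ \<open>QQ idM\<close> Y(1)])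
        show "?U <= M" using UW WM by (rule order_trans)
      qed blast
      then obtain h where h: "range h <= M" "QQ h" "ok c Y h ?U" by (elim exE conjE)
      have "\<exists>z'\<in>tup M r. (\<forall>q\<in>\<Q>s. q (case_sum h (asg z'))) & Ind (set z') A (h ` ?U) & X z'"
        by (rule cond[OF h(1) fU UW _ okD(1)[OF h(3)]]) auto
      then obtain z where z: "z \<in> tup M r" "\<forall>q\<in>\<Q>s. q (case_sum h (asg z))" "Ind (set z) A (h ` ?U)" "X z" by (elim bexE conjE)
      have "\<not> PP (case_sum h (asg z))" using h(2) z(1) unfolding QQ_def by (simp only: not_not bex_simps) metis
      then have "\<exists>t\<in>T0. \<not> P t (case_sum h (asg z))" unfolding PP_def by simp
      then obtain t where t: "t \<in> T0" "\<not> P t (case_sum h (asg z))" by (elim bexE)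
      show False
      proof (cases t)
        case (Inl q')
        then have "q' \<in> \<Q>s" using t(1) T0(1) unfolding T_def by auto
        from bspec[OF z(2) this] show False using t(2) unfolding Inl P_def by simp
      next
        case (Inr s)
        obtain U' Q' Y' where s: "s = (U', Q', Y')" by (cases s)
        have sB: "s \<in> B" using Inr t(1) unfolding B_def by simp
        have U': "U' <= ?U"
        proof -
          have "vr t = U'" unfolding Inr s vr_def by simp
          then show ?thesis using t(1) by blast
        qed
        have "Q' (case_sum h (asg z))" using t(2) unfolding Inr s P_def by simp
        moreover have "ok c Y' h U'" by (rule ok_mono[OF h(3) U']) (use bspec[OF Y(2) sB] s in auto)
        moreover have "Ind (set z) A (h ` U')" by (rule Ind_mono[OF z(3) order_refl image_mono[OF U']])
        ultimately have "\<exists>h z'. range h <= M & z' \<in> tup M r & Q' (case_sum h (asg z')) & ok c Y' h U' & Ind (set z') A (h ` U') & X z'"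
          using h(1) z(1,4) by (intro exI[of _ h] exI[of _ z] conjI)
        moreover have "\<not> (\<exists>h z'. range h <= M & z' \<in> tup M r & Q' (case_sum h (asg z')) & ok c Y' h U' & Ind (set z') A (h ` U') & X z')"
          using Bbad[OF sB] unfolding s bad_def prod.case by (elim conjE)
        ultimately show False by (rule notE[rotated])
      qed
    qed
  qed
  then obtain f where f: "range f <= M" "\<forall>t\<in>T. P t (case_sum idM f)" by (elim exE conjE)
  let ?z = "map f [0..<r]"
  have zt: "?z \<in> tup M r" using f(1) by (auto simp: tup_iff)
  have fz: "P t (case_sum idM (asg ?z))" if t: "t \<in> T" for t
  proof -
    have "P t (case_sum idM (asg ?z)) = P t (case_sum idM f)"
    proof (rule DF_dep[OF DP[OF t]])
      show "range (case_sum idM (asg ?z)) <= M" by (rule rcs[OF range_idM zt])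
      show "range (case_sum idM f) <= M" using f(1) range_idM by (auto simp: image_subset_iff split: sum.split)
    qed (auto simp: asg_def)
    then show ?thesis using bspec[OF f(2) t] by (simp only:)
  qed
  show ?thesis
  proof (intro bexI[of _ ?z] conjI ballI allI impI zt)
    show "q (case_sum idM (asg ?z))" if "q \<in> \<Q>s" for q
    proof -
      have "Inl q \<in> T" unfolding T_def using that by blast
      from fz[OF this] show ?thesis unfolding P_def by (simp only: sum.case)
    qed
    fix U Q Y assume U: "finite U" "U <= W Un set ?z" "set a <= U" "DF U A Q" "Q idM" "Y \<in> NB"
    define z where "z = ?z"
    have zt': "z \<in> tup M r" using zt unfolding z_def .
    have lz: "length z = r" unfolding z_def by simp
    have zM: "set z <= M" using zt' by (simp add: tup_iff)
    let ?U0 = "U Int W"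
    have aU0: "set a <= ?U0" using U(3) W(2) by blast
    define idx where "idx x = (SOME i. i < r & z ! i = x)" for x
    have idx: "idx x < r & z ! idx x = x" if "x \<in> set z" for x
    proof -
      have "\<exists>i. i < r & z ! i = x" using that lz by (metis in_set_conv_nth)
      then show ?thesis unfolding idx_def by (rule someI_ex)
    qed
    \<comment> \<open>Entries of \<open>z\<close> may repeat or lie in \<open>W\<close>. Each
      element of \<open>z\<close> is represented by one index \<open>idx\<close>, and
      \<open>Q'\<close> records the coincidences, so that the values on \<open>U\<close> and on
      \<open>z\<close> fit together.\<close>
    define \<pi> where "\<pi> x = (if x \<in> set z then Inr (idx x) else Inl x)" for x
    define Q' where "Q' g = (Q (g \<circ> \<pi>) & (\<forall>x\<in>?U0 Int set z. g (Inl x) = g (Inr (idx x))) & (\<forall>i\<in>{..<r}. g (Inr i) = g (Inr (idx (z ! i)))))" for g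
    have "DF (Inl ` ?U0 Un Inr ` {..<r}) A Q'" unfolding Q'_def
    proof (intro DF_and DF_Ball)
      have "\<pi> ` U <= Inl ` ?U0 Un Inr ` {..<r}" using U(2) idx unfolding \<pi>_def z_def[symmetric] by auto
      then show "DF (Inl ` ?U0 Un Inr ` {..<r}) A (%g. Q (g \<circ> \<pi>))" by (rule DF_mono[OF DF_pull[OF U(4)]]) simp
      show "DF (Inl ` ?U0 Un Inr ` {..<r}) A (%g. g (Inl x) = g (Inr (idx x)))" if "x \<in> ?U0 Int set z" for x
        by (rule DF_eqv) (use that idx in auto)
      show "DF (Inl ` ?U0 Un Inr ` {..<r}) A (%g. g (Inr i) = g (Inr (idx (z ! i))))" if "i \<in> {..<r}" for i
        by (rule DF_eqv) (use that idx lz in auto)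
    qed (use U(1) in auto)
    note dQ' = this
    have Q'z: "Q' (case_sum idM (asg z))"
    proof -
      let ?g = "case_sum idM (asg z)"
      have az: "asg z (idx x) = x" if "x \<in> set z" for x using idx[OF that] lz by (simp add: asg_def)
      have gx: "(?g \<circ> \<pi>) x = x" if "x \<in> M" for x using az[of x] idM_M[OF that] unfolding \<pi>_def by auto
      have UM: "U <= M" using U(2) WM zM unfolding z_def[symmetric] by blast
      have rg: "range (?g \<circ> \<pi>) <= M" using rcs[OF range_idM zt'] by auto
      have "Q (?g \<circ> \<pi>) = Q idM"
      proof (rule DF_dep[OF U(4) rg range_idM])
        fix i assume "i \<in> U"
        then have "i \<in> M" using UM by blast
        then show "(?g \<circ> \<pi>) i = idM i" using gx idM_M by simp
      qed
      moreover have "?g (Inl x) = ?g (Inr (idx x))" if "x \<in> ?U0 Int set z" for x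
        using az[of x] that idM_M[of x] zM by auto
      moreover have "?g (Inr i) = ?g (Inr (idx (z ! i)))" if "i \<in> {..<r}" for i
        using az[of "z ! i"] that lz by (simp add: asg_def)
      ultimately show ?thesis unfolding Q'_def using U(5) by simp
    qed
    have nbad: "\<not> bad (?U0, Q', Y)"
    proof
      assume "bad (?U0, Q', Y)"
      then have "Inr (?U0, Q', Y) \<in> T" unfolding T_def by blast
      from fz[OF this] show False using Q'z unfolding P_def z_def by simp
    qed
    have "\<exists>h z'. range h <= M & z' \<in> tup M r & Q' (case_sum h (asg z')) & ok c Y h ?U0 & Ind (set z') A (h ` ?U0) & X z'"
    proof (rule ccontr)
      assume no: "\<not> ?thesis"
      have "bad (?U0, Q', Y)" unfolding bad_def prod.case
      proof (intro conjI)
        show "finite ?U0" using U(1) by simp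
        show "?U0 <= W" by simp
      qed (rule aU0 dQ' U(6) no)+
      with nbad show False by (rule notE)
    qed
    then obtain h z' where h: "range h <= M" "z' \<in> tup M r" "Q' (case_sum h (asg z'))" "ok c Y h ?U0" "Ind (set z') A (h ` ?U0)" "X z'"
      by (elim exE conjE)
    let ?h = "case_sum h (asg z') \<circ> \<pi>"
    have lz': "length z' = r" using h(2) by (simp add: tup_iff)
    note h3 = h(3)[unfolded Q'_def]
    have eq: "h x = ?h x" if x: "x \<in> ?U0" for x
    proof (cases "x \<in> set z")
      case True
      then show ?thesis using bspec[OF h3[THEN conjunct2, THEN conjunct1], of x] x unfolding \<pi>_def by simp
    next
      case False then show ?thesis unfolding \<pi>_def by simp
    qed
    have mz: "map ?h z = z'"
    proof (rule nth_equalityI)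
      show "length (map ?h z) = length z'" using lz lz' by simp
      fix i assume "i < length (map ?h z)"
      then have i: "i < r" using lz by simp
      then have "z ! i \<in> set z" using lz by simp
      then have "?h (z ! i) = asg z' (idx (z ! i))" unfolding \<pi>_def by simp
      also have "\<dots> = asg z' i" using bspec[OF h3[THEN conjunct2, THEN conjunct2], of i] i by simp
      finally show "map ?h z ! i = z' ! i" using i lz lz' by (simp add: asg_def)
    qed
    have 1: "range ?h <= M" using rcs[OF h(1,2)] by auto
    have 2: "Q ?h" by (rule h3[THEN conjunct1])
    have 3: "ok c Y ?h ?U0" by (rule ok_cong[OF h(4) eq aU0])
    have "?h ` set z = set z'" using mz by (metis image_set)
    moreover have "?h ` ?U0 = h ` ?U0" using eq by (intro image_cong refl) simp
    ultimately have 4: "Ind (?h ` set z) A (?h ` ?U0)" using h(5) by simp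
    have 5: "X (map ?h z)" using h(6) mz by simp
    show "\<exists>h. range h <= M & Q h & ok c Y h (U Int W) & Ind (h ` set ?z) A (h ` (U Int W)) & X (map h ?z)"
      unfolding z_def[symmetric] using 1 2 3 4 5 by (intro exI[of _ ?h] conjI)
  qed
qed

text \<open>Over a point of \<open>F\<close> the formula forks for no \<open>b\<close>, so by
  \<open>nonforking_realization\<close> every copy has a tester free from the copied part;
  \<open>legit_extend\<close> produces one over \<open>a\<close> itself.\<close>

lemma legit_tester:
  assumes c: "legit c" and b: "b \<in> tup M m"
  shows "\<exists>z\<in>tup M l. z @ a @ b @ p0 \<in> \<Phi> & legit (c Un Inl ` set z)"
proof -
  let ?W = "set a Un fld c Un set b" and ?V = "set a Un set b"
  have la: "length a = n" using at by (simp add: tup_iff)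
  have lb: "length b = m" and bM: "set b <= M" using b by (auto simp: tup_iff)
  have p0M: "set p0 <= M" using p0A AM by blast
  have sW: "sm ?W" using sm_set[OF aM] sm_set[OF bM] legit_sm[OF c] sm_Un by blast
  let ?q = "%g :: 'c + nat => 'c. map g (map Inr [0..<l] @ map Inl (a @ b)) @ p0 \<in> \<Phi>"
  have mq: "?q (case_sum h (asg z)) = (z @ map h a @ map h b @ p0 \<in> \<Phi>)" if "z \<in> tup M l" for h z
    using map_asg[of z] that by (simp add: case_sum_o_inj tup_iff)
  have "\<exists>z\<in>tup M l. (\<forall>q\<in>{?q}. q (case_sum idM (asg z))) &
    (\<forall>U Q Y. finite U --> U <= ?W Un set z --> set a <= U --> DF U A Q --> Q idM --> Y \<in> NB -->
      (\<exists>h. range h <= M & Q h & ok c Y h (U Int ?W) & Ind (h ` set z) A (h ` (U Int ?W)) & True))"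
  proof (rule legit_extend[OF c sW])
    show "set a Un fld c <= ?W" "?V <= ?W" "finite ?V" by auto
    show "DF (Inl ` ?V Un Inr ` {..<l}) A q" if "q \<in> {?q}" for q
    proof -
      have "DF (Inl ` ?V Un Inr ` {..<l}) A ?q"
        by (rule DF_mem[OF \<Phi>]) (use la lb p0A p0M in auto)
      then show ?thesis using that by simp
    qed
    fix h U assume h: "range h <= M" "finite U" "U <= ?W" "?V <= U" "map h a \<in> F"
    let ?c = "map h a @ map h b @ p0"
    have hM: "set ?c <= M" using h(1) p0M by auto
    have "map h b \<in> tup M m" using h(1) lb by (auto simp: tup_iff)
    from F_nf[OF h(5) this] have nf: "\<not> fk A l (Sol l \<Phi> ?c)" .
    have "\<Phi> \<in> Def (l + length ?c)" using \<Phi> la lb by (simp add: add.assoc)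
    from nonforking_realization[OF this hM nf sA sm_finite_image[OF h(2,1)]] obtain z where z: "z \<in> Sol l \<Phi> ?c" "Ind (set z) A (h ` U Un set ?c)" by (elim bexE)
    have zt: "z \<in> tup M l" using z(1) Sol_tup by blast
    have "Ind (set z) A (h ` U)" by (rule Ind_mono[OF z(2)]) auto
    then show "\<exists>z'\<in>tup M l. (\<forall>q\<in>{?q}. q (case_sum h (asg z'))) & Ind (set z') A (h ` U) & True"
      using z(1) zt mq[OF zt] by (intro bexI[of _ z]) (simp_all add: Sol_def)
  qed
  then obtain z where z: "z \<in> tup M l" "\<forall>q\<in>{?q}. q (case_sum idM (asg z))"
    "\<forall>U Q Y. finite U --> U <= ?W Un set z --> set a <= U --> DF U A Q --> Q idM --> Y \<in> NB -->
      (\<exists>h. range h <= M & Q h & ok c Y h (U Int ?W) & Ind (h ` set z) A (h ` (U Int ?W)) & True)" by (elim bexE conjE)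
  have zM: "set z <= M" using z(1) by (simp add: tup_iff)
  have "z @ a @ b @ p0 \<in> \<Phi>" using z(2) mq[OF z(1), of idM] map_idM[OF aM] map_idM[OF bM] by simp
  moreover have "legit (c Un Inl ` set z)"
  proof (rule legitI[of _ "?W Un set z"])
    let ?c = "c Un Inl ` set z"
    have t: "tst ?c = tst c Un set z" by (auto simp: tst_def)
    have k: "cst ?c = cst c" by (auto simp: cst_def fun_eq_iff)
    have f: "fld ?c = fld c Un set z" unfolding fld_def t k by blast
    show "sm (fld ?c)" unfolding f by (rule sm_Un[OF legit_sm[OF c] sm_set[OF zM]])
    show "length e = m" if "cst ?c e ~= {}" for e using legit_length[OF c] that k by simp
    show "set a Un fld ?c <= ?W Un set z" unfolding f by blast
    fix U Q Y assume U: "finite U" "U <= ?W Un set z" "U <= M" "set a <= U" "DF U A Q" "Q idM" "Y \<in> NB"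
    from z(3)[rule_format, OF U(1,2,4,5,6,7)] obtain h where h: "range h <= M" "Q h" "ok c Y h (U Int ?W)" "Ind (h ` set z) A (h ` (U Int ?W))" by (elim exE conjE)
    have o: "ok c Y h U" by (rule ok_restrict[OF h(3)]) blast
    note d = okD[OF o]
    have fin: "sm (h ` S)" if "S <= U \<or> S <= set z" for S
      by (rule sm_finite_image[OF _ h(1)]) (use that U(1) finite_subset in auto)
    have "ok ?c Y h U"
    proof (rule okI[OF d(1,2)])
      \<comment> \<open>The new tester is independent from the entire copied part, so transitivity
        adds it to the old testers here and to the constraints of each \<open>e\<close>
        below.\<close>
      have "Ind (h ` set z) (A Un h ` (tst c Int U)) (h ` set a)"
        by (rule Ind_mono[OF Ind_base_mono[OF h(4), of "A Un h ` (tst c Int U)"]]) (use tst_fld[of c] U(4) in auto)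
      then have "Ind (h ` (tst c Int U) Un h ` set z) A (h ` set a)"
        by (rule left_transitivity[OF d(3)]) (use fin sA U(4) in auto)
      then show "Ind (h ` (tst ?c Int U)) A (h ` set a)" by (rule Ind_mono) (auto simp: t)
      fix e assume "cst ?c e ~= {}" and eU: "set e <= U"
      then have e: "cst c e ~= {}" using k by simp
      show "eqt A e (map h e)" by (rule d(4)[OF e eU])
      let ?G = "h ` ((cst c e Un tst c) Int U)"
      have G: "?G <= h ` (U Int ?W)" using tst_fld[of c] cst_fld[of c e] by auto
      have eW: "h ` set e <= h ` (U Int ?W)" using eU dom_fld[OF e] by auto
      have "Ind ?G A (h ` set e)" by (rule symmetry[OF d(5)[OF e eU]]) (use fin eU sA in auto)
      moreover have "Ind (h ` set z) (A Un ?G) (h ` set e)"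
        by (rule Ind_mono[OF Ind_base_mono[OF h(4), of "A Un ?G"] order_refl eW]) (use G in auto)
      ultimately have "Ind (?G Un h ` set z) A (h ` set e)"
        by (rule left_transitivity) (use fin eU sA in auto)
      then have "Ind (h ` set e) A (?G Un h ` set z)"
        by (rule symmetry) (use fin eU sA sm_Un in auto)
      then show "Ind (h ` set e) A (h ` ((cst ?c e Un tst ?c) Int U))" by (rule Ind_mono) (auto simp: t k)
    qed
    then show "\<exists>h. range h <= M & Q h & ok ?c Y h U" using h by (intro exI[of _ h] conjI)
  qed
  ultimately show ?thesis using z(1) by blast
qed

text \<open>In every copy tp(b0/A) has a realization free from the copied part. The formulas
  \<open>\<Q>s\<close> make \<open>e\<close> realize tp(b0/A), and the predicate passed to
  \<open>legit_extend\<close> does the same for its copies.\<close>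

lemma legit_constrained:
  assumes c: "legit c" and G: "sm G"
  shows "\<exists>e\<in>tup M m. eqt A b0 e & legit (c Un Inr ` ({e} \<times> G))"
proof -
  let ?W = "set a Un fld c Un G"
  have lb: "length b0 = m" using b0t by (simp add: tup_iff)
  have sW: "sm ?W" using sm_set[OF aM] G legit_sm[OF c] sm_Un by blast
  define qf where "qf p R = (%g :: 'c + nat => 'c. map g (map Inr [0..<m]) @ p \<in> R)" for p R
  define \<Q>s where "\<Q>s = {qf p R | R p. set p <= A & R \<in> Def (m + length p) & b0 @ p \<in> R}"
  have mq: "qf p R (case_sum h (asg z)) = (z @ p \<in> R)" if "z \<in> tup M m" for h z p R
    using map_asg[of z] that unfolding qf_def by (simp add: case_sum_o_inj tup_iff)
  have "\<exists>z\<in>tup M m. (\<forall>q\<in>\<Q>s. q (case_sum idM (asg z))) &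
    (\<forall>U Q Y. finite U --> U <= ?W Un set z --> set a <= U --> DF U A Q --> Q idM --> Y \<in> NB -->
      (\<exists>h. range h <= M & Q h & ok c Y h (U Int ?W) & Ind (h ` set z) A (h ` (U Int ?W)) & eqt A b0 (map h z)))"
  proof (rule legit_extend[OF c sW])
    show "set a Un fld c <= ?W" "{} <= ?W" "finite {}" by auto
    show "DF (Inl ` {} Un Inr ` {..<m}) A q" if qQ: "q \<in> \<Q>s" for q
    proof -
      obtain R p where R: "q = qf p R" "set p <= A" "R \<in> Def (m + length p)"
        using qQ unfolding \<Q>s_def by blast
      show ?thesis unfolding R(1) qf_def by (rule DF_mem[OF R(3)]) (use R(2) AM in auto)
    qed
    fix h :: "'c => 'c" and U assume h: "range h <= M" "finite (U :: 'c set)"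
    from nonforking_extension_exists[OF sA sm_finite_image[OF h(2,1)] b0M] obtain z where z: "eqt A b0 z" "Ind (set z) A (h ` U)" by (elim exE conjE)
    have zt: "z \<in> tup M m" using eqt_length[OF z(1)] eqt_M[OF z(1)] lb by (simp add: tup_iff)
    have "q (case_sum h (asg z))" if qQ: "q \<in> \<Q>s" for q
    proof -
      obtain R p where R: "q = qf p R" "set p <= A" "R \<in> Def (m + length p)" "b0 @ p \<in> R"
        using qQ unfolding \<Q>s_def by blast
      show ?thesis unfolding R(1) mq[OF zt] by (rule eqtD[OF z(1) R(4) _ R(2)]) (use R(3) lb in simp)
    qed
    then show "\<exists>z'\<in>tup M m. (\<forall>q\<in>\<Q>s. q (case_sum h (asg z'))) & Ind (set z') A (h ` U) & eqt A b0 z'"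
      using z zt by (intro bexI[of _ z] conjI ballI)
  qed
  then obtain e where e: "e \<in> tup M m" "\<forall>q\<in>\<Q>s. q (case_sum idM (asg e))"
    "\<forall>U Q Y. finite U --> U <= ?W Un set e --> set a <= U --> DF U A Q --> Q idM --> Y \<in> NB -->
      (\<exists>h. range h <= M & Q h & ok c Y h (U Int ?W) & Ind (h ` set e) A (h ` (U Int ?W)) & eqt A b0 (map h e))" by (elim bexE conjE)
  have eM: "set e <= M" using e(1) by (simp add: tup_iff)
  have eb: "eqt A b0 e"
  proof (rule eqtI)
    show "length b0 = length e" "set b0 <= M" "set e <= M" using lb b0M e(1) by (auto simp: tup_iff)
    fix R p assume R: "set p <= A" "R \<in> Def (length b0 + length p)" "b0 @ p \<in> R"
    then have "qf p R \<in> \<Q>s" unfolding \<Q>s_def using lb by blast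
    from bspec[OF e(2) this] show "e @ p \<in> R" using mq[OF e(1)] by simp
  qed
  moreover have "legit (c Un Inr ` ({e} \<times> G))"
  proof (rule legitI[of _ "?W Un set e"])
    let ?c = "c Un Inr ` ({e} \<times> G)"
    have t: "tst ?c = tst c" by (auto simp: tst_def)
    have k: "cst ?c u = (if u = e then cst c e Un G else cst c u)" for u by (auto simp: cst_def)
    have f: "fld ?c <= fld c Un G Un set e"
    proof
      fix x assume "x \<in> fld ?c"
      then consider "x \<in> tst c" | u where "cst ?c u ~= {}" "x \<in> set u Un cst ?c u" unfolding fld_def t by blast
      then show "x \<in> fld c Un G Un set e"
      proof cases
        case 1 then show ?thesis using tst_fld by blast
      next
        case 2
        show ?thesis
        proof (cases "u = e")
          case True
          then have "x \<in> set e Un (cst c e Un G)" using 2(2) k[of u] by simp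
          then show ?thesis using cst_fld[of c e] by blast
        next
          case False
          then have "cst c u ~= {}" "x \<in> set u Un cst c u" using 2 k[of u] by simp_all
          then show ?thesis using cst_fld[of c u] dom_fld[of c u] by blast
        qed
      qed
    qed
    show "sm (fld ?c)" by (rule sm_mono[OF sm_Un[OF sm_Un[OF legit_sm[OF c] G] sm_set[OF eM]] f])
    show "length u = m" if "cst ?c u ~= {}" for u using legit_length[OF c, of u] that k[of u] e(1) by (auto simp: tup_iff split: if_splits)
    show "set a Un fld ?c <= ?W Un set e" using f by blast
    fix U Q Y assume U: "finite U" "U <= ?W Un set e" "U <= M" "set a <= U" "DF U A Q" "Q idM" "Y \<in> NB"
    from e(3)[rule_format, OF U(1,2,4,5,6,7)] obtain h where h: "range h <= M" "Q h" "ok c Y h (U Int ?W)" "Ind (h ` set e) A (h ` (U Int ?W))" "eqt A b0 (map h e)" by (elim exE conjE)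
    have o: "ok c Y h U" by (rule ok_restrict[OF h(3)]) blast
    note d = okD[OF o]
    have "ok ?c Y h U"
    proof (rule okI[OF d(1,2)])
      show "Ind (h ` (tst ?c Int U)) A (h ` set a)" using d(3) t by simp
      fix u assume u: "cst ?c u ~= {}" "set u <= U"
      show "eqt A u (map h u)"
      proof (cases "u = e")
        case True then show ?thesis using eqt_trans[OF eqt_sym[OF eb] h(5)] by simp
      next
        case False then show ?thesis using d(4)[of u] u k by simp
      qed
      show "Ind (h ` set u) A (h ` ((cst ?c u Un tst ?c) Int U))"
      proof (cases "u = e")
        case True
        show ?thesis unfolding True by (rule Ind_mono[OF h(4)]) (use tst_fld[of c] cst_fld[of c e] in \<open>auto simp: t k\<close>)
      next
        case False then show ?thesis using d(5)[of u] u k t by simp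
      qed
    qed
    then show "\<exists>h. range h <= M & Q h & ok ?c Y h U" using h by (intro exI[of _ h] conjI)
  qed
  ultimately show ?thesis using e(1) by blast
qed

end

section \<open>Indiscernible sequences of constrained tuples\<close>

lemma concat_nth_block:
  "(!!d. d \<in> set ds ==> length d = m) ==> q < length ds ==> p < m ==> concat ds ! (q * m + p) = ds ! q ! p"
proof (induction ds arbitrary: q)
  case (Cons d ds)
  have d: "length d = m" using Cons.prems by simp
  show ?case
  proof (cases q)
    case 0 then show ?thesis using d Cons.prems by (simp add: nth_append)
  next
    case (Suc q')
    have "concat ds ! (q' * m + p) = ds ! q' ! p" using Cons.IH[of q'] Cons.prems Suc by auto
    then show ?thesis using d Suc by (simp add: nth_append add.assoc)
  qed
qed simp

lemma length_concat_block: "(!!d. d \<in> set ds ==> length d = m) ==> length (concat ds) = length ds * m"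
  by (induction ds) auto

lemma block_less: "q < r ==> p < m ==> q * m + p < r * (m::nat)"
proof -
  assume a: "q < r" "p < m"
  then have "q * m + p < Suc q * m" by simp
  also have "\<dots> \<le> r * m" using a by (intro mult_le_mono1) simp
  finally show ?thesis .
qed

context simplestruct
begin

lemma algb_eqt: "eqt C b b' ==> algb C b ==> algb C b'"
  unfolding algb_def using eqtD eqt_length by (metis (no_types, lifting))

end

context worlds
begin

lemma fld_Union: "fld (\<Union>\<C>) = (\<Union>c\<in>\<C>. fld c)"
proof
  show "fld (\<Union>\<C>) <= (\<Union>c\<in>\<C>. fld c)"
  proof
    fix x assume "x \<in> fld (\<Union>\<C>)"
    then consider "x \<in> tst (\<Union>\<C>)" | u where "cst (\<Union>\<C>) u ~= {}" "x \<in> set u" | u where "x \<in> cst (\<Union>\<C>) u"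
      unfolding fld_def by blast
    then show "x \<in> (\<Union>c\<in>\<C>. fld c)"
    proof cases
      case 1
      then obtain c where "c \<in> \<C>" "x \<in> tst c" unfolding tst_def by blast
      then show ?thesis using tst_fld by blast
    next
      case 2
      then obtain c where "c \<in> \<C>" "cst c u ~= {}" unfolding cst_def by blast
      then show ?thesis using dom_fld 2(2) by blast
    next
      case 3
      then obtain c where "c \<in> \<C>" "x \<in> cst c u" unfolding cst_def by blast
      then show ?thesis using cst_fld by blast
    qed
  qed
  have "fld c <= fld (\<Union>\<C>)" if "c \<in> \<C>" for c
  proof -
    have "tst c <= tst (\<Union>\<C>)" "cst c u <= cst (\<Union>\<C>) u" for u using that by (auto simp: tst_def cst_def)
    then show ?thesis unfolding fld_def by blast
  qed
  then show "(\<Union>c\<in>\<C>. fld c) <= fld (\<Union>\<C>)" by blast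
qed

lemma legit_chain:
  fixes f :: "'i => ('c + 'c list \<times> 'c) set"
  assumes J: "J ~= {}" "|J| \<le>o \<nu>" and lg: "!!i. i \<in> J ==> legit (f i)"
    and ch: "!!i j. i \<in> J ==> j \<in> J ==> f i <= f j \<or> f j <= f i"
  shows "legit (\<Union>i\<in>J. f i)"
proof (rule legit_Union)
  show "f ` J ~= {}" using J by simp
  show "c <= d \<or> d <= c" if "c \<in> f ` J" "d \<in> f ` J" for c d using that ch by blast
  show "legit c" if "c \<in> f ` J" for c using that lg by blast
  show "sm (fld (\<Union> (f ` J)))" unfolding fld_Union image_image by (rule sm_UN[OF J(2) legit_sm[OF lg]])
qed

lemma m_pos: assumes "\<not> algb A b0" shows "m ~= 0"
proof
  assume m: "m = 0"
  then have "b0 = []" using b0t by (simp add: tup_iff)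
  moreover have "finite (Sol 0 (tup M 0) [])" by (rule finite_subset[of _ "{[]}"]) (auto simp: Sol_def tup_iff)
  ultimately have "algb A b0" unfolding algb_def using Def_full[of 0]
    by (intro exI[of _ "tup M 0"] exI[of _ "[]"]) (auto simp: tup_iff)
  then show False using assms by blast
qed

text \<open>Each new tuple is constrained by \<open>G\<close> and by all earlier ones. If two of the
  tuples coincided, the later one would be independent from itself over \<open>A\<close> and hence
  algebraic; this gives injectivity.\<close>

lemma omega_sequence:
  assumes c: "legit c" and G: "sm G" "G ~= {}" and na: "\<not> algb A b0"
  shows "\<exists>d e. legit d & c <= d & (\<forall>t::nat. e t \<in> tup M m) & (\<forall>t. eqt A b0 (e t)) & (\<forall>t. G Un (\<Union>s<t. set (e s)) <= cst d (e t)) & inj e"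
proof -
  let ?P = "%S. legit (fst S) & sm (fst (snd S)) & snd (snd S) \<in> tup M m & eqt A b0 (snd (snd S)) &
     legit (fst S Un Inr ` ({snd (snd S)} \<times> fst (snd S)))"
  have st: "\<exists>e. ?P (d, X, e)" if "legit d" "sm X" for d X
    using legit_constrained[OF that] that by auto
  have "\<exists>f. \<forall>t::nat. (?P (f t) & (t = 0 --> fst (f t) = c & fst (snd (f t)) = G)) & (fst (f (Suc t)) = fst (f t) Un Inr ` ({snd (snd (f t))} \<times> fst (snd (f t))) &
       fst (snd (f (Suc t))) = fst (snd (f t)) Un set (snd (snd (f t))))"
    proof (rule dependent_nat_choice)
      obtain e where "?P (c, G, e)" using st[OF c G(1)] by (elim exE)
      then show "\<exists>S. ?P S & (0 = (0::nat) --> fst S = c & fst (snd S) = G)" by (intro exI[of _ "(c, G, e)"]) simp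
      fix S and t :: nat assume S: "?P S & (t = 0 --> fst S = c & fst (snd S) = G)"
      let ?d = "fst S Un Inr ` ({snd (snd S)} \<times> fst (snd S))" and ?X = "fst (snd S) Un set (snd (snd S))"
      have "legit ?d" "sm ?X" using S sm_Un sm_set by (auto simp: tup_iff)
      from st[OF this] obtain e where "?P (?d, ?X, e)" by (elim exE)
      then show "\<exists>T. (?P T & (Suc t = 0 --> fst T = c & fst (snd T) = G)) & fst T = ?d & fst (snd T) = ?X"
        by (intro exI[of _ "(?d, ?X, e)"]) simp
    qed
  then obtain f where f: "\<forall>t::nat. (?P (f t) & (t = 0 --> fst (f t) = c & fst (snd (f t)) = G)) & (fst (f (Suc t)) = fst (f t) Un Inr ` ({snd (snd (f t))} \<times> fst (snd (f t))) &
       fst (snd (f (Suc t))) = fst (snd (f t)) Un set (snd (snd (f t))))" by (elim exE)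
  define d where "d t = fst (f t)" for t
  define X where "X t = fst (snd (f t))" for t
  define e where "e t = snd (snd (f t))" for t
  have F1: "legit (d t)" for t unfolding d_def X_def e_def using f[rule_format, of t] by (elim conjE)
  have F2: "e t \<in> tup M m" for t unfolding d_def X_def e_def using f[rule_format, of t] by (elim conjE)
  have F3: "eqt A b0 (e t)" for t unfolding d_def X_def e_def using f[rule_format, of t] by (elim conjE)
  have F4: "d (Suc t) = d t Un Inr ` ({e t} \<times> X t)" for t unfolding d_def X_def e_def using f[rule_format, of t] by (elim conjE)
  have F5: "X (Suc t) = X t Un set (e t)" for t unfolding d_def X_def e_def using f[rule_format, of t] by (elim conjE)
  note F = F1 F2 F3 F4 F5
  have F0: "d 0 = c" "X 0 = G" unfolding d_def X_def using f[rule_format, of 0] by simp_all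
  have X: "X t = G Un (\<Union>s<t. set (e s))" for t
    by (induction t) (auto simp: F(5) F0 lessThan_Suc)
  have mono: "s \<le> t ==> d s <= d t" for s t by (rule lift_Suc_mono_le) (use F(4) in auto)
  let ?d = "\<Union>t\<in>UNIV. d t"
  have L: "legit ?d"
  proof (rule legit_chain)
    show "d s <= d t \<or> d t <= d s" for s t using mono[of s t] mono[of t s] nat_le_linear[of s t] by blast
  qed (use F(1) countable_le_nu[of "UNIV :: nat set"] in auto)
  have cs: "G Un (\<Union>s<t. set (e s)) <= cst ?d (e t)" for t
  proof
    fix x assume "x \<in> G Un (\<Union>s<t. set (e s))"
    then have "Inr (e t, x) \<in> d (Suc t)" using F(4)[of t] X[of t] by simp
    then show "x \<in> cst ?d (e t)" unfolding cst_def by blast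
  qed
  have ne: "e s ~= e t" if st: "s < t" for s t
  proof
    assume eq: "e s = e t"
    have "cst ?d (e t) ~= {}" using cs[of t] G(2) by blast
    from legit_cst_Ind[OF L this] have "Ind (set (e t)) A (set (e t))"
    proof (rule Ind_mono)
      have "set (e s) <= cst ?d (e t)" using cs[of t] st by blast
      then show "set (e t) <= cst ?d (e t) Un tst ?d" unfolding eq by blast
    qed simp
    then have "algb A (e t)" using algb_of_self_Ind[OF _ sA] eqt_M[OF F(3)] by blast
    then show False using algb_eqt[OF eqt_sym[OF F(3)]] na by blast
  qed
  show ?thesis
  proof (intro exI[of _ ?d] exI[of _ e] conjI allI)
    show "c <= ?d" using F0(1) by blast
    show "inj e" using ne by (intro injI) (metis linorder_neqE_nat)
  qed (rule L F2 F3 cs)+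
qed

text \<open>A finite requirement on the indiscernible sequence is a formula, so it holds for an
  increasing part of the sequence of \<open>omega_sequence\<close>. Copies of that part, which exist
  by legitimacy of \<open>d\<close>, serve as copies of the corresponding \<open>J i\<close>. The
  configuration \<open>d\<close> is only a source of copies and is not put into
  \<open>c'\<close>.\<close>

lemma EM_legit:
  assumes c: "legit c" and g: "sm g" "g ~= {}" "set a <= g" and na: "\<not> algb A b0"
  shows "\<exists>c' J. legit c' & c <= c' & (\<forall>i\<in>Field \<nu>. eqt A b0 (J i)) & indisc (Field \<nu>) nlt (A Un g Un fld c) m J &
    (\<forall>i\<in>Field \<nu>. g Un (\<Union>k\<in>{k. nlt k i}. set (J k)) <= cst c' (J i))"
proof -
  let ?BG = "g Un fld c"
  have sB0: "sm ?BG" by (rule sm_Un[OF g(1) legit_sm[OF c]])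
  let ?B = "A Un ?BG"
  have sB: "sm ?B" by (rule sm_Un[OF sA sB0])
  have BM: "?B <= M" by (rule sm_sub[OF sB])
  have "?BG ~= {}" using g(2) by blast
  from omega_sequence[OF c sB0 this na] obtain d e where d0: "legit d" "c <= d" "\<forall>t::nat. e t \<in> tup M m" "\<forall>t. eqt A b0 (e t)"
     "\<forall>t. ?BG Un (\<Union>s<t. set (e s)) <= cst d (e t)" "inj e" by (elim exE conjE)
  note d = d0(1,2) d0(3)[rule_format] d0(4)[rule_format] d0(5)[rule_format] d0(6)
  have le: "length (e t) = m" for t using d(3) by (simp add: tup_iff)
  have "\<exists>J. indisc (Field \<nu>) nlt ?B m J &
    (\<forall>is R c. increasing (Field \<nu>) nlt is --> set c <= ?B --> R \<in> Def (length is * m + length c) --> concat (map J is) @ c \<in> R -->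
       (\<exists>js. sorted_wrt (<) js & length js = length is & concat (map e js) @ c \<in> R))"
    by (rule EM_sequence[OF d(3) sB nu_subset[OF order_refl]]) (rule nlt_irrefl, erule (1) nlt_trans)
  then obtain J where J: "indisc (Field \<nu>) nlt ?B m J"
    "\<forall>is R c. increasing (Field \<nu>) nlt is --> set c <= ?B --> R \<in> Def (length is * m + length c) --> concat (map J is) @ c \<in> R -->
       (\<exists>js. sorted_wrt (<) js & length js = length is & concat (map e js) @ c \<in> R)" by (elim exE conjE)
  have Jt: "J i \<in> tup M m" if "i \<in> Field \<nu>" for i using J(1) that unfolding indisc_def by blast
  have Jl: "length (J i) = m" "set (J i) <= M" if "i \<in> Field \<nu>" for i using Jt[OF that] by (auto simp: tup_iff)
  have lb: "length b0 = m" using b0t by (simp add: tup_iff)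
  have eb: "eqt A b0 (J i)" if i: "i \<in> Field \<nu>" for i
  proof (rule eqtI)
    show "length b0 = length (J i)" "set b0 <= M" "set (J i) <= M" using lb Jl[OF i] b0M by auto
    fix R p assume p: "set p <= A" "R \<in> Def (length b0 + length p)" "b0 @ p \<in> R"
    show "J i @ p \<in> R"
    proof (rule ccontr)
      assume "J i @ p \<notin> R"
      then have 1: "concat (map J [i]) @ p \<in> tup M (m + length p) - R" using Jl[OF i] p(1) AM by (auto simp: tup_iff)
      have 2: "tup M (m + length p) - R \<in> Def (length [i] * m + length p)" using Def_Diff[OF p(2)] lb by simp
      have 3: "increasing (Field \<nu>) nlt [i]" using i by (simp add: increasing_def)
      have 4: "set p <= ?B" using p(1) by blast
      from J(2)[rule_format, OF 3 4 2 1] obtain js where js: "length js = length [i]" "concat (map e js) @ p \<in> tup M (m + length p) - R" by (elim exE conjE)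
      then obtain j where "js = [j]" by (cases js) auto
      then have "e j @ p \<notin> R" using js(2) by simp
      then show False using eqtD[OF d(4)[of j] p(3,2,1)] by blast
    qed
  qed
  \<comment> \<open>Distinct indices must carry distinct tuples: otherwise a tuple would acquire the
    constraints of a later index, its own entries among them.\<close>
  have Jne: "J i ~= J k" if ik: "nlt i k" for i k
  proof
    assume eq: "J i = J k"
    have f: "i \<in> Field \<nu>" "k \<in> Field \<nu>" using nlt_Field[OF ik] by auto
    have "DF {..<2 * m} {} (%f. \<forall>p\<in>{..<m}. f p = f (m + p))" by (rule DF_Ball) (auto intro!: DF_eqv)
    from DF_Sol[OF this] obtain R cs where R: "set cs <= {} Int M" "R \<in> Def (2 * m + length cs)"
      "\<forall>w\<in>tup M (2 * m). (\<forall>p\<in>{..<m}. asg w p = asg w (m + p)) = (w @ cs \<in> R)" by (elim exE conjE)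
    have cs: "cs = []" using R(1) by simp
    have rep: "u @ v \<in> R \<longleftrightarrow> u = v" if "u \<in> tup M m" "v \<in> tup M m" for u v
    proof -
      have "u @ v \<in> tup M (2 * m)" using that by (auto simp: tup_iff)
      then have "(u @ v \<in> R) = (\<forall>p\<in>{..<m}. asg (u @ v) p = asg (u @ v) (m + p))" using R(3) cs by simp
      also have "\<dots> = (u = v)" using that by (auto simp: asg_def nth_append tup_iff list_eq_iff_nth_eq)
      finally show ?thesis .
    qed
    have 1: "increasing (Field \<nu>) nlt [i, k]" using f ik by (simp add: increasing_def)
    have 2: "R \<in> Def (length [i, k] * m + length ([] :: 'c list))" using R(2) cs by (simp add: mult_2)
    have "J i @ J k \<in> R" using rep[OF Jt[OF f(1)] Jt[OF f(2)]] eq by blast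
    then have 3: "concat (map J [i, k]) @ [] \<in> R" by simp
    from J(2)[rule_format, OF 1 _ 2 3] obtain js where js: "sorted_wrt (<) js" "length js = length [i, k]" "concat (map e js) @ [] \<in> R" by auto
    then obtain s t where st: "js = [s, t]" "s < t" by (auto simp: length_Suc_conv)
    then have "e s = e t" using rep[OF d(3) d(3)] js(3) by simp
    then show False using d(6) st(2) by (metis injD less_irrefl)
  qed
  have Jinj: "i = k" if "i \<in> Field \<nu>" "k \<in> Field \<nu>" "J i = J k" for i k
    using nlt_total[OF that(1,2)] Jne that(3) by metis
  define JJ where "JJ = (\<Union>i\<in>Field \<nu>. set (J i))"
  define L where "L i = (\<Union>k\<in>{k. nlt k i}. set (J k))" for i
  define c' where "c' = c Un {Inr (J i, x) | i x. i \<in> Field \<nu> & x \<in> ?BG Un L i}"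
  have LJ: "L i <= JJ" for i unfolding L_def JJ_def using nlt_Field by blast
  have t: "tst c' = tst c" by (auto simp: tst_def c'_def)
  have k1: "cst c' (J i) = cst c (J i) Un (?BG Un L i)" if "i \<in> Field \<nu>" for i
    unfolding cst_def c'_def using that Jinj by auto
  have k2: "cst c' u = cst c u" if "!!i. i \<in> Field \<nu> ==> u ~= J i" for u
    unfolding cst_def c'_def using that by auto
  have sJJ: "sm JJ" unfolding JJ_def by (rule sm_UN[OF nu_subset[OF order_refl] sm_set]) (rule Jl(2))
  have fl: "fld c' <= ?B Un JJ"
  proof
    fix x assume "x \<in> fld c'"
    then consider "x \<in> tst c'" | u where "cst c' u ~= {}" "x \<in> set u Un cst c' u" unfolding fld_def by blast
    then show "x \<in> ?B Un JJ"
    proof cases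
      case 1 then show ?thesis using tst_fld t by blast
    next
      case 2
      show ?thesis
      proof (cases "\<exists>i\<in>Field \<nu>. u = J i")
        case True
        then obtain i where i: "i \<in> Field \<nu>" "u = J i" by blast
        then show ?thesis using 2 k1[OF i(1)] cst_fld[of c u] LJ[of i] unfolding JJ_def by blast
      next
        case False
        then have "cst c' u = cst c u" by (intro k2) blast
        then show ?thesis using 2 cst_fld[of c u] dom_fld[of c u] by blast
      qed
    qed
  qed
  have "legit c'"
  proof (rule legitI[of _ "?B Un JJ"])
    show "sm (fld c')" by (rule sm_mono[OF sm_Un[OF sB sJJ] fl])
    show "length u = m" if "cst c' u ~= {}" for u
    proof (cases "\<exists>i\<in>Field \<nu>. u = J i")
      case True then show ?thesis using Jl(1) by blast
    next
      case False
      then have "cst c' u = cst c u" by (intro k2) blast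
      then show ?thesis using legit_length[OF c] that by simp
    qed
    show "set a Un fld c' <= ?B Un JJ" using g(3) fl by blast
    fix U Q Y assume U: "finite U" "U <= ?B Un JJ" "U <= M" "set a <= U" "DF U A Q" "Q idM" "Y \<in> NB"
    \<comment> \<open>An element may occur in several \<open>J k\<close>. The least such index is
      used, so that an element of \<open>L i\<close> is represented at an index below
      \<open>i\<close>.\<close>
    have "\<forall>x\<in>JJ. \<exists>k. k \<in> Field \<nu> & x \<in> set (J k) & (\<forall>j. nlt j k --> x \<notin> set (J j))"
    proof
      fix x assume "x \<in> JJ"
      then obtain k where "k \<in> Field \<nu> & x \<in> set (J k)" unfolding JJ_def by blast
      from nlt_least[of "%k. k \<in> Field \<nu> & x \<in> set (J k)", OF this]
      show "\<exists>k. k \<in> Field \<nu> & x \<in> set (J k) & (\<forall>j. nlt j k --> x \<notin> set (J j))" using nlt_Field by blast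
    qed
    from bchoice[OF this] obtain kk where kk: "\<forall>x\<in>JJ. kk x \<in> Field \<nu> & x \<in> set (J (kk x)) & (\<forall>j. nlt j (kk x) --> x \<notin> set (J j))" ..
    have "\<forall>x\<in>JJ. \<exists>p. p < m & J (kk x) ! p = x" using kk Jl(1) by (metis in_set_conv_nth)
    from bchoice[OF this] obtain ps where ps: "\<forall>x\<in>JJ. ps x < m & J (kk x) ! ps x = x" ..
    \<comment> \<open>The indices whose tuples lie inside \<open>U\<close>; only their tuples are
      subject to \<open>ok\<close>. \<open>K\<close> adds the indices needed to represent the
      elements of \<open>U\<close>.\<close>
    define I0 where "I0 = {i \<in> Field \<nu>. set (J i) <= U}"
    have fI0: "finite I0"
    proof (rule finite_imageD)
      show "finite (J ` I0)" by (rule finite_subset[OF _ finite_lists_length_eq[OF U(1), of m]]) (use Jl(1) in \<open>auto simp: I0_def\<close>)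
      show "inj_on J I0" by (rule inj_onI) (use Jinj in \<open>auto simp: I0_def\<close>)
    qed
    define K where "K = I0 Un kk ` (U Int JJ)"
    have K: "finite K" "K <= Field \<nu>" unfolding K_def using fI0 U(1) kk by (auto simp: I0_def)
    have "\<exists>ks. sorted_wrt nlt ks & set ks = K" by (rule sorted_enumeration[OF K]) (erule (2) nlt_total, erule (1) nlt_trans)
    then obtain ks where ks: "sorted_wrt nlt ks" "set ks = K" by (elim exE conjE)
    let ?r = "length ks"
    have "\<forall>k\<in>K. \<exists>q. q < ?r & ks ! q = k" using ks(2) by (metis in_set_conv_nth)
    from bchoice[OF this] obtain ix where ix: "\<forall>k\<in>K. ix k < ?r & ks ! ix k = k" ..
    have ixlt: "ix k < ix i" if "k \<in> K" "i \<in> K" "nlt k i" for k i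
    proof (rule ccontr)
      assume "\<not> ix k < ix i"
      then consider "ix k = ix i" | "ix i < ix k" by linarith
      then show False
      proof cases
        case 1 then show ?thesis using ix that nlt_irrefl by metis
      next
        case 2
        then have "nlt i k" using sorted_wrt_nth_less[OF ks(1) 2] ix that by auto
        then show ?thesis using that(3) nlt_trans nlt_irrefl by blast
      qed
    qed
    define \<pi> where "\<pi> x = (if x \<in> JJ then Inr (ix (kk x) * m + ps x) else Inl x)" for x
    define Q' where "Q' h = (Q (h \<circ> \<pi>) & (\<forall>x\<in>U Int ?B. h (Inl x) = h (\<pi> x)) &
       (\<forall>i\<in>I0. \<forall>p\<in>{..<m}. h (\<pi> (J i ! p)) = h (Inr (ix i * m + p))))" for h
    let ?V = "Inl ` (U Int ?B) Un Inr ` {..<?r * m}"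
    have \<pi>V: "\<pi> x \<in> ?V" if x: "x \<in> U" for x
    proof (cases "x \<in> JJ")
      case True
      then have "kk x \<in> K" using x unfolding K_def by blast
      then show ?thesis using True ix ps block_less[of "ix (kk x)" ?r "ps x" m] unfolding \<pi>_def by simp
    next
      case False then show ?thesis using x U(2) unfolding \<pi>_def by auto
    qed
    have I0V: "J i ! p \<in> U" "Inr (ix i * m + p) \<in> ?V" if "i \<in> I0" "p < m" for i p
    proof -
      show "J i ! p \<in> U" using that Jl(1)[of i] nth_mem[of p "J i"] unfolding I0_def by auto
      have "i \<in> K" using that unfolding K_def by blast
      then show "Inr (ix i * m + p) \<in> ?V" using ix block_less[of "ix i" ?r p m] that(2) by simp
    qed
    have dQ': "DF ?V A Q'" unfolding Q'_def
    proof (intro DF_and DF_Ball)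
      show "DF ?V A (%h. Q (h \<circ> \<pi>))" by (rule DF_mono[OF DF_pull[OF U(5)] image_subsetI[OF \<pi>V] order_refl])
      show "DF ?V A (%h. h (Inl x) = h (\<pi> x))" if "x \<in> U Int ?B" for x by (rule DF_eqv) (use that \<pi>V in auto)
      show "DF ?V A (%h. h (\<pi> (J i ! p)) = h (Inr (ix i * m + p)))" if "i \<in> I0" "p \<in> {..<m}" for i p
        by (rule DF_eqv) (use that I0V[of i p] \<pi>V in auto)
    qed (use U(1) fI0 in auto)
    have "DF {..<?r * m} (A Un (U Int ?B)) (%f. Q' (case_sum idM f))"
      by (rule DF_subst[OF dQ']) (use BM in blast)
    from DF_Sol[OF this] obtain R cs where R: "set cs <= (A Un (U Int ?B)) Int M" "R \<in> Def (?r * m + length cs)"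
      "\<forall>w\<in>tup M (?r * m). Q' (case_sum idM (asg w)) = (w @ cs \<in> R)" by (elim exE conjE)
    have wJ: "concat (map J ks) \<in> tup M (?r * m)"
      using length_concat_block[of "map J ks" m] Jl ks(2) K(2) by (auto simp: tup_iff)
    have wJn: "asg (concat (map J ks)) (ix k * m + p) = J k ! p" if "k \<in> K" "p < m" for k p
    proof -
      have "concat (map J ks) ! (ix k * m + p) = map J ks ! ix k ! p"
        by (rule concat_nth_block) (use Jl(1) ks(2) K(2) ix that in auto)
      moreover have "ix k * m + p < length (concat (map J ks))" using wJ ix that block_less[of "ix k" ?r p m] by (auto simp: tup_iff)
      ultimately show ?thesis using ix that by (simp add: asg_def)
    qed
    have rcs: "range (case_sum idM (asg w)) <= M" if "set w <= M" for w
      using asg_range[OF that] range_idM by (auto simp: image_subset_iff split: sum.split)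
    have "Q' (case_sum idM (asg (concat (map J ks))))"
    proof -
      let ?g = "case_sum idM (asg (concat (map J ks)))"
      have gx: "?g (\<pi> x) = x" if x: "x \<in> U" for x
      proof (cases "x \<in> JJ")
        case True
        then have "kk x \<in> K" using x unfolding K_def by blast
        then show ?thesis using True wJn ps unfolding \<pi>_def by simp
      next
        case False then show ?thesis using x U(3) idM_M unfolding \<pi>_def by auto
      qed
      have rg: "range ?g <= M" by (rule rcs) (use wJ in \<open>simp add: tup_iff\<close>)
      then have "range (?g \<circ> \<pi>) <= M" by (auto simp: image_subset_iff)
      then have "Q (?g \<circ> \<pi>) = Q idM"
      proof (rule DF_dep[OF U(5) _ range_idM])
        fix x assume x: "x \<in> U"
        then have "idM x = x" using U(3) idM_M by blast
        then show "(?g \<circ> \<pi>) x = idM x" using gx[OF x] by simp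
      qed
      moreover have "?g (Inl x) = ?g (\<pi> x)" if "x \<in> U Int ?B" for x
        using gx[of x] that U(3) idM_M[of x] by auto
      moreover have "?g (\<pi> (J i ! p)) = ?g (Inr (ix i * m + p))" if "i \<in> I0" "p \<in> {..<m}" for i p
        using gx[OF I0V(1)[of i p]] wJn[of i p] that unfolding K_def by simp
      ultimately show ?thesis unfolding Q'_def using U(6) by simp
    qed
    then have 1: "concat (map J ks) @ cs \<in> R" using bspec[OF R(3) wJ] by simp
    have 2: "increasing (Field \<nu>) nlt ks" using ks K(2) by (simp add: increasing_def)
    have 3: "set cs <= ?B" using R(1) by blast
    from J(2)[rule_format, OF 2 3 R(2) 1] obtain js where js: "sorted_wrt (<) js" "length js = ?r" "concat (map e js) @ cs \<in> R" by (elim exE conjE)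
    let ?w = "concat (map e js)"
    have wt: "?w \<in> tup M (?r * m)" using length_concat_block[of "map e js" m] le js(2) d(3) by (auto simp: tup_iff)
    have wM: "set ?w <= M" using wt by (simp add: tup_iff)
    have Q'w: "Q' (case_sum idM (asg ?w))" using bspec[OF R(3) wt] js(3) by simp
    have wn: "?w ! (q * m + p) = e (js ! q) ! p" if "q < ?r" "p < m" for q p
    proof -
      have "concat (map e js) ! (q * m + p) = map e js ! q ! p"
        by (rule concat_nth_block) (use le js(2) that in auto)
      then show ?thesis using js(2) that by simp
    qed
    let ?\<rho> = "case_sum id (%v. ?w ! v)"
    let ?U = "(U Int ?B) Un set ?w"
    have wl: "length ?w = ?r * m" using wt unfolding tup_iff by (rule conjunct2)
    have \<rho>V: "?\<rho> ` ?V <= ?U"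
    proof (rule image_subsetI)
      fix v assume v: "v \<in> ?V"
      show "?\<rho> v \<in> ?U"
      proof (cases v)
        case (Inl x) then show ?thesis using v by auto
      next
        case (Inr i)
        then have "i < length ?w" using v unfolding wl by auto
        then have "?w ! i \<in> set ?w" by (rule nth_mem)
        then show ?thesis unfolding Inr sum.case by (rule UnI2)
      qed
    qed
    have aU: "set a <= U Int ?B" using U(4) g(3) by blast
    have "\<exists>h. range h <= M & Q' (h \<circ> ?\<rho>) & ok d Y h ?U"
    proof (rule legitD[OF d(1)])
      show "finite ?U" using U(1) by simp
      show "?U <= M" using BM wM by blast
      show "set a <= ?U" using aU by blast
      show "DF ?U A (%h. Q' (h \<circ> ?\<rho>))" by (rule DF_mono[OF DF_pull[OF dQ'] \<rho>V order_refl])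
      have "Q' (idM \<circ> ?\<rho>) = Q' (case_sum idM (asg ?w))"
      proof (rule DF_dep[OF dQ' _ rcs[OF wM]])
        show "range (idM \<circ> ?\<rho>) <= M" using range_idM by (auto simp: image_subset_iff)
        fix v assume v: "v \<in> ?V"
        show "(idM \<circ> ?\<rho>) v = case_sum idM (asg ?w) v"
        proof (cases v)
          case (Inr i)
          then have "i < length ?w" using v unfolding wl by auto
          moreover from this have "?w ! i \<in> M" using wM nth_mem by blast
          ultimately show ?thesis using Inr idM_M by (simp add: asg_def)
        qed simp
      qed
      then show "Q' (idM \<circ> ?\<rho>)" using Q'w by (simp only:)
    qed (rule U(7))
    then obtain h where h: "range h <= M" "Q' (h \<circ> ?\<rho>)" "ok d Y h ?U" by (elim exE conjE)
    note q = h(2)[unfolded Q'_def]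
    note od = okD[OF h(3)]
    let ?h = "(h \<circ> ?\<rho>) \<circ> \<pi>"
    have hB: "?h x = h x" if "x \<in> U Int ?B" for x
      using bspec[OF q[THEN conjunct2, THEN conjunct1] that] by simp
    have hBi: "?h ` S = h ` S" if "S <= U Int ?B" for S by (rule image_cong[OF refl]) (use hB that in blast)
    have hBm: "map ?h u = map h u" if "set u <= U Int ?B" for u by (rule map_cong[OF refl]) (use hB that in blast)
    have hJ: "?h x \<in> h ` set (e (js ! ix (kk x)))" if x: "x \<in> U Int JJ" for x
    proof -
      have kK: "kk x \<in> K" using x unfolding K_def by blast
      have "?h x = h (e (js ! ix (kk x)) ! ps x)" using x kK ix ps wn[of "ix (kk x)" "ps x"] unfolding \<pi>_def by simp
      moreover have "e (js ! ix (kk x)) ! ps x \<in> set (e (js ! ix (kk x)))" using ps x le by simp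
      ultimately show ?thesis by blast
    qed
    have hI: "map ?h (J i) = map h (e (js ! ix i))" if i: "i \<in> I0" for i
    proof (rule nth_equalityI)
      have iK: "i \<in> K" "i \<in> Field \<nu>" using i unfolding K_def I0_def by auto
      show "length (map ?h (J i)) = length (map h (e (js ! ix i)))" using Jl(1)[OF iK(2)] le by simp
      fix p assume "p < length (map ?h (J i))"
      then have p: "p < m" using Jl(1)[OF iK(2)] by simp
      have "?h (J i ! p) = (h \<circ> ?\<rho>) (Inr (ix i * m + p))" using bspec[OF bspec[OF q[THEN conjunct2, THEN conjunct2] i], of p] p by simp
      also have "\<dots> = h (e (js ! ix i) ! p)" using wn[of "ix i" p] ix iK p by simp
      finally show "map ?h (J i) ! p = map h (e (js ! ix i)) ! p" using p Jl(1)[OF iK(2)] le by simp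
    qed
    have ew: "set (e (js ! q)) <= set ?w" if "q < ?r" for q
  proof -
    have "js ! q \<in> set js" using that js(2) by simp
    then show ?thesis unfolding set_concat set_map by blast
  qed
    have ok: "ok c' Y ?h U"
    proof (rule okI)
      show "map ?h a \<in> F" "map ?h a \<in> Y" unfolding hBm[OF aU] by (rule od(1), rule od(2))
      have tB: "tst c Int U <= U Int ?B" using tst_fld by blast
      have tcd: "tst c <= tst d" using d(2) by (auto simp: tst_def)
      show "Ind (?h ` (tst c' Int U)) A (?h ` set a)" unfolding t hBi[OF aU] hBi[OF tB]
        by (rule Ind_mono[OF od(3)]) (use tcd tB in auto)
      fix u assume u: "cst c' u ~= {}" "set u <= U"
      have "eqt A u (map ?h u) & Ind (?h ` set u) A (?h ` ((cst c' u Un tst c') Int U))"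
      proof (cases "\<exists>i\<in>Field \<nu>. u = J i")
        case True
        then obtain i where i: "i \<in> Field \<nu>" "u = J i" by blast
        have iI: "i \<in> I0" using i u(2) unfolding I0_def by blast
        have iK: "i \<in> K" using iI unfolding K_def by blast
        have ixi: "ix i < ?r" using ix iK by blast
        let ?e = "e (js ! ix i)"
        have ne: "cst d ?e ~= {}" using d(5)[of "js ! ix i"] g(2) by blast
        have eU: "set ?e <= ?U" using ew[OF ixi] by blast
        have "eqt A (J i) (map h ?e)"
          using eqt_trans[OF eqt_sym[OF eb[OF i(1)]] eqt_trans[OF d(4) od(4)[OF ne eU]]] .
        moreover have "Ind (?h ` set u) A (?h ` ((cst c' u Un tst c') Int U))"
        proof (rule Ind_mono[OF od(5)[OF ne eU]])
          have "?h ` set (J i) = set (map ?h (J i))" by (simp only: set_map)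
          also have "\<dots> = h ` set ?e" unfolding hI[OF iI] by (simp only: set_map)
          finally show "?h ` set u <= h ` set ?e" unfolding i(2) by simp
          show "?h ` ((cst c' u Un tst c') Int U) <= h ` ((cst d ?e Un tst d) Int ?U)"
          proof (rule image_subsetI)
            fix x assume x: "x \<in> (cst c' u Un tst c') Int U"
            have "x \<in> ?BG Un L i" using x k1[OF i(1)] t tst_fld[of c] cst_fld[of c "J i"] unfolding i(2) by blast
            then show "?h x \<in> h ` ((cst d ?e Un tst d) Int ?U)"
            proof (cases "x \<in> L i")
              case True
              then obtain k where k: "nlt k i" "x \<in> set (J k)" unfolding L_def by blast
              have xJ: "x \<in> U Int JJ" using x True LJ by blast
              then have kx: "kk x \<in> Field \<nu>" "\<not> nlt k (kk x)" using kk k(2) by blast+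
              have "kk x = k \<or> nlt (kk x) k" using nlt_total[of "kk x" k] kx nlt_Field[OF k(1)] by blast
              then have "nlt (kk x) i" using k(1) nlt_trans by blast
              moreover have kK: "kk x \<in> K" using xJ unfolding K_def by blast
              ultimately have lt: "ix (kk x) < ix i" using ixlt iK by blast
              then have "js ! ix (kk x) < js ! ix i" using sorted_wrt_nth_less[OF js(1)] ixi js(2) by simp
              then have "set (e (js ! ix (kk x))) <= cst d ?e" using d(5)[of "js ! ix i"] by blast
              moreover have "set (e (js ! ix (kk x))) <= ?U" using ew[of "ix (kk x)"] lt ixi by auto
              ultimately show ?thesis using hJ[OF xJ] by blast
            next
              case False
              then have xB: "x \<in> ?BG" using \<open>x \<in> ?BG Un L i\<close> by blast
              then have "x \<in> cst d ?e" using d(5)[of "js ! ix i"] by blast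
              moreover have "x \<in> U Int ?B" using xB x by blast
              ultimately show ?thesis using hB[of x] by (metis IntI UnI1 imageI)
            qed
          qed
        qed
        ultimately show ?thesis unfolding i(2) hI[OF iI] by blast
      next
        case False
        then have e: "cst c' u = cst c u" by (intro k2) blast
        then have ne: "cst c u ~= {}" using u(1) by simp
        have uB: "set u <= U Int ?B" using dom_fld[OF ne] u(2) by blast
        have cd: "cst c u <= cst d u" using d(2) by (auto simp: cst_def)
        then have ned: "cst d u ~= {}" using ne by blast
        have uU: "set u <= ?U" using uB by blast
        have sB': "(cst c u Un tst c) Int U <= U Int ?B" using tst_fld[of c] cst_fld[of c u] by blast
        have "Ind (h ` set u) A (h ` ((cst c u Un tst c) Int U))"
          by (rule Ind_mono[OF od(5)[OF ned uU]]) (use cd tcd sB' in auto)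
        then show ?thesis unfolding e t hBm[OF uB] hBi[OF uB] hBi[OF sB'] using od(4)[OF ned uU] by blast
      qed
      then show "eqt A u (map ?h u)" "Ind (?h ` set u) A (?h ` ((cst c' u Un tst c') Int U))" by blast+
    qed
    have "range ?h <= M" using h(1) by (auto simp: image_subset_iff)
    then show "\<exists>h. range h <= M & Q h & ok c' Y h U" using q[THEN conjunct1] ok by (intro exI[of _ ?h] conjI)
  qed
  then show ?thesis
  proof (intro exI[of _ c'] exI[of _ J] conjI ballI)
    show "c <= c'" unfolding c'_def by blast
    show "eqt A b0 (J i)" if "i \<in> Field \<nu>" for i by (rule eb[OF that])
    show "indisc (Field \<nu>) nlt (A Un g Un fld c) m J" using J(1) by (simp add: Un_assoc)
    show "g Un (\<Union>k\<in>{k. nlt k i}. set (J k)) <= cst c' (J i)" if "i \<in> Field \<nu>" for i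
      using k1[OF that] unfolding L_def by blast
  qed
qed

end

section \<open>The transfinite construction\<close>

context simplestruct
begin

lemma chain_finite:
  fixes S :: "'i => 'a set"
  assumes "J ~= {}" "!!i j. i \<in> J ==> j \<in> J ==> S i <= S j \<or> S j <= S i" "finite X" "X <= (\<Union>i\<in>J. S i)"
  shows "\<exists>i\<in>J. X <= S i"
  using assms(3,4)
proof (induction X rule: finite_induct)
  case empty then show ?case using assms(1) by blast
next
  case (insert x X)
  then obtain i where i: "i \<in> J" "X <= S i" by auto
  obtain j where j: "j \<in> J" "x \<in> S j" using insert.prems by blast
  show ?case using assms(2)[OF i(1) j(1)] i j by blast
qed

end

text \<open>\<open>UNI\<close> is non-orthogonality of the types of \<open>e\<close> and
  \<open>b\<close> over \<open>C\<close>: dependent realizations of non-forking extensions over a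
  common \<open>D\<close>.\<close>

locale uniworlds = worlds M Def \<nu> A n m l a b0 p0 F NB \<Phi>
  for M :: "'c set" and Def :: "nat => 'c list set set" and \<nu> :: "'v rel" and A n m l a b0 p0 F NB \<Phi> +
  assumes UNI: "!!C e b. sm C ==> set e <= M ==> set b <= M ==> \<not> algb C e ==> \<not> algb C b ==>
    \<exists>D e' b'. D <= M & C <= D & eqt C e e' & eqt C b b' & Ind (set e') C D & Ind (set b') C D & \<not> Ind (set e') D (set b')"
begin

text \<open>The last clause ranges over all later configurations, because the tester used against
  algebraicity of the current \<open>b\<close> is not yet part of \<open>c\<close>. The set
  \<open>g\<close> collects what has been added to the base besides testers.\<close>

definition state :: "('c + 'c list \<times> 'c) set => 'c set => 'c list => bool" where
  "state c g b \<longleftrightarrow> legit c & sm g & set a <= g & eqt (A Un set a) b0 b & Ind (set b) (A Un set a) (tst c) &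
     (\<forall>c'. legit c' --> c <= c' --> Ind g (A Un tst c) (tst c'))"

definition base :: "('c + 'c list \<times> 'c) set => 'c set => 'c set" where "base c g = A Un tst c Un g"

lemma legit_sm_tst: "legit c ==> sm (tst c)"
  by (rule sm_mono[OF legit_sm tst_fld])

lemma tst_mono: "c <= c' ==> tst c <= tst c'" by (auto simp: tst_def)
lemma cst_mono: "c <= c' ==> cst c e <= cst c' e" by (auto simp: cst_def)

lemma state_sm: "state c g b ==> sm (base c g) & sm g & sm (tst c) & set b <= M"
  unfolding state_def base_def using legit_sm_tst sA sm_Un eqt_M by metis

lemma sm_a: "sm (set a)" by (rule sm_set[OF aM])

text \<open>A tester \<open>z\<close> for \<open>(a, b)\<close> is independent from \<open>a, b\<close> over \<open>A\<close> as soon as \<open>b\<close> is algebraic over the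
  current base, whereas \<open>\<Phi>(z, a, b)\<close> forks over \<open>A\<close>.\<close>

lemma state_not_algb:
  assumes S: "state c g b" shows "\<not> algb (base c g) b"
proof
  assume al: "algb (base c g) b"
  have s: "legit c" "sm g" "set a <= g" "eqt (A Un set a) b0 b" "Ind (set b) (A Un set a) (tst c)"
    "\<forall>c'. legit c' --> c <= c' --> Ind g (A Un tst c) (tst c')" using S unfolding state_def by blast+
  have bM: "set b <= M" and sT: "sm (tst c)" using state_sm[OF S] by blast+
  have sb: "sm (set b)" by (rule sm_set[OF bM])
  have bt: "b \<in> tup M m" using eqt_length[OF s(4)] b0t bM by (simp add: tup_iff)
  from legit_tester[OF s(1) bt] obtain z where z: "z \<in> tup M l" "z @ a @ b @ p0 \<in> \<Phi>" "legit (c Un Inl ` set z)" by (elim bexE conjE)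
  have sz: "sm (set z)" by (rule sm_set) (use z(1) in \<open>simp add: tup_iff\<close>)
  \<comment> \<open>The clause about later configurations is applied to the configuration enlarged
    by \<open>z\<close>.\<close>
  have "Ind g (A Un tst c) (tst (c Un Inl ` set z))" using s(6)[rule_format, OF z(3)] by blast
  then have 1: "Ind g (A Un tst c) (set z)" by (rule Ind_mono) (auto simp: tst_def)
  have sB: "sm (base c g)" using state_sm[OF S] by blast
  have 2: "Ind (set b) (A Un tst c Un g) (set z)" using Ind_algb[OF al sB bM] unfolding base_def .
  have sAT: "sm (A Un tst c)" by (rule sm_Un[OF sA sT])
  have "Ind (g Un set b) (A Un tst c) (set z)" by (rule left_transitivity[OF 1 2 s(2) sb sz sAT])
  then have 3: "Ind (set a Un set b) (A Un tst c) (set z)" by (rule Ind_mono) (use s(3) in auto)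
  have sab: "sm (set a Un set b)" by (rule sm_Un[OF sm_a sb])
  have 4: "Ind (set z) (A Un tst c) (set a Un set b)" by (rule symmetry[OF 3 sab sz sAT])
  have "Ind (set a Un set b) A (tst c)" by (rule left_transitivity[OF legit_tst_Ind[OF s(1)] s(5) sm_a sb sT sA])
  then have 5: "Ind (tst c) A (set a Un set b)" by (rule symmetry[OF _ sab sT sA])
  have "Ind (tst c Un set z) A (set a Un set b)" by (rule left_transitivity[OF 5 4 sT sz sab sA])
  then have 6: "Ind (set z) A (set a Un set b)" by (rule Ind_mono) auto
  have la: "length a = n" "length b0 = m" using at b0t by (auto simp: tup_iff)
  have e: "eqt A (a @ b0) (a @ b)" by (rule eqt_mono[OF eqt_prepend[OF s(4) _ aM sm_Un[OF sA sm_a]]]) auto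
  have "fk A l (Sol l \<Phi> ((a @ b) @ p0))"
    by (rule fk_eqt[OF e sA p0A]) (use \<Phi> fork_ab0 la in \<open>simp_all\<close>)
  moreover have "length z = l" using z(1) by (simp add: tup_iff)
  ultimately show False using IndD[OF 6 order_refl, of "(a @ b) @ p0" \<Phi>] z(2) p0A \<Phi> la eqt_length[OF s(4)] by (auto simp: add.assoc)
qed

lemma b0_not_algb:
  assumes S: "state c g b" shows "\<not> algb A b0"
proof
  assume "algb A b0"
  have e: "eqt (A Un set a) b0 b" using S unfolding state_def by blast
  have "algb A b" by (rule algb_eqt[OF eqt_mono[OF e] \<open>algb A b0\<close>]) blast
  then have "algb (base c g) b" by (rule algb_mono) (auto simp: base_def)
  then show False using state_not_algb[OF S] by blast
qed

text \<open>The dependence is witnessed by one formula, so \<open>D\<close> can be cut down to its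
  finitely many parameters in it; a conjugation over \<open>C\<close> then restores \<open>e\<close>
  itself.\<close>

lemma finite_UNI:
  assumes "sm C" "set e <= M" "set b <= M" "\<not> algb C e" "\<not> algb C b"
  shows "\<exists>d b'. set d <= M & eqt C b b' & Ind (set e) C (set d) & Ind (set b') C (set d) & \<not> Ind (set e) (C Un set d) (set b')"
proof -
  from UNI[OF assms] obtain D e' b' where D: "D <= M" "C <= D" "eqt C e e'" "eqt C b b'" "Ind (set e') C D" "Ind (set b') C D" "\<not> Ind (set e') D (set b')"
    by (elim exE conjE)
  from D(7) obtain x y R where x: "set x <= set e'" "set y <= set b' Un D" "R \<in> Def (length x + length y)" "x @ y \<in> R"
    "fk D (length x) (Sol (length x) R y)" unfolding Ind_def by blast
  let ?d = "filter (%z. z \<in> D) y"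
  have dD: "set ?d <= D" by auto
  have ni: "\<not> Ind (set e') (C Un set ?d) (set b')"
  proof
    assume I: "Ind (set e') (C Un set ?d) (set b')"
    have "set y <= set b' Un (C Un set ?d)" using x(2) by auto
    from IndD[OF I x(1) this x(3,4)] fk_base[OF x(5)] dD D(2) show False by blast
  qed
  obtain \<sigma> where \<sigma>: "fixes_on C \<sigma>" "map \<sigma> e' = e" by (rule eqt_aut[OF eqt_sym[OF D(3)] assms(1)])
  note aut = fixes_aut[OF \<sigma>(1)]
  have M: "set e' <= M" "set b' <= M" "set ?d <= M" "C <= M" using eqt_M[OF D(3)] eqt_M[OF D(4)] dD D(1) sm_sub[OF assms(1)] by blast+
  have C: "\<sigma> ` C = C" by (rule fixes_image[OF \<sigma>(1) order_refl])
  have E: "\<sigma> ` set e' = set e" using \<sigma>(2) by (metis image_set)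
  obtain \<tau> where \<tau>: "fixes_on C \<tau>" "!!x. x \<in> M ==> \<tau> (\<sigma> x) = x" using fixes_inverse[OF \<sigma>(1) M(4)] by metis
  have ts: "\<tau> ` \<sigma> ` S = S" if "S <= M" for S using that \<tau>(2) by (force simp: image_image)
  show ?thesis
  proof (rule exI[of _ "map \<sigma> ?d"], rule exI[of _ "map \<sigma> b'"], intro conjI)
    show "set (map \<sigma> ?d) <= M" using aut_set[OF aut M(3)] by simp
    show "eqt C b (map \<sigma> b')" by (rule eqt_trans[OF D(4) fixes_eqt[OF \<sigma>(1) M(2)]])
    have "Ind (\<sigma> ` set e') (\<sigma> ` C) (\<sigma> ` set ?d)" by (rule Ind_aut[OF aut M(1,3,4) Ind_mono[OF D(5) order_refl dD]])
    then show "Ind (set e) C (set (map \<sigma> ?d))" unfolding C E by (simp only: set_map)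
    have "Ind (\<sigma> ` set b') (\<sigma> ` C) (\<sigma> ` set ?d)" by (rule Ind_aut[OF aut M(2,3,4) Ind_mono[OF D(6) order_refl dD]])
    then show "Ind (set (map \<sigma> b')) C (set (map \<sigma> ?d))" unfolding C by (simp only: set_map)
    show "\<not> Ind (set e) (C Un set (map \<sigma> ?d)) (set (map \<sigma> b'))"
    proof
      assume I: "Ind (set e) (C Un set (map \<sigma> ?d)) (set (map \<sigma> b'))"
      have "Ind (\<tau> ` set e) (\<tau> ` (C Un set (map \<sigma> ?d))) (\<tau> ` set (map \<sigma> b'))"
        by (rule Ind_aut[OF fixes_aut[OF \<tau>(1)] _ _ _ I]) (use assms(2) M aut_set[OF aut] in auto)
      moreover have "\<tau> ` set e = set e'" using ts[OF M(1)] E by simp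
      moreover have "\<tau> ` set (map \<sigma> b') = set b'" using ts[OF M(2)] by (simp only: set_map)
      moreover have "\<tau> ` (C Un set (map \<sigma> ?d)) = C Un set ?d"
        using ts[OF M(3)] fixes_image[OF \<tau>(1) order_refl] by (simp only: set_map image_Un)
      ultimately show False using ni by simp
    qed
  qed
qed

text \<open>Otherwise configurations could be enlarged along \<open>\<nu>\<close>, with unions at
  limits, so that \<open>d\<close> depends on the new testers at every step, against local
  character.\<close>

lemma capture:
  assumes d: "set d <= M" and B: "sm B" and c: "legit c"
  shows "\<exists>c1. legit c1 & c <= c1 & (\<forall>c2. legit c2 --> c1 <= c2 --> Ind (set d) (B Un tst c1) (tst c2))"
proof (rule ccontr)
  assume no: "\<not> ?thesis"
  let ?X = "{c'. legit c' & c <= c'}"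
  let ?sl = "%s t. s <= t & \<not> Ind (set d) (B Un tst s) (tst t)"
  have "\<exists>f. (\<forall>i\<in>Field \<nu>. f i \<in> ?X) & (\<forall>i j. nlt i j --> ?sl (f i) (f j))"
  proof (rule nu_recursion[where le = "(<=)"])
    fix J and f :: "'v => ('c + 'c list \<times> 'c) set"
    assume J: "J <= Field \<nu>" and f: "!!i. i \<in> J ==> f i \<in> ?X" and ch: "!!i j. i \<in> J ==> j \<in> J ==> nlt i j ==> f i <= f j"
    show "\<exists>t\<in>?X. \<forall>i\<in>J. f i <= t"
    proof (cases "J = {}")
      case True then show ?thesis using c by (intro bexI[of _ c]) auto
    next
      case False
      have "f i <= f j \<or> f j <= f i" if "i \<in> J" "j \<in> J" for i j
        using nlt_total[of i j] J that ch by (cases "i = j") auto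
      then have "legit (\<Union>i\<in>J. f i)" using f by (intro legit_chain[OF False nu_subset[OF J]]) auto
      moreover have "c <= (\<Union>i\<in>J. f i)" using f False by blast
      ultimately show ?thesis by (intro bexI[of _ "\<Union>i\<in>J. f i"]) auto
    qed
  next
    fix s assume s: "s \<in> ?X"
    then have "\<not> (\<forall>c2. legit c2 --> s <= c2 --> Ind (set d) (B Un tst s) (tst c2))" using no by blast
    then obtain c2 where "legit c2" "s <= c2" "\<not> Ind (set d) (B Un tst s) (tst c2)" by blast
    then show "\<exists>t\<in>?X. ?sl s t" using s by (intro bexI[of _ c2]) auto
  next
    fix s t u assume a: "s \<in> ?X" "t \<in> ?X" "u \<in> ?X" "s <= t" "?sl t u"
    have "\<not> Ind (set d) (B Un tst s) (tst u)"
    proof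
      assume I: "Ind (set d) (B Un tst s) (tst u)"
      have "Ind (set d) (B Un tst t) (tst u)"
        by (rule Ind_base_mono[OF I]) (use tst_mono[of s t] tst_mono[of t u] a in auto)
      then show False using a(5) by blast
    qed
    then show "?sl s u" using a by blast
  qed blast
  then obtain f where f: "\<forall>i\<in>Field \<nu>. f i \<in> ?X" "\<forall>i j. nlt i j --> ?sl (f i) (f j)" by (elim exE conjE)
  show False
  proof (rule local_character_chain[OF d, of "%i. B Un tst (f i)"])
    show "sm (B Un tst (f i))" if "i \<in> Field \<nu>" for i using f(1) that sm_Un[OF B legit_sm_tst] by blast
    show "B Un tst (f i) <= B Un tst (f j)" if "nlt i j" for i j using f(2) that tst_mono[of "f i" "f j"] by blast
    show "\<not> Ind (set d) (B Un tst (f i)) (B Un tst (f j))" if "nlt i j" for i j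
    proof
      assume "Ind (set d) (B Un tst (f i)) (B Un tst (f j))"
      then have "Ind (set d) (B Un tst (f i)) (tst (f j))" by (rule Ind_mono) auto
      then show False using f(2) that by blast
    qed
  qed
qed

lemma progress:
  assumes S: "state c g b"
  shows "\<exists>c1 g1 b1. state c1 g1 b1 & c <= c1 & g <= g1 & eqt (base c g) b b1 & \<not> Ind (set b1) (base c g) (base c1 g1)"
proof -
  have s: "legit c" "sm g" "set a <= g" "eqt (A Un set a) b0 b" "Ind (set b) (A Un set a) (tst c)"
    "\<forall>c'. legit c' --> c <= c' --> Ind g (A Un tst c) (tst c')" using S unfolding state_def by blast+
  define T where "T = tst c"
  define C where "C = A Un T Un g"
  have Cb: "base c g = C" unfolding C_def T_def base_def ..
  have bM: "set b <= M" and sT: "sm T" and sC: "sm C" using state_sm[OF S] unfolding Cb T_def by blast+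
  have sb: "sm (set b)" by (rule sm_set[OF bM])
  have nab: "\<not> algb C b" using state_not_algb[OF S] unfolding Cb .
  have na0: "\<not> algb A b0" by (rule b0_not_algb[OF S])
  have lb: "length b0 = m" using b0t by (simp add: tup_iff)
  \<comment> \<open>Both \<open>a\<close> and \<open>g\<close> may be empty, whereas a tuple counts
    as constrained only if it has a constraint. The entries of \<open>y\<close>, which exist since
    \<open>m\<close> is not 0, make \<open>g'\<close> nonempty.\<close>
  from legit_constrained[OF s(1,2)] obtain y where y: "y \<in> tup M m" by (elim bexE)
  define g' where "g' = g Un set y"
  have "y ~= []" using y m_pos[OF na0] by (auto simp: tup_iff)
  then have g': "sm g'" "g' ~= {}" "set a <= g'" unfolding g'_def using s(2,3) y sm_Un sm_set by (auto simp: tup_iff)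
  from EM_legit[OF s(1) g' na0] obtain cE J where E: "legit cE" "c <= cE" "\<forall>i\<in>Field \<nu>. eqt A b0 (J i)" "indisc (Field \<nu>) nlt (A Un g' Un fld c) m J"
    "\<forall>i\<in>Field \<nu>. g' Un (\<Union>k\<in>{k. nlt k i}. set (J k)) <= cst cE (J i)" by (elim exE conjE)
  define L where "L i = (\<Union>k\<in>{k. nlt k i}. set (J k))" for i
  define EE where "EE = (\<Union>i\<in>Field \<nu>. set (J i))"
  have JM: "set (J i) <= M" if "i \<in> Field \<nu>" for i using eqt_M E(3) that by blast
  have sJ: "sm (set (J i))" if "i \<in> Field \<nu>" for i by (rule sm_set[OF JM[OF that]])
  have sL: "sm (L i)" for i unfolding L_def by (rule sm_UN[OF nu_subset sJ]) (use nlt_Field in auto)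
  have sEE: "sm EE" unfolding EE_def by (rule sm_UN[OF nu_subset[OF order_refl] sJ])
  \<comment> \<open>Constraints persist when the configuration grows, so each \<open>J i\<close> is
    free from the testers of all later configurations as well.\<close>
  have JI: "Ind (set (J i)) A (g Un L i Un tst c2)" if i: "i \<in> Field \<nu>" and c2: "legit c2" "cE <= c2" for i c2
  proof -
    have sub: "g' Un L i <= cst c2 (J i)" using E(5) i cst_mono[OF c2(2), of "J i"] unfolding L_def by blast
    then have "cst c2 (J i) ~= {}" using g'(2) by blast
    from legit_cst_Ind[OF c2(1) this] show ?thesis by (rule Ind_mono) (use sub in \<open>auto simp: g'_def\<close>)
  qed
  have indC: "indisc (Field \<nu>) nlt C m J"
  proof -
    have "C <= A Un g' Un fld c" unfolding C_def T_def g'_def using tst_fld by blast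
    then show ?thesis using E(4) unfolding indisc_def using eqt_mono by blast
  qed
  obtain i0 where i0: "i0 \<in> Field \<nu>" using nu_ne by blast
  have nae: "\<not> algb C (J i0)"
  proof
    assume al: "algb C (J i0)"
    have "Ind (set (J i0)) A (T Un g)" by (rule Ind_mono[OF JI[OF i0 E(1) order_refl]]) (use tst_mono[OF E(2)] in \<open>auto simp: T_def\<close>)
    moreover have "algb (A Un (T Un g)) (J i0)" using al unfolding C_def by (simp add: Un_assoc)
    ultimately have "algb A (J i0)" by (rule algb_Ind[OF _ _ sA sm_Un[OF sT s(2)] JM[OF i0]])
    then show False using na0 algb_eqt[OF eqt_sym] E(3) i0 by blast
  qed
  from finite_UNI[OF sC JM[OF i0] bM nae nab] obtain d b1 where d: "set d <= M" "eqt C b b1" "Ind (set (J i0)) C (set d)" "Ind (set b1) C (set d)"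
    "\<not> Ind (set (J i0)) (C Un set d) (set b1)" by (elim exE conjE)
  have b1M: "set b1 <= M" using eqt_M[OF d(2)] by blast
  from nlt_sequence obtain \<iota> :: "nat => 'v" where \<iota>: "\<forall>t. \<iota> t \<in> Field \<nu>" "\<forall>s t. s < t --> nlt (\<iota> s) (\<iota> t)" by (elim exE conjE)
  have lJ: "length (J i) = m" if "i \<in> Field \<nu>" for i using eqt_length E(3) lb that by metis
  \<comment> \<open>One copy \<open>d'\<close> of \<open>d\<close> is in the same relation to every
    \<open>J i\<close> as \<open>d\<close> is to \<open>J i0\<close>; this permits choosing the
    index after \<open>c1\<close>.\<close>
  have "\<exists>f. range f <= M & (\<forall>i\<in>Field \<nu>. \<forall>u. set u <= set d --> eqt C (u @ J i0) (map f u @ J i))"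
  proof (rule common_realization[OF _ sm_set[OF d(1)] sC JM[OF i0]])
    show "Ind (set d) C (set (J i0))" by (rule symmetry[OF d(3) sJ[OF i0] sm_set[OF d(1)] sC])
    show "indisc (Field \<nu>) nlt C (length (J i0)) J" using indC lJ[OF i0] by simp
    show "eqt C (J i0) (J i)" if i: "i \<in> Field \<nu>" for i
    proof -
      have "increasing (Field \<nu>) nlt [i0]" "increasing (Field \<nu>) nlt [i]" using i i0 by (auto simp: increasing_def)
      then have "eqt C (concat (map J [i0])) (concat (map J [i]))" using indC unfolding indisc_def by (metis length_Cons)
      then show ?thesis by simp
    qed
    show "\<iota> t \<in> Field \<nu>" for t using \<iota>(1) by simp
    show "nlt (\<iota> s) (\<iota> t)" if "s < t" for s t using \<iota>(2) that by simp
    show "nlt i k" if "nlt i j" "nlt j k" for i j k using nlt_trans that .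
    show "nlt i j \<or> nlt j i" if "i \<in> Field \<nu>" "j \<in> Field \<nu>" "i ~= j" for i j using nlt_total that .
    show "|Field \<nu>| \<le>o \<nu>" by (rule nu_subset[OF order_refl])
  qed
  then obtain f where f: "range f <= M" "\<forall>i\<in>Field \<nu>. \<forall>u. set u <= set d --> eqt C (u @ J i0) (map f u @ J i)" by (elim exE conjE)
  define d' where "d' = map f d"
  have dd: "eqt C (d @ J i0) (d' @ J i)" if "i \<in> Field \<nu>" for i using f(2) that unfolding d'_def by blast
  have d'M: "set d' <= M" using f(1) unfolding d'_def by auto
  have sd': "sm (set d')" by (rule sm_set[OF d'M])
  \<comment> \<open>The index is still open, so \<open>d'\<close> is captured over the whole
    sequence \<open>EE\<close>.\<close>
  have sAgE: "sm (A Un g Un EE)" using sA s(2) sEE sm_Un by blast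
  from capture[OF d'M sAgE E(1)] obtain c1 where c1: "legit c1" "cE <= c1"
    "\<forall>c2. legit c2 --> c1 <= c2 --> Ind (set d') (A Un g Un EE Un tst c1) (tst c2)" by (elim exE conjE)
  define T1 where "T1 = tst c1"
  have TT1: "T <= T1" unfolding T_def T1_def using tst_mono[OF E(2)] tst_mono[OF c1(2)] by blast
  have sT1: "sm T1" unfolding T1_def by (rule legit_sm_tst[OF c1(1)])
  \<comment> \<open>The segments \<open>L i\<close> form a chain of length \<open>\<nu>\<close>;
    local character gives an index at which \<open>d'\<close> and \<open>J i\<close> are independent
    over the testers of \<open>c1\<close>.\<close>
  have "\<exists>i\<in>Field \<nu>. Ind (set d') (A Un g Un T1 Un L i) (set (J i))"
  proof (rule local_character[OF d'M])
    show "sm (A Un g Un T1 Un L i)" for i using sA s(2) sT1 sL sm_Un by blast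
    fix i j assume "(i, j) \<in> \<nu>" "i ~= j"
    then have ij: "nlt i j" by (simp add: nlt_def)
    then have "set (J i) <= L j" "L i <= L j" unfolding L_def using nlt_trans by blast+
    then show "A Un g Un T1 Un L i Un set (J i) <= A Un g Un T1 Un L j" by blast
  qed
  then obtain i where i: "i \<in> Field \<nu>" "Ind (set d') (A Un g Un T1 Un L i) (set (J i))" by (elim bexE)
  let ?j = "set (J i)" and ?d = "set d'"
  have sj: "sm ?j" by (rule sJ[OF i(1)])
  have sTL: "sm (T1 Un L i)" by (rule sm_Un[OF sT1 sL])
  have sCd: "sm (C Un ?d)" by (rule sm_Un[OF sC sd'])
  \<comment> \<open>This is the purpose of the choice of \<open>i\<close>: over \<open>C\<close> and
    \<open>d'\<close> the tuple \<open>J i\<close> is independent from the testers of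
    \<open>c1\<close>, although these were chosen after \<open>d'\<close>.\<close>
  have K7: "Ind ?j (C Un ?d) T1"
  proof -
    have 1: "Ind ?j A (g Un L i Un T1)" using JI[OF i(1) c1(1,2)] unfolding T1_def .
    have 2: "Ind ?j C (T1 Un L i)"
      by (rule Ind_mono[OF Ind_base_mono[OF 1, of C]]) (use TT1 in \<open>auto simp: C_def\<close>)
    have "Ind ?j (A Un g Un T1 Un L i) ?d"
      by (rule symmetry[OF i(2) sd' sj]) (use sA s(2) sT1 sL sm_Un in blast)
    moreover have "A Un g Un T1 Un L i = C Un (T1 Un L i)" using TT1 unfolding C_def by blast
    ultimately have 3: "Ind ?j (C Un (T1 Un L i)) ?d" by simp
    have 4: "Ind ?j C ((T1 Un L i) Un ?d)" by (rule right_transitivity[OF 2 3 sj sC sTL sd'])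
    show ?thesis by (rule Ind_mono[OF Ind_base_mono[OF 4, of "C Un ?d"]]) auto
  qed
  obtain \<sigma> where \<sigma>: "fixes_on C \<sigma>" "map \<sigma> (d @ J i0) = d' @ J i" by (rule eqt_aut[OF dd[OF i(1)] sC])
  have ld: "length d = length d'" unfolding d'_def by simp
  have \<sigma>d: "map \<sigma> d = d'" "map \<sigma> (J i0) = J i" using \<sigma>(2) ld by simp_all
  have \<sigma>s: "\<sigma> ` set d = ?d" "\<sigma> ` set (J i0) = ?j" using \<sigma>d by (metis image_set)+
  note aut = fixes_aut[OF \<sigma>(1)]
  have \<sigma>C: "\<sigma> ` C = C" by (rule fixes_image[OF \<sigma>(1) order_refl])
  have CM: "C <= M" by (rule sm_sub[OF sC])
  define b1' where "b1' = map \<sigma> b1"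
  have \<sigma>b: "\<sigma> ` set b1 = set b1'" unfolding b1'_def by simp
  have b1'M: "set b1' <= M" using aut_set[OF aut b1M] \<sigma>b by simp
  have bb1: "eqt C b b1'" unfolding b1'_def by (rule eqt_trans[OF d(2) fixes_eqt[OF \<sigma>(1) b1M]])
  have b1d: "Ind (set b1') C ?d" using Ind_aut[OF aut b1M d(1) CM d(4)] unfolding \<sigma>C \<sigma>b \<sigma>s .
  have nj: "\<not> Ind ?j (C Un ?d) (set b1')"
  proof
    assume I: "Ind ?j (C Un ?d) (set b1')"
    obtain \<tau> where \<tau>: "fixes_on C \<tau>" "!!x. x \<in> M ==> \<tau> (\<sigma> x) = x" using fixes_inverse[OF \<sigma>(1) CM] by metis
    have ts: "\<tau> ` \<sigma> ` S = S" if "S <= M" for S using that \<tau>(2) by (force simp: image_image)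
    have "Ind (\<tau> ` ?j) (\<tau> ` (C Un ?d)) (\<tau> ` set b1')"
      by (rule Ind_aut[OF fixes_aut[OF \<tau>(1)] JM[OF i(1)] b1'M _ I]) (use CM d'M in blast)
    moreover have "\<tau> ` ?j = set (J i0)" using ts[OF JM[OF i0]] \<sigma>s(2) by simp
    moreover have "\<tau> ` set b1' = set b1" using ts[OF b1M] \<sigma>b by simp
    moreover have "\<tau> ` (C Un ?d) = C Un set d" using ts[OF d(1)] \<sigma>s(1) fixes_image[OF \<tau>(1) order_refl] by (simp add: image_Un)
    ultimately show False using d(5) by simp
  qed
  have sD2: "sm (C Un ?d Un ?j)" by (rule sm_Un[OF sCd sj])
  \<comment> \<open>Conjugation over \<open>C\<close>, \<open>d'\<close> and \<open>J i\<close>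
    preserves the dependence on \<open>J i\<close>, while the new copy becomes free from the testers
    of \<open>c1\<close>.\<close>
  from nonforking_extension_exists[OF sD2 sT1 b1'M] obtain b2 where b2: "eqt (C Un ?d Un ?j) b1' b2" "Ind (set b2) (C Un ?d Un ?j) T1" by (elim exE conjE)
  have b2M: "set b2 <= M" using eqt_M[OF b2(1)] by blast
  have sb2: "sm (set b2)" by (rule sm_set[OF b2M])
  have bb2: "eqt C b b2" by (rule eqt_trans[OF bb1 eqt_mono[OF b2(1)]]) blast
  have b2d: "Ind (set b2) C ?d" by (rule Ind_eqt[OF b2(1) sD2 b1d]) blast
  have nb2: "\<not> Ind (set b2) (C Un ?d) ?j"
  proof
    assume "Ind (set b2) (C Un ?d) ?j"
    then have "Ind (set b1') (C Un ?d) ?j" by (rule Ind_eqt[OF eqt_sym[OF b2(1)] sD2]) blast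
    then have "Ind ?j (C Un ?d) (set b1')" by (rule symmetry[OF _ sm_set[OF b1'M] sj sCd])
    then show False using nj by blast
  qed
  define g1 where "g1 = g Un ?d Un ?j"
  have sg1: "sm g1" unfolding g1_def using s(2) sd' sj sm_Un by blast
  have cc1: "c <= c1" using E(2) c1(2) by blast
  \<comment> \<open>Transitivity in the order \<open>g\<close>, then the sequence member by member,
    then \<open>d'\<close>: the constraints of \<open>J k\<close> handle each member, and the
    capture handles \<open>d'\<close>.\<close>
  have cap: "Ind g1 (A Un T1) (tst c2)" if c2: "legit c2" "c1 <= c2" for c2
  proof -
    have sT2: "sm (tst c2)" by (rule legit_sm_tst[OF c2(1)])
    have T12: "T1 <= tst c2" unfolding T1_def by (rule tst_mono[OF c2(2)])
    have sAT1: "sm (A Un T1)" by (rule sm_Un[OF sA sT1])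
    have cE2: "cE <= c2" using c1(2) c2(2) by blast
    have "Ind g (A Un T) (tst c2)" using s(6) c2 cc1 unfolding T_def by blast
    then have h1: "Ind g (A Un T1) (tst c2)" by (rule Ind_base_mono) (use TT1 T12 in auto)
    let ?C2 = "A Un T1 Un g"
    have sC2: "sm ?C2" by (rule sm_Un[OF sAT1 s(2)])
    have hk: "Ind (\<Union>k\<in>set ks. set (J k)) ?C2 (tst c2)" if "sorted_wrt nlt ks" "set ks <= Field \<nu>" for ks
      using that
    proof (induction ks rule: rev_induct)
      case Nil show ?case using Ind_empty[OF sC2] by simp
    next
      case (snoc k ks)
      let ?U = "\<Union>k\<in>set ks. set (J k)"
      have IH: "Ind ?U ?C2 (tst c2)" using snoc by (simp add: sorted_wrt_append)
      have kF: "k \<in> Field \<nu>" using snoc.prems by simp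
      have "set ks <= {k'. nlt k' k}" using snoc.prems(1) by (auto simp: sorted_wrt_append)
      then have UL: "?U <= L k" unfolding L_def by blast
      have "Ind (set (J k)) (?C2 Un ?U) (g Un L k Un tst c2)"
        by (rule Ind_base_mono[OF JI[OF kF c2(1) cE2]]) (use UL T12 in auto)
      then have "Ind (set (J k)) (?C2 Un ?U) (tst c2)" by (rule Ind_mono) auto
      then have "Ind (?U Un set (J k)) ?C2 (tst c2)"
        by (rule left_transitivity[OF IH _ sm_mono[OF sL UL] sJ[OF kF] sT2 sC2])
      then show ?case by (simp add: Un_commute)
    qed
    have h2: "Ind EE (A Un T1 Un g) (tst c2)"
    proof (rule Ind_lists)
      fix x assume x: "set x <= EE"
      have "\<forall>z\<in>set x. \<exists>k. k \<in> Field \<nu> & z \<in> set (J k)" using x unfolding EE_def by blast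
      from bchoice[OF this] obtain kf where kf: "\<forall>z\<in>set x. kf z \<in> Field \<nu> & z \<in> set (J (kf z))" ..
      have K: "finite (kf ` set x)" "kf ` set x <= Field \<nu>" using kf by auto
      have "\<exists>ks. sorted_wrt nlt ks & set ks = kf ` set x" by (rule sorted_enumeration[OF K]) (erule (2) nlt_total, erule (1) nlt_trans)
      then obtain ks where ks: "sorted_wrt nlt ks" "set ks = kf ` set x" by (elim exE conjE)
      show "Ind (set x) ?C2 (tst c2)" by (rule Ind_mono[OF hk[OF ks(1)]]) (use ks(2) K(2) kf in auto)
    qed
    have "Ind ?d (A Un g Un EE Un T1) (tst c2)" using c1(3) c2 unfolding T1_def by blast
    moreover have "A Un g Un EE Un T1 = (A Un T1) Un (g Un EE)" by blast
    ultimately have h3: "Ind ?d ((A Un T1) Un (g Un EE)) (tst c2)" by simp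
    have h4: "Ind (g Un EE) (A Un T1) (tst c2)" by (rule left_transitivity[OF h1 h2 s(2) sEE sT2 sAT1])
    have "Ind ((g Un EE) Un ?d) (A Un T1) (tst c2)"
      by (rule left_transitivity[OF h4 h3 sm_Un[OF s(2) sEE] sd' sT2 sAT1])
    then show ?thesis by (rule Ind_mono) (use i(1) in \<open>auto simp: g1_def EE_def\<close>)
  qed
  \<comment> \<open>The base descends in three stages: to \<open>C Un ?d\<close> by
    \<open>K7\<close>, to \<open>C\<close> because \<open>b2\<close> is independent from
    \<open>d'\<close> over \<open>C\<close>, and to \<open>A Un set a\<close> by the clauses of
    \<open>state\<close> for \<open>g\<close> and for \<open>b\<close>.\<close>
  have b2T1: "Ind (set b2) (A Un set a) T1"
  proof -
    have s1: "Ind T1 (C Un ?d Un ?j) (set b2)" by (rule symmetry[OF b2(2) sb2 sT1 sD2])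
    have s2: "Ind T1 (C Un ?d) ?j" by (rule symmetry[OF K7 sj sT1 sCd])
    have "Ind T1 (C Un ?d) (?j Un set b2)" by (rule right_transitivity[OF s2 s1 sT1 sCd sj sb2])
    then have "Ind T1 (C Un ?d) (set b2)" by (rule Ind_mono) auto
    then have "Ind (set b2) (C Un ?d) T1" by (rule symmetry[OF _ sT1 sb2 sCd])
    then have "Ind (set b2) C (?d Un T1)" by (rule right_transitivity[OF b2d _ sb2 sC sd' sT1])
    then have "Ind (set b2) C T1" by (rule Ind_mono) auto
    then have s3: "Ind T1 (A Un T Un g) (set b2)" unfolding C_def[symmetric] by (rule symmetry[OF _ sb2 sT1 sC])
    have sAT: "sm (A Un T)" by (rule sm_Un[OF sA sT])
    have "Ind g (A Un T) T1" using s(6) c1(1) cc1 unfolding T_def T1_def by blast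
    then have "Ind T1 (A Un T) g" by (rule symmetry[OF _ s(2) sT1 sAT])
    then have s4: "Ind T1 (A Un T) (g Un set b2)" by (rule right_transitivity[OF _ s3 sT1 sAT s(2) sb2])
    have sAa: "sm (A Un set a)" by (rule sm_Un[OF sA sm_a])
    have sAaT: "sm (A Un set a Un T)" by (rule sm_Un[OF sAa sT])
    have "Ind T1 (A Un set a Un T) (set b2)"
      by (rule Ind_mono[OF Ind_base_mono[OF s4, of "A Un set a Un T"]]) (use s(3) in auto)
    then have s5: "Ind (set b2) (A Un set a Un T) T1" by (rule symmetry[OF _ sT1 sb2 sAaT])
    have s6: "Ind (set b2) (A Un set a) T"
      by (rule Ind_eqt[OF bb2 sC]) (use s(3,5) in \<open>auto simp: C_def T_def\<close>)
    have "Ind (set b2) (A Un set a) (T Un T1)" by (rule right_transitivity[OF s6 s5 sb2 sAa sT sT1])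
    then show ?thesis by (rule Ind_mono) auto
  qed
  have st: "state c1 g1 b2" unfolding state_def
  proof (intro conjI allI impI)
    show "legit c1" by (rule c1(1))
    show "sm g1" by (rule sg1)
    show "set a <= g1" using s(3) unfolding g1_def by blast
    show "eqt (A Un set a) b0 b2" by (rule eqt_trans[OF s(4) eqt_mono[OF bb2]]) (use s(3) in \<open>auto simp: C_def\<close>)
    show "Ind (set b2) (A Un set a) (tst c1)" using b2T1 unfolding T1_def .
    show "Ind g1 (A Un tst c1) (tst c2)" if "legit c2" "c1 <= c2" for c2 using cap[OF that] unfolding T1_def .
  qed
  have "\<not> Ind (set b2) C (base c1 g1)"
  proof
    assume I: "Ind (set b2) C (base c1 g1)"
    have "Ind (set b2) (C Un ?d) (base c1 g1)" by (rule Ind_base_mono[OF I]) (auto simp: base_def g1_def)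
    then have "Ind (set b2) (C Un ?d) ?j" by (rule Ind_mono) (auto simp: base_def g1_def)
    then show False using nb2 by blast
  qed
  then show ?thesis using st cc1 bb2 unfolding Cb by (intro exI[of _ c1] exI[of _ g1] exI[of _ b2]) (auto simp: g1_def)
qed

text \<open>The tuple may change, but its type over the earlier base is kept; along a chain the
  types over the bases therefore increase.\<close>

definition below :: "('c + 'c list \<times> 'c) set \<times> 'c set \<times> 'c list => ('c + 'c list \<times> 'c) set \<times> 'c set \<times> 'c list => bool" where
  "below s t \<longleftrightarrow> fst s <= fst t & fst (snd s) <= fst (snd t) & eqt (base (fst s) (fst (snd s))) (snd (snd s)) (snd (snd t))"

definition bs :: "('c + 'c list \<times> 'c) set \<times> 'c set \<times> 'c list => 'c set" where "bs s = base (fst s) (fst (snd s))"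

definition states :: "(('c + 'c list \<times> 'c) set \<times> 'c set \<times> 'c list) set" where
  "states = {s. state (fst s) (fst (snd s)) (snd (snd s))}"

lemma base_mono: "c <= c' ==> g <= g' ==> base c g <= base c' g'"
  unfolding base_def using tst_mono by blast

lemma below_bs: "below s t ==> bs s <= bs t"
  unfolding below_def bs_def by (intro base_mono) auto

text \<open>A finite part of the union of the types is realized by the tuple \<open>f j\<close> that
  \<open>ub\<close> provides for the indices involved.\<close>

lemma common_tuple:
  fixes f :: "'i => 'c list"
  assumes J: "J ~= {}" "|J| \<le>o \<nu>" and B: "!!i. i \<in> J ==> sm (B i)" and f: "!!i. i \<in> J ==> f i \<in> tup M k"
    and ub: "!!K. finite K ==> K <= J ==> K ~= {} ==> \<exists>j\<in>K. \<forall>i\<in>K. eqt (B i) (f i) (f j)"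
  shows "\<exists>b. \<forall>i\<in>J. eqt (B i) (f i) b"
proof -
  define T where "T = {(i, R, p). i \<in> J & set p <= B i & R \<in> Def (k + length p) & f i @ p \<in> R}"
  define Q where "Q t h = (map h [0..<k] @ snd (snd t) \<in> fst (snd t))" for t :: "'i \<times> 'c list set \<times> 'c list" and h
  have sB: "sm (\<Union>i\<in>J. B i)" by (rule sm_UN[OF J(2) B])
  have fl: "length (f i) = k" "set (f i) <= M" if "i \<in> J" for i using f[OF that] by (auto simp: tup_iff)
  have "\<exists>h. range h <= M & (\<forall>t\<in>T. Q t h)"
  proof (rule compactness_indexed[of "{..<k}" "\<Union>i\<in>J. B i"])
    show "|{..<k}| \<le>o \<nu>" by (rule finite_le_nu) simp
    show "sm (\<Union>i\<in>J. B i)" by (rule sB)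
    show "DF {..<k} (\<Union>i\<in>J. B i) (Q t)" if t: "t \<in> T" for t
    proof -
      obtain i R p where tt: "t = (i, R, p)" by (cases t)
      have p: "i \<in> J" "set p <= B i" "R \<in> Def (k + length p)" using t unfolding tt T_def by auto
      show ?thesis unfolding Q_def tt fst_conv snd_conv
        by (rule DF_mem[OF p(3)]) (use p sm_sub[OF B[OF p(1)]] in auto)
    qed
    fix T0 assume T0: "T0 <= T" "finite T0"
    obtain j where j: "j \<in> J" "\<forall>i\<in>fst ` T0. eqt (B i) (f i) (f j)"
    proof (cases "T0 = {}")
      case True
      obtain j where "j \<in> J" using J(1) by blast
      then show ?thesis using that[of j] True by simp
    next
      case False
      have "fst ` T0 <= J" using T0(1) unfolding T_def by auto
      then show ?thesis using ub[of "fst ` T0"] T0(2) False that by blast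
    qed
    have mj: "map (asg (f j)) [0..<k] = f j" using map_asg[of "f j"] fl(1)[OF j(1)] by simp
    have "Q t (asg (f j))" if t: "t \<in> T0" for t
    proof -
      obtain i R p where tt: "t = (i, R, p)" by (cases t)
      have p: "i \<in> J" "set p <= B i" "R \<in> Def (k + length p)" "f i @ p \<in> R" using t T0(1) unfolding tt T_def by auto
      have "eqt (B i) (f i) (f j)" using j(2) t tt by force
      from eqtD[OF this p(4) _ p(2)] have "f j @ p \<in> R" using p(3) fl(1)[OF p(1)] by simp
      then show ?thesis unfolding Q_def tt fst_conv snd_conv mj .
    qed
    moreover have "range (asg (f j)) <= M" by (rule asg_range[OF fl(2)[OF j(1)]])
    ultimately show "\<exists>h. range h <= M & (\<forall>t\<in>T0. Q t h)" by (intro exI[of _ "asg (f j)"] conjI ballI)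
  qed
  then obtain h where h: "range h <= M" "\<forall>t\<in>T. Q t h" by (elim exE conjE)
  have "eqt (B i) (f i) (map h [0..<k])" if i: "i \<in> J" for i
  proof (rule eqtI)
    show "length (f i) = length (map h [0..<k])" "set (f i) <= M" "set (map h [0..<k]) <= M" using fl[OF i] h(1) by auto
    fix R p assume "set p <= B i" "R \<in> Def (length (f i) + length p)" "f i @ p \<in> R"
    then have "(i, R, p) \<in> T" unfolding T_def using i fl(1)[OF i] by simp
    from bspec[OF h(2) this] show "map h [0..<k] @ p \<in> R" unfolding Q_def by simp
  qed
  then show ?thesis by blast
qed

text \<open>Configurations and base sets are united, and the new tuple realizes the union of the
  types. The independence clauses survive by finite character of the independent side. The empty
  chain yields the initial state \<open>({}, set a, b0)\<close>, whose last clause is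
  \<open>legit_tst_Ind\<close>.\<close>

lemma states_limit:
  assumes J: "J <= Field \<nu>" and f: "!!i. i \<in> J ==> f i \<in> states" and ch: "!!i j. i \<in> J ==> j \<in> J ==> nlt i j ==> below (f i) (f j)"
  shows "\<exists>t\<in>states. \<forall>i\<in>J. below (f i) t"
proof (cases "J = {}")
  case True
  have "state {} (set a) b0" unfolding state_def
  proof (intro conjI allI impI legit_empty sm_a order_refl)
    show "eqt (A Un set a) b0 b0" by (rule eqt_refl[OF b0M])
    show "Ind (set b0) (A Un set a) (tst {})" by (rule Ind_mono[OF Ind_refl[OF sm_Un[OF sA sm_a] b0M]]) (auto simp: tst_def)
    show "Ind (set a) (A Un tst {}) (tst c')" if "legit c'" for c' using legit_tst_Ind[OF that] by (simp add: tst_def)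
  qed
  then show ?thesis using True by (intro bexI[of _ "({}, set a, b0)"]) (auto simp: states_def)
next
  case False
  let ?c = "%i. fst (f i)" and ?g = "%i. fst (snd (f i))" and ?b = "%i. snd (snd (f i))"
  have S: "state (?c i) (?g i) (?b i)" if "i \<in> J" for i using f[OF that] unfolding states_def by simp
  have s: "legit (?c i)" "sm (?g i)" "set a <= ?g i" "eqt (A Un set a) b0 (?b i)" "Ind (set (?b i)) (A Un set a) (tst (?c i))"
    "\<forall>c'. legit c' --> ?c i <= c' --> Ind (?g i) (A Un tst (?c i)) (tst c')" if "i \<in> J" for i
    using S[OF that] unfolding state_def by blast+
  have b: "?c i <= ?c j" "?g i <= ?g j" "eqt (bs (f i)) (?b i) (?b j)" if "i \<in> J" "j \<in> J" "nlt i j" for i j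
    using ch[OF that] unfolding below_def bs_def by simp_all
  have tot: "i = j \<or> nlt i j \<or> nlt j i" if "i \<in> J" "j \<in> J" for i j using nlt_total J that by blast
  have cch: "?c i <= ?c j \<or> ?c j <= ?c i" if "i \<in> J" "j \<in> J" for i j using tot[OF that] b(1) that by blast
  have gch: "?g i <= ?g j \<or> ?g j <= ?g i" if "i \<in> J" "j \<in> J" for i j using tot[OF that] b(2) that by blast
  have bM: "set (?b i) <= M" if "i \<in> J" for i using eqt_M[OF s(4)[OF that]] by blast
  have bl: "?b i \<in> tup M m" if "i \<in> J" for i using eqt_length[OF s(4)[OF that]] b0t bM[OF that] by (simp add: tup_iff)
  have sbs: "sm (bs (f i))" if "i \<in> J" for i using state_sm[OF S[OF that]] unfolding bs_def by blast
  have "\<exists>b. \<forall>i\<in>J. eqt (bs (f i)) (?b i) b"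
  proof (rule common_tuple[OF False nu_subset[OF J] sbs bl])
    fix K assume K: "finite K" "K <= J" "K ~= {}"
    have KF: "K <= Field \<nu>" using K(2) J by blast
    have "\<exists>ks. sorted_wrt nlt ks & set ks = K" by (rule sorted_enumeration[OF K(1) KF]) (erule (2) nlt_total, erule (1) nlt_trans)
    then obtain ks where ks: "sorted_wrt nlt ks" "set ks = K" by (elim exE conjE)
    have kn: "ks ~= []" using ks(2) K(3) by auto
    let ?j = "last ks"
    have jK: "?j \<in> K" using kn ks(2) by auto
    have "eqt (bs (f i)) (?b i) (?b ?j)" if i: "i \<in> K" for i
    proof (cases "i = ?j")
      case True then show ?thesis using eqt_refl[OF bM] i K(2) by auto
    next
      case False
      have "ks = butlast ks @ [?j]" using kn by simp
      then have "i \<in> set (butlast ks)" "\<forall>x\<in>set (butlast ks). nlt x ?j"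
        using i ks False by (metis set_append Un_iff empty_iff insert_iff list.set(1,2), metis sorted_wrt_append list.set_intros(1))
      then have "nlt i ?j" by blast
      then show ?thesis using b(3)[of i ?j] i jK K(2) by blast
    qed
    then show "\<exists>j\<in>K. \<forall>i\<in>K. eqt (bs (f i)) (?b i) (?b j)" using jK by (intro bexI[of _ ?j] ballI)
  qed
  then obtain b where be: "\<forall>i\<in>J. eqt (bs (f i)) (?b i) b" by (elim exE)
  let ?C = "\<Union>i\<in>J. ?c i" and ?G = "\<Union>i\<in>J. ?g i"
  have LC: "legit ?C" by (rule legit_chain[OF False nu_subset[OF J] s(1) cch])
  have tC: "tst ?C = (\<Union>i\<in>J. tst (?c i))" by (auto simp: tst_def)
  obtain i1 where i1: "i1 \<in> J" using False by blast
  have aAb: "A Un set a <= bs (f i)" if "i \<in> J" for i using s(3)[OF that] unfolding bs_def base_def by blast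
  have "state ?C ?G b" unfolding state_def
  proof (intro conjI allI impI)
    show "legit ?C" by (rule LC)
    show "sm ?G" by (rule sm_UN[OF nu_subset[OF J] s(2)])
    show "set a <= ?G" using s(3)[OF i1] i1 by blast
    show "eqt (A Un set a) b0 b" using eqt_trans[OF s(4)[OF i1] eqt_mono[OF bspec[OF be i1] aAb[OF i1]]] .
    show "Ind (set b) (A Un set a) (tst ?C)"
    proof (rule Ind_finite_character)
      fix x y assume x: "set x <= set b" "set y <= tst ?C"
      have "\<exists>i\<in>J. set y <= tst (?c i)"
      proof (rule chain_finite[OF False])
        show "tst (?c i) <= tst (?c j) \<or> tst (?c j) <= tst (?c i)" if "i \<in> J" "j \<in> J" for i j using cch[OF that] tst_mono by blast
      qed (use x(2) tC in auto)
      then obtain i where i: "i \<in> J" "set y <= tst (?c i)" by blast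
      have "Ind (set b) (A Un set a) (tst (?c i))"
        by (rule Ind_eqt[OF bspec[OF be i(1)] sbs[OF i(1)] s(5)[OF i(1)]]) (use aAb[OF i(1)] in \<open>auto simp: bs_def base_def\<close>)
      then show "Ind (set x) (A Un set a) (set y)" by (rule Ind_mono[OF _ x(1) i(2)])
    qed
    fix c' assume c': "legit c'" "?C <= c'"
    show "Ind ?G (A Un tst ?C) (tst c')"
    proof (rule Ind_lists)
      fix x assume x: "set x <= ?G"
      have "\<exists>i\<in>J. set x <= ?g i" by (rule chain_finite[OF False gch _ x]) auto
      then obtain i where i: "i \<in> J" "set x <= ?g i" by blast
      have ci: "?c i <= c'" using c'(2) i(1) by blast
      have I: "Ind (?g i) (A Un tst (?c i)) (tst c')" by (rule s(6)[OF i(1), rule_format, OF c'(1) ci])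
      have "Ind (?g i) (A Un tst ?C) (tst c')"
        by (rule Ind_base_mono[OF I]) (use i(1) tC tst_mono[OF c'(2)] in auto)
      then show "Ind (set x) (A Un tst ?C) (tst c')" by (rule Ind_mono[OF _ i(2) order_refl])
    qed
  qed
  then have "(?C, ?G, b) \<in> states" unfolding states_def by simp
  moreover have "below (f i) (?C, ?G, b)" if "i \<in> J" for i unfolding below_def fst_conv snd_conv
    using bspec[OF be that] that unfolding bs_def by (intro conjI) auto
  ultimately show ?thesis by blast
qed

text \<open>A chain of states of length \<open>\<nu>\<close> has an upper bound, whose tuple has
  over each base the type of the tuple of that state. It therefore forks at every step of the
  chain.\<close>

theorem contradiction: False
proof -
  let ?sl = "%s t. below s t & \<not> Ind (set (snd (snd t))) (bs s) (bs t)"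
  have "\<exists>f. (\<forall>i\<in>Field \<nu>. f i \<in> states) & (\<forall>i j. nlt i j --> ?sl (f i) (f j))"
  proof (rule nu_recursion[where le = below])
    fix J and f :: "'v => ('c + 'c list \<times> 'c) set \<times> 'c set \<times> 'c list"
    assume "J <= Field \<nu>" "!!i. i \<in> J ==> f i \<in> states" "!!i j. i \<in> J ==> j \<in> J ==> nlt i j ==> below (f i) (f j)"
    then show "\<exists>t\<in>states. \<forall>i\<in>J. below (f i) t" by (rule states_limit)
  next
    fix s assume s: "s \<in> states"
    then have "state (fst s) (fst (snd s)) (snd (snd s))" by (simp add: states_def)
    from progress[OF this] obtain c1 g1 b1 where t: "state c1 g1 b1" "fst s <= c1" "fst (snd s) <= g1"
      "eqt (base (fst s) (fst (snd s))) (snd (snd s)) b1" "\<not> Ind (set b1) (base (fst s) (fst (snd s))) (base c1 g1)" by (elim exE conjE)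
    show "\<exists>t\<in>states. ?sl s t"
      by (rule bexI[of _ "(c1, g1, b1)"]) (use t in \<open>simp_all add: below_def bs_def states_def\<close>)
  next
    fix s t u assume st: "s \<in> states" "t \<in> states" "u \<in> states" "below s t" "?sl t u"
    have sub: "bs s <= bs t" "bs t <= bs u" using below_bs st by blast+
    have "below s u" using st(4,5) eqt_trans[OF _ eqt_mono[of "bs t"]] sub(1) unfolding below_def bs_def by blast
    moreover have "\<not> Ind (set (snd (snd u))) (bs s) (bs u)"
    proof
      assume I: "Ind (set (snd (snd u))) (bs s) (bs u)"
      have "Ind (set (snd (snd u))) (bs t) (bs u)" by (rule Ind_base_mono[OF I]) (use sub in auto)
      then show False using st(5) by blast
    qed
    ultimately show "?sl s u" by blast
  qed blast
  then obtain f where f: "\<forall>i\<in>Field \<nu>. f i \<in> states" "\<forall>i j. nlt i j --> ?sl (f i) (f j)" by (elim exE conjE)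
  have "\<exists>t\<in>states. \<forall>i\<in>Field \<nu>. below (f i) t" by (rule states_limit) (use f in auto)
  then obtain t where t: "t \<in> states" "\<forall>i\<in>Field \<nu>. below (f i) t" by (elim bexE)
  let ?b = "snd (snd t)"
  have sS: "sm (bs s)" "set (snd (snd s)) <= M" if "s \<in> states" for s using that state_sm unfolding states_def bs_def by blast+
  show False
  proof (rule local_character_chain[of ?b "%i. bs (f i)"])
    show "set ?b <= M" by (rule sS(2)[OF t(1)])
    show "sm (bs (f i))" if "i \<in> Field \<nu>" for i using sS(1) f(1) that by blast
    show "bs (f i) <= bs (f j)" if "nlt i j" for i j using below_bs f(2) that by blast
    show "\<not> Ind (set ?b) (bs (f i)) (bs (f j))" if ij: "nlt i j" for i j
    proof
      assume I: "Ind (set ?b) (bs (f i)) (bs (f j))"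
      have jF: "j \<in> Field \<nu>" using nlt_Field[OF ij] by blast
      have e: "eqt (bs (f j)) ?b (snd (snd (f j)))" using t(2) jF eqt_sym unfolding below_def bs_def by blast
      have "Ind (set (snd (snd (f j)))) (bs (f i)) (bs (f j))"
        by (rule Ind_eqt[OF e _ I]) (use sS(1) f jF ij below_bs in auto)
      then show False using f(2) ij by blast
    qed
  qed
qed

end

section \<open>Basic tau^f-open sets as sets of tuples\<close>

context dstruct begin

lemma Def_Un: "R \<in> Def n ==> S \<in> Def n ==> R Un S \<in> Def n"
proof -
  assume RS: "R \<in> Def n" "S \<in> Def n"
  have "tup M n - ((tup M n - R) Int (tup M n - S)) \<in> Def n" by (intro Def_Diff Def_Int RS)
  moreover have "tup M n - ((tup M n - R) Int (tup M n - S)) = R Un S" using Def_sub RS by blast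
  ultimately show ?thesis by simp
qed

end

context simplestruct begin

text \<open>The forking variables are placed before \<open>a\<close>, and parameters from
  \<open>A\<close> after it. The agreement with the basic sets of the forking topology is
  \<open>tauf_basic_iff\<close>.\<close>

definition basic :: "'c set => nat => 'c list set set" where
  "basic A n = {{a \<in> tup M n. fk A k (Sol k R (a @ p))} | k R p. set p <= A & R \<in> Def (k + (n + length p))}"

lemma basicI: "set p <= A ==> R \<in> Def (k + (n + length p)) ==> {a \<in> tup M n. fk A k (Sol k R (a @ p))} \<in> basic A n"
  unfolding basic_def by blast

lemma basicE: "X \<in> basic A n ==> \<exists>k R p. set p <= A & R \<in> Def (k + (n + length p)) & X = {a \<in> tup M n. fk A k (Sol k R (a @ p))}"
  unfolding basic_def by blast

lemma basic_full: "tup M n \<in> basic A n"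
proof -
  have "tup M (0 + (n + 0)) - tup M (0 + (n + 0)) \<in> Def (0 + (n + 0))" by (rule Def_Diff[OF Def_full])
  from basicI[of "[]" A "{}" 0 n] this show ?thesis by (simp add: Sol_def fk_empty)
qed

text \<open>A formula without variables forks over \<open>A\<close> exactly when it is false, so
  \<open>k = 0\<close> and the complement of \<open>R\<close> give the set defined by
  \<open>R\<close>.\<close>

lemma basic_Def:
  assumes "sm A" "set p <= A" "R \<in> Def (n + length p)" shows "Sol n R p \<in> basic A n"
proof -
  let ?R = "tup M (0 + (n + length p)) - R"
  have nf: "\<not> fk A 0 (tup M 0)"
    using IndD[OF Ind_refl[OF assms(1) empty_subsetI], of "[]" "[]" "tup M 0"] Def_full[of 0] by (auto simp: Sol_def tup_def)
  have "p \<in> tup M (length p)" using assms(2) sm_sub[OF assms(1)] by (auto simp: tup_iff)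
  then have "fk A 0 (Sol 0 ?R (a @ p)) \<longleftrightarrow> a \<in> Sol n R p" if "a \<in> tup M n" for a
  proof (cases "a @ p \<in> R")
    case True
    then have "Sol 0 ?R (a @ p) = {}" by (auto simp: Sol_def tup_iff)
    then have "fk A 0 (Sol 0 ?R (a @ p))" by (simp only: fk_empty)
    then show ?thesis using True that by (simp add: Sol_def)
  next
    case False
    then have "Sol 0 ?R (a @ p) = tup M 0" using that \<open>p \<in> tup M (length p)\<close> by (auto simp: Sol_def tup_iff)
    then show ?thesis using nf False that by (simp add: Sol_def)
  qed
  then have "{a \<in> tup M n. fk A 0 (Sol 0 ?R (a @ p))} = Sol n R p" by (auto simp: Sol_def)
  then show ?thesis using basicI[OF assms(2), of ?R 0 n] Def_Diff[of R "0 + (n + length p)"] assms(3) by simp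
qed

lemma basic_eqt:
  assumes "sm A" "X \<in> basic A n" "a \<in> X" "eqt A a a'" shows "a' \<in> X"
proof -
  from basicE[OF assms(2)] obtain k R p where k: "set p <= A" "R \<in> Def (k + (n + length p))"
    "X = {a \<in> tup M n. fk A k (Sol k R (a @ p))}" by (elim exE conjE)
  have "fk A k (Sol k R (a' @ p))" by (rule fk_eqt[OF assms(4,1) k(1)]) (use assms(3) k in \<open>auto simp: tup_iff\<close>)
  then show ?thesis using k(3) assms(3) eqt_length[OF assms(4)] eqt_M[OF assms(4)] by (auto simp: tup_iff)
qed

text \<open>Otherwise take a solution free from the parameters over \<open>A\<close> and
  \<open>j\<close> further elements free over it. Together they are independent from the parameters
  and satisfy a forking formula.\<close>

lemma fk_projection:
  assumes sA: "sm A" and R: "R \<in> Def (k + length c)" and R': "R' \<in> Def (k' + length c')" and c: "set c <= set c'" "set c' <= M"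
    and f: "fk A k' (Sol k' R' c')"
    and z: "!!x y. x \<in> Sol k R c ==> y \<in> tup M j ==> \<exists>z\<in>Sol k' R' c'. set z = set x Un set y"
  shows "fk A k (Sol k R c)"
proof (rule ccontr)
  assume nf: "\<not> ?thesis"
  have sc: "sm (set c')" by (rule sm_set[OF c(2)])
  from nonforking_realization[OF R _ nf sA sc] c obtain x where x: "x \<in> Sol k R c" "Ind (set x) A (set c' Un set c)" by blast
  have I1: "Ind (set x) A (set c')" by (rule Ind_mono[OF x(2)]) auto
  have xM: "set x <= M" using x(1) by (simp add: Sol_def tup_iff)
  have sx: "sm (set x)" by (rule sm_set[OF xM])
  have y0: "set (replicate j x0) <= M" using x0 by auto
  from nonforking_extension_exists[OF sm_Un[OF sA sx] sc y0]
  obtain y where y: "eqt (A Un set x) (replicate j x0) y" "Ind (set y) (A Un set x) (set c')" by blast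
  have yt: "y \<in> tup M j" using eqt_M[OF y(1)] eqt_length[OF y(1)] by (simp add: tup_iff)
  then have "sm (set y)" by (intro sm_set) (simp add: tup_iff)
  then have I: "Ind (set x Un set y) A (set c')" by (rule left_transitivity[OF I1 y(2) sx _ sc sA])
  from z[OF x(1) yt] obtain z where z: "z \<in> Sol k' R' c'" "set z = set x Un set y" by blast
  show False by (rule IndD[OF I, of z c' R']) (use z R' f in \<open>auto simp: Sol_def tup_iff\<close>)
qed

text \<open>The union of the cylinders over \<open>X\<^sub>1\<close> and \<open>X\<^sub>2\<close> forks if and only if both \<open>X\<^sub>1\<close> and \<open>X\<^sub>2\<close> fork.\<close>

lemma basic_Int:
  assumes sA: "sm A" and "X1 \<in> basic A n" "X2 \<in> basic A n" shows "X1 Int X2 \<in> basic A n"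
proof -
  from basicE[OF assms(2)] obtain k1 R1 p1 where 1: "set p1 <= A" "R1 \<in> Def (k1 + (n + length p1))"
    "X1 = {a \<in> tup M n. fk A k1 (Sol k1 R1 (a @ p1))}" by (elim exE conjE)
  from basicE[OF assms(3)] obtain k2 R2 p2 where 2: "set p2 <= A" "R2 \<in> Def (k2 + (n + length p2))"
    "X2 = {a \<in> tup M n. fk A k2 (Sol k2 R2 (a @ p2))}" by (elim exE conjE)
  let ?k = "k1 + k2" and ?p = "p1 @ p2"
  let ?N = "?k + (n + length ?p)" and ?N1 = "k1 + (n + length p1)" and ?N2 = "k2 + (n + length p2)"
  \<comment> \<open>The maps read \<open>x1 @ a @ p1\<close> and \<open>x2 @ a @ p2\<close> off the
    tuple \<open>(x1 @ x2) @ a @ p1 @ p2\<close>.\<close>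
  let ?s1 = "%i. if i < k1 then i else i + k2" and ?s2 = "%i. if i < k2 + n then i + k1 else i + k1 + length p1"
  define R where "R = {z \<in> tup M ?N. map (%i. z ! ?s1 i) [0..<?N1] \<in> R1} Un {z \<in> tup M ?N. map (%i. z ! ?s2 i) [0..<?N2] \<in> R2}"
  have R: "R \<in> Def ?N" unfolding R_def by (intro Def_Un Def_reindex 1(2) 2(2)) auto
  have AM: "A <= M" by (rule sm_sub[OF sA])
  have mem: "(x1 @ x2) @ a @ ?p \<in> R \<longleftrightarrow> x1 @ a @ p1 \<in> R1 \<or> x2 @ a @ p2 \<in> R2"
    if "x1 \<in> tup M k1" "x2 \<in> tup M k2" "a \<in> tup M n" for x1 x2 a
  proof -
    let ?z = "(x1 @ x2) @ a @ ?p"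
    have "?z \<in> tup M ?N" using that 1(1) 2(1) AM by (auto simp: tup_iff)
    moreover have "map (%i. ?z ! ?s1 i) [0..<?N1] = x1 @ a @ p1"
      by (rule nth_equalityI) (use that in \<open>auto simp: tup_iff nth_append\<close>)
    moreover have "map (%i. ?z ! ?s2 i) [0..<?N2] = x2 @ a @ p2"
      by (rule nth_equalityI) (use that in \<open>auto simp: tup_iff nth_append\<close>)
    ultimately show ?thesis unfolding R_def by simp
  qed
  have split: "\<exists>x1\<in>tup M k1. \<exists>x2\<in>tup M k2. z = x1 @ x2" if "z \<in> tup M ?k" for z
    using that set_take_subset[of k1 z] set_drop_subset[of k1 z]
    by (intro bexI[of _ "take k1 z"] bexI[of _ "drop k1 z"]) (auto simp: tup_iff)
  have "fk A ?k (Sol ?k R (a @ ?p)) \<longleftrightarrow> fk A k1 (Sol k1 R1 (a @ p1)) & fk A k2 (Sol k2 R2 (a @ p2))" if a: "a \<in> tup M n" for a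
  proof (intro iffI conjI)
    assume f: "fk A ?k (Sol ?k R (a @ ?p))"
    have al: "length a = n" "set (a @ ?p) <= M" using a 1(1) 2(1) AM by (auto simp: tup_iff)
    show "fk A k1 (Sol k1 R1 (a @ p1))"
    proof (rule fk_projection[OF sA _ _ _ al(2) f, where j = k2])
      fix x y assume x: "x \<in> Sol k1 R1 (a @ p1)" and y: "y \<in> tup M k2"
      have "x @ y \<in> Sol ?k R (a @ ?p)" using x y mem[OF _ y a, of x] by (auto simp: Sol_def tup_iff)
      then show "\<exists>z\<in>Sol ?k R (a @ ?p). set z = set x Un set y" by (intro bexI[of _ "x @ y"]) auto
    qed (use 1 R al in auto)
    show "fk A k2 (Sol k2 R2 (a @ p2))"
    proof (rule fk_projection[OF sA _ _ _ al(2) f, where j = k1])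
      fix x y assume x: "x \<in> Sol k2 R2 (a @ p2)" and y: "y \<in> tup M k1"
      have "y @ x \<in> Sol ?k R (a @ ?p)" using x y mem[OF y _ a, of x] by (auto simp: Sol_def tup_iff)
      then show "\<exists>z\<in>Sol ?k R (a @ ?p). set z = set x Un set y" by (intro bexI[of _ "y @ x"]) auto
    qed (use 2 R al in auto)
  next
    assume f: "fk A k1 (Sol k1 R1 (a @ p1)) & fk A k2 (Sol k2 R2 (a @ p2))"
    have "fk A ?k (pre (%i. i) k1 ?k (Sol k1 R1 (a @ p1)) Un pre (%i. i + k1) k2 ?k (Sol k2 R2 (a @ p2)))"
      by (intro fk_Un fk_pre) (use f in auto)
    then show "fk A ?k (Sol ?k R (a @ ?p))"
    proof (rule fk_mono)
      show "Sol ?k R (a @ ?p) <= pre (%i. i) k1 ?k (Sol k1 R1 (a @ p1)) Un pre (%i. i + k1) k2 ?k (Sol k2 R2 (a @ p2))"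
      proof
        fix z assume z: "z \<in> Sol ?k R (a @ ?p)"
        then have "z \<in> tup M ?k" by (simp add: Sol_def)
        from split[OF this] obtain x1 x2 where x: "x1 \<in> tup M k1" "x2 \<in> tup M k2" "z = x1 @ x2" by blast
        have "map (%i. z ! i) [0..<k1] = x1" "map (%i. z ! (i + k1)) [0..<k2] = x2"
          by (rule nth_equalityI; use x in \<open>auto simp: tup_iff nth_append\<close>)+
        then show "z \<in> pre (%i. i) k1 ?k (Sol k1 R1 (a @ p1)) Un pre (%i. i + k1) k2 ?k (Sol k2 R2 (a @ p2))"
          using z x mem[OF x(1,2) a] by (auto simp: pre_def Sol_def)
      qed
    qed
  qed
  then have "X1 Int X2 = {a \<in> tup M n. fk A ?k (Sol ?k R (a @ ?p))}" unfolding 1(3) 2(3) by blast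
  then show ?thesis using basicI[of ?p A R ?k n] R 1(1) 2(1) by simp
qed

end

locale unistruct = simplestruct M Def \<nu>
  for M :: "'c set" and Def :: "nat => 'c list set set" and \<nu> :: "'v rel" +
  assumes UNI: "!!C e b. sm C ==> set e <= M ==> set b <= M ==> \<not> algb C e ==> \<not> algb C b ==>
    \<exists>D e' b'. D <= M & C <= D & eqt C e e' & eqt C b b' & Ind (set e') C D & Ind (set b') C D & \<not> Ind (set e') D (set b')"
begin

text \<open>If the claim failed, the points over which no \<open>b\<close> makes
  \<open>\<Phi>\<close> fork would meet every basic neighbourhood of \<open>a\<close>, which is the
  situation refuted by \<open>uniworlds\<close>.\<close>

theorem forking_projection:
  assumes sA: "sm A" and p0: "set p0 <= A" and \<Phi>: "\<Phi> \<in> Def (l + (n + m + length p0))" and a: "a \<in> tup M n" and b: "b0 \<in> tup M m"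
    and f: "fk A l (Sol l \<Phi> (a @ b0 @ p0))"
  shows "\<exists>X\<in>basic A n. a \<in> X & (\<forall>a'\<in>X. \<exists>b\<in>tup M m. fk A l (Sol l \<Phi> (a' @ b @ p0)))"
proof (rule ccontr)
  assume no: "\<not> ?thesis"
  define F where "F = {a' \<in> tup M n. \<forall>b\<in>tup M m. \<not> fk A l (Sol l \<Phi> (a' @ b @ p0))}"
  define NB where "NB = {X \<in> basic A n. a \<in> X}"
  have "uniworlds M Def \<nu> A n m l a b0 p0 F NB \<Phi>"
  proof (unfold_locales, goal_cases)
    case (7) then show ?case unfolding F_def by blast
  next
    case (8 a' b) then show ?case unfolding F_def by blast
  next
    case 9 then show ?case unfolding NB_def using basic_full a by blast
  next
    case (10 O1 O2) then show ?case unfolding NB_def using basic_Int[OF sA] by blast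
  next
    case (11 R p) then show ?case unfolding NB_def using basic_Def[OF sA] a by (auto simp: Sol_def)
  next
    case (12 R p k) then show ?case unfolding NB_def using basicI a by blast
  next
    case (13 X)
    then have "X \<in> basic A n" "a \<in> X" unfolding NB_def by auto
    then obtain a' where "a' \<in> X" "\<forall>b\<in>tup M m. \<not> fk A l (Sol l \<Phi> (a' @ b @ p0))" using no by blast
    moreover have "a' \<in> tup M n" using basicE[OF \<open>X \<in> basic A n\<close>] \<open>a' \<in> X\<close> by blast
    ultimately show ?case unfolding F_def by blast
  qed (fact sA a b p0 \<Phi> f | rule UNI; assumption)+
  then show False by (rule uniworlds.contradiction)
qed

end

section \<open>Definable relations of a structure\<close>

lemma finite_fv_tm: "finite (fv_tm t)"
  by (induction t) auto

lemma eval_cong: "(!!i. i \<in> fv_tm t ==> e i = e' i) ==> eval_tm M e t = eval_tm M e' t"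
proof (induction t)
  case (Fn f ts)
  have "map (eval_tm M e) ts = map (eval_tm M e') ts" using Fn by (intro map_cong) auto
  then show ?case by (simp only: eval_tm.simps)
qed simp

lemma sat_cong: "(!!i. i \<in> fv_fm \<phi> ==> e i = e' i) ==> sat M e \<phi> = sat M e' \<phi>"
proof (induction \<phi> arbitrary: e e')
  case (Eql s t) then show ?case using eval_cong[of s e e' M] eval_cong[of t e e' M] by auto
next
  case (Rel r ts)
  have "map (eval_tm M e) ts = map (eval_tm M e') ts" using Rel by (intro map_cong refl eval_cong) auto
  then show ?case by (simp only: sat.simps)
next
  case (Con \<phi>1 \<phi>2)
  have "sat M e \<phi>1 = sat M e' \<phi>1" "sat M e \<phi>2 = sat M e' \<phi>2"
    by (rule Con.IH(1), use Con.prems in simp) (rule Con.IH(2), use Con.prems in simp)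
  then show ?case by simp
next
  case (Exi i \<phi>)
  have "sat M (e(i := d)) \<phi> = sat M (e'(i := d)) \<phi>" for d by (rule Exi.IH) (use Exi.prems in auto)
  then show ?case by simp
next
  case (Neg \<phi>)
  have "sat M e \<phi> = sat M e' \<phi>" by (rule Neg.IH) (use Neg.prems in simp)
  then show ?case by simp
qed

primrec tr_tm :: "('f => 'g tm list => 'g tm) => (nat => 'g tm) => 'f tm => 'g tm" where
  "tr_tm G s (Var i) = s i"
| "tr_tm G s (Fn f ts) = G f (map (tr_tm G s) ts)"

text \<open>Translation of formulas along a translation \<open>G\<close> of the function symbols and a substitution \<open>s\<close>. The
  variables in \<open>X\<close> are reserved for values prescribed by the condition \<open>E\<close> on assignments; bound variables
  are renamed in order to avoid them.\<close>

locale translation =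
  fixes L :: "('f, 'r) language" and M :: "('f, 'r, 'c) struct" and L' :: "('g, 'r) language" and N :: "('g, 'r, 'c) struct"
    and G :: "'f => 'g tm list => 'g tm" and X :: "nat set" and E :: "(nat => 'c) => bool"
  assumes X: "finite X" and carr: "carr N = carr M" and rint: "rint N = rint M"
    and rels: "rels L <= rels L'" "rel_ar L' = rel_ar L"
    and G_wf: "!!f ts. f \<in> funs L ==> length ts = fun_ar L f ==> \<forall>t\<in>set ts. wf_tm L' t ==> wf_tm L' (G f ts)"
    and G_fv: "!!f ts. f \<in> funs L ==> fv_tm (G f ts) <= X Un (\<Union>t\<in>set ts. fv_tm t)"
    and G_eval: "!!f ts e. E e ==> f \<in> funs L ==> length ts = fun_ar L f ==> eval_tm N e (G f ts) = fint M f (map (eval_tm N e) ts)"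
    and E: "!!e j d. E e ==> j \<notin> X ==> E (e(j := d))"
begin

lemma tr_tm: "wf_tm L t ==> (!!i. i \<in> fv_tm t ==> wf_tm L' (s i)) ==>
   wf_tm L' (tr_tm G s t) & fv_tm (tr_tm G s t) <= X Un (\<Union>i\<in>fv_tm t. fv_tm (s i)) &
   (\<forall>e. E e --> eval_tm N e (tr_tm G s t) = eval_tm M (%i. eval_tm N e (s i)) t)"
proof (induction t)
  case (Fn f ts)
  have f: "f \<in> funs L" "length ts = fun_ar L f" using Fn.prems(1) by auto
  have IH: "wf_tm L' (tr_tm G s t)" "fv_tm (tr_tm G s t) <= X Un (\<Union>i\<in>fv_tm t. fv_tm (s i))"
    "!!e. E e ==> eval_tm N e (tr_tm G s t) = eval_tm M (%i. eval_tm N e (s i)) t" if "t \<in> set ts" for t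
    using Fn.IH[OF that] Fn.prems that by auto
  have "wf_tm L' (tr_tm G s (Fn f ts))" using G_wf[OF f(1), of "map (tr_tm G s) ts"] f IH(1) by simp
  moreover have "fv_tm (tr_tm G s (Fn f ts)) <= X Un (\<Union>i\<in>fv_tm (Fn f ts). fv_tm (s i))"
    using G_fv[OF f(1), of "map (tr_tm G s) ts"] IH(2) by fastforce
  moreover have "eval_tm N e (tr_tm G s (Fn f ts)) = eval_tm M (%i. eval_tm N e (s i)) (Fn f ts)" if e: "E e" for e
  proof -
    have "map (%t. eval_tm N e (tr_tm G s t)) ts = map (eval_tm M (%i. eval_tm N e (s i))) ts"
      using IH(3)[OF _ e] by (intro map_cong) auto
    then show ?thesis using G_eval[OF e f(1), of "map (tr_tm G s) ts"] f(2) by (simp only: tr_tm.simps eval_tm.simps map_map comp_def length_map)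
  qed
  ultimately show ?case by blast
qed auto

lemma tr_tms:
  assumes "\<forall>t\<in>set ts. wf_tm L t" "!!i. i \<in> (\<Union>t\<in>set ts. fv_tm t) ==> wf_tm L' (s i)"
  shows "(\<forall>t\<in>set (map (tr_tm G s) ts). wf_tm L' t) &
    (\<Union>t\<in>set (map (tr_tm G s) ts). fv_tm t) <= X Un (\<Union>i\<in>(\<Union>t\<in>set ts. fv_tm t). fv_tm (s i)) &
    (\<forall>e. E e --> map (eval_tm N e) (map (tr_tm G s) ts) = map (eval_tm M (%i. eval_tm N e (s i))) ts)"
proof -
  have t: "wf_tm L' (tr_tm G s t)" "fv_tm (tr_tm G s t) <= X Un (\<Union>i\<in>fv_tm t. fv_tm (s i))"
    "!!e. E e ==> eval_tm N e (tr_tm G s t) = eval_tm M (%i. eval_tm N e (s i)) t" if "t \<in> set ts" for t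
    using tr_tm[of t s] assms that by auto
  show ?thesis using t(1,3) by (intro conjI; use t(2) in fastforce)
qed

lemma tr_fm: "wf_fm L \<phi> ==> (!!i. i \<in> fv_fm \<phi> ==> wf_tm L' (s i)) ==>
   \<exists>\<psi>. wf_fm L' \<psi> & fv_fm \<psi> <= X Un (\<Union>i\<in>fv_fm \<phi>. fv_tm (s i)) &
   (\<forall>e. E e --> sat N e \<psi> = sat M (%i. eval_tm N e (s i)) \<phi>)"
proof (induction \<phi> arbitrary: s)
  case (Eql t u)
  show ?case using tr_tm[of t s] tr_tm[of u s] Eql by (intro exI[of _ "Eql (tr_tm G s t) (tr_tm G s u)"]) auto
next
  case (Rel r ts)
  note t = tr_tms[of ts s]
  have "wf_fm L' (Rel r (map (tr_tm G s) ts))" using t Rel.prems rels by auto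
  moreover have "fv_fm (Rel r (map (tr_tm G s) ts)) <= X Un (\<Union>i\<in>fv_fm (Rel r ts). fv_tm (s i))" using t Rel.prems by simp
  moreover have "sat N e (Rel r (map (tr_tm G s) ts)) = sat M (%i. eval_tm N e (s i)) (Rel r ts)" if "E e" for e
    using t Rel.prems that rint by (metis fv_fm.simps(2) sat.simps(2) wf_fm.simps(2))
  ultimately show ?case by blast
next
  case (Neg \<phi>)
  have "\<exists>\<psi>. wf_fm L' \<psi> & fv_fm \<psi> <= X Un (\<Union>i\<in>fv_fm \<phi>. fv_tm (s i)) &
   (\<forall>e. E e --> sat N e \<psi> = sat M (%i. eval_tm N e (s i)) \<phi>)" by (rule Neg.IH) (use Neg.prems in auto)
  then obtain \<psi> where "wf_fm L' \<psi>" "fv_fm \<psi> <= X Un (\<Union>i\<in>fv_fm \<phi>. fv_tm (s i))"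
   "\<forall>e. E e --> sat N e \<psi> = sat M (%i. eval_tm N e (s i)) \<phi>" by (elim exE conjE)
  then show ?case by (intro exI[of _ "Neg \<psi>"]) simp
next
  case (Con \<phi>1 \<phi>2)
  have "\<exists>\<psi>. wf_fm L' \<psi> & fv_fm \<psi> <= X Un (\<Union>i\<in>fv_fm \<phi>1. fv_tm (s i)) &
   (\<forall>e. E e --> sat N e \<psi> = sat M (%i. eval_tm N e (s i)) \<phi>1)" by (rule Con.IH(1)) (use Con.prems in auto)
  then obtain \<psi>1 where 1: "wf_fm L' \<psi>1" "fv_fm \<psi>1 <= X Un (\<Union>i\<in>fv_fm \<phi>1. fv_tm (s i))"
   "\<forall>e. E e --> sat N e \<psi>1 = sat M (%i. eval_tm N e (s i)) \<phi>1" by (elim exE conjE)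
  have "\<exists>\<psi>. wf_fm L' \<psi> & fv_fm \<psi> <= X Un (\<Union>i\<in>fv_fm \<phi>2. fv_tm (s i)) &
   (\<forall>e. E e --> sat N e \<psi> = sat M (%i. eval_tm N e (s i)) \<phi>2)" by (rule Con.IH(2)) (use Con.prems in auto)
  then obtain \<psi>2 where 2: "wf_fm L' \<psi>2" "fv_fm \<psi>2 <= X Un (\<Union>i\<in>fv_fm \<phi>2. fv_tm (s i))"
   "\<forall>e. E e --> sat N e \<psi>2 = sat M (%i. eval_tm N e (s i)) \<phi>2" by (elim exE conjE)
  show ?case using 1 2 by (intro exI[of _ "Con \<psi>1 \<psi>2"]) auto
next
  case (Exi i \<phi>)
  let ?Y = "X Un (\<Union>k\<in>fv_fm (Exi i \<phi>). fv_tm (s k))"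
  have "finite (fv_fm \<phi>)" by (induction \<phi>) (auto simp: finite_fv_tm)
  then have "finite ?Y" using X finite_fv_tm by auto
  then obtain j where j: "j \<notin> ?Y" using ex_new_if_finite[OF infinite_UNIV_nat] by blast
  let ?s = "s(i := Var j)"
  have "\<exists>\<psi>. wf_fm L' \<psi> & fv_fm \<psi> <= X Un (\<Union>i\<in>fv_fm \<phi>. fv_tm (?s i)) & (\<forall>e. E e --> sat N e \<psi> = sat M (%i. eval_tm N e (?s i)) \<phi>)"
    by (rule Exi.IH) (use Exi.prems in auto)
  then obtain \<psi> where \<psi>: "wf_fm L' \<psi>" "fv_fm \<psi> <= X Un (\<Union>i\<in>fv_fm \<phi>. fv_tm (?s i))"
    "!!e. E e ==> sat N e \<psi> = sat M (%i. eval_tm N e (?s i)) \<phi>" by blast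
  have fv: "fv_fm (Exi j \<psi>) <= ?Y" using \<psi>(2) by (auto split: if_splits)
  have "sat N e (Exi j \<psi>) = sat M (%k. eval_tm N e (s k)) (Exi i \<phi>)" if e: "E e" for e
  proof -
    have "sat N (e(j := d)) \<psi> = sat M ((%k. eval_tm N e (s k))(i := d)) \<phi>" for d
    proof -
      have "sat N (e(j := d)) \<psi> = sat M (%k. eval_tm N (e(j := d)) (?s k)) \<phi>" by (rule \<psi>(3)[OF E[OF e]]) (use j in blast)
      also have "\<dots> = sat M ((%k. eval_tm N e (s k))(i := d)) \<phi>"
      proof (rule sat_cong)
        fix k assume k: "k \<in> fv_fm \<phi>"
        have "eval_tm N (e(j := d)) (s k) = eval_tm N e (s k)" if "k ~= i" by (rule eval_cong) (use j k that in auto)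
        then show "eval_tm N (e(j := d)) (?s k) = ((%k. eval_tm N e (s k))(i := d)) k" by simp
      qed
      finally show ?thesis .
    qed
    then show ?thesis using carr by simp
  qed
  then show ?case using \<psi>(1) fv by (intro exI[of _ "Exi j \<psi>"]) simp
qed

end

lemma nth_tuple: "a \<in> tuples M n ==> i < n ==> a ! i \<in> carr M"
  by (auto simp: tuples_def)

lemma holds_cong: "\<phi> \<in> fmls L n ==> (!!i. i < n ==> e i = a ! i) ==> holds M \<phi> a = sat M e \<phi>"
  unfolding holds_def fmls_def by (rule sat_cong) auto

lemma holds_rename:
  assumes "\<phi> \<in> fmls L m" "!!i. i < m ==> \<sigma> i < n"
  shows "\<exists>\<psi>\<in>fmls L n. \<forall>a\<in>tuples M n. holds M \<psi> a = holds M \<phi> (map (%i. a ! \<sigma> i) [0..<m])"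
proof -
  interpret translation L M L M Fn "{}" "%_. True" by unfold_locales auto
  have wf: "wf_fm L \<phi>" using assms(1) by (simp add: fmls_def)
  have "\<exists>\<psi>. wf_fm L \<psi> & fv_fm \<psi> <= (\<Union>i\<in>fv_fm \<phi>. {\<sigma> i}) & (\<forall>e. sat M e \<psi> = sat M (%i. e (\<sigma> i)) \<phi>)"
    using tr_fm[OF wf, of "%i. Var (\<sigma> i)"] by simp
  then obtain \<psi> where \<psi>: "wf_fm L \<psi>" "fv_fm \<psi> <= (\<Union>i\<in>fv_fm \<phi>. {\<sigma> i})" "\<forall>e. sat M e \<psi> = sat M (%i. e (\<sigma> i)) \<phi>"
    by (elim exE conjE)
  have "holds M \<phi> (map (%i. a ! \<sigma> i) [0..<m]) = sat M (%i. a ! \<sigma> i) \<phi>" for a by (rule holds_cong[OF assms(1)]) simp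
  moreover have "fv_fm \<psi> <= {..<n}"
  proof
    fix x assume "x \<in> fv_fm \<psi>"
    then obtain i where "i \<in> fv_fm \<phi>" "x = \<sigma> i" using \<psi>(2) by blast
    then show "x \<in> {..<n}" using assms by (auto simp: fmls_def)
  qed
  ultimately show ?thesis using \<psi>(1,3) by (intro bexI[of _ \<psi>]) (simp_all add: fmls_def holds_def)
qed

text \<open>A formula contains only finitely many of the new constants; they are turned into
  variables placed after the first \<open>n\<close>.\<close>

lemma holds_abstract:
  fixes L :: "('f, 'r) language" and M :: "('f, 'r, 'c) struct"
  assumes "\<phi> \<in> fmls (lang L A) n"
  shows "\<exists>\<psi> c. set c <= A & \<psi> \<in> fmls L (n + length c) & (\<forall>a\<in>tuples M n. holds (named M) \<phi> a = holds M \<psi> (a @ c))"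
proof -
  have wt: "\<exists>K. finite K & K <= A & (\<forall>K'. K <= K' --> wf_tm (lang L K') t)" if "wf_tm (lang L A) t" for t :: "('f + 'c) tm"
    using that
  proof (induction t)
    case (Fn f ts)
    have "\<forall>t\<in>set ts. \<exists>K. finite K & K <= A & (\<forall>K'. K <= K' --> wf_tm (lang L K') t)" using Fn by auto
    from bchoice[OF this] obtain K where K: "\<forall>t\<in>set ts. finite (K t) & K t <= A & (\<forall>K'. K t <= K' --> wf_tm (lang L K') t)" ..
    define K0 where "K0 = (\<Union>t\<in>set ts. K t) Un (case f of Inl _ => {} | Inr x => {x})"
    have "finite K0" "K0 <= A" using K Fn.prems by (auto simp: K0_def lang_def split: sum.splits)
    moreover have "wf_tm (lang L K') (Fn f ts)" if "K0 <= K'" for K'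
    proof -
      have "\<forall>t\<in>set ts. wf_tm (lang L K') t" using K that unfolding K0_def by blast
      moreover have "f \<in> funs (lang L K')" using Fn.prems that by (auto simp: K0_def lang_def split: sum.splits)
      moreover have "length ts = fun_ar (lang L K') f" using Fn.prems by (simp add: lang_def)
      ultimately show ?thesis by simp
    qed
    ultimately show ?case by blast
  qed auto
  have wts: "\<exists>K. finite K & K <= A & (\<forall>K'. K <= K' --> (\<forall>t\<in>set ts. wf_tm (lang L K') t))"
    if "\<forall>t\<in>set ts. wf_tm (lang L A) t" for ts :: "('f + 'c) tm list"
  proof -
    from bchoice[OF ballI[OF wt[OF bspec[OF that]]]]
    obtain K where K: "\<forall>t\<in>set ts. finite (K t) & K t <= A & (\<forall>K'. K t <= K' --> wf_tm (lang L K') t)" ..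
    then show ?thesis by (intro exI[of _ "\<Union>t\<in>set ts. K t"]) (auto simp: UN_subset_iff)
  qed
  have wf: "\<exists>K. finite K & K <= A & (\<forall>K'. K <= K' --> wf_fm (lang L K') \<phi>)" if "wf_fm (lang L A) \<phi>" for \<phi> :: "('f + 'c, 'r) fm"
    using that
  proof (induction \<phi>)
    case (Eql s t) then show ?case using wts[of "[s, t]"] by simp
  next
    case (Rel r ts) then show ?case using wts[of ts] by (auto simp: lang_def)
  next
    case (Con \<phi>1 \<phi>2)
    then obtain K1 K2 where "finite K1" "K1 <= A" "\<forall>K'. K1 <= K' --> wf_fm (lang L K') \<phi>1"
       "finite K2" "K2 <= A" "\<forall>K'. K2 <= K' --> wf_fm (lang L K') \<phi>2" by auto
    then show ?case by (intro exI[of _ "K1 Un K2"]) simp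
  qed auto
  have "wf_fm (lang L A) \<phi>" using assms by (simp add: fmls_def)
  from wf[OF this] obtain K where K: "finite K" "K <= A" "wf_fm (lang L K) \<phi>" by blast
  obtain c where c: "set c = K" using finite_list[OF K(1)] by blast
  \<comment> \<open>The constant \<open>x\<close> becomes the variable at its position in
    \<open>c\<close>, shifted by \<open>n\<close>.\<close>
  define v where "v x = n + (SOME i. i < length c & c ! i = x)" for x
  have v: "v x < n + length c & n \<le> v x & c ! (v x - n) = x" if "x \<in> K" for x
  proof -
    have "\<exists>i. i < length c & c ! i = x" using that c by (metis in_set_conv_nth)
    from someI_ex[OF this] show ?thesis unfolding v_def by simp
  qed
  interpret translation "lang L K" "named M" L M "%f ts. case f of Inl g => Fn g ts | Inr x => Var (v x)" "v ` K" "%e. \<forall>x\<in>K. e (v x) = x"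
  proof (unfold_locales, goal_cases)
    case 1 then show ?case using K(1) by simp
  qed (auto simp: lang_def named_def split: sum.splits)
  have "\<exists>\<psi>. wf_fm L \<psi> & fv_fm \<psi> <= v ` K Un fv_fm \<phi> & (\<forall>e. (\<forall>x\<in>K. e (v x) = x) --> sat M e \<psi> = sat (named M) e \<phi>)"
    using tr_fm[OF K(3), of Var] by simp
  then obtain \<psi> where \<psi>: "wf_fm L \<psi>" "fv_fm \<psi> <= v ` K Un fv_fm \<phi>"
    "\<forall>e. (\<forall>x\<in>K. e (v x) = x) --> sat M e \<psi> = sat (named M) e \<phi>" by (elim exE conjE)
  have "\<psi> \<in> fmls L (n + length c)" using \<psi>(1,2) assms v by (force simp: fmls_def)
  moreover have "holds (named M) \<phi> a = holds M \<psi> (a @ c)" if "a \<in> tuples M n" for a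
  proof -
    have l: "length a = n" using that by (simp add: tuples_def)
    have "holds (named M) \<phi> a = sat (named M) ((!) (a @ c)) \<phi>" by (rule holds_cong[OF assms]) (simp add: nth_append l)
    also have "\<dots> = sat M ((!) (a @ c)) \<psi>" by (rule \<psi>(3)[rule_format, symmetric]) (use v l in \<open>simp add: nth_append leD\<close>)
    finally show ?thesis by (simp add: holds_def)
  qed
  ultimately show ?thesis using c K(2) by blast
qed

lemma holds_instantiate:
  fixes L :: "('f, 'r) language" and M :: "('f, 'r, 'c) struct"
  assumes "\<psi> \<in> fmls L (n + length c)" "set c <= A"
  shows "\<exists>\<phi>\<in>fmls (lang L A) n. \<forall>a\<in>tuples M n. holds (named M) \<phi> a = holds M \<psi> (a @ c)"
proof -
  interpret translation L M "lang L A" "named M" "%f. Fn (Inl f)" "{}" "%_. True"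
  proof (unfold_locales, goal_cases)
    case (4) then show ?case by (simp add: lang_def)
  next
    case (7 f ts) then show ?case by simp
  next
    case (8 f ts e) then show ?case by (simp add: named_def)
  qed (simp_all add: lang_def named_def)
  let ?s = "%i. if i < n then Var i else Fn (Inr (c ! (i - n)) :: 'f + 'c) []"
  have ci: "c ! (i - n) \<in> A" if "i \<in> fv_fm \<psi>" "\<not> i < n" for i
  proof -
    have "i < n + length c" using that(1) assms(1) by (auto simp: fmls_def)
    then have "c ! (i - n) \<in> set c" using that(2) by (intro nth_mem) simp
    then show ?thesis using assms(2) by blast
  qed
  have wf: "wf_fm L \<psi>" using assms(1) by (simp add: fmls_def)
  have "\<exists>\<phi>. wf_fm (lang L A) \<phi> & fv_fm \<phi> <= (\<Union>i\<in>fv_fm \<psi>. fv_tm (?s i)) &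
     (\<forall>e. sat (named M) e \<phi> = sat M (%i. eval_tm (named M) e (?s i)) \<psi>)"
  proof -
    have "wf_tm (lang L A) (?s i)" if "i \<in> fv_fm \<psi>" for i using ci[OF that] by (simp add: lang_def)
    from tr_fm[OF wf, of ?s, OF this] show ?thesis by simp
  qed
  then obtain \<phi> where \<phi>: "wf_fm (lang L A) \<phi>" "fv_fm \<phi> <= (\<Union>i\<in>fv_fm \<psi>. fv_tm (?s i))"
    "\<forall>e. sat (named M) e \<phi> = sat M (%i. eval_tm (named M) e (?s i)) \<psi>" by (elim exE conjE)
  have "fv_fm \<phi> <= {..<n}" using \<phi>(2) by (auto split: if_splits)
  moreover have "holds (named M) \<phi> a = holds M \<psi> (a @ c)" if "a \<in> tuples M n" for a
  proof -
    have l: "length a = n" using that by (simp add: tuples_def)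
    have "holds M \<psi> (a @ c) = sat M (%i. eval_tm (named M) ((!) a) (?s i)) \<psi>"
      by (rule holds_cong[OF assms(1)]) (simp add: nth_append l named_def)
    then show ?thesis using \<phi>(3)[rule_format, of "(!) a"] by (simp add: holds_def)
  qed
  ultimately show ?thesis using \<phi>(1) by (intro bexI[of _ \<phi>]) (auto simp: fmls_def)
qed

lemma holds_automorphism:
  assumes st: "is_struct L M" and g: "automorphism L M g" and \<phi>: "\<phi> \<in> fmls L n" and a: "a \<in> tuples M n"
  shows "holds M \<phi> (map g a) = holds M \<phi> a"
proof -
  have cl: "eval_tm M e t \<in> carr M & g (eval_tm M e t) = eval_tm M (g \<circ> e) t" if "wf_tm L t" "range e <= carr M" for e t
    using that(1)
  proof (induction t)
    case (Var i) then show ?case using that(2) by auto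
  next
    case (Fn f ts)
    have IH: "!!t. t \<in> set ts ==> eval_tm M e t \<in> carr M" "!!t. t \<in> set ts ==> g (eval_tm M e t) = eval_tm M (g \<circ> e) t"
      using Fn.IH Fn.prems unfolding wf_tm.simps by blast+
    have "map g (map (eval_tm M e) ts) = map (eval_tm M (g \<circ> e)) ts" using IH(2) by simp
    moreover have t: "map (eval_tm M e) ts \<in> tuples M (fun_ar L f)" "f \<in> funs L" using Fn.prems IH(1) by (auto simp: tuples_def)
    moreover have "g (fint M f (map (eval_tm M e) ts)) = fint M f (map g (map (eval_tm M e) ts))" "fint M f (map (eval_tm M e) ts) \<in> carr M"
      using st g t unfolding is_struct_def automorphism_def by blast+
    ultimately show ?case by (simp only: eval_tm.simps)
  qed
  have bij: "bij_betw g (carr M) (carr M)" using g by (simp add: automorphism_def)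
  have s: "sat M (g \<circ> e) \<phi> = sat M e \<phi>" if "wf_fm L \<phi>" "range e <= carr M" for e \<phi>
    using that
  proof (induction \<phi> arbitrary: e)
    case (Eql s t)
    have "eval_tm M (g \<circ> e) s = g (eval_tm M e s)" "eval_tm M (g \<circ> e) t = g (eval_tm M e t)"
      "eval_tm M e s \<in> carr M" "eval_tm M e t \<in> carr M" using cl[of s e] cl[of t e] Eql by auto
    then show ?case using inj_on_eq_iff[OF bij_betw_imp_inj_on[OF bij]] by (simp only: sat.simps)
  next
    case (Rel r ts)
    have 1: "g (eval_tm M e t) = eval_tm M (g \<circ> e) t" "eval_tm M e t \<in> carr M" if "t \<in> set ts" for t
      using cl[of t e] Rel.prems that by auto
    have "map g (map (eval_tm M e) ts) = map (eval_tm M (g \<circ> e)) ts"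
      unfolding map_map by (rule map_cong[OF refl]) (simp only: comp_apply 1(1))
    moreover have "map (eval_tm M e) ts \<in> tuples M (rel_ar L r)" "r \<in> rels L" using Rel.prems(1) 1(2) by (auto simp: tuples_def)
    ultimately show ?case using g unfolding automorphism_def sat.simps by metis
  next
    case (Exi i \<phi>)
    have A: "sat M ((g \<circ> e)(i := g d)) \<phi> = sat M (e(i := d)) \<phi>" if "d \<in> carr M" for d
    proof -
      have "sat M (g \<circ> e(i := d)) \<phi> = sat M (e(i := d)) \<phi>" by (rule Exi.IH) (use Exi.prems that in auto)
      then show ?thesis by (simp only: fun_upd_comp)
    qed
    have img: "g ` carr M = carr M" using bij by (simp add: bij_betw_def)
    have "(\<exists>d\<in>g ` carr M. P d) \<longleftrightarrow> (\<exists>d\<in>carr M. P (g d))" for P by blast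
    note ex = this[unfolded img]
    show ?case unfolding sat.simps ex[of "%d. sat M ((g \<circ> e)(i := d)) \<phi>"] by (rule bex_cong[OF refl A])
  next
    case (Neg \<phi>) show ?case using Neg.prems by (simp only: sat.simps wf_fm.simps Neg.IH)
  next
    case (Con \<phi>1 \<phi>2) show ?case using Con.prems by (simp only: sat.simps wf_fm.simps Con.IH)
  qed
  obtain y where y: "y \<in> carr M" using st by (auto simp: is_struct_def)
  define e where "e i = (if i < n then a ! i else y)" for i
  have l: "length a = n" using a by (simp add: tuples_def)
  have "holds M \<phi> (map g a) = sat M (g \<circ> e) \<phi>" by (rule holds_cong[OF \<phi>]) (simp add: e_def l)
  also have "\<dots> = sat M e \<phi>" by (rule s) (use \<phi> y nth_tuple[OF a] in \<open>auto simp: fmls_def e_def\<close>)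
  also have "\<dots> = holds M \<phi> a" by (rule holds_cong[OF \<phi>, symmetric]) (simp add: e_def)
  finally show ?thesis .
qed

text \<open>A maximal finitely satisfiable set decides every formula: finite parts refuting
  \<open>\<phi>\<close> and \<open>Neg \<phi>\<close> would together be unsatisfiable.\<close>

lemma complete_type_extension:
  assumes S: "S <= fmls (lang L A) n" and fs: "!!P. finite P ==> P <= S ==> \<exists>a\<in>tuples M n. realizes M a P"
  shows "\<exists>p\<in>types L M A n. S <= p"
proof -
  define \<A> where "\<A> = {p. S <= p & p <= fmls (lang L A) n & (\<forall>P. finite P --> P <= p --> (\<exists>a\<in>tuples M n. realizes M a P))}"
  have "\<exists>p\<in>\<A>. \<forall>q\<in>\<A>. p <= q --> q = p"
  proof (rule subset_Zorn_nonempty)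
    show "\<A> ~= {}" using S fs unfolding \<A>_def by blast
    fix \<C> assume C: "\<C> ~= {}" "subset.chain \<A> \<C>"
    have CA: "\<C> <= \<A>" using C(2) by (auto simp: subset.chain_def)
    have "\<exists>a\<in>tuples M n. realizes M a P" if P: "finite P" "P <= \<Union>\<C>" for P
    proof -
      obtain q where "q \<in> \<C>" "P <= q" using finite_subset_Union_chain[OF P C] by blast
      then show ?thesis using CA P(1) unfolding \<A>_def by blast
    qed
    then show "\<Union>\<C> \<in> \<A>" using CA C(1) unfolding \<A>_def by blast
  qed
  then obtain p where p: "p \<in> \<A>" "!!q. q \<in> \<A> ==> p <= q ==> q = p" by blast
  have "\<phi> \<in> p \<or> Neg \<phi> \<in> p" if \<phi>: "\<phi> \<in> fmls (lang L A) n" for \<phi>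
  proof (rule ccontr)
    assume n: "\<not> ?thesis"
    have N: "Neg \<phi> \<in> fmls (lang L A) n" using \<phi> by (simp add: fmls_def)
    have "\<exists>P. finite P & P <= p & \<not> (\<exists>a\<in>tuples M n. realizes M a (insert \<chi> P))" if \<chi>: "\<chi> \<in> fmls (lang L A) n" "\<chi> \<notin> p" for \<chi>
    proof (rule ccontr)
      assume no: "\<not> ?thesis"
      have "\<exists>a\<in>tuples M n. realizes M a P" if P: "finite P" "P <= insert \<chi> p" for P
      proof -
        have "finite (P - {\<chi>})" "P - {\<chi>} <= p" using P by auto
        then obtain a where "a \<in> tuples M n" "realizes M a (insert \<chi> (P - {\<chi>}))" using no by blast
        then show ?thesis unfolding realizes_def by blast
      qed
      then have "insert \<chi> p \<in> \<A>" using p(1) \<chi>(1) unfolding \<A>_def by blast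
      from p(2)[OF this] show False using \<chi>(2) by blast
    qed
    from this[OF \<phi>] this[OF N] n obtain P Q where P: "finite P" "P <= p" "!!a. a \<in> tuples M n ==> \<not> realizes M a (insert \<phi> P)"
      and Q: "finite Q" "Q <= p" "!!a. a \<in> tuples M n ==> \<not> realizes M a (insert (Neg \<phi>) Q)" by blast
    have "finite (P Un Q)" "P Un Q <= p" using P Q by auto
    then obtain a where a: "a \<in> tuples M n" "realizes M a (P Un Q)" using p(1) unfolding \<A>_def by blast
    show False using P(3)[OF a(1)] Q(3)[OF a(1)] a(2) by (auto simp: realizes_def holds_def)
  qed
  then show ?thesis using p(1) unfolding types_def \<A>_def by (intro bexI[of _ p]) auto
qed

section \<open>Cardinalities\<close>

lemma card_le_Times: "infinite Z ==> |X| \<le>o |Z| ==> |Y| \<le>o |Z| ==> |X \<times> Y| \<le>o |Z|"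
  by (rule card_of_Times_ordLeq_infinite_Field[OF _ _ _ card_of_Card_order]) (simp_all add: Field_card_of)

lemma card_le_Un: "infinite Z ==> |X| \<le>o |Z| ==> |Y| \<le>o |Z| ==> |X Un Y| \<le>o |Z|"
  by (rule card_of_Un_ordLeq_infinite_Field[OF _ _ _ card_of_Card_order]) (simp_all add: Field_card_of)

lemma card_le_image: "|X| \<le>o |Z| ==> |f ` X| \<le>o |Z|"
  using card_of_image ordLeq_transitive by blast

lemma card_le_nat: "infinite Z ==> |N :: nat set| \<le>o |Z|"
  using infinite_iff_card_of_nat card_of_mono1[OF subset_UNIV] ordLeq_transitive by metis

lemma card_le_UN_nat: "infinite Z ==> (!!n::nat. |X n| \<le>o |Z| ) ==> |\<Union>n. X n| \<le>o |Z|"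
  by (rule card_of_UNION_ordLeq_infinite) (auto simp: card_le_nat)

lemma card_le_subset: "X <= Y ==> |Y| \<le>o |Z| ==> |X| \<le>o |Z|"
  using card_of_mono1 ordLeq_transitive by blast

lemma card_le_lists:
  assumes "infinite Z" "|X| \<le>o |Z|" shows "|{xs. set xs <= X}| \<le>o |Z|"
proof -
  have "|{xs. set xs <= X & length xs = n}| \<le>o |Z|" for n
  proof (induction n)
    case 0
    have "Z ~= {}" using assms(1) by auto
    then show ?case by (intro card_le_subset[OF _ card_of_singl_ordLeq, of _ "[]"]) auto
  next
    case (Suc n)
    have "|(%(x, xs). x # xs) ` (X \<times> {xs. set xs <= X & length xs = n})| \<le>o |Z|"
      by (intro card_le_image card_le_Times assms Suc)
    moreover have "{xs. set xs <= X & length xs = Suc n} <= (%(x, xs). x # xs) ` (X \<times> {xs. set xs <= X & length xs = n})"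
      by (auto simp: length_Suc_conv image_iff)
    ultimately show ?case by (rule card_le_subset[rotated])
  qed
  then have "|\<Union>n. {xs. set xs <= X & length xs = n}| \<le>o |Z|" by (rule card_le_UN_nat[OF assms(1)])
  then show ?thesis by (rule card_le_subset[rotated]) auto
qed

text \<open>Terms and formulas are stratified by size; each layer arises from the one before by
  finitely many constructors, applied to symbols, variables, lists and pairs.\<close>

lemma card_le_formulas:
  assumes Z: "infinite Z" and f: "|funs L| \<le>o |Z|" and r: "|rels L| \<le>o |Z|"
  shows "|{\<phi>. wf_fm L \<phi>}| \<le>o |Z|"
proof -
  have "|{t. wf_tm L t & size t < n}| \<le>o |Z|" for n
  proof (induction n)
    case 0 then show ?case using card_of_empty by simp
  next
    case (Suc n)
    let ?T = "{t. wf_tm L t & size t < n}"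
    have "|Var ` (UNIV :: nat set) Un (%(f, ts). Fn f ts) ` (funs L \<times> {ts. set ts <= ?T})| \<le>o |Z|"
      by (intro card_le_Un card_le_image card_le_Times card_le_nat card_le_lists Z f Suc)
    moreover have "{t. wf_tm L t & size t < Suc n} <= Var ` (UNIV :: nat set) Un (%(f, ts). Fn f ts) ` (funs L \<times> {ts. set ts <= ?T})"
    proof
      fix t assume t: "t \<in> {t. wf_tm L t & size t < Suc n}"
      show "t \<in> Var ` (UNIV :: nat set) Un (%(f, ts). Fn f ts) ` (funs L \<times> {ts. set ts <= ?T})"
      proof (cases t)
        case (Fn g ts)
        have "size u < n" if "u \<in> set ts" for u
        proof -
          have "size u \<le> size_list size ts" using size_list_estimation'[OF that, of "size u" size] by simp
          then show ?thesis using t Fn by simp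
        qed
        then have "(g, ts) \<in> funs L \<times> {ts. set ts <= ?T}" using t Fn by auto
        then show ?thesis unfolding Fn by force
      qed simp
    qed
    ultimately show ?case by (rule card_le_subset[rotated])
  qed
  then have "|\<Union>n. {t. wf_tm L t & size t < n}| \<le>o |Z|" by (rule card_le_UN_nat[OF Z])
  then have T: "|{t. wf_tm L t}| \<le>o |Z|" by (rule card_le_subset[rotated]) auto
  have "|{\<phi>. wf_fm L \<phi> & size \<phi> < n}| \<le>o |Z|" for n
  proof (induction n)
    case 0 then show ?case using card_of_empty by simp
  next
    case (Suc n)
    let ?F = "{\<phi>. wf_fm L \<phi> & size \<phi> < n}" and ?T = "{t. wf_tm L t}"
    let ?G = "(%(s, t). Eql s t) ` (?T \<times> ?T) Un ((%(r, ts). Rel r ts) ` (rels L \<times> {ts. set ts <= ?T}) \<union>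
      (Neg ` ?F Un ((%(\<phi>, \<psi>). Con \<phi> \<psi>) ` (?F \<times> ?F) Un (%(i, \<phi>). Exi i \<phi>) ` ((UNIV :: nat set) \<times> ?F))))"
    have "|?G| \<le>o |Z|" by (intro card_le_Un card_le_image card_le_Times card_le_nat card_le_lists Z r T Suc)
    moreover have "{\<phi>. wf_fm L \<phi> & size \<phi> < Suc n} <= ?G"
    proof
      fix \<phi> assume p: "\<phi> \<in> {\<phi>. wf_fm L \<phi> & size \<phi> < Suc n}"
      then show "\<phi> \<in> ?G" by (cases \<phi>) (auto simp: image_iff)
    qed
    ultimately show ?case by (rule card_le_subset[rotated])
  qed
  then have "|\<Union>n. {\<phi>. wf_fm L \<phi> & size \<phi> < n}| \<le>o |Z|" by (rule card_le_UN_nat[OF Z])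
  then show ?thesis by (rule card_le_subset[rotated]) auto
qed

text \<open>The hypothesis concerns subsets of \<open>Field \<kappa>\<close>, so \<open>S\<close> is
  first embedded there.\<close>

lemma strong_limit_Pow:
  assumes "Card_order \<kappa>" "\<forall>X \<subseteq> Field \<kappa>. |X| <o \<kappa> --> |Pow X| <o \<kappa>" "|S| <o \<kappa>"
  shows "|Pow S| <o \<kappa>"
proof -
  have "|S| \<le>o |Field \<kappa>|" using assms(1,3) card_of_Field_ordIso ordIso_symmetric ordLess_imp_ordLeq ordLeq_ordIso_trans by metis
  then obtain f where f: "inj_on f S" "f ` S <= Field \<kappa>" unfolding card_of_ordLeq[symmetric] by blast
  have "|f ` S| <o \<kappa>" using card_of_image assms(3) ordLeq_ordLess_trans by blast
  then have P: "|Pow (f ` S)| <o \<kappa>" using assms(2) f(2) by blast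
  have "|Pow S| \<le>o |Pow (f ` S)|"
    unfolding card_of_ordLeq[symmetric] by (intro exI[of _ "image f"] conjI inj_on_image_Pow f(1)) auto
  then show ?thesis using P ordLeq_ordLess_trans by blast
qed

text \<open>The set \<open>W\<close> has at most |S| finite subsets. If all fibres were finite,
  \<open>Pow S\<close> would be a union of at most |S| finite sets, against Cantor's
  theorem.\<close>

lemma infinite_fibre:
  assumes S: "infinite S" and W: "|W| \<le>o |S|" and F: "!!i. i \<in> Pow S ==> finite (F i) & F i <= W"
  shows "\<exists>\<Delta>. infinite {i \<in> Pow S. F i = \<Delta>}"
proof (rule ccontr)
  assume "\<not> ?thesis"
  then have fin: "finite {i \<in> Pow S. F i = \<Delta>}" for \<Delta> by blast
  have "|set ` {xs. set xs <= W}| \<le>o |S|" by (rule card_le_image[OF card_le_lists[OF S W]])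
  moreover have "F ` Pow S <= set ` {xs. set xs <= W}"
  proof
    fix \<Delta> assume "\<Delta> \<in> F ` Pow S"
    then have "finite \<Delta>" "\<Delta> <= W" using F by auto
    then show "\<Delta> \<in> set ` {xs. set xs <= W}" using finite_list[of \<Delta>] by blast
  qed
  ultimately have FP: "|F ` Pow S| \<le>o |S|" by (rule card_le_subset[rotated])
  have "|\<Union>\<Delta>\<in>F ` Pow S. {i \<in> Pow S. F i = \<Delta>}| \<le>o |S|"
  proof (rule card_of_UNION_ordLeq_infinite[OF S FP], intro ballI)
    fix \<Delta> show "|{i \<in> Pow S. F i = \<Delta>}| \<le>o |S|"
      using S fin[of \<Delta>] by (intro ordLess_imp_ordLeq finite_ordLess_infinite card_of_Well_order) (simp_all add: Field_card_of)
  qed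
  then have "|Pow S| \<le>o |S|" by (rule card_le_subset[rotated]) auto
  then show False using card_of_Pow[of S] not_ordLess_ordLeq by blast
qed

section \<open>The monster model\<close>

locale unidim =
  fixes L :: "('f, 'r) language" and T :: "('f, 'r) fm set" and M :: "('f, 'r, 'c) struct" and \<kappa> :: "'k rel" and A :: "'c set"
  assumes mon: "monster \<kappa> L T M" and simple: "simple_theory L M" and uni: "unidimensional \<kappa> L M" and A: "small \<kappa> M A"
begin

definition Dfn :: "nat => 'c list set set" where
  "Dfn n = (%\<phi>. {a \<in> tuples M n. holds M \<phi> a}) ` fmls L n"

text \<open>The power set makes room for the pigeonhole principle.\<close>

definition pset :: "(nat + 'c list set + 'c) set" where "pset = UNIV <+> (\<Union>n. Dfn n) <+> A"
definition nu :: "(nat + 'c list set + 'c) set rel" where "nu = |Pow pset|"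

lemma tup_tuples: "tup (carr M) n = tuples M n" by (simp add: tup_def tuples_def)

lemma struct: "is_struct L M" using mon by (simp add: monster_def is_model_def)

lemma kap: "Card_order \<kappa>" "infinite (Field \<kappa>)"
proof -
  show "Card_order \<kappa>" using mon by (simp add: monster_def)
  have "natLeq <o \<kappa>" using mon by (simp add: monster_def)
  then show "infinite (Field \<kappa>)" using natLeq_ordLeq_cinfinite cinfinite_def
    by (metis ordLess_imp_ordLeq cinfinite_mono natLeq_cinfinite)
qed

lemma pset: "infinite pset" "|pset| <o \<kappa>"
proof -
  have "infinite ((UNIV :: nat set) <+> B)" for B :: "'x set" by (simp add: finite_Plus_iff)
  then show "infinite pset" unfolding pset_def by simp
  let ?Z = "(UNIV :: nat set) <+> funs L <+> rels L"
  have Z: "infinite ?Z" by (simp add: finite_Plus_iff)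
  have nat: "|UNIV :: nat set| <o \<kappa>" using mon card_of_nat ordIso_ordLess_trans by (auto simp: monster_def)
  have Zk: "|?Z| <o \<kappa>" using mon by (intro card_of_Plus_ordLess_infinite_Field kap nat) (simp_all add: monster_def)
  have f: "|funs L| \<le>o |?Z|" "|rels L| \<le>o |?Z|"
    by (rule ordLeq_transitive[OF card_of_Plus1 card_of_Plus2]) (rule ordLeq_transitive[OF card_of_Plus2 card_of_Plus2])
  have "|Dfn n| \<le>o |?Z|" for n unfolding Dfn_def
    by (intro card_le_image card_le_subset[OF _ card_le_formulas[OF Z f]]) (auto simp: fmls_def)
  then have "|\<Union>n. Dfn n| \<le>o |?Z|" by (rule card_le_UN_nat[OF Z])
  then have "|\<Union>n. Dfn n| <o \<kappa>" using Zk ordLeq_ordLess_trans by blast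
  then show "|pset| <o \<kappa>" unfolding pset_def using A
    by (intro card_of_Plus_ordLess_infinite_Field kap nat) (simp_all add: small_def)
qed

lemma nu_kap: "nu <o \<kappa>"
  unfolding nu_def by (rule strong_limit_Pow[OF kap(1) _ pset(2)]) (use mon in \<open>simp add: monster_def\<close>)

lemma small_nu: "B <= carr M ==> |B| \<le>o nu ==> small \<kappa> M B"
  unfolding small_def using nu_kap ordLeq_ordLess_trans by blast

lemma DfnI: "\<psi> \<in> fmls L n ==> {a \<in> tuples M n. holds M \<psi> a} \<in> Dfn n"
  unfolding Dfn_def by blast

lemma formula_Sol:
  assumes "\<phi> \<in> fmls (lang L B) n" "B <= carr M"
  shows "\<exists>R c. set c <= B & R \<in> Dfn (n + length c) & (\<forall>a\<in>tuples M n. holds (named M) \<phi> a = (a @ c \<in> R))"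
proof -
  from holds_abstract[OF assms(1), of M] obtain \<psi> c where c: "set c <= B" "\<psi> \<in> fmls L (n + length c)"
    "\<forall>a\<in>tuples M n. holds (named M) \<phi> a = holds M \<psi> (a @ c)" by (elim exE conjE)
  have "\<forall>a\<in>tuples M n. a @ c \<in> tuples M (n + length c)" using c(1) assms(2) by (auto simp: tuples_def)
  then show ?thesis using c DfnI[OF c(2)] by blast
qed

lemma Sol_formula:
  assumes "R \<in> Dfn (n + length c)" "set c <= B" "B <= carr M"
  shows "\<exists>\<phi>\<in>fmls (lang L B) n. \<forall>a\<in>tuples M n. holds (named M) \<phi> a = (a @ c \<in> R)"
proof -
  from assms(1) obtain \<psi> where \<psi>: "\<psi> \<in> fmls L (n + length c)" "R = {a \<in> tuples M (n + length c). holds M \<psi> a}"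
    unfolding Dfn_def by (elim imageE)
  have "\<forall>a\<in>tuples M n. a @ c \<in> tuples M (n + length c)" using assms by (auto simp: tuples_def)
  then show ?thesis using holds_instantiate[OF \<psi>(1) assms(2), of M] \<psi>(2) by blast
qed

sublocale dstruct "carr M" Dfn nu
proof (unfold_locales, goal_cases)
  case 1 then show ?case using struct by (simp add: is_struct_def)
next
  case (2 R n) then show ?case by (auto simp: Dfn_def tup_tuples)
next
  case (3 n)
  have "Exi 0 (Eql (Var 0) (Var 0)) \<in> fmls L n" by (simp add: fmls_def)
  from DfnI[OF this] show ?case using struct by (simp add: holds_def is_struct_def tup_tuples ex_in_conv)
next
  case (4 R n)
  then obtain \<phi> where \<phi>: "\<phi> \<in> fmls L n" "R = {a \<in> tuples M n. holds M \<phi> a}" unfolding Dfn_def by (elim imageE)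
  have "Neg \<phi> \<in> fmls L n" using \<phi>(1) by (simp add: fmls_def)
  moreover have "tup (carr M) n - R = {a \<in> tuples M n. holds M (Neg \<phi>) a}" unfolding \<phi>(2) tup_tuples by (auto simp: holds_def)
  ultimately show ?case using DfnI by simp
next
  case (5 R S n)
  from 5(1) obtain \<phi> where \<phi>: "\<phi> \<in> fmls L n" "R = {a \<in> tuples M n. holds M \<phi> a}" unfolding Dfn_def by (elim imageE)
  from 5(2) obtain \<psi> where \<psi>: "\<psi> \<in> fmls L n" "S = {a \<in> tuples M n. holds M \<psi> a}" unfolding Dfn_def by (elim imageE)
  have "Con \<phi> \<psi> \<in> fmls L n" using \<phi>(1) \<psi>(1) by (simp add: fmls_def)
  moreover have "R Int S = {a \<in> tuples M n. holds M (Con \<phi> \<psi>) a}" unfolding \<phi>(2) \<psi>(2) by (auto simp: holds_def)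
  ultimately show ?case using DfnI by simp
next
  case (6 R m n \<sigma>)
  then obtain \<phi> where \<phi>: "\<phi> \<in> fmls L m" "R = {a \<in> tuples M m. holds M \<phi> a}" unfolding Dfn_def by (elim imageE)
  from holds_rename[where \<sigma> = \<sigma> and n = n and M = M, OF \<phi>(1) 6(2)] obtain \<psi> where \<psi>: "\<psi> \<in> fmls L n"
    "\<forall>a\<in>tuples M n. holds M \<psi> a = holds M \<phi> (map (%i. a ! \<sigma> i) [0..<m])" by blast
  have "map (%i. a ! \<sigma> i) [0..<m] \<in> tuples M m" if "a \<in> tuples M n" for a
    using nth_tuple[OF that] 6(2) by (auto simp: tuples_def)
  then have "{a \<in> tup (carr M) n. map (%i. a ! \<sigma> i) [0..<m] \<in> R} = {a \<in> tuples M n. holds M \<psi> a}"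
    using \<psi>(2) unfolding \<phi>(2) tup_tuples by blast
  then show ?case using DfnI[OF \<psi>(1)] by simp
next
  case (7 R n)
  then obtain \<phi> where \<phi>: "\<phi> \<in> fmls L (Suc n)" "R = {a \<in> tuples M (Suc n). holds M \<phi> a}" unfolding Dfn_def by (elim imageE)
  have E: "Exi n \<phi> \<in> fmls L n" using \<phi>(1) by (auto simp: fmls_def less_Suc_eq)
  have "a @ [x] \<in> R \<longleftrightarrow> sat M (((!) a)(n := x)) \<phi>" if "a \<in> tuples M n" "x \<in> carr M" for a x
  proof -
    have l: "length a = n" "a @ [x] \<in> tuples M (Suc n)" using that by (auto simp: tuples_def)
    have "holds M \<phi> (a @ [x]) = sat M (((!) a)(n := x)) \<phi>" by (rule holds_cong[OF \<phi>(1)]) (auto simp: nth_append l(1))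
    then show ?thesis using l(2) \<phi>(2) by simp
  qed
  then have "{a \<in> tup (carr M) n. \<exists>x\<in>carr M. a @ [x] \<in> R} = {a \<in> tuples M n. holds M (Exi n \<phi>) a}"
    unfolding tup_tuples holds_def by auto
  then show ?case using DfnI[OF E] by simp
next
  case 8
  have "Eql (Var 0) (Var 1) \<in> fmls L 2" by (simp add: fmls_def)
  from DfnI[OF this] show ?case by (simp add: holds_def tup_tuples)
next
  case 9 show ?case unfolding nu_def by (rule card_of_Card_order)
next
  case 10 show ?case unfolding nu_def using pset(1) by (simp add: Field_card_of)
next
  case (11 B \<Psi>)
  \<comment> \<open>Saturation of \<open>M\<close> is stated for complete types, so the given
    conditions are turned into formulas and completed first.\<close>
  define S where "S = {\<phi> \<in> fmls (lang L B) 1. \<exists>(R, c)\<in>\<Psi>. \<forall>a\<in>tuples M 1. holds (named M) \<phi> a = (a @ c \<in> R)}"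
  have "\<exists>p\<in>types L M B 1. S <= p"
  proof (rule complete_type_extension)
    show "S <= fmls (lang L B) 1" unfolding S_def by blast
    fix P assume P: "finite P" "P <= S"
    have "\<forall>\<phi>\<in>P. \<exists>q. q \<in> \<Psi> & (\<forall>a\<in>tuples M 1. holds (named M) \<phi> a = (a @ snd q \<in> fst q))"
      using P(2) unfolding S_def by fastforce
    from bchoice[OF this] obtain q where q: "\<forall>\<phi>\<in>P. q \<phi> \<in> \<Psi> & (\<forall>a\<in>tuples M 1. holds (named M) \<phi> a = (a @ snd (q \<phi>) \<in> fst (q \<phi>)))" ..
    have "\<exists>x\<in>carr M. \<forall>(R, c)\<in>q ` P. x # c \<in> R" by (rule 11(4)) (use q P(1) in auto)
    then obtain x where x: "x \<in> carr M" "!!\<phi>. \<phi> \<in> P ==> x # snd (q \<phi>) \<in> fst (q \<phi>)" by (auto simp: case_prod_beta)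
    have t: "[x] \<in> tuples M 1" using x(1) by (simp add: tuples_def)
    have "realizes M [x] P" unfolding realizes_def using q t x(2) by fastforce
    then show "\<exists>a\<in>tuples M 1. realizes M a P" using t by blast
  qed
  then obtain p where p: "p \<in> types L M B 1" "S <= p" by blast
  have "saturated \<kappa> L M" using mon by (simp add: monster_def)
  then obtain a where a: "a \<in> tuples M 1" "realizes M a p" using p(1) small_nu[OF 11(1,2)] unfolding saturated_def by blast
  then obtain x where x: "a = [x]" "x \<in> carr M" by (auto simp: tuples_def length_Suc_conv)
  have "x # c \<in> R" if "(R, c) \<in> \<Psi>" for R c
  proof -
    have R: "R \<in> Dfn (1 + length c)" "set c <= B" using 11(3)[OF that] by auto
    from Sol_formula[OF R 11(1)] obtain \<phi> where \<phi>: "\<phi> \<in> fmls (lang L B) 1" "\<forall>a\<in>tuples M 1. holds (named M) \<phi> a = (a @ c \<in> R)" by blast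
    then have "\<phi> \<in> S" unfolding S_def using that by blast
    then have "holds (named M) \<phi> a" using a(2) p(2) by (auto simp: realizes_def)
    then show ?thesis using \<phi>(2) a(1) x(1) by simp
  qed
  then show ?case using x(2) by blast
qed

sublocale simplestruct "carr M" Dfn nu
proof (unfold_locales, goal_cases)
  case (1 S h)
  have "elementary_on L M S h" unfolding elementary_on_def
  proof (intro conjI allI ballI impI)
    show "h ` S <= carr M" by (rule 1(3))
    fix n \<phi> a assume \<phi>: "\<phi> \<in> fmls L n" and a: "set a <= S & length a = n"
    have t: "a \<in> tuples M n" "map h a \<in> tuples M n" using a 1(1,3) by (auto simp: tuples_def)
    have N: "Neg \<phi> \<in> fmls L n" using \<phi> by (simp add: fmls_def)
    have "holds M \<chi> (map h a)" if "\<chi> \<in> fmls L n" "holds M \<chi> a" for \<chi>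
      using 1(4)[OF DfnI[OF that(1)], of a] that(2) t a by simp
    from this[OF \<phi>] this[OF N] show "holds M \<phi> a = holds M \<phi> (map h a)" by (auto simp: holds_def)
  qed
  moreover have "strongly_homogeneous \<kappa> L M" using mon by (simp add: monster_def)
  ultimately obtain g where g: "automorphism L M g" "\<forall>x\<in>S. g x = h x"
    using small_nu[OF 1(1,2)] unfolding strongly_homogeneous_def by blast
  have "map g u \<in> R" if R: "R \<in> Dfn n" "u \<in> R" for n R u
  proof -
    obtain \<phi> where \<phi>: "\<phi> \<in> fmls L n" "R = {a \<in> tuples M n. holds M \<phi> a}" using R(1) unfolding Dfn_def by (elim imageE)
    have u: "u \<in> tuples M n" "holds M \<phi> u" using R(2) \<phi>(2) by auto
    have "map g u \<in> tuples M n" using u(1) g(1) by (auto simp: tuples_def automorphism_def bij_betw_def)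
    then show ?thesis using holds_automorphism[OF struct g(1) \<phi>(1) u(1)] u(2) \<phi>(2) by simp
  qed
  then show ?case using g by (intro exI[of _ g]) (simp add: automorphism_def)
next
  \<comment> \<open>The field of \<open>nu\<close> is \<open>Pow pset\<close>, while the possible
    members of the sets \<open>F i\<close> form a set no larger than \<open>pset\<close>.\<close>
  case (2 F)
  let ?W = "(UNIV :: nat set) \<times> (\<Union>n. Dfn n) \<times> (UNIV :: nat set)"
  have "|(\<Union>n. Dfn n) <+> A| \<le>o |pset|" unfolding pset_def by (rule card_of_Plus2)
  then have "|\<Union>n. Dfn n| \<le>o |pset|" using card_of_Plus1 ordLeq_transitive by blast
  then have W: "|?W| \<le>o |pset|" by (intro card_le_Times card_le_nat pset(1))
  have "finite (F i) & F i <= ?W" if "i \<in> Pow pset" for i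
  proof -
    have i: "i \<in> Field nu" using that by (simp add: nu_def Field_card_of)
    show ?thesis using 2(1)[OF i] 2(2)[OF i] by fast
  qed
  from infinite_fibre[OF pset(1) W this] show ?case by (simp add: nu_def Field_card_of)
next
  case (3 n m \<psi> k a)
  from 3(1) have "\<psi> \<in> Dfn ((n + m) + length [])" by simp
  from Sol_formula[OF this, of "{}"] obtain \<phi> where \<phi>: "\<phi> \<in> fmls (lang L {}) (n + m)"
    "\<forall>a\<in>tuples M (n + m). holds (named M) \<phi> a = (a \<in> \<psi>)" by auto
  have s: "solutions M n \<phi> (a s) = {x \<in> tup (carr M) n. x @ a s \<in> \<psi>}" if "s ~= []" for s
  proof -
    have "x @ a s \<in> tuples M (n + m)" if "x \<in> tuples M n" for x
      using that 3(2)[OF \<open>s ~= []\<close>] by (auto simp: tuples_def tup_def)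
    then show ?thesis using \<phi>(2) unfolding solutions_def tup_tuples by blast
  qed
  have "tree_property M n m \<phi>" unfolding tree_property_def
  proof (intro exI[of _ k] exI[of _ a] conjI allI impI)
    show "a s \<in> tuples M m" if "s ~= []" for s using 3(2)[OF that] by (simp only: tup_tuples)
    show "k_inconsistent k (%i. solutions M n \<phi> (a (s @ [i])))" for s using 3(3)[of s] s[of "s @ [_]"] by simp
    fix \<eta> :: "nat => nat" and J :: "nat set" assume J: "finite J & J <= {1..}"
    then obtain x where x: "x \<in> tup (carr M) n" "\<forall>j\<in>J. x @ a (map \<eta> [0..<j]) \<in> \<psi>" using 3(4)[of J \<eta>] by blast
    have "x \<in> solutions M n \<phi> (a (map \<eta> [0..<j]))" if "j \<in> J" for j
    proof -
      have "map \<eta> [0..<j] ~= []" using J that by auto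
      from s[OF this] show ?thesis using x that by simp
    qed
    then show "\<exists>x\<in>tuples M n. \<forall>j\<in>J. x \<in> solutions M n \<phi> (a (map \<eta> [0..<j]))" using x(1) unfolding tup_tuples by blast
  qed
  then show ?case using simple \<phi>(1) unfolding simple_theory_def by blast
qed

end

section \<open>Comparison with the given notions of type, forking, orthogonality and forking
  topology\<close>

context unidim begin

lemma tp_eq_iff:
  assumes a: "a \<in> tuples M n" and b: "b \<in> tuples M n" and B: "B <= carr M"
  shows "tp L M a B = tp L M b B \<longleftrightarrow> eqt B a b"
proof
  have l: "length a = n" "length b = n" "set a <= carr M" "set b <= carr M" using a b by (auto simp: tuples_def)
  show "eqt B a b" if t: "tp L M a B = tp L M b B"
  proof (rule eqtI)
    fix R c assume R: "set c <= B" "R \<in> Dfn (length a + length c)" "a @ c \<in> R"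
    from Sol_formula[OF R(2,1) B] l obtain \<phi> where \<phi>: "\<phi> \<in> fmls (lang L B) n" "\<forall>a\<in>tuples M n. holds (named M) \<phi> a = (a @ c \<in> R)" by auto
    then have "\<phi> \<in> tp L M b B" using t a R(3) l by (auto simp: tp_def)
    then show "b @ c \<in> R" using \<phi>(2) b by (simp add: tp_def)
  qed (use l in auto)
  assume e: "eqt B a b"
  have "holds (named M) \<phi> a = holds (named M) \<phi> b" if "\<phi> \<in> fmls (lang L B) n" for \<phi>
  proof -
    from formula_Sol[OF that B] obtain R c where R: "set c <= B" "R \<in> Dfn (n + length c)" "\<forall>a\<in>tuples M n. holds (named M) \<phi> a = (a @ c \<in> R)"
      by (elim exE conjE)
    then show ?thesis using eqt_iff[OF e _ R(1), of R] a b l by simp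
  qed
  then show "tp L M a B = tp L M b B" unfolding tp_def l(1,2) by (intro Collect_cong conj_cong refl)
qed

text \<open>The parameters from \<open>B\<close> inside the formula are appended to the tuple
  \<open>c\<close>; conjugation over \<open>B\<close> fixes them, so the dividing sequence can be
  extended by the same parameters.\<close>

lemma divides_kd:
  assumes d: "divides L M B n \<phi> c" and B: "B <= carr M"
  shows "\<exists>\<psi> d k. kd n B \<psi> d k & solutions M n \<phi> c <= Sol n \<psi> d"
proof -
  have \<phi>: "\<phi> \<in> fmls (lang L B) (n + length c)" and c: "c \<in> tuples M (length c)" using d by (auto simp: divides_def)
  from d obtain k s where s: "\<forall>i::nat. s i \<in> tuples M (length c) & tp L M (s i) B = tp L M c B" "k_inconsistent k (%i. solutions M n \<phi> (s i))"
    unfolding divides_def by (elim exE conjE)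
  from formula_Sol[OF \<phi> B] obtain R p where R: "set p <= B" "R \<in> Dfn (n + length c + length p)"
    "\<forall>a\<in>tuples M (n + length c). holds (named M) \<phi> a = (a @ p \<in> R)" by (elim exE conjE)
  have sol: "solutions M n \<phi> e = Sol n R (e @ p)" if "e \<in> tuples M (length c)" for e
  proof -
    have "\<forall>a\<in>tuples M n. a @ e \<in> tuples M (n + length c)" using that by (auto simp: tuples_def)
    then show ?thesis using R(3) unfolding solutions_def Sol_def tup_tuples by auto
  qed
  have pM: "set p <= carr M" using R(1) B by blast
  have "eqt B (c @ p) (s i @ p)" for i
  proof (rule eqt_append[OF _ R(1) pM])
    show "eqt B c (s i)" using s(1) tp_eq_iff[OF c _ B, of "s i"] by auto
  qed
  moreover have "k_inconsistent k (%i. Sol n R (s i @ p))" using s sol by simp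
  ultimately have "kd n B R (c @ p) k" unfolding kd_def using R(2) c pM
    by (intro conjI exI[of _ "%i. s i @ p"]) (auto simp: tuples_def add.assoc)
  then show ?thesis using sol[OF c] by blast
qed

lemma kd_divides:
  assumes k: "kd n B \<psi> d k" and B: "B <= carr M"
  shows "\<exists>\<phi>. divides L M B n \<phi> d & Sol n \<psi> d <= solutions M n \<phi> d"
proof -
  have \<psi>: "\<psi> \<in> Dfn ((n + length d) + length [])" and d: "d \<in> tuples M (length d)" using k by (auto simp: kd_def tuples_def)
  from k obtain s where s: "\<forall>i::nat. eqt B d (s i)" "k_inconsistent k (%i. Sol n \<psi> (s i))" unfolding kd_def by (elim exE conjE)
  have "set [] <= B" by simp
  from Sol_formula[OF \<psi> this B] obtain \<phi> where \<phi>: "\<phi> \<in> fmls (lang L B) (n + length d)" "\<forall>a\<in>tuples M (n + length d). holds (named M) \<phi> a = (a \<in> \<psi>)"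
    by auto
  have sol: "solutions M n \<phi> e = Sol n \<psi> e" if "e \<in> tuples M (length d)" for e
  proof -
    have "\<forall>a\<in>tuples M n. a @ e \<in> tuples M (n + length d)" using that by (auto simp: tuples_def)
    then show ?thesis using \<phi>(2) unfolding solutions_def Sol_def tup_tuples by auto
  qed
  have st: "s i \<in> tuples M (length d)" for i using eqt_M eqt_length s(1)[rule_format, of i] by (auto simp: tuples_def)
  have "tp L M (s i) B = tp L M d B" for i using tp_eq_iff[OF d st B] s(1) by blast
  moreover have "k_inconsistent k (%i. solutions M n \<phi> (s i))" using s(2) sol[OF st] by simp
  ultimately have "divides L M B n \<phi> d" unfolding divides_def using \<phi>(1) d st by blast
  then show ?thesis using sol[OF d] by blast
qed

lemma forks_iff:
  assumes B: "B <= carr M" shows "forks L M B n X \<longleftrightarrow> fk B n X"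
proof
  assume "forks L M B n X"
  then obtain D where D: "finite D" "\<forall>(\<psi>, d)\<in>D. divides L M B n \<psi> d" "X <= (\<Union>(\<psi>, d)\<in>D. solutions M n \<psi> d)"
    unfolding forks_def by (elim exE conjE)
  have "fk B n (\<Union>p\<in>D. solutions M n (fst p) (snd p))"
  proof (rule fk_UN[OF D(1)])
    fix p assume "p \<in> D"
    then have "divides L M B n (fst p) (snd p)" using D(2) by auto
    from divides_kd[OF this B] show "fk B n (solutions M n (fst p) (snd p))" using fkI by blast
  qed
  then show "fk B n X" by (rule fk_mono) (use D(3) in \<open>simp add: case_prod_beta\<close>)
next
  assume "fk B n X"
  from fk_cover[OF this] obtain D where D: "finite D" "\<forall>p\<in>D. \<exists>k. kd n B (fst p) (snd p) k" "X <= (\<Union>p\<in>D. Sol n (fst p) (snd p))"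
    by (elim exE conjE)
  have "\<forall>p\<in>D. \<exists>\<phi>. divides L M B n \<phi> (snd p) & Sol n (fst p) (snd p) <= solutions M n \<phi> (snd p)"
    using D(2) kd_divides[OF _ B] by blast
  from bchoice[OF this] obtain g where g: "\<forall>p\<in>D. divides L M B n (g p) (snd p) & Sol n (fst p) (snd p) <= solutions M n (g p) (snd p)" ..
  show "forks L M B n X" unfolding forks_def
  proof (intro exI[of _ "(%p. (g p, snd p)) ` D"] conjI)
    show "X <= (\<Union>(\<psi>, d)\<in>(%p. (g p, snd p)) ` D. solutions M n \<psi> d)" using D(3) g by fastforce
  qed (use D(1) g in auto)
qed

lemma conjunction:
  assumes "finite P" "P <= fmls (lang L B) n"
  shows "\<exists>\<chi>\<in>fmls (lang L B) n. \<forall>a\<in>tuples M n. realizes M a P = holds (named M) \<chi> a"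
  using assms
proof (induction P rule: finite_induct)
  case empty
  have "Exi 0 (Eql (Var 0) (Var 0)) \<in> fmls (lang L B) n" by (simp add: fmls_def)
  moreover have "holds (named M) (Exi 0 (Eql (Var 0) (Var 0))) a" for a
    using struct by (auto simp: holds_def named_def is_struct_def)
  ultimately show ?case unfolding realizes_def by blast
next
  case (insert \<phi> P)
  then obtain \<chi> where \<chi>: "\<chi> \<in> fmls (lang L B) n" "\<forall>a\<in>tuples M n. realizes M a P = holds (named M) \<chi> a" by auto
  have "Con \<phi> \<chi> \<in> fmls (lang L B) n" using insert.prems \<chi>(1) by (simp add: fmls_def)
  moreover have "realizes M a (insert \<phi> P) = holds (named M) (Con \<phi> \<chi>) a" if "a \<in> tuples M n" for a
    using \<chi>(2) that by (simp add: realizes_def holds_def)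
  ultimately show ?case by blast
qed

text \<open>\<open>type_forks\<close> speaks of finite sets of formulas and \<open>Ind\<close> of
  single relations; a finite part of the type is replaced by its conjunction.\<close>

lemma Ind_iff:
  assumes a: "set a <= carr M" and B: "B <= carr M" and C: "C <= carr M"
  shows "type_forks L M C (length a) (tp L M a (C Un B)) \<longleftrightarrow> \<not> Ind (set a) C B"
proof -
  let ?n = "length a"
  have BC: "C Un B <= carr M" using B C by blast
  have at: "a \<in> tuples M ?n" using a by (simp add: tuples_def)
  have "Ind (set a) C B" if nf: "\<not> type_forks L M C ?n (tp L M a (C Un B))"
  proof (rule Ind_list[OF a], rule notI)
    fix c R assume R: "set c <= B Un C" "R \<in> Dfn (?n + length c)" "a @ c \<in> R" "fk C ?n (Sol ?n R c)"
    from Sol_formula[OF R(2) _ BC] R(1) obtain \<phi> where \<phi>: "\<phi> \<in> fmls (lang L (C Un B)) ?n" "\<forall>a\<in>tuples M ?n. holds (named M) \<phi> a = (a @ c \<in> R)"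
      by (auto simp: Un_commute)
    have "{\<phi>} <= tp L M a (C Un B)" using \<phi> at R(3) by (simp add: tp_def)
    moreover have "{x \<in> tuples M ?n. realizes M x {\<phi>}} = Sol ?n R c" using \<phi>(2) by (auto simp: realizes_def Sol_def tup_tuples)
    ultimately show False using nf R(4) forks_iff[OF C] unfolding type_forks_def by (metis finite.emptyI finite.insertI)
  qed
  moreover have "\<not> Ind (set a) C B" if f: "type_forks L M C ?n (tp L M a (C Un B))"
  proof
    assume I: "Ind (set a) C B"
    from f obtain P where P: "finite P" "P <= tp L M a (C Un B)" "forks L M C ?n {x \<in> tuples M ?n. realizes M x P}"
      unfolding type_forks_def by (elim exE conjE)
    have "P <= fmls (lang L (C Un B)) ?n" using P(2) by (auto simp: tp_def)
    from conjunction[OF P(1) this] obtain \<chi> where \<chi>: "\<chi> \<in> fmls (lang L (C Un B)) ?n" "\<forall>a\<in>tuples M ?n. realizes M a P = holds (named M) \<chi> a" by blast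
    from formula_Sol[OF \<chi>(1) BC] obtain R c where R: "set c <= C Un B" "R \<in> Dfn (?n + length c)"
      "\<forall>a\<in>tuples M ?n. holds (named M) \<chi> a = (a @ c \<in> R)" by (elim exE conjE)
    have "realizes M a P" using P(2) by (auto simp: realizes_def tp_def)
    then have "a @ c \<in> R" using \<chi>(2) R(3) at by blast
    moreover have "{x \<in> tuples M ?n. realizes M x P} = Sol ?n R c" using \<chi>(2) R(3) by (auto simp: Sol_def tup_tuples)
    then have "fk C ?n (Sol ?n R c)" using P(3) forks_iff[OF C] by simp
    ultimately show False using IndD[OF I order_refl _ R(2)] R(1) by blast
  qed
  ultimately show ?thesis by blast
qed

lemma tp_types: "set a <= carr M ==> tp L M a B \<in> types L M B (length a)"
  unfolding types_def tp_def by (auto simp: realizes_def fmls_def holds_def tuples_def intro!: bexI[of _ a])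

lemma realizes_type:
  assumes "p \<in> types L M B n" "a \<in> tuples M n" "realizes M a p" shows "p = tp L M a B"
proof -
  have l: "length a = n" using assms(2) by (simp add: tuples_def)
  have "\<phi> \<in> p" if "\<phi> \<in> tp L M a B" for \<phi>
  proof (rule ccontr)
    assume "\<phi> \<notin> p"
    then have "Neg \<phi> \<in> p" using assms(1) that l by (auto simp: types_def tp_def)
    then show False using assms(3) that by (auto simp: realizes_def tp_def holds_def)
  qed
  moreover have "p <= tp L M a B" using assms(1,3) l by (auto simp: types_def tp_def realizes_def)
  ultimately show ?thesis by blast
qed

lemma algebraic_algb:
  assumes "set a <= carr M" "B <= carr M" "algebraic M (length a) (tp L M a B)" shows "algb B a"
proof -
  from assms(3) obtain \<phi> where \<phi>: "\<phi> \<in> fmls (lang L B) (length a)" "holds (named M) \<phi> a" "finite {x \<in> tuples M (length a). holds (named M) \<phi> x}"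
    unfolding algebraic_def tp_def by blast
  from formula_Sol[OF \<phi>(1) assms(2)] obtain R c where R: "set c <= B" "R \<in> Dfn (length a + length c)"
    "\<forall>x\<in>tuples M (length a). holds (named M) \<phi> x = (x @ c \<in> R)" by (elim exE conjE)
  have "Sol (length a) R c = {x \<in> tuples M (length a). holds (named M) \<phi> x}" using R(3) by (auto simp: Sol_def tup_tuples)
  moreover have "a @ c \<in> R" using R(3) \<phi>(2) assms(1) by (simp add: tuples_def)
  ultimately show ?thesis unfolding algb_def using R(1,2) \<phi>(3) by (intro exI[of _ R] exI[of _ c]) simp
qed

sublocale unistruct "carr M" Dfn nu
proof (unfold_locales, goal_cases)
  case (1 C e b)
  have CM: "C <= carr M" using 1(1) by (rule sm_sub)
  have C: "small \<kappa> M C" using 1(1) small_nu unfolding sm_def by blast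
  let ?n = "length e" and ?m = "length b" and ?p = "tp L M e C" and ?q = "tp L M b C"
  have "\<not> orthogonal \<kappa> L M ?n C ?p ?m C ?q"
    using uni C tp_types 1(2,3) algebraic_algb[OF _ CM] 1(4,5) unfolding unidimensional_def by blast
  then obtain D p' q' e' b' where D: "small \<kappa> M D" "C Un C <= D" "nonforking_extension L M ?n C ?p D p'" "nonforking_extension L M ?m C ?q D q'"
    "e' \<in> tuples M ?n" "b' \<in> tuples M ?m" "realizes M e' p'" "realizes M b' q'" "\<not> Defs.indep L M e' b' D"
    unfolding orthogonal_def by blast
  have DM: "D <= carr M" and CD: "C <= D" "C Un D = D" using D(1,2) by (auto simp: small_def)
  have t: "p' = tp L M e' D" "q' = tp L M b' D"
    using D(3,4) realizes_type D(5-8) unfolding nonforking_extension_def by blast+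
  have l: "length e' = ?n" "length b' = ?m" "set e' <= carr M" "set b' <= carr M" using D(5,6) by (auto simp: tuples_def)
  have I: "Ind (set e') C D" "Ind (set b') C D" "\<not> Ind (set e') D (set b')"
    using D(3,4,9) Ind_iff[OF l(3) DM CM] Ind_iff[OF l(4) DM CM] Ind_iff[OF l(3,4) DM]
    unfolding nonforking_extension_def Defs.indep_def t CD(2) l(1,2) by blast+
  have "?p = tp L M e' C" "?q = tp L M b' C"
    using realizes_type[OF tp_types[OF 1(2)] D(5)] realizes_type[OF tp_types[OF 1(3)] D(6)] D(3,4,7,8)
    unfolding nonforking_extension_def realizes_def by blast+
  then have "eqt C e e'" "eqt C b b'" using tp_eq_iff[OF _ _ CM] D(5,6) 1(2,3) by (auto simp: tuples_def)
  then show ?case using DM CD(1) I by blast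
qed

text \<open>The summand \<open>A\<close> of \<open>pset\<close> makes \<open>nu\<close> large enough
  for this.\<close>

lemma sm_A: "sm A"
proof -
  have "|A| \<le>o |(\<Union>n. Dfn n) <+> A|" "|(\<Union>n. Dfn n) <+> A| \<le>o |pset|" "|pset| \<le>o nu"
    unfolding pset_def nu_def by (rule card_of_Plus2, rule card_of_Plus2, rule ordLess_imp_ordLeq[OF card_of_Pow])
  then show ?thesis using A unfolding sm_def small_def by (meson ordLeq_transitive)
qed

lemma A_carr: "A <= carr M" using A by (simp add: small_def)

lemma tauf_basic_iff: "(\<exists>k \<phi>. \<phi> \<in> fmls (lang L A) (n + k) & X = tauf_basic L M A n k \<phi>) \<longleftrightarrow> X \<in> basic A n"
proof
  assume "\<exists>k \<phi>. \<phi> \<in> fmls (lang L A) (n + k) & X = tauf_basic L M A n k \<phi>"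
  then obtain k \<phi> where \<phi>: "\<phi> \<in> fmls (lang L A) (n + k)" "X = tauf_basic L M A n k \<phi>" by blast
  from formula_Sol[OF \<phi>(1) A_carr] obtain R p where R: "set p <= A" "R \<in> Dfn (n + k + length p)"
    "\<forall>a\<in>tuples M (n + k). holds (named M) \<phi> a = (a @ p \<in> R)" by (elim exE conjE)
  obtain R' where R': "R' \<in> Dfn (k + (n + length p))"
    "!!a x e. a \<in> tup (carr M) n ==> x \<in> tup (carr M) k ==> e \<in> tup (carr M) (length p) ==> x @ a @ e \<in> R' \<longleftrightarrow> a @ x @ e \<in> R"
    by (rule Def_swap[OF R(2)]) (rule that, assumption, blast)
  have p: "p \<in> tup (carr M) (length p)" using R(1) A_carr by (auto simp: tup_def)
  have "{b \<in> tuples M k. holds (named M) \<phi> (a @ b)} = Sol k R' (a @ p)" if a: "a \<in> tuples M n" for a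
  proof -
    have "a @ b \<in> tuples M (n + k)" if "b \<in> tuples M k" for b using a that by (auto simp: tuples_def)
    then show ?thesis using R(3) R'(2)[OF _ _ p] a unfolding Sol_def tup_tuples by auto
  qed
  then have "X = {a \<in> tup (carr M) n. fk A k (Sol k R' (a @ p))}"
    unfolding \<phi>(2) tauf_basic_def tup_tuples forks_iff[OF A_carr] by auto
  then show "X \<in> basic A n" using basicI[OF R(1) R'(1)] by simp
next
  assume "X \<in> basic A n"
  from basicE[OF this] obtain k R p where R: "set p <= A" "R \<in> Dfn (k + (n + length p))" "X = {a \<in> tup (carr M) n. fk A k (Sol k R (a @ p))}"
    by (elim exE conjE)
  have R2: "R \<in> Dfn (k + n + length p)" using R(2) by (simp add: add.assoc)
  obtain R' where R': "R' \<in> Dfn (n + (k + length p))"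
    "!!a x e. a \<in> tup (carr M) k ==> x \<in> tup (carr M) n ==> e \<in> tup (carr M) (length p) ==> x @ a @ e \<in> R' \<longleftrightarrow> a @ x @ e \<in> R"
    by (rule Def_swap[OF R2]) (rule that, assumption, blast)
  have p: "p \<in> tup (carr M) (length p)" using R(1) A_carr by (auto simp: tup_def)
  have R3: "R' \<in> Dfn ((n + k) + length p)" using R'(1) by (simp add: add.assoc)
  from Sol_formula[OF R3 R(1) A_carr] obtain \<phi> where \<phi>: "\<phi> \<in> fmls (lang L A) (n + k)" "\<forall>a\<in>tuples M (n + k). holds (named M) \<phi> a = (a @ p \<in> R')" by blast
  have "{b \<in> tuples M k. holds (named M) \<phi> (a @ b)} = Sol k R (a @ p)" if a: "a \<in> tuples M n" for a
  proof -
    have "a @ b \<in> tuples M (n + k)" if "b \<in> tuples M k" for b using a that by (auto simp: tuples_def)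
    then show ?thesis using \<phi>(2) R'(2)[OF _ _ p] a unfolding Sol_def tup_tuples by auto
  qed
  then have "X = tauf_basic L M A n k \<phi>"
    unfolding R(3) tauf_basic_def tup_tuples forks_iff[OF A_carr] by auto
  then show "\<exists>k \<phi>. \<phi> \<in> fmls (lang L A) (n + k) & X = tauf_basic L M A n k \<phi>" using \<phi>(1) by blast
qed

lemma basic_tuples: "X \<in> basic A n ==> X <= tuples M n"
  using basicE[of X A n] unfolding tup_tuples by blast

text \<open>Basic sets are invariant under equality of types over \<open>A\<close>
  (\<open>basic_eqt\<close>), so nothing is lost in passing from tuples to types.\<close>

lemma tp_in_basic:
  assumes X: "X \<in> basic A n" and a: "a \<in> tuples M n" shows "tp L M a A \<in> (%a. tp L M a A) ` X \<longleftrightarrow> a \<in> X"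
proof
  assume "tp L M a A \<in> (%a. tp L M a A) ` X"
  then obtain x where x: "x \<in> X" "tp L M a A = tp L M x A" by blast
  have "eqt A x a" using tp_eq_iff[OF _ a A_carr, of x] x basic_tuples[OF X] by auto
  then show "a \<in> X" by (rule basic_eqt[OF sm_A X x(1)])
qed blast

lemma tauf_topology_basic: "tauf_topology L M A n = topology_generated_by {(%a. tp L M a A) ` X | X. X \<in> basic A n}"
proof -
  have "{(%a. tp L M a A) ` tauf_basic L M A n k \<phi> | k \<phi>. \<phi> \<in> fmls (lang L A) (n + k)} = {(%a. tp L M a A) ` X | X. X \<in> basic A n}"
    unfolding tauf_basic_iff[symmetric] by blast
  then show ?thesis by (simp add: tauf_topology_def)
qed

text \<open>By \<open>basic_Int\<close> the generating family is closed under binary intersections,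
  so it is a base and not merely a subbase of the topology.\<close>

lemma tauf_open_iff: "tauf_open L M A n U \<longleftrightarrow> U <= tuples M n & (\<forall>a\<in>U. \<exists>X\<in>basic A n. a \<in> X & X <= U)"
proof
  assume "tauf_open L M A n U"
  then obtain Q where Q: "openin (tauf_topology L M A n) Q" "U = {a \<in> tuples M n. tp L M a A \<in> Q}" unfolding tauf_open_def by blast
  have "generate_topology_on {(%a. tp L M a A) ` X | X. X \<in> basic A n} Q"
    using Q(1) unfolding tauf_topology_basic openin_topology_generated_by_iff .
  then have "\<forall>a\<in>tuples M n. tp L M a A \<in> Q --> (\<exists>X\<in>basic A n. a \<in> X & (\<forall>x\<in>X. tp L M x A \<in> Q))"
  proof (induction rule: generate_topology_on.induct)
    case (Int Q1 Q2)
    show ?case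
    proof (intro ballI impI)
      fix a assume a: "a \<in> tuples M n" "tp L M a A \<in> Q1 Int Q2"
      obtain X1 where X1: "X1 \<in> basic A n" "a \<in> X1" "\<forall>x\<in>X1. tp L M x A \<in> Q1" using Int.IH(1) a by blast
      obtain X2 where X2: "X2 \<in> basic A n" "a \<in> X2" "\<forall>x\<in>X2. tp L M x A \<in> Q2" using Int.IH(2) a by blast
      show "\<exists>X\<in>basic A n. a \<in> X & (\<forall>x\<in>X. tp L M x A \<in> Q1 Int Q2)"
        using X1 X2 basic_Int[OF sm_A X1(1) X2(1)] by (intro bexI[of _ "X1 Int X2"]) auto
    qed
  next
    case (UN K)
    show ?case
    proof (intro ballI impI)
      fix a assume a: "a \<in> tuples M n" "tp L M a A \<in> \<Union>K"
      then obtain k where k: "k \<in> K" "tp L M a A \<in> k" by blast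
      from UN.IH[OF k(1), rule_format, OF a(1) k(2)] obtain X where "X \<in> basic A n" "a \<in> X" "\<forall>x\<in>X. tp L M x A \<in> k" by blast
      then show "\<exists>X\<in>basic A n. a \<in> X & (\<forall>x\<in>X. tp L M x A \<in> \<Union>K)" using k(1) by (intro bexI[of _ X]) auto
    qed
  next
    case (Basis Q)
    then obtain X where X: "Q = (%a. tp L M a A) ` X" "X \<in> basic A n" by (elim CollectE exE conjE)
    show ?case
    proof (intro ballI impI)
      fix a assume a: "a \<in> tuples M n" "tp L M a A \<in> Q"
      have "a \<in> X" using a(2) tp_in_basic[OF X(2) a(1)] unfolding X(1) by (simp only:)
      then show "\<exists>X\<in>basic A n. a \<in> X & (\<forall>x\<in>X. tp L M x A \<in> Q)" using X by (intro bexI[of _ X]) auto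
    qed
  qed blast
  note nb = this
  have "\<exists>X\<in>basic A n. a \<in> X & X <= U" if a: "a \<in> U" for a
  proof -
    have "a \<in> tuples M n" "tp L M a A \<in> Q" using a Q(2) by auto
    from nb[rule_format, OF this] obtain X where X: "X \<in> basic A n" "a \<in> X" "\<forall>x\<in>X. tp L M x A \<in> Q" by blast
    then have "X <= U" using basic_tuples[OF X(1)] Q(2) by auto
    then show ?thesis using X(1,2) by blast
  qed
  then show "U <= tuples M n & (\<forall>a\<in>U. \<exists>X\<in>basic A n. a \<in> X & X <= U)" using Q(2) by auto
next
  assume U: "U <= tuples M n & (\<forall>a\<in>U. \<exists>X\<in>basic A n. a \<in> X & X <= U)"
  let ?K = "{(%a. tp L M a A) ` X | X. X \<in> basic A n & X <= U}"
  have "openin (tauf_topology L M A n) (\<Union>?K)"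
    unfolding tauf_topology_basic
  proof (rule openin_Union)
    fix S assume "S \<in> ?K"
    then show "openin (topology_generated_by {(%a. tp L M a A) ` X | X. X \<in> basic A n}) S"
      by (intro topology_generated_by_Basis) blast
  qed
  moreover have "a \<in> U \<longleftrightarrow> tp L M a A \<in> \<Union>?K" if a: "a \<in> tuples M n" for a
  proof
    assume "a \<in> U"
    then obtain X where "X \<in> basic A n" "a \<in> X" "X <= U" using U by blast
    then show "tp L M a A \<in> \<Union>?K" by (intro UnionI[of "(%a. tp L M a A) ` X"]) auto
  next
    assume "tp L M a A \<in> \<Union>?K"
    then obtain X where X: "X \<in> basic A n" "X <= U" "tp L M a A \<in> (%a. tp L M a A) ` X" by auto
    then show "a \<in> U" using tp_in_basic[OF X(1) a] by blast
  qed
  then have "U = {a \<in> tuples M n. tp L M a A \<in> \<Union>?K}" using U by auto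
  ultimately show "tauf_open L M A n U" unfolding tauf_open_def by blast
qed

lemma tauf_open_projection:
  assumes U: "tauf_open L M A (n + m) U" shows "tauf_open L M A n {a \<in> tuples M n. \<exists>b\<in>tuples M m. a @ b \<in> U}"
  unfolding tauf_open_iff
proof (intro conjI ballI)
  fix a assume "a \<in> {a \<in> tuples M n. \<exists>b\<in>tuples M m. a @ b \<in> U}"
  then obtain b where a: "a \<in> tup (carr M) n" and b: "b \<in> tup (carr M) m" and ab: "a @ b \<in> U" unfolding tup_tuples by blast
  from U ab obtain Y where Y: "Y \<in> basic A (n + m)" "a @ b \<in> Y" "Y <= U" unfolding tauf_open_iff by blast
  from basicE[OF Y(1)] obtain l \<Phi> p where \<Phi>: "set p <= A" "\<Phi> \<in> Dfn (l + (n + m + length p))"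
    "Y = {c \<in> tup (carr M) (n + m). fk A l (Sol l \<Phi> (c @ p))}" by (elim exE conjE)
  have "fk A l (Sol l \<Phi> (a @ b @ p))" using Y(2) \<Phi>(3) by simp
  from forking_projection[OF sm_A \<Phi>(1,2) a b this] obtain X where X: "X \<in> basic A n" "a \<in> X"
    "\<forall>a'\<in>X. \<exists>b\<in>tup (carr M) m. fk A l (Sol l \<Phi> (a' @ b @ p))" by blast
  have "X <= {a \<in> tuples M n. \<exists>b\<in>tuples M m. a @ b \<in> U}"
  proof
    fix a' assume a': "a' \<in> X"
    then obtain b' where b': "b' \<in> tup (carr M) m" "fk A l (Sol l \<Phi> (a' @ b' @ p))" using X(3) by blast
    have t: "a' \<in> tup (carr M) n" using basic_tuples[OF X(1)] a' unfolding tup_tuples by blast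
    then have "a' @ b' \<in> Y" unfolding \<Phi>(3) using b' by (simp add: tup_def)
    then show "a' \<in> {a \<in> tuples M n. \<exists>b\<in>tuples M m. a @ b \<in> U}" using Y(3) t b'(1) unfolding tup_tuples by blast
  qed
  then show "\<exists>X\<in>basic A n. a \<in> X & X <= {a \<in> tuples M n. \<exists>b\<in>tuples M m. a @ b \<in> U}" using X(1,2) by blast
qed blast

end

theorem theorem3p14:
  fixes L :: "('f, 'r) language"
    and T :: "('f, 'r) fm set"
    and M :: "('f, 'r, 'c) struct"
    and \<kappa> :: "'k rel"
  assumes "complete_theory L T"
    and "monster \<kappa> L T M"
    and "simple_theory L M"
    and "unidimensional \<kappa> L M"
  shows "PCFT \<kappa> L M"
  unfolding PCFT_def
proof (intro allI impI, elim conjE)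
  fix A n m U assume A: "small \<kappa> M A" and U: "tauf_open L M A (n + m) U"
  interpret unidim L T M \<kappa> A by unfold_locales (use assms A in auto)
  show "tauf_open L M A n {a \<in> tuples M n. \<exists>b\<in>tuples M m. a @ b \<in> U}" by (rule tauf_open_projection[OF U])
qed

end
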